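(* Let $N\geq 1$ be an integer and let $m>1$, $p>0$, $q>m-1$, $\alpha>0$ and $\beta\in(0,N)$. Consider the inequality $$\mathrm{div}\big(|x|^{-\alpha}|\nabla u|^{m-2}\nabla u\big)\geq (I_\beta\ast u^p)u^q\quad\text{in } B_1\setminus\{0\}\subset\mathbb{R}^N. \qquad (\ast)$$ (i) If $N\leq m+\alpha$, then $(\ast)$ always has (positive) singular solutions. (ii) If $N>m+\alpha$ and $p>m-1$, then $(\ast)$ has (positive) singular solutions if and only if all three of the following conditions hold: $$\max\{p,q\}<\frac{N(m-1)}{N-m-\alpha},\qquad p+q<\frac{(N+\beta)(m-1)}{N-m-\alpha},\qquad N-2m<2\alpha+\beta.$$
   Context: $B_R$ denotes the open ball in $\mathbb{R}^N$ centered at $0$ with radius $R$. The convolution is taken over $B_1$: $(I_\beta\ast u^p)(x)=\int_{B_1}I_\beta(x-y)u^p(y)\,dy$, where $I_\beta(x)=A_\beta|x|^{-(N-\beta)}$ is the Riesz potential of order $\beta\in(0,N)$, with $A_\beta=\frac{\Gamma((N-\beta)/2)}{\Gamma(\beta/2)\pi^{N/2}2^\beta}>0$. A positive solution of $(\ast)$ is a function $u\in W^{1,m}_{loc}(B_1\setminus\{0\})\cap C(\overline B_1\setminus\{0\})$ such that: $u>0$; $u\in L^p(B_1)$ (i.e. $\int_{B_1}u^p<\infty$); $\mathrm{div}(|x|^{-\alpha}|\nabla u|^{m-2}\nabla u)$ and $(I_\beta\ast u^p)u^q$ belong to $L^1_{loc}(B_1\setminus\{0\})$; and for every $\phi\in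 C_c^\infty(B_1\setminus\{0\})$ with $\phi\geq0$, $$\int_{B_1}|x|^{-\alpha}|\nabla u|^{m-2}\nabla u\cdot\nabla\phi+\int_{B_1}(I_\beta\ast u^p)u^q\phi\leq0.$$ A positive solution is called singular if $\limsup_{x\to0}u(x)=\infty$. *)

theory Defs
  imports "HOL-Analysis.Analysis"
begin

text \<open>
  The Euclidean space of dimension N is a type of class \<^class>\<open>euclidean_space\<close>, with
  N = DIM('a). A function on a subset is a total function whose values off that subset are
  irrelevant; test functions are extended by 0 and hence smooth on the whole space.
\<close>

primrec C_k :: "nat \<Rightarrow> ('a::euclidean_space \<Rightarrow> real) \<Rightarrow> bool" where
  "C_k 0 f \<longleftrightarrow> continuous_on UNIV f"
| "C_k (Suc k) f \<longleftrightarrow>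
     (\<forall>x. f differentiable (at x)) \<and> (\<forall>b\<in>Basis. C_k k (\<lambda>x. frechet_derivative f (at x) b))"

definition test_functions :: "'a::euclidean_space set \<Rightarrow> ('a \<Rightarrow> real) set" where
  "test_functions \<Omega> = {\<phi>. (\<forall>k. C_k k \<phi>) \<and>
     compact (closure {x. \<phi> x \<noteq> 0}) \<and> closure {x. \<phi> x \<noteq> 0} \<subseteq> \<Omega>}"

definition grad :: "('a::euclidean_space \<Rightarrow> real) \<Rightarrow> 'a \<Rightarrow> 'a" where
  "grad \<phi> x = (\<Sum>b\<in>Basis. frechet_derivative \<phi> (at x) b *\<^sub>R b)"

definition Lp_loc ::
    "real \<Rightarrow> 'a::euclidean_space set \<Rightarrow> ('a \<Rightarrow> 'b::euclidean_space) set" where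
  "Lp_loc s \<Omega> = {f. set_borel_measurable lebesgue \<Omega> f \<and>
     (\<forall>K. compact K \<and> K \<subseteq> \<Omega> \<longrightarrow> set_integrable lebesgue K (\<lambda>x. norm (f x) powr s))}"

definition weak_gradient ::
    "'a::euclidean_space set \<Rightarrow> ('a \<Rightarrow> real) \<Rightarrow> ('a \<Rightarrow> 'a) \<Rightarrow> bool" where
  "weak_gradient \<Omega> u g \<longleftrightarrow> u \<in> Lp_loc 1 \<Omega> \<and> g \<in> Lp_loc 1 \<Omega> \<and>
     (\<forall>\<phi>\<in>test_functions \<Omega>. \<forall>b\<in>Basis.
        (LINT x:\<Omega>|lebesgue. u x * (grad \<phi> x \<bullet> b)) = - (LINT x:\<Omega>|lebesgue. (g x \<bullet> b) * \<phi> x))"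

definition W1_loc :: "real \<Rightarrow> 'a::euclidean_space set \<Rightarrow> ('a \<Rightarrow> real) set" where
  "W1_loc s \<Omega> = {u \<in> Lp_loc s \<Omega>. \<exists>g\<in>Lp_loc s \<Omega>. weak_gradient \<Omega> u g}"

definition weak_divergence ::
    "'a::euclidean_space set \<Rightarrow> ('a \<Rightarrow> 'a) \<Rightarrow> ('a \<Rightarrow> real) \<Rightarrow> bool" where
  "weak_divergence \<Omega> F h \<longleftrightarrow> F \<in> Lp_loc 1 \<Omega> \<and> h \<in> Lp_loc 1 \<Omega> \<and>
     (\<forall>\<phi>\<in>test_functions \<Omega>.
        (LINT x:\<Omega>|lebesgue. F x \<bullet> grad \<phi> x) = - (LINT x:\<Omega>|lebesgue. h x * \<phi> x))"

definition riesz_const :: "'a::euclidean_space itself \<Rightarrow> real \<Rightarrow> real" where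
  "riesz_const _ \<beta> =
     Gamma ((real DIM('a) - \<beta>) / 2) / (Gamma (\<beta> / 2) * pi powr (real DIM('a) / 2) * 2 powr \<beta>)"

definition riesz_kernel :: "real \<Rightarrow> 'a::euclidean_space \<Rightarrow> real" where
  "riesz_kernel \<beta> x = riesz_const TYPE('a) \<beta> * norm x powr (- (real DIM('a) - \<beta>))"

text \<open>
  For positive u in L^p(B_1), continuous on the punctured closed ball, the integral is finite
  at every x in the punctured ball, so the convention that a Bochner integral of a
  non-integrable function is 0 plays no role where this is used.
\<close>

definition riesz_conv :: "real \<Rightarrow> real \<Rightarrow> ('a::euclidean_space \<Rightarrow> real) \<Rightarrow> 'a \<Rightarrow> real" where
  "riesz_conv \<beta> p u x = (LINT y:ball 0 1|lebesgue. riesz_kernel \<beta> (x - y) * u y powr p)"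

text \<open>
  The field |x|^(-\<alpha>) |g|^(m-2) g for a gradient field g. Where g vanishes the field is 0 for
  every m > 1, also for m < 2.
\<close>

definition flux :: "real \<Rightarrow> real \<Rightarrow> ('a::euclidean_space \<Rightarrow> 'a) \<Rightarrow> 'a \<Rightarrow> 'a" where
  "flux \<alpha> m g x = (norm x powr (- \<alpha>) * norm (g x) powr (m - 2)) *\<^sub>R g x"

text \<open>
  The weak gradient g is unique up to a null set, so the existential over g only names it.
\<close>

definition positive_solution ::
    "real \<Rightarrow> real \<Rightarrow> real \<Rightarrow> real \<Rightarrow> real \<Rightarrow> ('a::euclidean_space \<Rightarrow> real) \<Rightarrow> bool" where
  "positive_solution m p q \<alpha> \<beta> u \<longleftrightarrow>
     (let \<Omega> = ball 0 1 - {0} in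
      u \<in> W1_loc m \<Omega> \<and>
      continuous_on (cball 0 1 - {0}) u \<and>
      (\<forall>x\<in>\<Omega>. u x > 0) \<and>
      set_integrable lebesgue (ball 0 1) (\<lambda>x. u x powr p) \<and>
      (\<lambda>x. riesz_conv \<beta> p u x * u x powr q) \<in> Lp_loc 1 \<Omega> \<and>
      (\<exists>g. weak_gradient \<Omega> u g \<and>
           (\<exists>h. weak_divergence \<Omega> (flux \<alpha> m g) h) \<and>
           (\<forall>\<phi>\<in>test_functions \<Omega>. (\<forall>x. \<phi> x \<ge> 0) \<longrightarrow>
              (LINT x:ball 0 1|lebesgue. flux \<alpha> m g x \<bullet> grad \<phi> x)
              + (LINT x:ball 0 1|lebesgue. riesz_conv \<beta> p u x * u x powr q * \<phi> x) \<le> 0)))"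

definition singular_solution ::
    "real \<Rightarrow> real \<Rightarrow> real \<Rightarrow> real \<Rightarrow> real \<Rightarrow> ('a::euclidean_space \<Rightarrow> real) \<Rightarrow> bool" where
  "singular_solution m p q \<alpha> \<beta> u \<longleftrightarrow>
     positive_solution m p q \<alpha> \<beta> u \<and> Limsup (at 0) (\<lambda>x. ereal (u x)) = \<infinity>"

end

theory Submission
  imports Defs
begin

text \<open>
  Put \<open>\<sigma> = (N - m - \<alpha>) / (m - 1)\<close>, so that \<open>|x|\<^sup>-\<^sup>\<sigma>\<close> is the fundamental solution of the operator.

  Existence: \<open>k |x|\<^sup>-\<^sup>a\<close> with \<open>a > max 0 \<sigma>\<close> close to \<open>max 0 \<sigma>\<close> and \<open>k\<close> small is a solution, because its
  divergence term is an explicit positive power of \<open>|x|\<close> and the potential of \<open>|x|\<^sup>-\<^sup>s\<close> is at most a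
  multiple of \<open>|x|\<close> to the power \<open>\<beta> - s\<close>.

  Necessity: the test function \<open>\<zeta>\<^sup>n u\<^sup>k\<close> with a cutoff \<open>\<zeta>\<close> of an annulus of radius \<open>r\<close> yields an energy
  estimate, and hence a bound for the flux through the annulus in terms of the integral of \<open>u\<^sup>s\<close>,
  \<open>s = m - 1 + k\<close>. If these integrals were \<open>o(r\<^sup>N\<^sup>-\<^sup>\<sigma>\<^sup>s)\<close> along a sequence of radii, the flux would tend
  to 0, and testing with a bounded function of \<open>u\<close> would show that \<open>u\<close> is bounded. So the integral of
  \<open>u\<^sup>w\<close> over the annulus is at least of order \<open>r\<^sup>N\<^sup>-\<^sup>\<sigma>\<^sup>w\<close> whenever \<open>w \<ge> s\<close>, which for \<open>w = p\<close> contradicts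
  \<open>u \<in> L\<^sup>p\<close> unless \<open>\<sigma> p < N\<close>. If the right-hand side of the inequality dominates \<open>r\<^sup>-\<^sup>\<tau> u\<^sup>q\<close> with
  \<open>\<sigma> q + \<tau> \<ge> N\<close>, a Keller-Osserman argument gives the matching upper bound, so the flux stays bounded
  and the right-hand side is integrable near 0; this contradicts its lower bound. The cases
  \<open>\<tau> = 0\<close> and \<open>\<tau> = \<sigma> p - \<beta>\<close> give the other two conditions.
\<close>

text \<open>The definition admits only smooth test functions, while the argument tests with \<psi>
  times G(u) for a \<open>u\<close> that is merely continuous with a weak gradient in L^m. Since the
  flux is of size |g|^(m-1), convergence of mollified gradients against this unbounded weight is the
  technical obstacle.

  The origin of \<sigma> is scaling. A function of size T on the shell of radius \<rho>, with
  gradient of size T / \<rho>, sends a flux of order \<rho>^(N-1-\<alpha>) (T / \<rho>)^(m-1)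
  through the shell; for T = \<kappa> \<rho>^-\<sigma> this is \<kappa>^(m-1) whatever \<rho> is.
  Bounds are therefore compared with \<rho>^(N - \<sigma> w), the order of the integral of u^w for u
  = \<rho>^-\<sigma>. They concern integrals over shells, not pointwise values, so no Harnack
  inequality enters.

  For necessity the nonlocal term is used only through lower bounds of the potential at distance
  \<rho> from 0: the whole mass of u^p gives a constant, hence \<tau> = 0, while the mass in a shell
  at distance comparable with \<rho> gives \<rho>^(\<beta>-N) \<rho>^(N - \<sigma> p), hence \<tau>
  = \<sigma> p - \<beta>.\<close>

section \<open>Reflection and translation invariance of Lebesgue measure\<close>

lemma distr_lborel_minus:
  "distr lborel borel (\<lambda>x. a - x) = (lborel :: 'a::euclidean_space measure)"
  using lborel_affine[of "-1" a] by (simp add: density_1)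

lemma distr_lborel_plus:
  "distr lborel borel (\<lambda>x. x + a) = (lborel :: 'a::euclidean_space measure)"
  using lborel_affine[of "1" a] by (simp add: density_1 add.commute)

lemma integral_lborel_minus:
  fixes f :: "'a::euclidean_space \<Rightarrow> 'b::euclidean_space"
  assumes [measurable]: "f \<in> borel_measurable borel"
  shows "(\<integral>x. f (a - x) \<partial>lborel) = (\<integral>x. f x \<partial>lborel)"
proof -
  have "(\<integral>x. f x \<partial>lborel) = (\<integral>x. f x \<partial>(distr lborel borel (\<lambda>x. a - x)))"
    by (simp only: distr_lborel_minus)
  also have "\<dots> = (\<integral>x. f (a - x) \<partial>lborel)"
    by (subst integral_distr) auto
  finally show ?thesis by simp
qed

lemma integrable_lborel_minus:
  fixes f :: "'a::euclidean_space \<Rightarrow> 'b::euclidean_space"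
  assumes "integrable lborel f"
  shows "integrable lborel (\<lambda>x. f (a - x))"
proof -
  have [measurable]: "f \<in> borel_measurable borel"
    using assms by auto
  show ?thesis
    using integrable_distr_eq[of "\<lambda>x. a - x" lborel borel f] assms by (simp add: distr_lborel_minus)
qed

lemma integral_lborel_plus:
  fixes f :: "'a::euclidean_space \<Rightarrow> 'b::euclidean_space"
  assumes [measurable]: "f \<in> borel_measurable borel"
  shows "(\<integral>x. f (x + a) \<partial>lborel) = (\<integral>x. f x \<partial>lborel)"
proof -
  have "(\<integral>x. f x \<partial>lborel) = (\<integral>x. f x \<partial>(distr lborel borel (\<lambda>x. x + a)))"
    by (simp only: distr_lborel_plus)
  also have "\<dots> = (\<integral>x. f (x + a) \<partial>lborel)"
    by (subst integral_distr) auto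
  finally show ?thesis by simp
qed

lemma integrable_lborel_plus:
  fixes f :: "'a::euclidean_space \<Rightarrow> 'b::euclidean_space"
  assumes "integrable lborel f"
  shows "integrable lborel (\<lambda>x. f (x + a))"
proof -
  have [measurable]: "f \<in> borel_measurable borel"
    using assms by auto
  show ?thesis
    using integrable_distr_eq[of "\<lambda>x. x + a" lborel borel f] assms by (simp add: distr_lborel_plus)
qed

lemma nn_integral_lborel_minus:
  fixes f :: "'a::euclidean_space \<Rightarrow> ennreal"
  assumes [measurable]: "f \<in> borel_measurable borel"
  shows "(\<integral>\<^sup>+x. f (a - x) \<partial>lborel) = (\<integral>\<^sup>+x. f x \<partial>lborel)"
proof -
  have "(\<integral>\<^sup>+x. f x \<partial>lborel) = (\<integral>\<^sup>+x. f x \<partial>(distr lborel borel (\<lambda>x. a - x)))"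
    by (simp only: distr_lborel_minus)
  also have "\<dots> = (\<integral>\<^sup>+x. f (a - x) \<partial>lborel)"
    by (subst nn_integral_distr) auto
  finally show ?thesis by simp
qed

subsection \<open>Integrals of powers of the norm\<close>

lemma dyadic_index:
  fixes y :: real
  assumes "y \<ge> 1"
  obtains j :: nat where "2 ^ j \<le> y" "y < 2 ^ Suc j"
proof -
  have l: "0 \<le> log 2 y" using assms by simp
  obtain j :: nat where j: "real j \<le> log 2 y" "log 2 y < real j + 1"
    using l that by (metis floor_of_nat le_floor_iff of_int_of_nat_eq of_nat_nat real_of_int_floor_add_one_gt
        of_int_floor_le zero_le_floor)
  have "2 powr (real j) \<le> 2 powr (log 2 y)" using j by simp
  moreover have "2 powr (log 2 y) < 2 powr (real j + 1)"
    using j by (intro powr_less_mono) auto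
  ultimately show ?thesis
    using that[of j] assms by (simp add: powr_realpow powr_add mult.commute)
qed

text \<open>The sets on which \<open>a j\<close> bounds \<open>f\<close> may overlap: the sum of
  multiples of ball indicators still dominates \<open>f\<close>, so upper estimates of radial
  integrals cost only a series and volumes of balls. The origin lies in no dyadic shell, hence the
  separate condition \<open>f 0 = 0\<close>.\<close>

lemma nn_integral_dyadic_le:
  fixes f :: "'a::euclidean_space \<Rightarrow> ennreal" and a :: "nat \<Rightarrow> real"
  assumes f: "\<And>x. x \<noteq> 0 \<Longrightarrow> f x \<noteq> 0 \<Longrightarrow> \<exists>j. norm x < \<rho> j \<and> f x \<le> ennreal (a j)"
    and f0: "f 0 = 0"
    and a: "\<And>j. 0 \<le> a j" and r: "\<And>j. 0 < \<rho> j"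
    and S: "(\<lambda>j. a j * \<rho> j ^ DIM('a)) sums S"
  shows "(\<integral>\<^sup>+x. f x \<partial>lborel) \<le> ennreal (unit_ball_vol (real DIM('a)) * S)"
proof -
  let ?V = "unit_ball_vol (real DIM('a))"
  have "(\<integral>\<^sup>+x. f x \<partial>lborel) \<le> (\<integral>\<^sup>+x. (\<Sum>j. ennreal (a j) * indicator (ball (0::'a) (\<rho> j)) x) \<partial>lborel)"
  proof (rule nn_integral_mono)
    fix x :: 'a
    show "f x \<le> (\<Sum>j. ennreal (a j) * indicator (ball (0::'a) (\<rho> j)) x)"
    proof (cases "x = 0 \<or> f x = 0")
      case True
      then show ?thesis using f0 by auto
    next
      case False
      then obtain j where j: "norm x < \<rho> j" "f x \<le> ennreal (a j)" using f by blast
      have "f x \<le> (\<Sum>j\<in>{j}. ennreal (a j) * indicator (ball (0::'a) (\<rho> j)) x)"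
        using j by simp
      also have "\<dots> \<le> (\<Sum>j. ennreal (a j) * indicator (ball (0::'a) (\<rho> j)) x)"
        by (intro sum_le_suminf) auto
      finally show ?thesis .
    qed
  qed
  also have "\<dots> = (\<Sum>j. \<integral>\<^sup>+x. ennreal (a j) * indicator (ball (0::'a) (\<rho> j)) x \<partial>lborel)"
    by (intro nn_integral_suminf borel_measurable_times_ennreal borel_measurable_const borel_measurable_indicator) auto
  also have "\<dots> = (\<Sum>j. ennreal (?V * (a j * \<rho> j ^ DIM('a))))"
    using a r by (intro suminf_cong)
      (simp add: nn_integral_cmult_indicator emeasure_ball less_imp_le ennreal_mult' [symmetric] mult_ac
        del: unit_ball_vol_numeral)
  also have "\<dots> = ennreal (?V * S)"
    using a r by (intro suminf_ennreal_eq sums_mult S mult_nonneg_nonneg)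
      (auto simp: less_imp_le)
  finally show ?thesis .
qed

text \<open>On the shell between \<open>R / 2 ^ Suc j\<close> and \<open>R / 2 ^ j\<close> the
  integrand is at most \<open>2 powr t\<close> times its value at the outer radius. With N the
  dimension, the shells sum to a geometric series of ratio 2^(t - N), below 1 because
  \<open>t < N\<close>, and the power of R factors out.\<close>

lemma nn_integral_norm_powr_ball:
  assumes t: "0 \<le> t" "t < real DIM('a::euclidean_space)"
  obtains C where "C \<ge> 0"
    "\<And>R. R > 0 \<Longrightarrow> (\<integral>\<^sup>+x. ennreal (norm x powr (- t)) * indicator (ball (0::'a) R) x \<partial>lborel)
       \<le> ennreal (C * R powr (real DIM('a) - t))"
proof -
  let ?N = "real DIM('a)"
  let ?q = "2 powr (- (?N - t)) :: real"
  let ?V = "unit_ball_vol (real DIM('a))"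
  define M :: real where "M = 2 powr t * 2 ^ DIM('a)"
  have q: "0 < ?q" "?q < 1" using t powr_less_mono[of "- (?N - t)" 0 "2::real"] by auto
  define C where "C = ?V * (M * (1 / (1 - ?q)))"
  show thesis
  proof (rule that[of C])
    show "C \<ge> 0" using q unfolding C_def M_def by auto
    fix R :: real assume R: "R > 0"
    let ?a = "\<lambda>j::nat. 2 powr t * (R / 2 ^ j) powr (- t)"
    \<comment> \<open>Twice the outer radius of the shell, so that its outer boundary lies in the
      open ball.\<close>
    let ?r = "\<lambda>j::nat. 2 * (R / 2 ^ j)"
    have eq: "?a j * ?r j ^ DIM('a) = M * R powr (?N - t) * ?q ^ j" for j
    proof -
      define y where "y = R / 2 ^ j"
      have y: "y > 0" using R by (simp add: y_def)
      then have "2 powr t * y powr (- t) * (2 * y) ^ DIM('a) = M * (y powr (- t) * y powr ?N)"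
        by (simp add: powr_realpow power_mult_distrib M_def)
      also have "\<dots> = M * y powr (?N - t)"
        by (simp add: powr_add[symmetric])
      also have "y powr (?N - t) = R powr (?N - t) * ?q ^ j"
      proof -
        have "y = R * 2 powr (- real j)" by (simp add: y_def powr_minus powr_realpow divide_inverse)
        then show ?thesis using R by (simp add: powr_mult powr_powr powr_realpow[symmetric] algebra_simps)
      qed
      finally show ?thesis by (simp add: y_def)
    qed
    have "(\<lambda>j. ?q ^ j) sums (1 / (1 - ?q))" using q by (intro geometric_sums) auto
    then have S: "(\<lambda>j. ?a j * ?r j ^ DIM('a)) sums (M * R powr (?N - t) * (1 / (1 - ?q)))"
      unfolding eq by (rule sums_mult)
    have "(\<integral>\<^sup>+x. ennreal (norm x powr (- t)) * indicator (ball (0::'a) R) x \<partial>lborel)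
       \<le> ennreal (?V * (M * R powr (?N - t) * (1 / (1 - ?q))))"
    proof (rule nn_integral_dyadic_le[OF _ _ _ _ S])
      fix x :: 'a
      assume x: "x \<noteq> 0" "ennreal (norm x powr - t) * indicator (ball 0 R) x \<noteq> 0"
      then have xR: "norm x < R" by (auto simp: indicator_def split: if_splits)
      have "1 \<le> R / norm x" using xR x by simp
      then obtain j where j: "2 ^ j \<le> R / norm x" "R / norm x < 2 ^ Suc j"
        using dyadic_index by blast
      have j': "norm x \<le> R / 2 ^ j" "R / 2 ^ j / 2 < norm x"
        using j x by (auto simp: field_simps)
      have "norm x powr (- t) \<le> (R / 2 ^ j / 2) powr (- t)"
        using j' R t by (intro powr_mono2') auto
      also have "\<dots> = 2 powr t * (R / 2 ^ j) powr (- t)"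
        using R by (subst powr_divide) (auto simp: powr_minus field_simps)
      finally have "norm x powr (- t) \<le> 2 powr t * (R / 2 ^ j) powr (- t)" .
      moreover have "norm x < 2 * (R / 2 ^ j)" using j' x
        by (smt (verit) zero_less_norm_iff)
      ultimately show "\<exists>j. norm x < 2 * (R / 2 ^ j) \<and>
            ennreal (norm x powr - t) * indicator (ball 0 R) x \<le> ennreal (2 powr t * (R / 2 ^ j) powr - t)"
        by (intro exI[of _ j]) (auto simp: indicator_def intro: ennreal_leI)
    qed (use R in auto)
    then show "(\<integral>\<^sup>+x. ennreal (norm x powr (- t)) * indicator (ball (0::'a) R) x \<partial>lborel)
       \<le> ennreal (C * R powr (real DIM('a) - t))"
      by (simp add: C_def mult_ac)
  qed
qed

text \<open>The dyadic shells now run outward from R; their series has ratio 2^(N - t) and converges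
  because t exceeds the dimension N.\<close>

lemma nn_integral_norm_powr_exterior:
  assumes t: "t > real DIM('a::euclidean_space)"
  obtains C where "C \<ge> 0"
    "\<And>R. R > 0 \<Longrightarrow> (\<integral>\<^sup>+x. ennreal (norm x powr (- t)) * indicator (- ball (0::'a) R) x \<partial>lborel)
       \<le> ennreal (C * R powr (real DIM('a) - t))"
proof -
  let ?N = "real DIM('a)"
  let ?q = "2 powr (?N - t) :: real"
  let ?V = "unit_ball_vol (real DIM('a))"
  define M :: real where "M = 2 ^ DIM('a)"
  have t0: "t > 0" using t by (smt (verit) of_nat_0_le_iff)
  have q: "0 < ?q" "?q < 1" using t powr_less_mono[of "?N - t" 0 "2::real"] by auto
  define C where "C = ?V * (M * (1 / (1 - ?q)))"
  show thesis
  proof (rule that[of C])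
    show "C \<ge> 0" using q unfolding C_def M_def by auto
    fix R :: real assume R: "R > 0"
    let ?a = "\<lambda>j::nat. (R * 2 ^ j) powr (- t)"
    let ?r = "\<lambda>j::nat. 2 * (R * 2 ^ j)"
    have eq: "?a j * ?r j ^ DIM('a) = M * R powr (?N - t) * ?q ^ j" for j
    proof -
      define y where "y = R * 2 ^ j"
      have y: "y > 0" using R by (simp add: y_def)
      then have "y powr (- t) * (2 * y) ^ DIM('a) = M * (y powr (- t) * y powr ?N)"
        by (simp add: powr_realpow power_mult_distrib M_def)
      also have "\<dots> = M * y powr (?N - t)"
        by (simp add: powr_add[symmetric])
      also have "y powr (?N - t) = R powr (?N - t) * ?q ^ j"
        using R by (simp add: y_def powr_mult powr_realpow[symmetric] powr_powr mult_ac)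
      finally show ?thesis by (simp add: y_def)
    qed
    have "(\<lambda>j. ?q ^ j) sums (1 / (1 - ?q))" using q by (intro geometric_sums) auto
    then have S: "(\<lambda>j. ?a j * ?r j ^ DIM('a)) sums (M * R powr (?N - t) * (1 / (1 - ?q)))"
      unfolding eq by (rule sums_mult)
    have "(\<integral>\<^sup>+x. ennreal (norm x powr (- t)) * indicator (- ball (0::'a) R) x \<partial>lborel)
       \<le> ennreal (?V * (M * R powr (?N - t) * (1 / (1 - ?q))))"
    proof (rule nn_integral_dyadic_le[OF _ _ _ _ S])
      fix x :: 'a
      assume x: "x \<noteq> 0" "ennreal (norm x powr - t) * indicator (- ball 0 R) x \<noteq> 0"
      then have xR: "norm x \<ge> R" by (auto simp: indicator_def split: if_splits)
      have "1 \<le> norm x / R" using xR R by simp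
      then obtain j where j: "2 ^ j \<le> norm x / R" "norm x / R < 2 ^ Suc j"
        using dyadic_index by blast
      have j': "R * 2 ^ j \<le> norm x" "norm x < 2 * (R * 2 ^ j)"
        using j R by (auto simp: field_simps)
      have "norm x powr (- t) \<le> (R * 2 ^ j) powr (- t)"
        using j' R t0 by (intro powr_mono2') auto
      with j' show "\<exists>j. norm x < 2 * (R * 2 ^ j) \<and>
            ennreal (norm x powr - t) * indicator (- ball 0 R) x \<le> ennreal ((R * 2 ^ j) powr - t)"
        by (intro exI[of _ j]) (auto simp: indicator_def intro: ennreal_leI)
    qed (use R in auto)
    then show "(\<integral>\<^sup>+x. ennreal (norm x powr (- t)) * indicator (- ball (0::'a) R) x \<partial>lborel)
       \<le> ennreal (C * R powr (real DIM('a) - t))"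
      by (simp add: C_def mult_ac)
  qed
qed

subsection \<open>Continuity of translations in the mean\<close>

text \<open>For x in U the points \<open>x - Y n\<close> are eventually in U, but at boundary points
  the indicators need not converge. Only the positive part of
  \<open>indicator U x - indicator U (x - Y n)\<close> tends to 0 pointwise; as U and its translate
  have equal measure, it carries exactly half of the L1 distance.\<close>

lemma tendsto_translation_open:
  fixes Y :: "nat \<Rightarrow> 'a::euclidean_space"
  assumes U: "open U" "emeasure lborel U < \<infinity>" and Y: "Y \<longlonglongrightarrow> 0"
  shows "(\<lambda>n. \<integral>x. \<bar>indicator U (x - Y n) - indicator U x :: real\<bar> \<partial>lborel) \<longlonglongrightarrow> 0"
proof -
  have [measurable]: "U \<in> sets borel" using U by auto
  have iU: "integrable lborel (indicator U :: 'a \<Rightarrow> real)"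
    using U by (simp add: integrable_indicator_iff)
  have iU': "integrable lborel (\<lambda>x. indicator U (x - y) :: real)" for y
    using integrable_lborel_plus[OF iU, of "- y"] by simp
  have eq: "(\<integral>x. \<bar>indicator U (x - y) - indicator U x :: real\<bar> \<partial>lborel)
      = 2 * (\<integral>x. max 0 (indicator U x - indicator U (x - y)) \<partial>lborel)" for y
  proof -
    have "(\<integral>x. \<bar>indicator U (x - y) - indicator U x :: real\<bar> \<partial>lborel)
      = (\<integral>x. (indicator U (x - y) - indicator U x) + 2 * max 0 (indicator U x - indicator U (x - y)) \<partial>lborel)"
      by (intro Bochner_Integration.integral_cong) (auto simp: indicator_def)
    also have "\<dots> = (\<integral>x. indicator U (x - y) \<partial>lborel) - (\<integral>x. indicator U x \<partial>lborel)
        + 2 * (\<integral>x. max 0 (indicator U x - indicator U (x - y)) \<partial>lborel)"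
      using iU iU' by (simp add: integrable_max)
    also have "(\<integral>x. indicator U (x - y) \<partial>lborel) = (\<integral>x. indicator U x \<partial>lborel :: real)"
      using integral_lborel_plus[of "indicator U :: 'a \<Rightarrow> real" "- y"] by simp
    finally show ?thesis by simp
  qed
  have "(\<lambda>n. \<integral>x. max 0 (indicator U x - indicator U (x - Y n)) \<partial>lborel) \<longlonglongrightarrow> (\<integral>x. 0 \<partial>(lborel :: 'a measure) :: real)"
  proof (rule integral_dominated_convergence[where w = "indicator U"])
    show "AE x in lborel. (\<lambda>n. max 0 (indicator U x - indicator U (x - Y n) :: real)) \<longlonglongrightarrow> 0"
    proof (rule AE_I2)
      fix x
      show "(\<lambda>n. max 0 (indicator U x - indicator U (x - Y n) :: real)) \<longlonglongrightarrow> 0"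
      proof (cases "x \<in> U")
        case True
        have "(\<lambda>n. x - Y n) \<longlonglongrightarrow> x - 0" by (intro tendsto_intros Y)
        then have "eventually (\<lambda>n. x - Y n \<in> U) sequentially"
          using True U by (simp add: topological_tendstoD)
        then show ?thesis
          by (rule tendsto_eventually[OF eventually_mono]) (use True in auto)
      next
        case False
        then have "(\<lambda>n. max 0 (indicator U x - indicator U (x - Y n) :: real)) = (\<lambda>n. 0)"
          by (auto simp: indicator_def)
        then show ?thesis by simp
      qed
    qed
    show "integrable lborel (indicator U :: 'a \<Rightarrow> real)" by (rule iU)
  qed (auto simp: indicator_def)
  then have "(\<lambda>n. 2 * (\<integral>x. max 0 (indicator U x - indicator U (x - Y n)) \<partial>lborel)) \<longlonglongrightarrow> (2 * 0 :: real)"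
    by (intro tendsto_mult) auto
  then show ?thesis unfolding eq by simp
qed

text \<open>A three-term splitting through h: by translation invariance the first and the last term
  are both the L1 distance of f and h, so only the translates of h have to be treated.\<close>

lemma tendsto_translation_approx:
  fixes f :: "'a::euclidean_space \<Rightarrow> 'b::euclidean_space" and Y :: "nat \<Rightarrow> 'a"
  assumes f: "integrable lborel f"
    and ap: "\<And>e. e > 0 \<Longrightarrow> \<exists>h. integrable lborel h \<and> (\<integral>x. norm (f x - h x) \<partial>lborel) < e \<and>
          (\<lambda>n. \<integral>x. norm (h (x - Y n) - h x) \<partial>lborel) \<longlonglongrightarrow> 0"
  shows "(\<lambda>n. \<integral>x. norm (f (x - Y n) - f x) \<partial>lborel) \<longlonglongrightarrow> 0"
proof (rule LIMSEQ_I)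
  fix e :: real assume "e > 0"
  then obtain h where h: "integrable lborel h" "(\<integral>x. norm (f x - h x) \<partial>lborel) < e/3"
      "(\<lambda>n. \<integral>x. norm (h (x - Y n) - h x) \<partial>lborel) \<longlonglongrightarrow> 0"
    using ap[of "e/3"] by auto
  have [measurable]: "f \<in> borel_measurable borel" "h \<in> borel_measurable borel"
    using f h(1) by auto
  obtain n0 where n0: "\<And>n. n \<ge> n0 \<Longrightarrow> norm ((\<integral>x. norm (h (x - Y n) - h x) \<partial>lborel) - 0) < e/3"
    using LIMSEQ_D[OF h(3), of "e/3"] \<open>e > 0\<close> by auto
  have "norm ((\<integral>x. norm (f (x - Y n) - f x) \<partial>lborel) - 0) < e" if n: "n \<ge> n0" for n
  proof -
    note [simp] = f h(1) integrable_lborel_plus[OF f, of "- Y n", simplified]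
      integrable_lborel_plus[OF h(1), of "- Y n", simplified]
    have "(\<integral>x. norm (f (x - Y n) - f x) \<partial>lborel)
       \<le> (\<integral>x. norm (f (x - Y n) - h (x - Y n)) + norm (h (x - Y n) - h x) + norm (f x - h x) \<partial>lborel)"
    proof (rule integral_mono)
      fix x
      have "f (x - Y n) - f x = (f (x - Y n) - h (x - Y n)) + (h (x - Y n) - h x) - (f x - h x)" by simp
      then show "norm (f (x - Y n) - f x) \<le> norm (f (x - Y n) - h (x - Y n)) + norm (h (x - Y n) - h x) + norm (f x - h x)"
        by (smt (verit) norm_triangle_ineq norm_triangle_ineq4)
    qed (auto intro!: integrable_norm)
    also have "\<dots> = (\<integral>x. norm (f (x - Y n) - h (x - Y n)) \<partial>lborel)
        + (\<integral>x. norm (h (x - Y n) - h x) \<partial>lborel) + (\<integral>x. norm (f x - h x) \<partial>lborel)"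
      by (subst Bochner_Integration.integral_add, (auto intro!: integrable_norm)[2])+ simp
    also have "(\<integral>x. norm (f (x - Y n) - h (x - Y n)) \<partial>lborel) = (\<integral>x. norm (f x - h x) \<partial>lborel)"
      using integral_lborel_plus[of "\<lambda>x. norm (f x - h x)" "- Y n"] by simp
    finally have "(\<integral>x. norm (f (x - Y n) - f x) \<partial>lborel) < e"
      using h(2) n0[OF n] by (simp add: abs_if split: if_splits)
    moreover have "(\<integral>x. norm (f (x - Y n) - f x) \<partial>lborel) \<ge> 0" by simp
    ultimately show ?thesis by simp
  qed
  then show "\<exists>no. \<forall>n\<ge>no. norm ((\<integral>x. norm (f (x - Y n) - f x) \<partial>lborel) - 0) < e" by blast
qed

lemma tendsto_translation_L1:
  fixes f :: "'a::euclidean_space \<Rightarrow> 'b::euclidean_space" and Y :: "nat \<Rightarrow> 'a"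
  assumes f: "integrable lborel f" and Y: "Y \<longlonglongrightarrow> 0"
  shows "(\<lambda>n. \<integral>x. norm (f (x - Y n) - f x) \<partial>lborel) \<longlonglongrightarrow> 0"
  using f
proof (induction rule: integrable_induct)
  case (base A c)
  then have [measurable]: "A \<in> sets borel" by auto
  have iA: "integrable lborel (\<lambda>x. indicator A x *\<^sub>R c)"
    using base by (intro integrable_scaleR_left impI integrable_real_indicator) auto
  show ?case
  proof (rule tendsto_translation_approx[OF iA])
    fix e :: real assume e: "e > 0"
    \<comment> \<open>The added 1 covers \<open>c = 0\<close>; an open superset of A that exceeds A
      by measure less than d changes the step function by less than e in L1.\<close>
    define d where "d = e / (norm c + 1)"
    have d: "d > 0" "d * norm c < e" using e by (auto simp: d_def field_simps add_pos_nonneg intro!: divide_pos_pos)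
    obtain U where U: "open U" "A \<subseteq> U" "emeasure lborel (U - A) < ennreal d"
      using outer_regular_lborel[of A d] base d by auto
    have [measurable]: "U \<in> sets borel" using U by auto
    have mU: "emeasure lborel U < \<infinity>"
    proof -
      have "emeasure lborel U = emeasure lborel (A \<union> (U - A))" using U by (simp add: Un_absorb1)
      also have "\<dots> \<le> emeasure lborel A + emeasure lborel (U - A)" by (rule emeasure_subadditive) auto
      also have "\<dots> < \<infinity>" using base U by (auto simp: less_top[symmetric] top_unique intro: order.strict_trans)
      finally show ?thesis .
    qed
    have "(\<integral>x. norm (indicator A x *\<^sub>R c - indicator U x *\<^sub>R c) \<partial>lborel)
        = (\<integral>x. indicator (U - A) x * norm c \<partial>lborel)"
      using U by (intro Bochner_Integration.integral_cong) (auto simp: indicator_def)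
    also have "\<dots> = measure lborel (U - A) * norm c" by simp
    also have "\<dots> \<le> d * norm c"
      using U(3) d(1) unfolding measure_def by (intro mult_right_mono enn2real_leI less_imp_le[OF U(3)]) auto
    also have "\<dots> < e" by (rule d)
    finally have 1: "(\<integral>x. norm (indicator A x *\<^sub>R c - indicator U x *\<^sub>R c) \<partial>lborel) < e" .
    have "(\<lambda>n. (\<integral>x. \<bar>indicator U (x - Y n) - indicator U x :: real\<bar> \<partial>lborel) * norm c) \<longlonglongrightarrow> 0 * norm c"
      by (intro tendsto_intros tendsto_translation_open U mU Y)
    then have 2: "(\<lambda>n. (\<integral>x. norm (indicator U (x - Y n) *\<^sub>R c - indicator U x *\<^sub>R c) \<partial>lborel)) \<longlonglongrightarrow> 0"
      by (simp add: scaleR_diff_left[symmetric] )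
    show "\<exists>h. integrable lborel h \<and> (\<integral>x. norm (indicat_real A x *\<^sub>R c - h x) \<partial>lborel) < e \<and>
          (\<lambda>n. \<integral>x. norm (h (x - Y n) - h x) \<partial>lborel) \<longlonglongrightarrow> 0"
      using 1 2 mU by (intro exI[of _ "\<lambda>x. indicator U x *\<^sub>R c"] conjI integrable_scaleR_left impI integrable_real_indicator) auto
  qed
next
  case (add f g)
  have [measurable]: "f \<in> borel_measurable borel" "g \<in> borel_measurable borel"
    using add by auto
  show ?case
  proof (rule Lim_null_comparison[OF always_eventually])
    show "(\<lambda>n. (\<integral>x. norm (f (x - Y n) - f x) \<partial>lborel) + (\<integral>x. norm (g (x - Y n) - g x) \<partial>lborel)) \<longlonglongrightarrow> 0"
      using tendsto_add[OF add(3,4)] by simp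
    show "\<forall>n. norm (\<integral>x. norm (f (x - Y n) + g (x - Y n) - (f x + g x)) \<partial>lborel)
      \<le> (\<integral>x. norm (f (x - Y n) - f x) \<partial>lborel) + (\<integral>x. norm (g (x - Y n) - g x) \<partial>lborel)"
    proof
      fix n
      note [simp] = add(1,2) integrable_lborel_plus[OF add(1), of "- Y n", simplified]
        integrable_lborel_plus[OF add(2), of "- Y n", simplified]
      have "(\<integral>x. norm (f (x - Y n) + g (x - Y n) - (f x + g x)) \<partial>lborel)
        \<le> (\<integral>x. norm (f (x - Y n) - f x) + norm (g (x - Y n) - g x) \<partial>lborel)"
        by (rule integral_mono) (auto intro!: integrable_norm norm_diff_triangle_ineq)
      also have "\<dots> = (\<integral>x. norm (f (x - Y n) - f x) \<partial>lborel) + (\<integral>x. norm (g (x - Y n) - g x) \<partial>lborel)"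
        by (intro Bochner_Integration.integral_add integrable_norm) auto
      finally show "norm (\<integral>x. norm (f (x - Y n) + g (x - Y n) - (f x + g x)) \<partial>lborel)
      \<le> (\<integral>x. norm (f (x - Y n) - f x) \<partial>lborel) + (\<integral>x. norm (g (x - Y n) - g x) \<partial>lborel)" by simp
    qed
  qed
next
  case (lim f s)
  have [measurable]: "f \<in> borel_measurable borel" "s i \<in> borel_measurable borel" for i
    using lim by auto
  \<comment> \<open>The induction rule supplies \<open>norm (s i x) \<le> 2 * norm (f x)\<close>,
    which gives the factor 3 in the dominating function.\<close>
  have "(\<lambda>i. \<integral>x. norm (f x - s i x) \<partial>lborel) \<longlonglongrightarrow> (\<integral>x. 0 \<partial>(lborel::'a measure))"
  proof (rule integral_dominated_convergence[where w = "\<lambda>x. 3 * norm (f x)"])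
    show "AE x in lborel. (\<lambda>i. norm (f x - s i x)) \<longlonglongrightarrow> 0"
    proof (rule AE_I2)
      fix x
      have "(\<lambda>i. norm (f x - s i x)) \<longlonglongrightarrow> norm (f x - f x)" by (intro tendsto_intros lim(2)) auto
      then show "(\<lambda>i. norm (f x - s i x)) \<longlonglongrightarrow> 0" by simp
    qed
    show "AE x in lborel. norm (norm (f x - s i x)) \<le> 3 * norm (f x)" for i
    proof (rule AE_I2)
      fix x
      show "norm (norm (f x - s i x)) \<le> 3 * norm (f x)"
        using lim(3)[of x i] norm_triangle_ineq4[of "f x" "s i x"] by auto
    qed
  qed (use lim in auto)
  then have L: "(\<lambda>i. \<integral>x. norm (f x - s i x) \<partial>lborel) \<longlonglongrightarrow> 0" by simp
  show ?case
  proof (rule tendsto_translation_approx[OF lim(4)])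
    fix e :: real assume "e > 0"
    then obtain i where "norm ((\<integral>x. norm (f x - s i x) \<partial>lborel) - 0) < e"
      using LIMSEQ_D[OF L] by blast
    then show "\<exists>h. integrable lborel h \<and> (\<integral>x. norm (f x - h x) \<partial>lborel) < e \<and>
          (\<lambda>n. \<integral>x. norm (h (x - Y n) - h x) \<partial>lborel) \<longlonglongrightarrow> 0"
      using lim(1,5) by (intro exI[of _ "s i"]) (auto simp: abs_if split: if_splits)
  qed
qed

subsection \<open>Smooth functions\<close>

lemma C_k_SucI:
  assumes "\<And>x. (f has_derivative f' x) (at x)" and "\<And>b. b \<in> Basis \<Longrightarrow> C_k k (\<lambda>x. f' x b)"
  shows "C_k (Suc k) f"
proof -
  have "frechet_derivative f (at x) = f' x" for x
    using frechet_derivative_at[OF assms(1)] by simp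
  then show ?thesis using assms by (auto intro: differentiableI)
qed

lemma C_k_has_derivative:
  assumes "C_k (Suc k) f"
  shows "(f has_derivative frechet_derivative f (at x)) (at x)"
  using assms by (auto simp: frechet_derivative_works[symmetric])

lemma C_k_SucD: "C_k (Suc k) f \<Longrightarrow> C_k k f"
proof (induction k arbitrary: f)
  case 0
  then show ?case
    by (auto intro!: continuous_at_imp_continuous_on differentiable_imp_continuous_within)
qed simp

lemma C_k_const: "C_k k (\<lambda>x. c)"
  by (induction k arbitrary: c) (auto intro!: C_k_SucI[where f' = "\<lambda>x v. 0"] simp del: C_k.simps(2))

lemma C_k_add:
  "C_k k f \<Longrightarrow> C_k k g \<Longrightarrow> C_k k (\<lambda>x. f x + g x)"
proof (induction k arbitrary: f g)
  case 0
  then show ?case by (auto intro: continuous_intros)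
next
  case (Suc k)
  show ?case
    by (rule C_k_SucI[OF has_derivative_add[OF C_k_has_derivative[OF Suc(2)] C_k_has_derivative[OF Suc(3)]]])
      (use Suc in auto)
qed

lemma C_k_mult:
  "C_k k f \<Longrightarrow> C_k k g \<Longrightarrow> C_k k (\<lambda>x. f x * g x)"
proof (induction k arbitrary: f g)
  case 0
  then show ?case by (auto intro: continuous_intros)
next
  case (Suc k)
  note [simp] = C_k_SucD[OF Suc(2)] C_k_SucD[OF Suc(3)]
  show ?case
    by (rule C_k_SucI[OF has_derivative_mult[OF C_k_has_derivative[OF Suc(2)] C_k_has_derivative[OF Suc(3)]]])
      (use Suc in \<open>auto intro!: C_k_add\<close>)
qed

lemma C_k_inner: "C_k k (\<lambda>x. x \<bullet> b)"
proof (cases k)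
  case (Suc j)
  show ?thesis unfolding Suc
    by (rule C_k_SucI[where f' = "\<lambda>x v. v \<bullet> b"]) (auto intro!: derivative_eq_intros C_k_const)
qed (auto intro: continuous_intros)

text \<open>Each derivative produces the next member of F times the linear factor
  \<open>- 2 * (x \<bullet> b)\<close>. A whole tower F, rather than one smooth function, lets the
  induction on k close.\<close>

lemma C_k_radial:
  fixes F :: "nat \<Rightarrow> real \<Rightarrow> real"
  assumes F: "\<And>j t. (F j has_real_derivative F (Suc j) t) (at t)"
  shows "C_k k (\<lambda>x::'a::euclidean_space. F j (c - x \<bullet> x))"
proof (induction k arbitrary: j)
  case 0
  have "continuous_on UNIV (F j)"
    using F by (auto intro!: continuous_at_imp_continuous_on DERIV_isCont)
  then show ?case
    by (auto intro!: continuous_intros continuous_on_compose2[of UNIV "F j"])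
next
  case (Suc k)
  show ?case
  proof (rule C_k_SucI)
    fix x :: 'a
    have "((\<lambda>x. c - x \<bullet> x) has_derivative (\<lambda>v. - 2 * (x \<bullet> v))) (at x)"
      by (auto intro!: derivative_eq_intros simp: inner_commute)
    from has_derivative_compose[OF this F[unfolded has_field_derivative_def]]
    show "((\<lambda>x. F j (c - x \<bullet> x)) has_derivative (\<lambda>v. F (Suc j) (c - x \<bullet> x) * (- 2 * (x \<bullet> v)))) (at x)" .
    show "C_k k (\<lambda>x. F (Suc j) (c - x \<bullet> x) * (- 2 * (x \<bullet> b)))" for b :: 'a
      by (intro C_k_mult Suc C_k_const C_k_inner)
  qed
qed

lemma C_k_affine:
  "C_k k \<eta> \<Longrightarrow> C_k k (\<lambda>y. \<eta> (a + s *\<^sub>R y))"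
proof (induction k arbitrary: \<eta>)
  case 0
  then show ?case
    by (auto intro!: continuous_intros continuous_on_compose2[of UNIV \<eta>])
next
  case (Suc k)
  show ?case
  proof (rule C_k_SucI)
    fix y
    have "((\<lambda>y. a + s *\<^sub>R y) has_derivative (\<lambda>v. s *\<^sub>R v)) (at y)"
      by (auto intro!: derivative_eq_intros)
    from has_derivative_compose[OF this C_k_has_derivative[OF Suc(2)]]
    show "((\<lambda>y. \<eta> (a + s *\<^sub>R y)) has_derivative (\<lambda>v. frechet_derivative \<eta> (at (a + s *\<^sub>R y)) (s *\<^sub>R v))) (at y)" .
  next
    fix b :: 'a assume b: "b \<in> Basis"
    have "(\<lambda>x. frechet_derivative \<eta> (at (a + s *\<^sub>R x)) (s *\<^sub>R b))
        = (\<lambda>x. s * frechet_derivative \<eta> (at (a + s *\<^sub>R x)) b)"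
      using C_k_has_derivative[OF Suc(2), THEN has_derivative_bounded_linear]
      by (auto simp: linear_simps)
    then show "C_k k (\<lambda>x. frechet_derivative \<eta> (at (a + s *\<^sub>R x)) (s *\<^sub>R b))"
      using Suc b by (auto intro!: C_k_mult C_k_const)
  qed
qed

text \<open>The polynomial parameter makes the functions
  \<open>poly P (1 / t) * exp (- (1 / t))\<close>, extended by 0, closed under differentiation: the
  derivative has the polynomial X^2 (P - P'), which is \<open>flat_deriv P\<close>.\<close>

definition flat :: "real poly \<Rightarrow> real \<Rightarrow> real" where
  "flat P t = (if t > 0 then poly P (1 / t) * exp (- (1 / t)) else 0)"

definition flat_deriv :: "real poly \<Rightarrow> real poly" where
  "flat_deriv P = [:0, 0, 1:] * (P - pderiv P)"

lemma poly_exp_tendsto_0: "((\<lambda>s. poly P s * exp (- s)) \<longlongrightarrow> (0::real)) at_top"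
proof -
  have "((\<lambda>s. \<Sum>i\<le>degree P. coeff P i * (s ^ i / exp s)) \<longlongrightarrow> (\<Sum>i\<le>degree P. coeff P i * 0)) at_top"
    by (intro tendsto_intros tendsto_power_div_exp_0)
  then show ?thesis
    by (simp add: poly_altdef sum_distrib_right exp_minus divide_inverse mult.assoc)
qed

lemma DERIV_flat: "(flat P has_real_derivative flat (flat_deriv P) t) (at t)"
proof (cases t "0 :: real" rule: linorder_cases)
  case less
  have "((\<lambda>t. 0) has_real_derivative 0) (at t)" by simp
  then have "(flat P has_real_derivative 0) (at t)"
    by (rule has_field_derivative_transform_within_open[of _ _ _ "{..<0}"])
      (use less in \<open>auto simp: flat_def\<close>)
  then show ?thesis using less by (simp add: flat_def)
next
  case greater
  have "((\<lambda>t. poly P (1 / t) * exp (- (1 / t))) has_real_derivative flat (flat_deriv P) t) (at t)"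
  proof -
    have inv: "((\<lambda>t. 1 / t) has_real_derivative (- ((1 / t) ^ 2))) (at t)"
      using greater by (auto intro!: derivative_eq_intros simp: power2_eq_square)
    have "((\<lambda>t. poly P (1 / t) * exp (- (1 / t))) has_real_derivative
        (poly P (1 / t) * (exp (- (1 / t)) * - (- ((1 / t) ^ 2)))
          + poly (pderiv P) (1 / t) * (- ((1 / t) ^ 2)) * exp (- (1 / t)))) (at t)"
      by (intro DERIV_mult' DERIV_chain2[OF poly_DERIV inv] DERIV_chain2[OF DERIV_exp DERIV_minus[OF inv]])
    moreover have "poly P (1 / t) * (exp (- (1 / t)) * - (- ((1 / t) ^ 2)))
          + poly (pderiv P) (1 / t) * (- ((1 / t) ^ 2)) * exp (- (1 / t)) = flat (flat_deriv P) t"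
    proof -
      define s where "s = 1 / t"
      show ?thesis unfolding s_def[symmetric] using greater
        by (simp add: flat_def flat_deriv_def power2_eq_square s_def[symmetric] left_diff_distrib right_diff_distrib)
    qed
    ultimately show ?thesis by (rule DERIV_cong)
  qed
  then show ?thesis
    by (rule has_field_derivative_transform_within_open[of _ _ _ "{0<..}"])
      (use greater in \<open>auto simp: flat_def\<close>)
next
  case equal
  have "((\<lambda>h. (flat P (0 + h) - flat P 0) / h) \<longlongrightarrow> 0) (at 0)"
  proof (rule filterlim_split_at_real)
    show "((\<lambda>h. (flat P (0 + h) - flat P 0) / h) \<longlongrightarrow> 0) (at_left 0)"
      by (rule tendsto_eventually) (auto simp: flat_def eventually_at_filter)
    \<comment> \<open>The extra factor X is the 1 / h of the difference quotient at 0, read in the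
      variable s = 1 / h.\<close>
    have "((\<lambda>s. poly ([:0, 1:] * P) s * exp (- s)) \<longlongrightarrow> 0) at_top"
      by (rule poly_exp_tendsto_0)
    then have "((\<lambda>h. poly ([:0, 1:] * P) (1 / h) * exp (- (1 / h))) \<longlongrightarrow> 0) (at_right 0)"
      by (simp add: filterlim_at_top_to_right inverse_eq_divide)
    then show "((\<lambda>h. (flat P (0 + h) - flat P 0) / h) \<longlongrightarrow> 0) (at_right 0)"
      by (rule Lim_transform_eventually) (auto simp: flat_def eventually_at_filter)
  qed
  then show ?thesis using equal by (simp add: has_field_derivative_iff flat_def)
qed

lemma integrable_continuous_compact_support:
  fixes f :: "'a::euclidean_space \<Rightarrow> 'b::euclidean_space"
  assumes f: "continuous_on UNIV f" and 0: "\<And>x. norm x > R \<Longrightarrow> f x = 0"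
  shows "integrable lborel f"
proof -
  have "integrable lborel (\<lambda>x. indicator (cball 0 R) x *\<^sub>R f x)"
    by (rule borel_integrable_compact) (auto intro: continuous_on_subset[OF f])
  also have "(\<lambda>x. indicator (cball 0 R) x *\<^sub>R f x) = f"
    using 0 by (auto simp: indicator_def fun_eq_iff)
  finally show ?thesis .
qed

lemma bounded_continuous_compact_support:
  fixes f :: "'a::euclidean_space \<Rightarrow> 'b::euclidean_space"
  assumes f: "continuous_on UNIV f" and 0: "\<And>x. norm x > R \<Longrightarrow> f x = 0"
  obtains B where "B \<ge> 0" "\<And>x. norm (f x) \<le> B"
proof -
  have "compact (f ` cball 0 R)"
    by (intro compact_continuous_image continuous_on_subset[OF f]) auto
  then obtain B where "\<forall>y\<in>f ` cball 0 R. norm y \<le> B"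
    using bounded_iff compact_imp_bounded by metis
  then have "norm (f x) \<le> max B 0" for x
    using 0[of x] by (cases "norm x \<le> R") (auto simp: le_max_iff_disj)
  then show ?thesis using that[of "max B 0"] by auto
qed

text \<open>The gradient is carried as a vector field, ready to be paired with the flux. Compactly
  supported functions of this class are what the smooth test functions are enlarged to.\<close>

definition C1_grad :: "('a::euclidean_space \<Rightarrow> real) \<Rightarrow> ('a \<Rightarrow> 'a) \<Rightarrow> bool" where
  "C1_grad f f' \<longleftrightarrow> (\<forall>x. (f has_derivative (\<lambda>v. f' x \<bullet> v)) (at x)) \<and> continuous_on UNIV f'"

lemma C1_grad_derivative: "C1_grad f f' \<Longrightarrow> (f has_derivative (\<lambda>v. f' x \<bullet> v)) (at x)"
  and C1_grad_continuous: "C1_grad f f' \<Longrightarrow> continuous_on UNIV f'"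
  by (auto simp: C1_grad_def)

lemma C1_grad_continuous': "C1_grad f f' \<Longrightarrow> continuous_on UNIV f"
  by (auto intro!: continuous_at_imp_continuous_on has_derivative_continuous dest: C1_grad_derivative)

lemma grad_inner:
  fixes f :: "'a::euclidean_space \<Rightarrow> real"
  assumes "f differentiable (at x)"
  shows "frechet_derivative f (at x) = (\<lambda>v. grad f x \<bullet> v)"
proof
  fix v
  have l: "bounded_linear (frechet_derivative f (at x))"
    using assms by (auto simp: frechet_derivative_works intro: has_derivative_bounded_linear)
  have "frechet_derivative f (at x) v = frechet_derivative f (at x) (\<Sum>b\<in>Basis. (v \<bullet> b) *\<^sub>R b)"
    by (simp add: euclidean_representation)
  also have "\<dots> = (\<Sum>b\<in>Basis. (v \<bullet> b) * frechet_derivative f (at x) b)"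
    using l by (simp add: linear_sum bounded_linear.linear linear_simps)
  also have "\<dots> = grad f x \<bullet> v"
    by (simp add: grad_def inner_sum_left inner_commute[of v] mult.commute)
  finally show "frechet_derivative f (at x) v = grad f x \<bullet> v" .
qed

lemma grad_eq:
  fixes f :: "'a::euclidean_space \<Rightarrow> real"
  assumes "(f has_derivative (\<lambda>v. g \<bullet> v)) (at x)"
  shows "grad f x = g"
proof -
  have "f differentiable (at x)" using assms by (rule differentiableI)
  from grad_inner[OF this] frechet_derivative_at[OF assms]
  have "grad f x \<bullet> v = g \<bullet> v" for v by metis
  then show ?thesis by (metis vector_eq_rdot)
qed

lemma C_k_grad_C1:
  fixes f :: "'a::euclidean_space \<Rightarrow> real"
  assumes "C_k 1 f" shows "C1_grad f (grad f)"
proof -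
  have f: "C_k (Suc 0) f" using assms by simp
  then have d: "f differentiable (at x)" for x by simp
  have "(f has_derivative (\<lambda>v. grad f x \<bullet> v)) (at x)" for x
    using C_k_has_derivative[OF f] grad_inner[OF d] by metis
  moreover have "continuous_on UNIV (grad f)"
    unfolding grad_def using f by (intro continuous_intros) auto
  ultimately show ?thesis by (auto simp: C1_grad_def)
qed

lemma C1_grad_zero:
  assumes "C1_grad f f'" "open S" "x \<in> S" "\<And>y. y \<in> S \<Longrightarrow> f y = 0"
  shows "f' x = 0"
proof -
  have "((\<lambda>x. 0) has_derivative (\<lambda>v. f' x \<bullet> v)) (at x)"
    using assms by (intro has_derivative_transform_within_open[OF C1_grad_derivative[OF assms(1)]]) auto
  then have "(\<lambda>v. f' x \<bullet> v) = (\<lambda>v. 0)" by (rule has_derivative_unique) simp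
  then have "f' x \<bullet> f' x = 0" by metis
  then show ?thesis by simp
qed

lemma C1_grad_Lipschitz:
  assumes f: "C1_grad f f'" and D: "\<And>x. norm (f' x) \<le> D"
  shows "\<bar>f x - f y\<bar> \<le> D * norm (x - y)"
proof -
  have "norm (f x - f y) \<le> D * norm (x - y)"
  proof (rule differentiable_bound[of UNIV f "\<lambda>x v. f' x \<bullet> v"])
    show "onorm (\<lambda>v. f' x \<bullet> v) \<le> D" for x
    proof (rule onorm_le)
      fix v
      show "norm (f' x \<bullet> v) \<le> D * norm v"
        using Cauchy_Schwarz_ineq2[of "f' x" v] mult_right_mono[OF D, of "norm v" x] by simp
    qed
  qed (use C1_grad_derivative[OF f] in auto)
  then show ?thesis by simp
qed

lemma test_functionsI:
  fixes \<phi> :: "'a::euclidean_space \<Rightarrow> real"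
  assumes "\<And>k. C_k k \<phi>" "compact K" "K \<subseteq> \<Omega>" "\<And>x. x \<notin> K \<Longrightarrow> \<phi> x = 0"
  shows "\<phi> \<in> test_functions \<Omega>"
proof -
  have "{x. \<phi> x \<noteq> 0} \<subseteq> K" using assms(4) by auto
  then have c: "closure {x. \<phi> x \<noteq> 0} \<subseteq> K"
    using assms(2) by (intro closure_minimal compact_imp_closed)
  then have "compact (closure {x. \<phi> x \<noteq> 0})"
    using assms(2) by (metis closed_closure closed_Int_compact inf.absorb_iff1)
  with c assms show ?thesis by (auto simp: test_functions_def)
qed

lemma test_functionsD:
  fixes \<phi> :: "'a::euclidean_space \<Rightarrow> real"
  assumes "\<phi> \<in> test_functions \<Omega>"
  obtains K where "C1_grad \<phi> (grad \<phi>)" "compact K" "K \<subseteq> \<Omega>"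
    "\<And>x. x \<notin> K \<Longrightarrow> \<phi> x = 0" "\<And>x. x \<notin> K \<Longrightarrow> grad \<phi> x = 0"
proof -
  let ?K = "closure {x. \<phi> x \<noteq> 0}"
  have g: "C1_grad \<phi> (grad \<phi>)" using assms by (intro C_k_grad_C1) (auto simp: test_functions_def)
  show thesis
  proof (rule that[OF g])
    show "compact ?K" "?K \<subseteq> \<Omega>" using assms by (auto simp: test_functions_def)
    show z: "\<phi> x = 0" if "x \<notin> ?K" for x
      using that closure_subset[of "{x. \<phi> x \<noteq> 0}"] by auto
    show "grad \<phi> x = 0" if "x \<notin> ?K" for x
    proof (rule C1_grad_zero[OF g])
      show "open (- ?K)" "x \<in> - ?K" using that by auto
      show "\<phi> y = 0" if "y \<in> - ?K" for y using z that by blast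
    qed
  qed
qed

subsection \<open>Mollifiers\<close>

definition mollifier :: "real \<Rightarrow> ('a::euclidean_space \<Rightarrow> real) \<Rightarrow> bool" where
  "mollifier e \<eta> \<longleftrightarrow> (\<forall>k. C_k k \<eta>) \<and> (\<forall>x. 0 \<le> \<eta> x) \<and> (\<forall>x. norm x \<ge> e \<longrightarrow> \<eta> x = 0) \<and>
     (\<integral>x. \<eta> x \<partial>lborel) = 1"

lemma mollifier_exists:
  assumes e: "e > 0"
  obtains \<eta> :: "'a::euclidean_space \<Rightarrow> real" where "mollifier e \<eta>"
proof -
  \<comment> \<open>All derivatives of exp(-1/t), the tower that \<open>C_k_radial\<close> asks for;
    the bump \<theta> is F 0 of e^2 - |x|^2 and vanishes for |x| at least e.\<close>
  define F where "F j = flat ((flat_deriv ^^ j) 1)" for j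
  have F: "(F j has_real_derivative F (Suc j) t) (at t)" for j t
    unfolding F_def by (simp add: DERIV_flat)
  define \<theta> :: "'a \<Rightarrow> real" where "\<theta> x = F 0 (e\<^sup>2 - x \<bullet> x)" for x
  have C: "C_k k \<theta>" for k unfolding \<theta>_def by (rule C_k_radial) (rule F)
  have ge: "\<theta> x \<ge> 0" for x by (simp add: \<theta>_def F_def flat_def)
  have gt: "\<theta> x > 0" if "norm x < e" for x
    using power_strict_mono[OF that, of 2] by (simp add: \<theta>_def F_def flat_def dot_square_norm)
  have z: "\<theta> x = 0" if "norm x \<ge> e" for x
  proof -
    have "\<not> (norm x)\<^sup>2 < e\<^sup>2" using power_mono[OF that, of 2] e by linarith
    then show ?thesis by (simp add: \<theta>_def F_def flat_def dot_square_norm)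
  qed
  have cont: "continuous_on UNIV \<theta>" using C[of 0] by simp
  have int: "integrable lborel \<theta>"
    by (rule integrable_continuous_compact_support[OF cont, of e]) (auto intro: z)
  have "(\<integral>x. \<theta> x \<partial>lborel) \<noteq> 0"
  proof
    assume "(\<integral>x. \<theta> x \<partial>lborel) = 0"
    then have "AE x in lborel. \<theta> x = 0"
      using integral_nonneg_eq_0_iff_AE[OF int] ge by auto
    then have "AE x in lborel. x \<notin> ball (0::'a) e"
      by (rule eventually_mono) (use gt in \<open>force simp: dist_norm\<close>)
    then have "emeasure lborel (ball (0::'a) e) = 0"
      by (subst (asm) AE_iff_measurable[of "ball 0 e"]) auto
    moreover have "0 < unit_ball_vol (real DIM('a)) * e ^ DIM('a)" using e by (intro mult_pos_pos) auto
    ultimately show False using e by (simp add: emeasure_ball ennreal_eq_0_iff)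
  qed
  then have pos: "(\<integral>x. \<theta> x \<partial>lborel) > 0" (is "?c > 0") using ge by (simp add: less_le)
  have "mollifier e (\<lambda>x. (1 / ?c) * \<theta> x)"
    unfolding mollifier_def using pos ge z
    by (intro conjI allI C_k_mult C_k_const C) (auto intro: divide_nonneg_pos)
  then show thesis by (rule that)
qed

definition mollify :: "('a::euclidean_space \<Rightarrow> real) \<Rightarrow> ('a \<Rightarrow> 'b::euclidean_space) \<Rightarrow> 'a \<Rightarrow> 'b" where
  "mollify \<eta> f x = (\<integral>y. \<eta> (x - y) *\<^sub>R f y \<partial>lborel)"

lemma integrable_bounded_scaleR:
  fixes f :: "'a::euclidean_space \<Rightarrow> 'b::euclidean_space" and k :: "'a \<Rightarrow> real"
  assumes f: "integrable lborel f" and [measurable]: "k \<in> borel_measurable borel" and B: "\<And>x. \<bar>k x\<bar> \<le> B"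
  shows "integrable lborel (\<lambda>y. k y *\<^sub>R f y)"
proof (rule Bochner_Integration.integrable_bound)
  show "integrable lborel (\<lambda>y. B * norm (f y))" using f by auto
  have [measurable]: "f \<in> borel_measurable borel" using f by auto
  show "(\<lambda>y. k y *\<^sub>R f y) \<in> borel_measurable lborel" by measurable
  show "AE y in lborel. norm (k y *\<^sub>R f y) \<le> norm (B * norm (f y))"
    using B by (auto intro!: AE_I2 simp: abs_mult intro!: mult_right_mono order.trans[OF _ abs_ge_self])
qed

lemma integrable_scaleR_bounded:
  fixes f :: "'a::euclidean_space \<Rightarrow> real" and k :: "'a \<Rightarrow> 'b::euclidean_space"
  assumes f: "integrable lborel f" and [measurable]: "k \<in> borel_measurable borel" and D: "\<And>x. norm (k x) \<le> D"
  shows "integrable lborel (\<lambda>y. f y *\<^sub>R k y)"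
proof (rule Bochner_Integration.integrable_bound)
  show "integrable lborel (\<lambda>y. D * norm (f y))" using f by auto
  have [measurable]: "f \<in> borel_measurable borel" using f by auto
  show "(\<lambda>y. f y *\<^sub>R k y) \<in> borel_measurable lborel" by measurable
  have "norm (f y *\<^sub>R k y) \<le> norm (D * norm (f y))" for y
    using mult_left_mono[OF D[of y], of "\<bar>f y\<bar>"] by (simp add: mult.commute order.trans[OF _ abs_ge_self])
  then show "AE y in lborel. norm (f y *\<^sub>R k y) \<le> norm (D * norm (f y))" by simp
qed

text \<open>Dominated convergence along sequences of increments: the Lipschitz constant D of \<eta>
  and the bound D of its gradient keep the remainder quotient \<open>?q\<close> below 2 D, so a
  multiple of |f| dominates.\<close>

lemma has_derivative_mollify:
  fixes f :: "'a::euclidean_space \<Rightarrow> real"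
  assumes f: "integrable lborel f" and \<eta>: "C1_grad \<eta> d\<eta>" and 0: "\<And>x. norm x > R \<Longrightarrow> \<eta> x = 0"
  shows "(mollify \<eta> f has_derivative (\<lambda>v. (\<integral>y. f y *\<^sub>R d\<eta> (x - y) \<partial>lborel) \<bullet> v)) (at x)"
proof -
  have c\<eta>: "continuous_on UNIV \<eta>" "continuous_on UNIV d\<eta>"
    using C1_grad_continuous'[OF \<eta>] C1_grad_continuous[OF \<eta>] by auto
  have d0: "d\<eta> x = 0" if "norm x > R" for x
    by (rule C1_grad_zero[OF \<eta>, of "- cball 0 R"]) (use that 0 in auto)
  have [measurable]: "\<eta> \<in> borel_measurable borel" "d\<eta> \<in> borel_measurable borel" "f \<in> borel_measurable borel"
    using c\<eta> f by (auto intro: borel_measurable_continuous_onI)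
  obtain B where B: "B \<ge> 0" "\<And>x. norm (\<eta> x) \<le> B"
    using bounded_continuous_compact_support[OF c\<eta>(1) 0] by blast
  obtain D where D: "D \<ge> 0" "\<And>x. norm (d\<eta> x) \<le> D"
    using bounded_continuous_compact_support[OF c\<eta>(2) d0] by blast
  note Lip = C1_grad_Lipschitz[OF \<eta> D(2)]
  have i1: "integrable lborel (\<lambda>y. \<eta> (z - y) * f y)" for z
    using integrable_bounded_scaleR[OF f, of "\<lambda>y. \<eta> (z - y)" B] B by simp
  have i2: "integrable lborel (\<lambda>y. f y *\<^sub>R d\<eta> (z - y))" for z
    by (rule integrable_scaleR_bounded[OF f, of _ D]) (use D in auto)
  let ?L = "\<lambda>v. (\<integral>y. f y *\<^sub>R d\<eta> (x - y) \<partial>lborel) \<bullet> v"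
  let ?q = "\<lambda>h y. (\<eta> (x + h - y) - \<eta> (x - y) - d\<eta> (x - y) \<bullet> h) / norm h"
  show ?thesis
    unfolding has_derivative_at
  proof
    show "bounded_linear ?L" by (intro bounded_linear_intros)
    show "(\<lambda>h. norm (mollify \<eta> f (x + h) - mollify \<eta> f x - ?L h) / norm h) \<midarrow>0\<rightarrow> 0"
      unfolding tendsto_at_iff_sequentially comp_def
    proof (intro allI impI)
      fix X :: "nat \<Rightarrow> 'a" assume X: "\<forall>i. X i \<in> UNIV - {0}" "X \<longlonglongrightarrow> 0"
      have i3: "integrable lborel (\<lambda>y. f y * (d\<eta> (x - y) \<bullet> h))" for h
        using integrable_inner_left[of h lborel "\<lambda>y. f y *\<^sub>R d\<eta> (x - y)"] i2 by simp
      have eq: "norm (mollify \<eta> f (x + h) - mollify \<eta> f x - ?L h) / norm h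
          = \<bar>\<integral>y. ?q h y * f y \<partial>lborel\<bar>" for h
      proof -
        have "?L h = (\<integral>y. (f y *\<^sub>R d\<eta> (x - y)) \<bullet> h \<partial>lborel)"
          using i2[of x] by (subst integral_inner_left[symmetric]) auto
        then have "mollify \<eta> f (x + h) - mollify \<eta> f x - ?L h
          = (\<integral>y. \<eta> (x + h - y) * f y - \<eta> (x - y) * f y - (f y *\<^sub>R d\<eta> (x - y)) \<bullet> h \<partial>lborel)"
          unfolding mollify_def real_scaleR_def
          by (subst Bochner_Integration.integral_diff Bochner_Integration.integral_diff)+
             (use i1 i3 in \<open>auto intro!: Bochner_Integration.integrable_diff\<close>)
        then have "norm (mollify \<eta> f (x + h) - mollify \<eta> f x - ?L h) / norm h
          = \<bar>(\<integral>y. \<eta> (x + h - y) * f y - \<eta> (x - y) * f y - (f y *\<^sub>R d\<eta> (x - y)) \<bullet> h \<partial>lborel) / norm h\<bar>"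
          by simp
        also have "\<dots> = \<bar>\<integral>y. (\<eta> (x + h - y) * f y - \<eta> (x - y) * f y - (f y *\<^sub>R d\<eta> (x - y)) \<bullet> h) / norm h \<partial>lborel\<bar>"
          by simp
        also have "\<dots> = \<bar>\<integral>y. ?q h y * f y \<partial>lborel\<bar>"
          by (intro arg_cong[where f = abs] Bochner_Integration.integral_cong) (auto simp: field_simps diff_divide_distrib)
        finally show ?thesis .
      qed
      have "(\<lambda>i. \<integral>y. ?q (X i) y * f y \<partial>lborel) \<longlonglongrightarrow> (\<integral>y. 0 \<partial>(lborel :: 'a measure))"
      proof (rule integral_dominated_convergence[where w = "\<lambda>y. (2 * D) * norm (f y)"])
        show "AE y in lborel. (\<lambda>i. ?q (X i) y * f y) \<longlonglongrightarrow> 0"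
        proof (rule AE_I2)
          fix y
          have "(\<lambda>h. norm (\<eta> (x - y + h) - \<eta> (x - y) - d\<eta> (x - y) \<bullet> h) / norm h) \<midarrow>0\<rightarrow> 0"
            using C1_grad_derivative[OF \<eta>, of "x - y"] by (simp add: has_derivative_at)
          then have "(\<lambda>i. norm (?q (X i) y)) \<longlonglongrightarrow> 0"
            using X by (auto simp: tendsto_at_iff_sequentially comp_def algebra_simps)
          then have "(\<lambda>i. ?q (X i) y) \<longlonglongrightarrow> 0" by (rule tendsto_norm_zero_cancel)
          then show "(\<lambda>i. ?q (X i) y * f y) \<longlonglongrightarrow> 0" by (rule tendsto_mult_left_zero)
        qed
        show "AE y in lborel. norm (?q (X i) y * f y) \<le> (2 * D) * norm (f y)" for i
        proof (rule AE_I2)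
          fix y
          have "norm (\<eta> (x + X i - y) - \<eta> (x - y) - d\<eta> (x - y) \<bullet> X i) \<le> (2 * D) * norm (X i)"
            using Lip[of "x + X i - y" "x - y"] Cauchy_Schwarz_ineq2[of "d\<eta> (x - y)" "X i"]
              mult_right_mono[OF D(2), of "norm (X i)" "x - y"] by (simp add: algebra_simps)
          then have "norm (?q (X i) y) \<le> 2 * D"
            using X(1) by (simp add: field_simps)
          then show "norm (?q (X i) y * f y) \<le> (2 * D) * norm (f y)"
            unfolding norm_mult by (rule mult_right_mono) simp
        qed
      qed (use f in auto)
      then show "(\<lambda>i. norm (mollify \<eta> f (x + X i) - mollify \<eta> f x - ?L (X i)) / norm (X i)) \<longlonglongrightarrow> 0"
        unfolding eq by (intro tendsto_rabs_zero) simp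
    qed
  qed
qed

text \<open>The induction generalises over the kernel: the derivative in direction b is the
  mollification of f with a partial derivative of \<eta>, which is smooth with the same support
  bound but need not be nonnegative.\<close>

lemma C_k_mollify:
  fixes f :: "'a::euclidean_space \<Rightarrow> real"
  assumes f: "integrable lborel f"
  shows "(\<And>j. C_k j \<eta>) \<Longrightarrow> (\<And>x. norm x > R \<Longrightarrow> \<eta> x = 0) \<Longrightarrow> C_k k (mollify \<eta> f)"
proof (induction k arbitrary: \<eta>)
  case 0
  have \<eta>: "C1_grad \<eta> (grad \<eta>)" by (rule C_k_grad_C1) (rule 0)
  show ?case
    using has_derivative_mollify[OF f \<eta>] 0(2)
    by (auto intro!: continuous_at_imp_continuous_on has_derivative_continuous)
next
  case (Suc k)
  have \<eta>: "C1_grad \<eta> (grad \<eta>)" by (rule C_k_grad_C1) (rule Suc)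
  show ?case
  proof (rule C_k_SucI[OF has_derivative_mollify[OF f \<eta>]])
    fix b :: 'a assume b: "b \<in> Basis"
    let ?d = "\<lambda>x. frechet_derivative \<eta> (at x) b"
    have diff: "\<eta> differentiable (at x)" for x using Suc(2)[of 1] by simp
    have d: "?d x = grad \<eta> x \<bullet> b" for x using grad_inner[OF diff, of x] by metis
    have g0: "grad \<eta> x = 0" if "norm x > R" for x
      by (rule C1_grad_zero[OF \<eta>, of "- cball 0 R"]) (use that Suc.prems(2) in auto)
    have cont: "continuous_on UNIV (grad \<eta>)" by (rule C1_grad_continuous[OF \<eta>])
    have [measurable]: "grad \<eta> \<in> borel_measurable borel" "f \<in> borel_measurable borel"
      using cont f by (auto intro: borel_measurable_continuous_onI)
    obtain D where D: "D \<ge> 0" "\<And>x. norm (grad \<eta> x) \<le> D"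
      using bounded_continuous_compact_support[OF cont g0] by blast
    have i2: "integrable lborel (\<lambda>y. f y *\<^sub>R grad \<eta> (z - y))" for z
      by (rule integrable_scaleR_bounded[OF f, of _ D]) (use D in auto)
    have "C_k k (mollify ?d f)"
    proof (rule Suc.IH)
      show "C_k j ?d" for j using Suc(2)[of "Suc j"] b by simp
      show "?d x = 0" if "norm x > R" for x using g0[OF that] d by simp
    qed
    also have "mollify ?d f = (\<lambda>x. (\<integral>y. f y *\<^sub>R grad \<eta> (x - y) \<partial>lborel) \<bullet> b)"
    proof
      fix x
      have "(\<integral>y. f y *\<^sub>R grad \<eta> (x - y) \<partial>lborel) \<bullet> b = (\<integral>y. (f y *\<^sub>R grad \<eta> (x - y)) \<bullet> b \<partial>lborel)"
        using i2[of x] by (subst integral_inner_left[symmetric]) auto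
      then show "mollify ?d f x = (\<integral>y. f y *\<^sub>R grad \<eta> (x - y) \<partial>lborel) \<bullet> b"
        by (simp add: mollify_def d mult.commute)
    qed
    finally show "C_k k (\<lambda>x. (\<integral>y. f y *\<^sub>R grad \<eta> (x - y) \<partial>lborel) \<bullet> b)" .
  qed (rule Suc.prems(2))
qed

lemma mollifierD:
  assumes "mollifier e (\<eta> :: 'a::euclidean_space \<Rightarrow> real)"
  shows "C_k k \<eta>" "0 \<le> \<eta> x" "norm x \<ge> e \<Longrightarrow> \<eta> x = 0" "(\<integral>x. \<eta> x \<partial>lborel) = 1"
    "continuous_on UNIV \<eta>" "\<eta> \<in> borel_measurable borel" "integrable lborel \<eta>" "C1_grad \<eta> (grad \<eta>)"
proof -
  show "C_k k \<eta>" "0 \<le> \<eta> x" "norm x \<ge> e \<Longrightarrow> \<eta> x = 0" "(\<integral>x. \<eta> x \<partial>lborel) = 1"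
    using assms by (auto simp: mollifier_def)
  have "C_k 0 \<eta>" using assms unfolding mollifier_def by blast
  then show c: "continuous_on UNIV \<eta>" by simp
  then show "\<eta> \<in> borel_measurable borel" by (rule borel_measurable_continuous_onI)
  show "integrable lborel \<eta>"
    by (rule integrable_continuous_compact_support[OF c, of e]) (use assms in \<open>auto simp: mollifier_def\<close>)
  show "C1_grad \<eta> (grad \<eta>)" by (rule C_k_grad_C1) (use assms in \<open>auto simp: mollifier_def\<close>)
qed

lemma integrable_mollify_kernel:
  fixes f :: "'a::euclidean_space \<Rightarrow> 'b::euclidean_space"
  assumes "mollifier e \<eta>" "integrable lborel f"
  shows "integrable lborel (\<lambda>y. \<eta> (x - y) *\<^sub>R f y)"
proof -
  note m = mollifierD[OF assms(1)]
  obtain B where "\<And>x. norm (\<eta> x) \<le> B"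
    using bounded_continuous_compact_support[OF m(5), of e] m(3) by (metis less_imp_le)
  then show ?thesis using m(6)
    by (intro integrable_bounded_scaleR[OF assms(2), of _ B]) (auto intro: measurable_compose[OF _ m(6)])
qed

lemma mollifier_minus_integral:
  assumes "mollifier e \<eta>"
  shows "integrable lborel (\<lambda>y. \<eta> (x - y))" "(\<integral>y. \<eta> (x - y) \<partial>lborel) = 1"
  using integrable_lborel_minus[OF mollifierD(7)[OF assms], of x]
    integral_lborel_minus[OF mollifierD(6)[OF assms], of x] mollifierD(4)[OF assms] by auto

lemma mollify_diff:
  fixes f :: "'a::euclidean_space \<Rightarrow> 'b::euclidean_space"
  assumes m: "mollifier e \<eta>" and f: "integrable lborel f"
  shows "mollify \<eta> f x - c = (\<integral>y. \<eta> (x - y) *\<^sub>R (f y - c) \<partial>lborel)"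
  unfolding mollify_def scaleR_diff_right
  using integrable_mollify_kernel[OF m f, of x] mollifier_minus_integral[OF m, of x]
  by (subst Bochner_Integration.integral_diff) auto

text \<open>An average with weights \<open>\<eta> (x - y)\<close> of total mass 1 stays in every
  closed ball that contains the averaged values. The centre c is free: \<open>f x\<close> yields
  pointwise convergence, 0 yields norm bounds, the midpoint of an interval yields order
  bounds.\<close>

lemma mollify_close:
  fixes f :: "'a::euclidean_space \<Rightarrow> 'b::euclidean_space"
  assumes m: "mollifier e \<eta>" and f: "integrable lborel f"
    and d: "\<And>z. norm (x - z) < e \<Longrightarrow> norm (f z - c) \<le> d"
  shows "norm (mollify \<eta> f x - c) \<le> d"
proof -
  have i: "integrable lborel (\<lambda>y. \<eta> (x - y) *\<^sub>R (f y - c))"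
    unfolding scaleR_diff_right
    using integrable_mollify_kernel[OF m f, of x] mollifier_minus_integral[OF m, of x] by auto
  have "norm (mollify \<eta> f x - c) \<le> (\<integral>y. norm (\<eta> (x - y) *\<^sub>R (f y - c)) \<partial>lborel)"
    unfolding mollify_diff[OF m f] by (rule integral_norm_bound)
  also have "\<dots> \<le> (\<integral>y. \<eta> (x - y) * d \<partial>lborel)"
  proof (rule integral_mono)
    show "norm (\<eta> (x - y) *\<^sub>R (f y - c)) \<le> \<eta> (x - y) * d" for y
      using d[of y] mollifierD(2,3)[OF m, of "x - y"]
      by (cases "norm (x - y) < e") (auto intro: mult_left_mono)
    show "integrable lborel (\<lambda>y. norm (\<eta> (x - y) *\<^sub>R (f y - c)))" by (rule integrable_norm[OF i])
  qed (use mollifier_minus_integral[OF m, of x] in auto)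
  also have "\<dots> = d" using mollifier_minus_integral[OF m, of x] by simp
  finally show ?thesis .
qed

lemma mollify_tendsto:
  fixes f :: "'a::euclidean_space \<Rightarrow> 'b::euclidean_space"
  assumes m: "\<And>n. mollifier (e n) (\<eta> n)" and e: "e \<longlonglongrightarrow> 0" and f: "integrable lborel f"
    and x: "isCont f x"
  shows "(\<lambda>n. mollify (\<eta> n) f x) \<longlonglongrightarrow> f x"
proof (rule LIMSEQ_I)
  fix r :: real assume r: "r > 0"
  obtain s where s: "s > 0" "\<And>z. norm (z - x) < s \<Longrightarrow> norm (f z - f x) < r/2"
    using LIM_D[OF x[unfolded isCont_def], of "r/2"] r by (metis half_gt_zero_iff norm_zero right_minus_eq)
  obtain n0 where n0: "\<And>n. n \<ge> n0 \<Longrightarrow> \<bar>e n\<bar> < s" using LIMSEQ_D[OF e s(1)] by auto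
  have "norm (mollify (\<eta> n) f x - f x) < r" if "n \<ge> n0" for n
  proof -
    have "norm (mollify (\<eta> n) f x - f x) \<le> r/2"
    proof (rule mollify_close[OF m f])
      fix z assume "norm (x - z) < e n"
      then have "norm (z - x) < s" using n0[OF that] by (simp add: norm_minus_commute)
      then show "norm (f z - f x) \<le> r / 2" by (rule less_imp_le[OF s(2)])
    qed
    then show ?thesis using r by simp
  qed
  then show "\<exists>no. \<forall>n\<ge>no. norm (mollify (\<eta> n) f x - f x) < r" by blast
qed

lemma mollify_bounds:
  fixes f :: "'a::euclidean_space \<Rightarrow> real"
  assumes m: "mollifier e \<eta>" and f: "integrable lborel f"
    and d: "\<And>z. norm (x - z) < e \<Longrightarrow> f z \<in> {a..b}"
  shows "mollify \<eta> f x \<in> {a..b}"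
proof -
  have "norm (mollify \<eta> f x - (a + b) / 2) \<le> (b - a) / 2"
    by (rule mollify_close[OF m f]) (use d in \<open>force simp: abs_le_iff field_simps\<close>)
  then show ?thesis by (auto simp: abs_le_iff field_simps)
qed

lemma borel_measurable_mollify [measurable]:
  fixes f :: "'a::euclidean_space \<Rightarrow> 'b::euclidean_space"
  assumes [measurable]: "\<eta> \<in> borel_measurable borel" "f \<in> borel_measurable borel"
  shows "mollify \<eta> f \<in> borel_measurable borel"
  unfolding mollify_def by measurable

text \<open>By Tonelli the average over the shifts y can be taken last, and its total weight is 1; a
  bound valid for each shift with \<open>norm y < e\<close> survives the averaging.\<close>

lemma nn_integral_mollify_le:
  fixes H :: "'a::euclidean_space \<Rightarrow> 'a \<Rightarrow> ennreal"
  assumes m: "mollifier e \<eta>" and [measurable]: "case_prod H \<in> borel_measurable (borel \<Otimes>\<^sub>M borel)"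
    and D: "\<And>y. norm y < e \<Longrightarrow> (\<integral>\<^sup>+x. H x y \<partial>lborel) \<le> D"
  shows "(\<integral>\<^sup>+x. (\<integral>\<^sup>+y. ennreal (\<eta> y) * H x y \<partial>lborel) \<partial>lborel) \<le> D"
proof -
  note [measurable] = mollifierD(6)[OF m]
  have "(\<integral>\<^sup>+x. (\<integral>\<^sup>+y. ennreal (\<eta> y) * H x y \<partial>lborel) \<partial>lborel)
     = (\<integral>\<^sup>+y. (\<integral>\<^sup>+x. ennreal (\<eta> y) * H x y \<partial>lborel) \<partial>lborel)"
    by (subst lborel_pair.Fubini') auto
  also have "\<dots> \<le> (\<integral>\<^sup>+y. ennreal (\<eta> y) * D \<partial>lborel)"
  proof (rule nn_integral_mono)
    fix y :: 'a
    show "(\<integral>\<^sup>+x. ennreal (\<eta> y) * H x y \<partial>lborel) \<le> ennreal (\<eta> y) * D"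
      using D[of y] mollifierD(3)[OF m, of y]
      by (cases "norm y < e") (auto simp: nn_integral_cmult intro: mult_left_mono)
  qed
  also have "\<dots> = D * (\<integral>\<^sup>+y. ennreal (\<eta> y) \<partial>lborel)"
    by (subst nn_integral_multc) (auto simp: mult.commute)
  also have "(\<integral>\<^sup>+y. ennreal (\<eta> y) \<partial>lborel) = 1"
    using mollifierD[OF m] by (subst nn_integral_eq_integral) auto
  finally show ?thesis by simp
qed

lemma mollify_alt:
  fixes f :: "'a::euclidean_space \<Rightarrow> 'b::euclidean_space"
  assumes [measurable]: "\<eta> \<in> borel_measurable borel" "f \<in> borel_measurable borel"
  shows "mollify \<eta> f x = (\<integral>y. \<eta> y *\<^sub>R f (x - y) \<partial>lborel)"
  using integral_lborel_minus[of "\<lambda>y. \<eta> y *\<^sub>R f (x - y)" x] by (simp add: mollify_def)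

lemma norm_integral_le_nn_integral:
  fixes f :: "'a \<Rightarrow> 'b::euclidean_space"
  shows "ennreal (norm (\<integral>x. f x \<partial>M)) \<le> (\<integral>\<^sup>+x. ennreal (norm (f x)) \<partial>M)"
  by (cases "integrable M f") (auto intro: integral_norm_bound_ennreal simp: not_integrable_integral_eq)

lemma mollify_L1_le:
  fixes f :: "'a::euclidean_space \<Rightarrow> 'b::euclidean_space"
  assumes m: "mollifier e \<eta>" and f: "integrable lborel f"
    and D: "\<And>y. norm y < e \<Longrightarrow> (\<integral>\<^sup>+x. ennreal (norm (f (x - y) - f x)) \<partial>lborel) \<le> D"
  shows "(\<integral>\<^sup>+x. ennreal (norm (mollify \<eta> f x - f x)) \<partial>lborel) \<le> D"
proof -
  note [measurable] = mollifierD(6)[OF m]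
  have [measurable]: "f \<in> borel_measurable borel" using f by auto
  have "(\<integral>\<^sup>+x. ennreal (norm (mollify \<eta> f x - f x)) \<partial>lborel)
    \<le> (\<integral>\<^sup>+x. (\<integral>\<^sup>+y. ennreal (\<eta> y) * ennreal (norm (f (x - y) - f x)) \<partial>lborel) \<partial>lborel)"
  proof (rule nn_integral_mono)
    fix x :: 'a
    have "mollify \<eta> f x - f x = (\<integral>y. \<eta> y *\<^sub>R (f (x - y) - f x) \<partial>lborel)"
      using integral_lborel_minus[of "\<lambda>y. \<eta> y *\<^sub>R (f (x - y) - f x)" x] by (simp add: mollify_diff[OF m f])
    then have "ennreal (norm (mollify \<eta> f x - f x)) \<le> (\<integral>\<^sup>+y. ennreal (norm (\<eta> y *\<^sub>R (f (x - y) - f x))) \<partial>lborel)"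
      using norm_integral_le_nn_integral by metis
    also have "\<dots> = (\<integral>\<^sup>+y. ennreal (\<eta> y) * ennreal (norm (f (x - y) - f x)) \<partial>lborel)"
      using mollifierD(2)[OF m] by (simp add: ennreal_mult)
    finally show "ennreal (norm (mollify \<eta> f x - f x)) \<le> \<dots>" .
  qed
  also have "\<dots> \<le> D" by (rule nn_integral_mollify_le[OF m]) (use D in auto)
  finally show ?thesis .
qed

section \<open>Convergence of mollifications against unbounded weights\<close>

text \<open>Comparing W with \<open>t * X\<close> decides which of the two terms alone dominates the
  product. The constants are not the sharp ones of Young's inequality, but they involve no conjugate
  exponent.\<close>

lemma young_split:
  fixes X W t m :: real
  assumes "0 \<le> X" "0 \<le> W" "t > 0" "m > 1"
  shows "X powr (m - 1) * W \<le> t * X powr m + t powr (- (m - 1)) * W powr m"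
proof (cases "W \<le> t * X")
  case True
  have "X powr (m - 1) * W \<le> X powr (m - 1) * (t * X)" by (intro mult_left_mono True) auto
  also have "\<dots> = t * X powr m"
    using assms(1) by (cases "X = 0") (auto simp: powr_mult_base' powr_diff)
  also have "\<dots> \<le> t * X powr m + t powr (- (m - 1)) * W powr m" by simp
  finally show ?thesis .
next
  case False
  then have "X \<le> W / t" using assms by (simp add: field_simps)
  then have "X powr (m - 1) * W \<le> (W / t) powr (m - 1) * W"
    using assms by (intro mult_right_mono powr_mono2) auto
  also have "\<dots> = t powr (- (m - 1)) * W powr m"
    using assms False by (cases "W = 0") (auto simp: powr_divide powr_minus powr_diff field_simps)
  also have "\<dots> \<le> t * X powr m + t powr (- (m - 1)) * W powr m" using assms by simp
  finally show ?thesis .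
qed

lemma nn_integral_young:
  fixes X W :: "'a::euclidean_space \<Rightarrow> real"
  assumes [measurable]: "X \<in> borel_measurable borel" "W \<in> borel_measurable borel"
    and "\<And>x. 0 \<le> X x" "\<And>x. 0 \<le> W x" "t > 0" "m > 1"
  shows "(\<integral>\<^sup>+x. ennreal (X x powr (m - 1) * W x) \<partial>lborel)
    \<le> ennreal t * (\<integral>\<^sup>+x. ennreal (X x powr m) \<partial>lborel) + ennreal (t powr (- (m - 1))) * (\<integral>\<^sup>+x. ennreal (W x powr m) \<partial>lborel)"
proof -
  have "(\<integral>\<^sup>+x. ennreal (X x powr (m - 1) * W x) \<partial>lborel)
    \<le> (\<integral>\<^sup>+x. ennreal t * ennreal (X x powr m) + ennreal (t powr (- (m - 1))) * ennreal (W x powr m) \<partial>lborel)"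
    using young_split[OF assms(3,4,5,6)] assms(5)
    by (intro nn_integral_mono) (auto simp flip: ennreal_mult ennreal_plus intro!: ennreal_leI)
  also have "\<dots> = ennreal t * (\<integral>\<^sup>+x. ennreal (X x powr m) \<partial>lborel) + ennreal (t powr (- (m - 1))) * (\<integral>\<^sup>+x. ennreal (W x powr m) \<partial>lborel)"
    by (subst nn_integral_add) (auto simp: nn_integral_cmult)
  finally show ?thesis .
qed

text \<open>Young's inequality is applied to each shift of w before averaging; translation
  invariance then restores the integral of \<open>norm (w x) powr m\<close>. A convexity estimate
  for the norm of the average is thereby bypassed.\<close>

lemma nn_integral_young_mollify:
  fixes X :: "'a::euclidean_space \<Rightarrow> real" and w :: "'a \<Rightarrow> 'b::euclidean_space"
  assumes m: "mollifier e \<eta>" and [measurable]: "X \<in> borel_measurable borel" "w \<in> borel_measurable borel"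
    and "\<And>x. 0 \<le> X x" "t > 0" "m > 1"
  shows "(\<integral>\<^sup>+x. ennreal (X x powr (m - 1) * norm (mollify \<eta> w x)) \<partial>lborel)
    \<le> ennreal t * (\<integral>\<^sup>+x. ennreal (X x powr m) \<partial>lborel) + ennreal (t powr (- (m - 1))) * (\<integral>\<^sup>+x. ennreal (norm (w x) powr m) \<partial>lborel)"
proof -
  note [measurable] = mollifierD(6)[OF m]
  have "(\<integral>\<^sup>+x. ennreal (X x powr (m - 1) * norm (mollify \<eta> w x)) \<partial>lborel)
    \<le> (\<integral>\<^sup>+x. (\<integral>\<^sup>+y. ennreal (\<eta> y) * ennreal (X x powr (m - 1) * norm (w (x - y))) \<partial>lborel) \<partial>lborel)"
  proof (rule nn_integral_mono)
    fix x :: 'a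
    have "ennreal (X x powr (m - 1) * norm (mollify \<eta> w x))
       = ennreal (X x powr (m - 1)) * ennreal (norm (\<integral>y. \<eta> y *\<^sub>R w (x - y) \<partial>lborel))"
      by (simp add: mollify_alt ennreal_mult)
    also have "\<dots> \<le> ennreal (X x powr (m - 1)) * (\<integral>\<^sup>+y. ennreal (norm (\<eta> y *\<^sub>R w (x - y))) \<partial>lborel)"
      by (intro mult_left_mono norm_integral_le_nn_integral) auto
    also have "\<dots> = (\<integral>\<^sup>+y. ennreal (X x powr (m - 1)) * ennreal (norm (\<eta> y *\<^sub>R w (x - y))) \<partial>lborel)"
      by (subst nn_integral_cmult) auto
    also have "\<dots> = (\<integral>\<^sup>+y. ennreal (\<eta> y) * ennreal (X x powr (m - 1) * norm (w (x - y))) \<partial>lborel)"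
      using mollifierD(2)[OF m] by (simp add: ennreal_mult mult_ac)
    finally show "ennreal (X x powr (m - 1) * norm (mollify \<eta> w x)) \<le> \<dots>" .
  qed
  also have "\<dots> \<le> ennreal t * (\<integral>\<^sup>+x. ennreal (X x powr m) \<partial>lborel) + ennreal (t powr (- (m - 1))) * (\<integral>\<^sup>+x. ennreal (norm (w x) powr m) \<partial>lborel)"
  proof (rule nn_integral_mollify_le[OF m])
    fix y :: 'a
    have "(\<integral>\<^sup>+x. ennreal (norm (w (x - y)) powr m) \<partial>lborel) = (\<integral>\<^sup>+x. ennreal (norm (w x) powr m) \<partial>lborel)"
    proof -
      have "(\<integral>\<^sup>+x. ennreal (norm (w x) powr m) \<partial>lborel)
          = (\<integral>\<^sup>+x. ennreal (norm (w x) powr m) \<partial>(distr lborel borel (\<lambda>x. x + (- y))))"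
        by (simp only: distr_lborel_plus)
      also have "\<dots> = (\<integral>\<^sup>+x. ennreal (norm (w (x - y)) powr m) \<partial>lborel)"
        by (subst nn_integral_distr) auto
      finally show ?thesis by simp
    qed
    then show "(\<integral>\<^sup>+x. ennreal (X x powr (m - 1) * norm (w (x - y))) \<partial>lborel)
      \<le> ennreal t * (\<integral>\<^sup>+x. ennreal (X x powr m) \<partial>lborel) + ennreal (t powr (- (m - 1))) * (\<integral>\<^sup>+x. ennreal (norm (w x) powr m) \<partial>lborel)"
      using nn_integral_young[of X "\<lambda>x. norm (w (x - y))" t m] assms(4-) by simp
  qed measurable
  finally show ?thesis .
qed

text \<open>A mollification averages translates by small shifts, and the L1 modulus \<tau> of the
  translates is small near 0.\<close>

lemma mollify_L1_tendsto:
  fixes f :: "'a::euclidean_space \<Rightarrow> 'b::euclidean_space"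
  assumes m: "\<And>n. mollifier (e n) (\<eta> n)" and e: "e \<longlonglongrightarrow> 0" and f: "integrable lborel f" and r: "r > 0"
  shows "eventually (\<lambda>n. (\<integral>\<^sup>+x. ennreal (norm (mollify (\<eta> n) f x - f x)) \<partial>lborel) \<le> ennreal r) sequentially"
proof -
  define \<tau> where "\<tau> y = (\<integral>x. norm (f (x - y) - f x) \<partial>lborel)" for y
  have "(\<tau> \<longlongrightarrow> 0) (at 0)"
    unfolding tendsto_at_iff_sequentially comp_def \<tau>_def using tendsto_translation_L1[OF f] by auto
  then obtain s where s: "s > 0" "\<And>y. y \<noteq> 0 \<Longrightarrow> norm y < s \<Longrightarrow> \<tau> y < r"
    using LIM_D[of \<tau> 0 0 r] r by (auto simp: abs_less_iff)
  have "\<tau> 0 = 0" by (simp add: \<tau>_def)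
  then have s': "\<tau> y \<le> r" if "norm y < s" for y using s(2)[of y] that r by (cases "y = 0") auto
  have "eventually (\<lambda>n. \<bar>e n\<bar> < s) sequentially"
    using tendstoD[OF e s(1)] by simp
  then show ?thesis
  proof eventually_elim
    case (elim n)
    show ?case
    proof (rule mollify_L1_le[OF m f])
      fix y :: 'a assume "norm y < e n"
      then have "\<tau> y \<le> r" using elim by (intro s') auto
      moreover have "(\<integral>\<^sup>+x. ennreal (norm (f (x - y) - f x)) \<partial>lborel) = ennreal (\<tau> y)"
        unfolding \<tau>_def using f integrable_lborel_plus[OF f, of "- y"]
        by (intro nn_integral_eq_integral integrable_norm Bochner_Integration.integrable_diff) auto
      ultimately show "(\<integral>\<^sup>+x. ennreal (norm (f (x - y) - f x)) \<partial>lborel) \<le> ennreal r"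
        by (simp add: ennreal_leI)
    qed
  qed
qed

text \<open>The weight is unbounded, so L1 convergence alone does not suffice. Where X is at most k,
  L1 convergence serves; the tail Y of X is small in L^m, and Young's inequality with a large t
  controls it against w and, uniformly in n, against the mollifications of w.\<close>

lemma mollify_weighted_tendsto:
  fixes X :: "'a::euclidean_space \<Rightarrow> real" and w :: "'a \<Rightarrow> 'b::euclidean_space"
  assumes m: "\<And>n. mollifier (e n) (\<eta> n)" and e: "e \<longlonglongrightarrow> 0" and w: "integrable lborel w"
    and wm: "integrable lborel (\<lambda>x. norm (w x) powr m)"
    and [measurable]: "X \<in> borel_measurable borel" and X0: "\<And>x. 0 \<le> X x"
    and Xm: "integrable lborel (\<lambda>x. X x powr m)" and "m > 1" and r: "r > 0"
  shows "eventually (\<lambda>n. (\<integral>\<^sup>+x. ennreal (X x powr (m - 1) * norm (mollify (\<eta> n) w x - w x)) \<partial>lborel) \<le> ennreal r) sequentially"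
proof -
  have [measurable]: "w \<in> borel_measurable borel" "\<And>n. \<eta> n \<in> borel_measurable borel"
    using w mollifierD(6)[OF m] by auto
  define W where "W = (\<integral>x. norm (w x) powr m \<partial>lborel)"
  have W0: "W \<ge> 0" by (simp add: W_def)
  have W: "(\<integral>\<^sup>+x. ennreal (norm (w x) powr m) \<partial>lborel) = ennreal W"
    unfolding W_def by (rule nn_integral_eq_integral[OF wm]) simp
  \<comment> \<open>Chosen so that \<open>t powr (- (m - 1)) * W\<close> is at most r / 6, with W +
    1 in place of W to allow W = 0. The truncation level k depends on t and is fixed
    afterwards.\<close>
  define t where "t = ((W + 1) / (r / 6)) powr (1 / (m - 1))"
  have t: "t > 0" "t powr (- (m - 1)) * W \<le> r / 6"
  proof -
    show "t > 0" using W0 r by (simp add: t_def)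
    have "1 / (m - 1) * (- (m - 1)) = -1" using \<open>m > 1\<close> by (simp add: field_simps)
    then have "t powr (- (m - 1)) = ((W + 1) / (r / 6)) powr (- 1)"
      unfolding t_def powr_powr by simp
    also have "\<dots> = (r / 6) / (W + 1)" using W0 r by (simp add: powr_minus_divide)
    finally have "t powr (- (m - 1)) = (r / 6) / (W + 1)" .
    then have "t powr (- (m - 1)) * W = (r / 6) * (W / (W + 1))" by simp
    also have "\<dots> \<le> (r / 6) * 1" using W0 r by (intro mult_left_mono) auto
    finally show "t powr (- (m - 1)) * W \<le> r / 6" by simp
  qed
  define Y where "Y k x = (if X x > real k then X x else 0)" for k :: nat and x
  have [measurable]: "Y k \<in> borel_measurable borel" for k unfolding Y_def by measurable
  have Y0: "0 \<le> Y k x" for k x using X0 by (simp add: Y_def)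
  have "(\<lambda>k. \<integral>x. Y k x powr m \<partial>lborel) \<longlonglongrightarrow> (\<integral>x. 0 \<partial>(lborel :: 'a measure))"
  proof (rule integral_dominated_convergence[OF _ _ Xm])
    show "AE x in lborel. (\<lambda>k. Y k x powr m) \<longlonglongrightarrow> 0"
    proof (rule AE_I2)
      fix x
      obtain k0 where "real k0 > X x" using reals_Archimedean2 by blast
      then have "\<forall>\<^sub>F k in sequentially. Y k x powr m = 0"
        unfolding eventually_sequentially by (intro exI[of _ k0]) (auto simp: Y_def)
      then show "(\<lambda>k. Y k x powr m) \<longlonglongrightarrow> 0" by (rule tendsto_eventually)
    qed
    show "AE x in lborel. norm (Y k x powr m) \<le> X x powr m" for k by (auto simp: Y_def)
  qed auto
  then have "(\<lambda>k. \<integral>x. Y k x powr m \<partial>lborel) \<longlonglongrightarrow> 0" by simp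
  from LIMSEQ_D[OF this, of "r / (6 * t)"] t r obtain k where k: "(\<integral>x. Y k x powr m \<partial>lborel) < r / (6 * t)"
    by (auto simp: abs_less_iff)
  have iY: "integrable lborel (\<lambda>x. Y k x powr m)"
    by (rule Bochner_Integration.integrable_bound[OF Xm]) (auto simp: Y_def)
  have bnd: "ennreal t * (\<integral>\<^sup>+x. ennreal (Y k x powr m) \<partial>lborel) + ennreal (t powr (- (m - 1))) * (\<integral>\<^sup>+x. ennreal (norm (w x) powr m) \<partial>lborel)
      \<le> ennreal (r / 3)"
  proof -
    have "(\<integral>\<^sup>+x. ennreal (Y k x powr m) \<partial>lborel) = ennreal (\<integral>x. Y k x powr m \<partial>lborel)"
      by (rule nn_integral_eq_integral[OF iY]) simp
    moreover have "t * (\<integral>x. Y k x powr m \<partial>lborel) \<le> r / 6" using k t by (simp add: field_simps)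
    ultimately show ?thesis using t W0 unfolding W
      by (auto simp flip: ennreal_mult ennreal_plus intro!: ennreal_leI)
  qed
  \<comment> \<open>\<open>Suc k\<close> instead of k keeps the divisor c positive for k =
    0.\<close>
  define c where "c = real (Suc k) powr (m - 1)"
  have c: "c > 0" by (simp add: c_def)
  have "eventually (\<lambda>n. (\<integral>\<^sup>+x. ennreal (norm (mollify (\<eta> n) w x - w x)) \<partial>lborel) \<le> ennreal (r / 3 / c)) sequentially"
    by (rule mollify_L1_tendsto[OF m e w]) (use r c in auto)
  then show ?thesis
  proof eventually_elim
    case (elim n)
    let ?D = "\<lambda>x. norm (mollify (\<eta> n) w x - w x)"
    have pt: "X x powr (m - 1) * ?D x \<le> c * ?D x + Y k x powr (m - 1) * norm (mollify (\<eta> n) w x) + Y k x powr (m - 1) * norm (w x)" for x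
    proof (cases "X x > real k")
      case True
      have "X x powr (m - 1) * ?D x \<le> X x powr (m - 1) * (norm (mollify (\<eta> n) w x) + norm (w x))"
        by (intro mult_left_mono norm_triangle_ineq4) auto
      moreover have "0 \<le> c * ?D x" using c by simp
      ultimately show ?thesis using True unfolding Y_def by (simp add: distrib_left)
    next
      case False
      then have "X x powr (m - 1) \<le> c" unfolding c_def using X0 \<open>m > 1\<close> by (intro powr_mono2) auto
      then have "X x powr (m - 1) * ?D x \<le> c * ?D x" by (rule mult_right_mono) simp
      then show ?thesis using False by (simp add: Y_def)
    qed
    have "(\<integral>\<^sup>+x. ennreal (X x powr (m - 1) * ?D x) \<partial>lborel)
      \<le> (\<integral>\<^sup>+x. ennreal c * ennreal (?D x) + ennreal (Y k x powr (m - 1) * norm (mollify (\<eta> n) w x)) + ennreal (Y k x powr (m - 1) * norm (w x)) \<partial>lborel)"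
      using pt c by (intro nn_integral_mono) (auto simp flip: ennreal_mult ennreal_plus intro!: ennreal_leI)
    also have "\<dots> = ennreal c * (\<integral>\<^sup>+x. ennreal (?D x) \<partial>lborel)
        + (\<integral>\<^sup>+x. ennreal (Y k x powr (m - 1) * norm (mollify (\<eta> n) w x)) \<partial>lborel)
        + (\<integral>\<^sup>+x. ennreal (Y k x powr (m - 1) * norm (w x)) \<partial>lborel)"
      by (simp add: nn_integral_add nn_integral_cmult)
    also have "\<dots> \<le> ennreal c * ennreal (r / 3 / c) + ennreal (r / 3) + ennreal (r / 3)"
    proof (intro add_mono mult_left_mono elim)
      show "(\<integral>\<^sup>+x. ennreal (Y k x powr (m - 1) * norm (mollify (\<eta> n) w x)) \<partial>lborel) \<le> ennreal (r / 3)"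
        by (rule order.trans[OF nn_integral_young_mollify[OF m _ _ Y0 t(1) \<open>m > 1\<close>] bnd]) auto
      show "(\<integral>\<^sup>+x. ennreal (Y k x powr (m - 1) * norm (w x)) \<partial>lborel) \<le> ennreal (r / 3)"
        by (rule order.trans[OF nn_integral_young[OF _ _ Y0 _ t(1) \<open>m > 1\<close>] bnd]) auto
    qed auto
    also have "\<dots> = ennreal r" using c r by (simp flip: ennreal_mult ennreal_plus)
    finally show ?case .
  qed
qed

subsection \<open>Extending the class of test functions\<close>

text \<open>Translation invariance makes the integral of every difference quotient of f vanish, and
  the quotients converge boundedly to the directional derivative. The integrations by parts below
  rest on this.\<close>

lemma integral_C1_grad_eq_0:
  fixes f :: "'a::euclidean_space \<Rightarrow> real"
  assumes f: "C1_grad f f'" and 0: "\<And>x. norm x > R \<Longrightarrow> f x = 0"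
  shows "(\<integral>x. f' x \<partial>lborel) = 0"
proof -
  have c: "continuous_on UNIV f" "continuous_on UNIV f'"
    using C1_grad_continuous'[OF f] C1_grad_continuous[OF f] by auto
  have d0: "f' x = 0" if "norm x > R" for x
    by (rule C1_grad_zero[OF f, of "- cball 0 R"]) (use that 0 in auto)
  have if': "integrable lborel f'" by (rule integrable_continuous_compact_support[OF c(2) d0])
  have intf: "integrable lborel f" by (rule integrable_continuous_compact_support[OF c(1) 0])
  have [measurable]: "f \<in> borel_measurable borel" using intf by auto
  obtain D where D: "D \<ge> 0" "\<And>x. norm (f' x) \<le> D"
    using bounded_continuous_compact_support[OF c(2) d0] by blast
  note Lip = C1_grad_Lipschitz[OF f D(2)]
  have "(\<integral>x. f' x \<partial>lborel) \<bullet> b = 0" if b: "b \<in> Basis" for b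
  proof -
    define h where "h n = 1 / real (Suc n)" for n
    have h: "h n > 0" "h n \<le> 1" for n by (auto simp: h_def)
    have h0: "h \<longlonglongrightarrow> 0" unfolding h_def by (rule LIMSEQ_Suc[OF lim_1_over_n])
    \<comment> \<open>Increments of length at most 1 keep the supports of all quotients inside the
      ball of radius R + 1, where the Lipschitz constant D dominates.\<close>
    have "(\<lambda>n. \<integral>x. (f (x + h n *\<^sub>R b) - f x) / h n \<partial>lborel) \<longlonglongrightarrow> (\<integral>x. f' x \<bullet> b \<partial>lborel)"
    proof (rule integral_dominated_convergence[where w = "\<lambda>x. indicator (cball 0 (R + 1)) x *\<^sub>R D"])
      show "AE x in lborel. (\<lambda>n. (f (x + h n *\<^sub>R b) - f x) / h n) \<longlonglongrightarrow> f' x \<bullet> b"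
      proof (rule AE_I2)
        fix x
        have "((\<lambda>t. x + t *\<^sub>R b) has_derivative (\<lambda>t. t *\<^sub>R b)) (at 0)"
          by (auto intro!: derivative_eq_intros)
        moreover have "(f has_derivative (\<lambda>v. f' x \<bullet> v)) (at (x + 0 *\<^sub>R b))"
          using C1_grad_derivative[OF f, of x] by simp
        ultimately have "((\<lambda>t. f (x + t *\<^sub>R b)) has_derivative (\<lambda>t. f' x \<bullet> (t *\<^sub>R b))) (at 0)"
          by (rule has_derivative_compose)
        then have "((\<lambda>t. f (x + t *\<^sub>R b)) has_real_derivative (f' x \<bullet> b)) (at 0)"
          by (simp add: has_field_derivative_def mult.commute[of _ "f' x \<bullet> b"])
        then have "((\<lambda>t. (f (x + t *\<^sub>R b) - f x) / t) \<longlongrightarrow> f' x \<bullet> b) (at 0)"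
          by (simp add: has_field_derivative_iff)
        then show "(\<lambda>n. (f (x + h n *\<^sub>R b) - f x) / h n) \<longlonglongrightarrow> f' x \<bullet> b"
          unfolding tendsto_at_iff_sequentially comp_def using h0 less_imp_neq[OF h(1)] by force
      qed
      show "AE x in lborel. norm ((f (x + h n *\<^sub>R b) - f x) / h n) \<le> indicator (cball 0 (R + 1)) x *\<^sub>R D" for n
      proof (rule AE_I2)
        fix x
        show "norm ((f (x + h n *\<^sub>R b) - f x) / h n) \<le> indicator (cball 0 (R + 1)) x *\<^sub>R D"
        proof (cases "norm x \<le> R + 1")
          case True
          then show ?thesis using Lip[of "x + h n *\<^sub>R b" x] h[of n] b by (simp add: field_simps)
        next
          case False
          have "norm x \<le> norm (x + h n *\<^sub>R b) + norm (h n *\<^sub>R b)"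
            using norm_triangle_ineq4[of "x + h n *\<^sub>R b" "h n *\<^sub>R b"] by simp
          then have "norm (x + h n *\<^sub>R b) > R" using False h[of n] b by simp
          then show ?thesis using False 0 by simp
        qed
      qed
      show "integrable lborel (\<lambda>x::'a. indicator (cball 0 (R + 1)) x *\<^sub>R D)"
        by (rule borel_integrable_compact) auto
    qed (use if' in auto)
    moreover have "(\<integral>x. (f (x + h n *\<^sub>R b) - f x) / h n \<partial>lborel) = 0" for n
      using integral_lborel_plus[of f "h n *\<^sub>R b"] integrable_lborel_plus[OF intf, of "h n *\<^sub>R b"] intf
      by simp
    ultimately have "(\<lambda>n::nat. 0) \<longlonglongrightarrow> (\<integral>x. f' x \<bullet> b \<partial>lborel)" by (simp only:)
    then have "(\<integral>x. f' x \<bullet> b \<partial>lborel) = 0" by (simp add: LIMSEQ_const_iff)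
    then show ?thesis using if' by (subst integral_inner_left[symmetric]) auto
  qed
  then show ?thesis by (metis euclidean_all_zero_iff)
qed

lemma C1_grad_mult:
  assumes "C1_grad f f'" "C1_grad g g'"
  shows "C1_grad (\<lambda>x. f x * g x) (\<lambda>x. f x *\<^sub>R g' x + g x *\<^sub>R f' x)"
  unfolding C1_grad_def
proof (intro conjI allI)
  fix x
  show "((\<lambda>x. f x * g x) has_derivative (\<lambda>v. (f x *\<^sub>R g' x + g x *\<^sub>R f' x) \<bullet> v)) (at x)"
    by (rule has_derivative_eq_rhs[OF has_derivative_mult[OF C1_grad_derivative[OF assms(1)] C1_grad_derivative[OF assms(2)]]])
      (auto simp: inner_add_left algebra_simps)
  show "continuous_on UNIV (\<lambda>x. f x *\<^sub>R g' x + g x *\<^sub>R f' x)"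
    using assms[THEN C1_grad_continuous'] assms[THEN C1_grad_continuous] by (intro continuous_intros)
qed

lemma C1_grad_reflect:
  assumes "C1_grad f f'"
  shows "C1_grad (\<lambda>y. f (x - y)) (\<lambda>y. - f' (x - y))"
  unfolding C1_grad_def
proof (intro conjI allI)
  fix y
  have "((\<lambda>y. x - y) has_derivative (\<lambda>v. - v)) (at y)" by (auto intro!: derivative_eq_intros)
  from has_derivative_compose[OF this C1_grad_derivative[OF assms]]
  show "((\<lambda>y. f (x - y)) has_derivative (\<lambda>v. - f' (x - y) \<bullet> v)) (at y)" by simp
  show "continuous_on UNIV (\<lambda>y. - f' (x - y))"
    by (intro continuous_on_minus continuous_on_compose2[OF C1_grad_continuous[OF assms]] continuous_intros) auto
qed

text \<open>Meant for products such as \<psi> times G of a mollified u, where G is differentiable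
  only at positive arguments: on V the formula makes sense, off K everything is 0, and these two
  open sets cover the space.\<close>

lemma C1_grad_extend:
  assumes V: "open V" and K: "compact K" "K \<subseteq> V"
    and d: "\<And>x. x \<in> V \<Longrightarrow> (f has_derivative (\<lambda>v. f' x \<bullet> v)) (at x)" and c: "continuous_on V f'"
    and 0: "\<And>x. x \<notin> K \<Longrightarrow> f x = 0" "\<And>x. x \<notin> K \<Longrightarrow> f' x = 0"
  shows "C1_grad f f'"
  unfolding C1_grad_def
proof (intro conjI allI)
  have oK: "open (- K)" using K compact_imp_closed by auto
  fix x
  show "(f has_derivative (\<lambda>v. f' x \<bullet> v)) (at x)"
  proof (cases "x \<in> K")
    case False
    have "((\<lambda>x. 0) has_derivative (\<lambda>v. f' x \<bullet> v)) (at x)" using 0(2)[OF False] by simp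
    then show ?thesis
      by (rule has_derivative_transform_within_open[OF _ oK]) (use False 0 in auto)
  qed (use d K in auto)
  have "continuous_on (- K) f'"
    using 0(2) by (subst continuous_on_cong[where g = "\<lambda>_. 0"]) auto
  then have "continuous_on (V \<union> - K) f'" using c V oK by (intro continuous_on_open_Un)
  moreover have "V \<union> - K = UNIV" using K by auto
  ultimately show "continuous_on UNIV f'" by simp
qed

text \<open>The margin \<delta> is the room in which a support may grow under mollification.\<close>

lemma compact_neighbourhood:
  fixes K :: "'a::euclidean_space set"
  assumes "compact K" "open \<Omega>" "K \<subseteq> \<Omega>"
  obtains K' \<delta> where "compact K'" "K' \<subseteq> \<Omega>" "\<delta> > 0" "\<And>x y. x \<in> K \<Longrightarrow> norm (x - y) \<le> \<delta> \<Longrightarrow> y \<in> K'"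
proof -
  obtain \<delta> where d: "\<delta> > 0" "(\<Union>x\<in>K. cball x \<delta>) \<subseteq> \<Omega>"
    using compact_subset_open_imp_cball_epsilon_subset[OF assms] by blast
  let ?K = "{x + y | x y. x \<in> K \<and> y \<in> cball 0 \<delta>}"
  show thesis
  proof (rule that[of ?K \<delta>])
    show "compact ?K" by (rule compact_sums[OF assms(1)]) simp
    show "?K \<subseteq> \<Omega>" using d(2) by (force simp: dist_norm)
    show "\<delta> > 0" by (rule d)
    show "y \<in> ?K" if "x \<in> K" "norm (x - y) \<le> \<delta>" for x y
      using that by (intro CollectI exI[of _ x] exI[of _ "y - x"]) (auto simp: norm_minus_commute)
  qed
qed

lemma mollifier_sequence:
  assumes "\<delta> > 0"
  obtains e and \<eta> :: "nat \<Rightarrow> 'a::euclidean_space \<Rightarrow> real"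
  where "\<And>n. mollifier (e n) (\<eta> n)" "e \<longlonglongrightarrow> 0" "\<And>n. 0 < e n" "\<And>n. e n \<le> \<delta>"
proof -
  define e where "e n = \<delta> / real (Suc n)" for n
  have "\<exists>\<eta> :: 'a \<Rightarrow> real. mollifier (e n) \<eta>" for n
    using mollifier_exists[of "e n"] assms by (auto simp: e_def)
  then obtain \<eta> :: "nat \<Rightarrow> 'a \<Rightarrow> real" where "\<And>n. mollifier (e n) (\<eta> n)" by metis
  moreover have "e \<longlonglongrightarrow> 0" unfolding e_def
    using tendsto_mult[OF tendsto_const[of \<delta>] LIMSEQ_Suc[OF lim_1_over_n]] by simp
  moreover have "e n \<le> \<delta>" "0 < e n" for n using assms by (auto simp: e_def field_simps)
  ultimately show thesis using that by blast
qed

lemma mollify_eq_0: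
  fixes f :: "'a::euclidean_space \<Rightarrow> 'b::euclidean_space"
  assumes m: "mollifier e \<eta>" and 0: "\<And>y. norm (x - y) < e \<Longrightarrow> f y = 0"
  shows "mollify \<eta> f x = 0"
proof -
  have "\<eta> (x - y) *\<^sub>R f y = 0" for y
    using 0[of y] mollifierD(3)[OF m, of "x - y"] by (cases "norm (x - y) < e") auto
  then have "(\<lambda>y. \<eta> (x - y) *\<^sub>R f y) = (\<lambda>y. 0)" by blast
  then show ?thesis by (simp add: mollify_def)
qed

lemma C1_grad_mollify:
  fixes f :: "'a::euclidean_space \<Rightarrow> real"
  assumes m: "mollifier e \<eta>" and f: "integrable lborel f"
  shows "C1_grad (mollify \<eta> f) (\<lambda>x. \<integral>y. f y *\<^sub>R grad \<eta> (x - y) \<partial>lborel)"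
proof -
  have d: "(mollify \<eta> f has_derivative (\<lambda>v. (\<integral>y. f y *\<^sub>R grad \<eta> (x - y) \<partial>lborel) \<bullet> v)) (at x)" for x
    by (rule has_derivative_mollify[OF f mollifierD(8)[OF m], of e]) (use mollifierD(3)[OF m] in auto)
  have "C_k 1 (mollify \<eta> f)"
    by (rule C_k_mollify[OF f, of _ e]) (use mollifierD(1,3)[OF m] in auto)
  from C_k_grad_C1[OF this] have "C1_grad (mollify \<eta> f) (grad (mollify \<eta> f))" .
  moreover have "grad (mollify \<eta> f) = (\<lambda>x. \<integral>y. f y *\<^sub>R grad \<eta> (x - y) \<partial>lborel)"
    using grad_eq[OF d] by auto
  ultimately show ?thesis by simp
qed

text \<open>The derivative is moved from the kernel onto f, because the integral of the gradient of
  \<open>f y * \<eta> (x - y)\<close> in y is 0.\<close>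

lemma grad_mollify:
  fixes f :: "'a::euclidean_space \<Rightarrow> real"
  assumes m: "mollifier e \<eta>" and f: "C1_grad f f'" and 0: "\<And>x. norm x > R \<Longrightarrow> f x = 0"
  shows "C1_grad (mollify \<eta> f) (mollify \<eta> f')"
proof -
  have c: "continuous_on UNIV f" "continuous_on UNIV f'"
    using C1_grad_continuous'[OF f] C1_grad_continuous[OF f] by auto
  have d0: "f' x = 0" if "norm x > R" for x
    by (rule C1_grad_zero[OF f, of "- cball 0 R"]) (use that 0 in auto)
  have if': "integrable lborel f'" by (rule integrable_continuous_compact_support[OF c(2) d0])
  have intf: "integrable lborel f" by (rule integrable_continuous_compact_support[OF c(1) 0])
  have "(\<integral>y. f y *\<^sub>R grad \<eta> (x - y) \<partial>lborel) = mollify \<eta> f' x" for x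
  proof -
    have e0: "\<eta> z = 0" if "norm z > e" for z using mollifierD(3)[OF m, of z] that by simp
    have g0: "grad \<eta> x = 0" if "norm x > e" for x
      by (rule C1_grad_zero[OF mollifierD(8)[OF m], of "- cball 0 e"]) (use that e0 in auto)
    obtain D where D: "D \<ge> 0" "\<And>x. norm (grad \<eta> x) \<le> D"
      using bounded_continuous_compact_support[OF C1_grad_continuous[OF mollifierD(8)[OF m]] g0] by blast
    have [measurable]: "grad \<eta> \<in> borel_measurable borel"
      using C1_grad_continuous[OF mollifierD(8)[OF m]] by (rule borel_measurable_continuous_onI)
    have i1: "integrable lborel (\<lambda>y. f y *\<^sub>R grad \<eta> (x - y))"
      by (rule integrable_scaleR_bounded[OF intf, of _ D]) (use D in auto)
    have "C1_grad (\<lambda>y. f y * \<eta> (x - y)) (\<lambda>y. f y *\<^sub>R (- grad \<eta> (x - y)) + \<eta> (x - y) *\<^sub>R f' y)"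
      by (rule C1_grad_mult[OF f C1_grad_reflect[OF mollifierD(8)[OF m]]])
    then have "(\<integral>y. f y *\<^sub>R (- grad \<eta> (x - y)) + \<eta> (x - y) *\<^sub>R f' y \<partial>lborel) = 0"
      by (rule integral_C1_grad_eq_0[of _ _ R]) (use 0 in auto)
    moreover have "(\<integral>y. f y *\<^sub>R (- grad \<eta> (x - y)) + \<eta> (x - y) *\<^sub>R f' y \<partial>lborel)
        = - (\<integral>y. f y *\<^sub>R grad \<eta> (x - y) \<partial>lborel) + mollify \<eta> f' x"
      unfolding mollify_def using i1 integrable_mollify_kernel[OF m if', of x]
      by (subst Bochner_Integration.integral_add) auto
    ultimately show ?thesis by simp
  qed
  then show ?thesis using C1_grad_mollify[OF m intf] by simp
qed

text \<open>Mollifying \<phi> gives admissible test functions, supported in one compact set K',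
  whose values and gradients converge pointwise and stay uniformly bounded. As F and h are
  integrable over K', both integrals pass to the limit.\<close>

lemma weak_inequality_C1:
  fixes F :: "'a::euclidean_space \<Rightarrow> 'a" and h :: "'a \<Rightarrow> real"
  assumes \<Omega>: "open \<Omega>"
    and F: "\<And>K. compact K \<Longrightarrow> K \<subseteq> \<Omega> \<Longrightarrow> integrable lborel (\<lambda>x. indicator K x *\<^sub>R F x)"
    and h: "\<And>K. compact K \<Longrightarrow> K \<subseteq> \<Omega> \<Longrightarrow> integrable lborel (\<lambda>x. indicator K x *\<^sub>R h x)"
    and ineq: "\<And>\<phi>. \<phi> \<in> test_functions \<Omega> \<Longrightarrow> (\<And>x. \<phi> x \<ge> 0) \<Longrightarrow>
       (\<integral>x. F x \<bullet> grad \<phi> x \<partial>lborel) + (\<integral>x. h x * \<phi> x \<partial>lborel) \<le> 0"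
    and \<phi>: "C1_grad \<phi> \<phi>'" "\<And>x. \<phi> x \<ge> 0" and K: "compact K" "K \<subseteq> \<Omega>" "\<And>x. x \<notin> K \<Longrightarrow> \<phi> x = 0"
  shows "(\<integral>x. F x \<bullet> \<phi>' x \<partial>lborel) + (\<integral>x. h x * \<phi> x \<partial>lborel) \<le> 0"
proof -
  obtain K' \<delta> where K': "compact K'" "K' \<subseteq> \<Omega>" "\<delta> > 0" "\<And>x y. x \<in> K \<Longrightarrow> norm (x - y) \<le> \<delta> \<Longrightarrow> y \<in> K'"
    using compact_neighbourhood[OF K(1) \<Omega> K(2)] by blast
  obtain e and \<eta> :: "nat \<Rightarrow> 'a \<Rightarrow> real"
    where m: "\<And>n. mollifier (e n) (\<eta> n)" and e: "e \<longlonglongrightarrow> 0" "\<And>n. 0 < e n" "\<And>n. e n \<le> \<delta>"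
    using mollifier_sequence[OF K'(3)] by blast
  obtain R where R: "\<And>x. x \<in> K \<Longrightarrow> norm x \<le> R"
    using compact_imp_bounded[OF K(1)] by (auto simp: bounded_iff)
  have \<phi>0: "\<phi> x = 0" if "norm x > R" for x using R[of x] K(3)[of x] that by force
  have \<phi>'0: "\<phi>' x = 0" if "x \<notin> K" for x
    by (rule C1_grad_zero[OF \<phi>(1), of "- K"]) (use that K compact_imp_closed in auto)
  have \<phi>'0': "\<phi>' x = 0" if "norm x > R" for x using R[of x] \<phi>'0[of x] that by force
  have c: "continuous_on UNIV \<phi>" "continuous_on UNIV \<phi>'"
    using C1_grad_continuous'[OF \<phi>(1)] C1_grad_continuous[OF \<phi>(1)] by auto
  have i: "integrable lborel \<phi>" "integrable lborel \<phi>'"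
    by (auto intro!: integrable_continuous_compact_support[OF c(1) \<phi>0] integrable_continuous_compact_support[OF c(2) \<phi>'0'])
  obtain B where B: "\<And>x. norm (\<phi> x) \<le> B" using bounded_continuous_compact_support[OF c(1) \<phi>0] by blast
  obtain B' where B': "\<And>x. norm (\<phi>' x) \<le> B'" using bounded_continuous_compact_support[OF c(2) \<phi>'0'] by blast
  define \<phi>n where "\<phi>n n = mollify (\<eta> n) \<phi>" for n
  define dn where "dn n = mollify (\<eta> n) \<phi>'" for n
  have Cn: "C1_grad (\<phi>n n) (dn n)" for n
    unfolding \<phi>n_def dn_def by (rule grad_mollify[OF m \<phi>(1) \<phi>0])
  have gn: "grad (\<phi>n n) = dn n" for n using grad_eq[OF C1_grad_derivative[OF Cn]] by auto
  have zero: "\<phi>n n x = 0" "dn n x = 0" if "x \<notin> K'" for n x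
  proof -
    have "y \<notin> K" if y: "norm (x - y) < e n" for y
      using K'(4)[of y x] e(3)[of n] y \<open>x \<notin> K'\<close> by (force simp: norm_minus_commute)
    then show "\<phi>n n x = 0" "dn n x = 0" unfolding \<phi>n_def dn_def
      by (auto intro!: mollify_eq_0[OF m] K(3) \<phi>'0)
  qed
  have test: "\<phi>n n \<in> test_functions \<Omega>" for n
  proof (rule test_functionsI[OF _ K'(1,2)])
    show "C_k k (\<phi>n n)" for k unfolding \<phi>n_def
      by (rule C_k_mollify[OF i(1), of _ "e n"]) (use mollifierD(1,3)[OF m] in auto)
  qed (rule zero)
  have bn: "norm (\<phi>n n x) \<le> B" "norm (dn n x) \<le> B'" for n x
    using mollify_close[OF m i(1), of x _ 0 B] mollify_close[OF m i(2), of x _ 0 B'] B B'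
    by (auto simp: \<phi>n_def dn_def)
  have ge: "\<phi>n n x \<ge> 0" for n x
    using mollify_bounds[OF m i(1), of x n 0 B] \<phi>(2) B by (auto simp: \<phi>n_def abs_le_iff)
  have lim: "(\<lambda>n. \<phi>n n x) \<longlonglongrightarrow> \<phi> x" "(\<lambda>n. dn n x) \<longlonglongrightarrow> \<phi>' x" for x
    unfolding \<phi>n_def dn_def using c
    by (auto intro!: mollify_tendsto[OF m e(1)] i simp: continuous_on_eq_continuous_at)
  have [measurable]: "\<phi>n n \<in> borel_measurable borel" "dn n \<in> borel_measurable borel" for n
    using C1_grad_continuous'[OF Cn] C1_grad_continuous[OF Cn] by (auto intro: borel_measurable_continuous_onI)
  have [measurable]: "\<phi> \<in> borel_measurable borel" "\<phi>' \<in> borel_measurable borel" using i by auto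
  define Fi where "Fi x = indicator K' x *\<^sub>R F x" for x
  define hi where "hi x = indicator K' x *\<^sub>R h x" for x
  have iF: "integrable lborel Fi" and ih: "integrable lborel hi"
    unfolding Fi_def hi_def using F[OF K'(1,2)] h[OF K'(1,2)] by auto
  have KK: "x \<notin> K' \<Longrightarrow> x \<notin> K" for x using K'(4)[of x x] K'(3) by auto
  have [measurable]: "Fi \<in> borel_measurable borel" "hi \<in> borel_measurable borel" using iF ih by auto
  have "(\<lambda>n. \<integral>x. Fi x \<bullet> dn n x \<partial>lborel) \<longlonglongrightarrow> (\<integral>x. Fi x \<bullet> \<phi>' x \<partial>lborel)"
  proof (rule integral_dominated_convergence[where w = "\<lambda>x. norm (Fi x) * B'"])
    show "AE x in lborel. norm (Fi x \<bullet> dn n x) \<le> norm (Fi x) * B'" for n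
    proof (rule AE_I2)
      fix x
      have "norm (Fi x \<bullet> dn n x) \<le> norm (Fi x) * norm (dn n x)"
        using Cauchy_Schwarz_ineq2[of "Fi x" "dn n x"] by simp
      also have "\<dots> \<le> norm (Fi x) * B'" by (intro mult_left_mono bn) auto
      finally show "norm (Fi x \<bullet> dn n x) \<le> norm (Fi x) * B'" .
    qed
  qed (use iF lim in \<open>auto intro!: tendsto_intros\<close>)
  moreover have "(\<lambda>n. \<integral>x. hi x * \<phi>n n x \<partial>lborel) \<longlonglongrightarrow> (\<integral>x. hi x * \<phi> x \<partial>lborel)"
  proof (rule integral_dominated_convergence[where w = "\<lambda>x. norm (hi x) * B"])
    show "AE x in lborel. norm (hi x * \<phi>n n x) \<le> norm (hi x) * B" for n
      unfolding norm_mult by (intro AE_I2 mult_left_mono bn) auto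
  qed (use ih lim in \<open>auto intro!: tendsto_intros\<close>)
  ultimately have L: "(\<lambda>n. (\<integral>x. Fi x \<bullet> dn n x \<partial>lborel) + (\<integral>x. hi x * \<phi>n n x \<partial>lborel))
      \<longlonglongrightarrow> (\<integral>x. Fi x \<bullet> \<phi>' x \<partial>lborel) + (\<integral>x. hi x * \<phi> x \<partial>lborel)" by (rule tendsto_add)
  have "(\<integral>x. Fi x \<bullet> dn n x \<partial>lborel) + (\<integral>x. hi x * \<phi>n n x \<partial>lborel) \<le> 0" for n
  proof -
    have "(\<integral>x. Fi x \<bullet> dn n x \<partial>lborel) = (\<integral>x. F x \<bullet> grad (\<phi>n n) x \<partial>lborel)"
      unfolding gn by (rule Bochner_Integration.integral_cong) (auto simp: Fi_def hi_def indicator_def zero)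
    moreover have "(\<integral>x. hi x * \<phi>n n x \<partial>lborel) = (\<integral>x. h x * \<phi>n n x \<partial>lborel)"
      by (rule Bochner_Integration.integral_cong) (auto simp: Fi_def hi_def indicator_def zero)
    ultimately show ?thesis using ineq[OF test ge] by simp
  qed
  then have "(\<integral>x. Fi x \<bullet> \<phi>' x \<partial>lborel) + (\<integral>x. hi x * \<phi> x \<partial>lborel) \<le> 0"
    using LIMSEQ_le_const2[OF L] by blast
  moreover have "(\<integral>x. Fi x \<bullet> \<phi>' x \<partial>lborel) = (\<integral>x. F x \<bullet> \<phi>' x \<partial>lborel)"
    by (rule Bochner_Integration.integral_cong) (use KK \<phi>'0 in \<open>auto simp: Fi_def hi_def indicator_def\<close>)
  moreover have "(\<integral>x. hi x * \<phi> x \<partial>lborel) = (\<integral>x. h x * \<phi> x \<partial>lborel)"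
    by (rule Bochner_Integration.integral_cong) (use KK K(3) in \<open>auto simp: Fi_def hi_def indicator_def\<close>)
  ultimately show ?thesis by simp
qed

lemma mollify_test_function:
  assumes m: "mollifier e \<eta>" and x: "cball x e \<subseteq> \<Omega>"
  shows "(\<lambda>y. \<eta> (x - y)) \<in> test_functions \<Omega>" "grad (\<lambda>y. \<eta> (x - y)) y = - grad \<eta> (x - y)"
proof -
  show "(\<lambda>y. \<eta> (x - y)) \<in> test_functions \<Omega>"
  proof (rule test_functionsI[OF _ compact_cball x])
    show "C_k k (\<lambda>y. \<eta> (x - y))" for k
      using C_k_affine[OF mollifierD(1)[OF m], of k x "-1"] by simp
    show "\<eta> (x - y) = 0" if "y \<notin> cball x e" for y
      using that by (intro mollifierD(3)[OF m]) (auto simp: dist_norm)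
  qed
  show "grad (\<lambda>y. \<eta> (x - y)) y = - grad \<eta> (x - y)"
    by (rule grad_eq) (rule C1_grad_derivative[OF C1_grad_reflect[OF mollifierD(8)[OF m]]])
qed

text \<open>Testing with \<open>\<eta> (x - y)\<close> shows that the mollifications of w vanish on
  K, and they converge to w in L1. The lemma serves to identify the weak gradient given by
  \<open>W1_loc\<close>, which lies in L^m, with the one in the differential inequality.\<close>

lemma weak_zero_imp_AE_zero:
  fixes w :: "'a::euclidean_space \<Rightarrow> 'b::euclidean_space"
  assumes \<Omega>: "open \<Omega>"
    and w: "\<And>K. compact K \<Longrightarrow> K \<subseteq> \<Omega> \<Longrightarrow> integrable lborel (\<lambda>x. indicator K x *\<^sub>R w x)"
    and z: "\<And>\<phi>. \<phi> \<in> test_functions \<Omega> \<Longrightarrow> (\<integral>x. \<phi> x *\<^sub>R w x \<partial>lborel) = 0"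
  shows "AE x in lborel. x \<in> \<Omega> \<longrightarrow> w x = 0"
proof -
  have AE_K: "AE x in lborel. x \<in> K \<longrightarrow> w x = 0" if K: "compact K" "K \<subseteq> \<Omega>" for K
  proof -
    obtain K' \<delta> where K': "compact K'" "K' \<subseteq> \<Omega>" "\<delta> > 0" "\<And>x y. x \<in> K \<Longrightarrow> norm (x - y) \<le> \<delta> \<Longrightarrow> y \<in> K'"
      using compact_neighbourhood[OF K(1) \<Omega> K(2)] by blast
    obtain e and \<eta> :: "nat \<Rightarrow> 'a \<Rightarrow> real"
      where m: "\<And>n. mollifier (e n) (\<eta> n)" and e: "e \<longlonglongrightarrow> 0" "\<And>n. 0 < e n" "\<And>n. e n \<le> \<delta>"
      using mollifier_sequence[OF K'(3)] by blast
    let ?w = "\<lambda>x. indicator K' x *\<^sub>R w x"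
    note iw = w[OF K'(1,2)]
    have [measurable]: "?w \<in> borel_measurable borel" "\<eta> n \<in> borel_measurable borel" "K \<in> sets borel" for n
      using iw mollifierD(6)[OF m] borel_compact[OF K(1)] by auto
    have zero: "mollify (\<eta> n) ?w x = 0" if "x \<in> K" for n x
    proof -
      have sub: "cball x (e n) \<subseteq> K'"
        using K'(4)[OF that] e(3)[of n] by (force simp: dist_norm)
      have "mollify (\<eta> n) ?w x = (\<integral>y. \<eta> n (x - y) *\<^sub>R w y \<partial>lborel)"
        unfolding mollify_def
      proof (rule Bochner_Integration.integral_cong)
        fix y
        show "\<eta> n (x - y) *\<^sub>R ?w y = \<eta> n (x - y) *\<^sub>R w y"
          using sub mollifierD(3)[OF m, of n "x - y"] by (cases "y \<in> K'") (force simp: dist_norm subset_iff)+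
      qed simp
      also have "\<dots> = 0"
        by (rule z, rule mollify_test_function[OF m]) (use sub K' in blast)
      finally show ?thesis .
    qed
    have "(\<integral>\<^sup>+x. ennreal (norm (?w x)) * indicator K x \<partial>lborel) \<le> ennreal r" if "r > 0" for r
    proof -
      obtain n where n: "(\<integral>\<^sup>+x. ennreal (norm (mollify (\<eta> n) ?w x - ?w x)) \<partial>lborel) \<le> ennreal r"
        using eventually_happens'[OF _ mollify_L1_tendsto[OF m e(1) iw \<open>r > 0\<close>]] by auto
      have "(\<integral>\<^sup>+x. ennreal (norm (?w x)) * indicator K x \<partial>lborel)
        \<le> (\<integral>\<^sup>+x. ennreal (norm (mollify (\<eta> n) ?w x - ?w x)) \<partial>lborel)"
      proof (rule nn_integral_mono)
        fix x
        show "ennreal (norm (?w x)) * indicator K x \<le> ennreal (norm (mollify (\<eta> n) ?w x - ?w x))"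
          using zero[of x n] by (cases "x \<in> K") auto
      qed
      with n show ?thesis by (rule order.trans[rotated])
    qed
    note le = this
    have "(\<integral>\<^sup>+x. ennreal (norm (?w x)) * indicator K x \<partial>lborel) \<le> 0"
      by (rule ennreal_le_epsilon, unfold add_0, rule le)
    then have "AE x in lborel. ennreal (norm (?w x)) * indicator K x = 0"
    proof -
      have M: "(\<lambda>x. ennreal (norm (?w x)) * indicator K x) \<in> borel_measurable lborel" by measurable
      show "(\<integral>\<^sup>+x. ennreal (norm (?w x)) * indicator K x \<partial>lborel) \<le> 0 \<Longrightarrow> ?thesis"
        using nn_integral_0_iff_AE[OF M] by (simp only: le_zero_eq)
    qed
    then show ?thesis
    proof eventually_elim
      case (elim x)
      have "x \<in> K \<Longrightarrow> x \<in> K'" using K'(4)[of x x] K'(3) by auto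
      then show ?case using elim by auto
    qed
  qed
  obtain C where C: "\<And>n::nat. compact (C n)" "\<And>n. C n \<subseteq> \<Omega>" "\<Union> (range C) = \<Omega>"
    using open_Union_compact_subsets[OF \<Omega>] by metis
  have "AE x in lborel. \<forall>n. x \<in> C n \<longrightarrow> w x = 0"
    unfolding AE_all_countable using AE_K[OF C(1,2)] by blast
  then show ?thesis by eventually_elim (use C(3) in auto)
qed

text \<open>
  Substituting \<open>\<psi> (G \<circ> u)\<close> for a continuous Sobolev function \<open>u\<close>: the mollified functions
  \<open>u\<^sub>n\<close> give \<open>C\<^sup>1\<close> test functions, and only \<open>\<integral> |F| |\<nabla>u\<^sub>n - \<nabla>u|\<close> needs more than dominated convergence.
\<close>

lemma weak_inequality_composite:
  fixes F g :: "'a::euclidean_space \<Rightarrow> 'a" and u h :: "'a \<Rightarrow> real"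
  assumes \<Omega>: "open \<Omega>" and m: "m > 1"
    and u: "continuous_on \<Omega> u" "\<And>x. x \<in> \<Omega> \<Longrightarrow> u x > 0"
    and g[measurable]: "g \<in> borel_measurable borel"
    and gm: "\<And>K. compact K \<Longrightarrow> K \<subseteq> \<Omega> \<Longrightarrow> integrable lborel (\<lambda>x. indicator K x * norm (g x) powr m)"
    and g1: "\<And>K. compact K \<Longrightarrow> K \<subseteq> \<Omega> \<Longrightarrow> integrable lborel (\<lambda>x. indicator K x *\<^sub>R g x)"
    and ug: "\<And>\<phi>. \<phi> \<in> test_functions \<Omega> \<Longrightarrow>
       (\<integral>x. u x *\<^sub>R grad \<phi> x \<partial>lborel) = - (\<integral>x. \<phi> x *\<^sub>R g x \<partial>lborel)"
    and F: "\<And>K. compact K \<Longrightarrow> K \<subseteq> \<Omega> \<Longrightarrow> integrable lborel (\<lambda>x. indicator K x *\<^sub>R F x)"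
    and Fm[measurable]: "F \<in> borel_measurable borel"
    and Fg: "\<And>K. compact K \<Longrightarrow> K \<subseteq> \<Omega> \<Longrightarrow> \<exists>A\<ge>0. \<forall>x\<in>K. norm (F x) \<le> A * norm (g x) powr (m - 1)"
    and h: "\<And>K. compact K \<Longrightarrow> K \<subseteq> \<Omega> \<Longrightarrow> integrable lborel (\<lambda>x. indicator K x *\<^sub>R h x)"
    and ineq: "\<And>\<phi>. \<phi> \<in> test_functions \<Omega> \<Longrightarrow> (\<And>x. \<phi> x \<ge> 0) \<Longrightarrow>
       (\<integral>x. F x \<bullet> grad \<phi> x \<partial>lborel) + (\<integral>x. h x * \<phi> x \<partial>lborel) \<le> 0"
    and \<psi>: "C1_grad \<psi> \<psi>'" "\<And>x. \<psi> x \<ge> 0" and K: "compact K" "K \<subseteq> \<Omega>" "\<And>x. x \<notin> K \<Longrightarrow> \<psi> x = 0"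
    and G: "\<And>t. t > 0 \<Longrightarrow> (G has_real_derivative G' t) (at t)" "continuous_on {0<..} G'" "\<And>t. t > 0 \<Longrightarrow> G t \<ge> 0"
  shows "(\<integral>x. G (u x) * (F x \<bullet> \<psi>' x) \<partial>lborel) + (\<integral>x. \<psi> x * G' (u x) * (F x \<bullet> g x) \<partial>lborel)
      + (\<integral>x. h x * (\<psi> x * G (u x)) \<partial>lborel) \<le> 0"
proof -
  obtain K' \<delta> where K': "compact K'" "K' \<subseteq> \<Omega>" "\<delta> > 0" "\<And>x y. x \<in> K \<Longrightarrow> norm (x - y) \<le> \<delta> \<Longrightarrow> y \<in> K'"
    using compact_neighbourhood[OF K(1) \<Omega> K(2)] by blast
  obtain e and \<eta> :: "nat \<Rightarrow> 'a \<Rightarrow> real"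
    where mo: "\<And>n. mollifier (e n) (\<eta> n)" and e: "e \<longlonglongrightarrow> 0" "\<And>n. 0 < e n" "\<And>n. e n \<le> \<delta>"
    using mollifier_sequence[OF K'(3)] by blast
  have KK: "x \<in> K \<Longrightarrow> x \<in> K'" for x using K'(4)[of x x] K'(3) by auto
  have [measurable]: "K \<in> sets borel" "K' \<in> sets borel" using K(1) K'(1) by (auto intro: borel_compact)
  have cu: "continuous_on K' u" using u(1) K'(2) by (rule continuous_on_subset)
  \<comment> \<open>On the compact set K' the values of u lie in an interval [a, b] of positive
    numbers. The averages formed at points of K stay in it, so G and G' are met on a compact set of
    arguments only.\<close>
  obtain a b where ab: "0 < a" "\<And>x. x \<in> K' \<Longrightarrow> u x \<in> {a..b}"
  proof (cases "K' = {}")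
    case False
    obtain x0 x1 where "x0 \<in> K'" "\<forall>y\<in>K'. u x0 \<le> u y" "x1 \<in> K'" "\<forall>y\<in>K'. u y \<le> u x1"
      using continuous_attains_inf[OF K'(1) False cu] continuous_attains_sup[OF K'(1) False cu] by blast
    then show ?thesis using that[of "u x0" "u x1"] u(2) K'(2) by auto
  qed (use that[of 1 1] in auto)
  define ut where "ut x = indicator K' x *\<^sub>R u x" for x
  define gt where "gt x = indicator K' x *\<^sub>R g x" for x
  have iu: "integrable lborel ut" unfolding ut_def by (rule borel_integrable_compact[OF K'(1) cu])
  have ig: "integrable lborel gt" unfolding gt_def by (rule g1[OF K'(1,2)])
  have igm: "integrable lborel (\<lambda>x. norm (gt x) powr m)"
  proof -
    have "(\<lambda>x. norm (gt x) powr m) = (\<lambda>x. indicator K' x * norm (g x) powr m)"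
      using m by (auto simp: gt_def indicator_def fun_eq_iff)
    then show ?thesis using gm[OF K'(1,2)] by simp
  qed
  define un where "un n = mollify (\<eta> n) ut" for n
  define dn where "dn n x = (\<integral>y. ut y *\<^sub>R grad (\<eta> n) (x - y) \<partial>lborel)" for n x
  have Cn: "C1_grad (un n) (dn n)" for n
    unfolding un_def dn_def by (rule C1_grad_mollify[OF mo iu])
  have sub: "cball x (e n) \<subseteq> K'" if "x \<in> K" for x n
    using K'(4)[OF that] e(3)[of n] by (force simp: dist_norm)
  \<comment> \<open>For x in K the function \<open>\<eta> n (x - y)\<close> of y is an admissible
    test function, so the classical gradient of the mollified u is there the mollified weak
    gradient. Off K this may fail, but \<psi> vanishes.\<close>
  have dn_eq: "dn n x = mollify (\<eta> n) gt x" if x: "x \<in> K" for n x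
  proof -
    have g0: "grad (\<eta> n) z = 0" if "norm z > e n" for z
      by (rule C1_grad_zero[OF mollifierD(8)[OF mo], of "- cball 0 (e n)"]) (use that mollifierD(3)[OF mo, of n] in auto)
    note tf = mollify_test_function[OF mo order.trans[OF sub[OF x] K'(2)], of n]
    have "dn n x = - (\<integral>y. u y *\<^sub>R grad (\<lambda>y. \<eta> n (x - y)) y \<partial>lborel)"
      unfolding dn_def tf(2) integral_minus[symmetric]
    proof (rule Bochner_Integration.integral_cong)
      fix y
      show "ut y *\<^sub>R grad (\<eta> n) (x - y) = - (u y *\<^sub>R - grad (\<eta> n) (x - y))"
        using sub[OF x, of n] g0[of "x - y"] by (cases "y \<in> K'") (force simp: ut_def dist_norm subset_iff)+
    qed simp
    also have "\<dots> = (\<integral>y. \<eta> n (x - y) *\<^sub>R g y \<partial>lborel)" using ug[OF tf(1)] by simp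
    also have "\<dots> = mollify (\<eta> n) gt x"
      unfolding mollify_def
    proof (rule Bochner_Integration.integral_cong)
      fix y
      show "\<eta> n (x - y) *\<^sub>R g y = \<eta> n (x - y) *\<^sub>R gt y"
        using sub[OF x, of n] mollifierD(3)[OF mo, of n "x - y"] by (cases "y \<in> K'") (force simp: gt_def dist_norm subset_iff)+
    qed simp
    finally show ?thesis .
  qed
  have un_ab: "un n x \<in> {a..b}" if x: "x \<in> K" for n x
    unfolding un_def
  proof (rule mollify_bounds[OF mo iu])
    fix z assume "norm (x - z) < e n"
    then have "z \<in> K'" using sub[OF x, of n] by (force simp: dist_norm)
    then show "ut z \<in> {a..b}" using ab(2)[of z] by (simp add: ut_def)
  qed
  have un_lim: "(\<lambda>n. un n x) \<longlonglongrightarrow> u x" if x: "x \<in> K" for x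
  proof -
    have xi: "ball x \<delta> \<subseteq> K'" using K'(4)[OF x] by (force simp: dist_norm)
    have "continuous_on (ball x \<delta>) u" using cu xi by (rule continuous_on_subset)
    then have "isCont u x" using K'(3) by (simp add: continuous_on_eq_continuous_at)
    then have "isCont ut x"
      using xi K'(3) by (subst isCont_cong[where g = u]) (auto simp: ut_def eventually_nhds_in_open eventually_nhds intro!: exI[of _ "ball x \<delta>"])
    then have "(\<lambda>n. un n x) \<longlonglongrightarrow> ut x" unfolding un_def by (intro mollify_tendsto[OF mo e(1) iu])
    then show ?thesis using KK[OF x] by (simp add: ut_def)
  qed
  have G_cont: "continuous_on {0<..} G"
    using G(1) by (auto intro!: continuous_at_imp_continuous_on DERIV_isCont)
  have cG: "compact (G ` {a..b})" "compact (G' ` {a..b})"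
    using ab(1) by (auto intro!: compact_continuous_image continuous_on_subset[OF G_cont] continuous_on_subset[OF G(2)])
  obtain B where "\<forall>y\<in>G ` {a..b}. norm y \<le> B"
    using compact_imp_bounded[OF cG(1)] unfolding bounded_iff by blast
  then have B: "\<bar>G t\<bar> \<le> B" if "t \<in> {a..b}" for t using that by auto
  obtain B' where "\<forall>y\<in>G' ` {a..b}. norm y \<le> B'"
    using compact_imp_bounded[OF cG(2)] unfolding bounded_iff by blast
  then have B': "\<bar>G' t\<bar> \<le> B'" if "t \<in> {a..b}" for t using that by auto
  have \<psi>'0: "\<psi>' x = 0" if "x \<notin> K" for x
    by (rule C1_grad_zero[OF \<psi>(1), of "- K"]) (use that K compact_imp_closed in auto)
  have c\<psi>: "continuous_on UNIV \<psi>" "continuous_on UNIV \<psi>'"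
    using C1_grad_continuous'[OF \<psi>(1)] C1_grad_continuous[OF \<psi>(1)] by auto
  obtain R where R: "\<And>x. x \<in> K \<Longrightarrow> norm x \<le> R"
    using compact_imp_bounded[OF K(1)] by (auto simp: bounded_iff)
  have R': "x \<notin> K" if "norm x > R" for x using R[of x] that by force
  obtain P where P: "P \<ge> 0" "\<And>x. norm (\<psi> x) \<le> P" using bounded_continuous_compact_support[OF c\<psi>(1), of R] K(3) R' by metis
  obtain P' where P': "P' \<ge> 0" "\<And>x. norm (\<psi>' x) \<le> P'" using bounded_continuous_compact_support[OF c\<psi>(2), of R] \<psi>'0 R' by metis
  define \<phi> where "\<phi> n x = \<psi> x * G (un n x)" for n x
  define \<phi>' where "\<phi>' n x = G (un n x) *\<^sub>R \<psi>' x + (\<psi> x * G' (un n x)) *\<^sub>R dn n x" for n x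
  have C\<phi>: "C1_grad (\<phi> n) (\<phi>' n)" for n
  proof (rule C1_grad_extend[where V = "{x. 0 < un n x}" and K = K])
    have c: "continuous_on UNIV (un n)" "continuous_on UNIV (dn n)"
      using C1_grad_continuous'[OF Cn] C1_grad_continuous[OF Cn] by auto
    show "open {x. 0 < un n x}" using c by (intro open_Collect_less) auto
    show "compact K" by (rule K)
    show "K \<subseteq> {x. 0 < un n x}"
    proof
      fix x assume "x \<in> K"
      from un_ab[OF this, of n] ab(1) show "x \<in> {x. 0 < un n x}" by simp
    qed
    show "\<phi> n x = 0" "\<phi>' n x = 0" if "x \<notin> K" for x using that K(3) \<psi>'0 by (auto simp: \<phi>_def \<phi>'_def)
    have "continuous_on {x. 0 < un n x} (\<lambda>x. G (un n x))" "continuous_on {x. 0 < un n x} (\<lambda>x. G' (un n x))"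
      by (rule continuous_on_compose2[OF G_cont] continuous_on_compose2[OF G(2)], auto intro: continuous_on_subset[OF c(1)])+
    then show "continuous_on {x. 0 < un n x} (\<phi>' n)"
      unfolding \<phi>'_def
      by (intro continuous_intros continuous_on_subset[OF c(2)] continuous_on_subset[OF c\<psi>(1)] continuous_on_subset[OF c\<psi>(2)]) auto
    fix x assume x: "x \<in> {x. 0 < un n x}"
    have "((\<lambda>x. G (un n x)) has_derivative (\<lambda>v. G' (un n x) * (dn n x \<bullet> v))) (at x)"
      by (rule has_derivative_compose[OF C1_grad_derivative[OF Cn] G(1)[unfolded has_field_derivative_def]]) (use x in auto)
    from has_derivative_mult[OF C1_grad_derivative[OF \<psi>(1)] this]
    show "(\<phi> n has_derivative (\<lambda>v. \<phi>' n x \<bullet> v)) (at x)"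
      unfolding \<phi>_def by (rule has_derivative_eq_rhs) (auto simp: \<phi>'_def inner_add_left algebra_simps)
  qed
  have \<phi>_ge: "\<phi> n x \<ge> 0" for n x
    using \<psi>(2)[of x] un_ab[of x n] ab(1) K(3)[of x] G(3)[of "un n x"] by (cases "x \<in> K") (auto simp: \<phi>_def)
  have main: "(\<integral>x. F x \<bullet> \<phi>' n x \<partial>lborel) + (\<integral>x. h x * \<phi> n x \<partial>lborel) \<le> 0" for n
    by (rule weak_inequality_C1[OF \<Omega> F h ineq C\<phi> \<phi>_ge K(1,2)]) (auto simp: \<phi>_def K(3))
  obtain A where A: "A \<ge> 0" "\<And>x. x \<in> K \<Longrightarrow> norm (F x) \<le> A * norm (g x) powr (m - 1)"
    using Fg[OF K(1,2)] by blast
  define FK where "FK x = indicator K x *\<^sub>R F x" for x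
  define hK where "hK x = indicator K x *\<^sub>R h x" for x
  define X where "X x = norm (gt x)" for x
  \<comment> \<open>Off K the constant a is substituted, so that the compositions with G and G' are
    Borel and bounded on the whole space; the factors \<psi>, \<open>FK\<close> and
    \<open>hK\<close> vanish where the change was made.\<close>
  define uK where "uK x = (if x \<in> K then u x else a)" for x
  define unK where "unK n x = (if x \<in> K then un n x else a)" for n x
  have iF: "integrable lborel FK" and ih: "integrable lborel hK"
    unfolding FK_def hK_def using F[OF K(1,2)] h[OF K(1,2)] by auto
  have [measurable]: "\<psi> \<in> borel_measurable borel" "\<psi>' \<in> borel_measurable borel"
    "un n \<in> borel_measurable borel" "dn n \<in> borel_measurable borel" "gt \<in> borel_measurable borel"
    "ut \<in> borel_measurable borel" "FK \<in> borel_measurable borel" "hK \<in> borel_measurable borel"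
    "\<eta> n \<in> borel_measurable borel" for n
    using c\<psi> C1_grad_continuous'[OF Cn] C1_grad_continuous[OF Cn] ig iu iF ih mollifierD(6)[OF mo]
    by (auto intro: borel_measurable_continuous_onI)
  have uK_eq: "uK x = (if x \<in> K then ut x else a)" for x using KK by (auto simp: uK_def ut_def)
  have [measurable]: "uK \<in> borel_measurable borel" "unK n \<in> borel_measurable borel" for n
    unfolding uK_eq unK_def by measurable
  have uK_ab: "uK x \<in> {a..b}" "unK n x \<in> {a..b}" if "K \<noteq> {}" for n x
  proof -
    have "a \<le> b" using un_ab \<open>K \<noteq> {}\<close> by fastforce
    then show "uK x \<in> {a..b}" "unK n x \<in> {a..b}" using un_ab[of x n] ab(2)[of x] KK[of x] by (auto simp: uK_def unK_def)
  qed
  have pos: "uK x > 0" "unK n x > 0" for x n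
    using un_ab[of x n] ab u(2)[of x] K(2) by (auto simp: uK_def unK_def)
  have G_meas: "(\<lambda>x. G (v x)) \<in> borel_measurable borel" "(\<lambda>x. G' (v x)) \<in> borel_measurable borel"
    if [measurable]: "v \<in> borel_measurable borel" and v: "\<And>x. v x > 0" for v :: "'a \<Rightarrow> real"
  proof -
    have 1: "(\<lambda>t. indicator {0<..} t *\<^sub>R G t) \<in> borel_measurable borel" "(\<lambda>t. indicator {0<..} t *\<^sub>R G' t) \<in> borel_measurable borel"
      by (intro borel_measurable_continuous_on_indicator G_cont G(2); simp)+
    have "(\<lambda>x. G (v x)) = (\<lambda>x. indicator {0<..} (v x) *\<^sub>R G (v x))" "(\<lambda>x. G' (v x)) = (\<lambda>x. indicator {0<..} (v x) *\<^sub>R G' (v x))"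
      using v by auto
    then show "(\<lambda>x. G (v x)) \<in> borel_measurable borel" "(\<lambda>x. G' (v x)) \<in> borel_measurable borel"
      using measurable_compose[OF that(1) 1(1)] measurable_compose[OF that(1) 1(2)] by simp_all
  qed
  have Gm [measurable]: "(\<lambda>x. G (uK x)) \<in> borel_measurable borel" "(\<lambda>x. G' (uK x)) \<in> borel_measurable borel"
    "(\<lambda>x. G (unK n x)) \<in> borel_measurable borel" "(\<lambda>x. G' (unK n x)) \<in> borel_measurable borel" for n
    by (auto intro!: G_meas pos)
  have lim: "(\<lambda>n. unK n x) \<longlonglongrightarrow> uK x" for x
    using un_lim[of x] by (cases "x \<in> K") (auto simp: unK_def uK_def)
  have limG: "(\<lambda>n. G (unK n x)) \<longlonglongrightarrow> G (uK x)" "(\<lambda>n. G' (unK n x)) \<longlonglongrightarrow> G' (uK x)" for x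
    using G_cont G(2) pos(1)[of x]
    by (auto intro!: isCont_tendsto_compose[OF _ lim] simp: continuous_on_eq_continuous_at)
  show ?thesis
  proof (cases "K = {}")
    case True
    then show ?thesis using K(3) \<psi>'0 by simp
  next
    case False
    note uK_ab = uK_ab[OF False]
    have B0: "B \<ge> 0" using B[OF uK_ab(1)[of undefined]] by (rule order.trans[OF abs_ge_zero])
    have X0: "X x \<ge> 0" and [measurable]: "X \<in> borel_measurable borel" for x
      unfolding X_def by (simp, measurable)
    have iXm: "integrable lborel (\<lambda>x. X x powr m)" unfolding X_def by (rule igm)
    have FX: "norm (FK x) \<le> A * X x powr (m - 1)" for x
      using A(2)[of x] A(1) KK[of x] by (cases "x \<in> K") (auto simp: FK_def X_def gt_def)
    have T1: "(\<lambda>n. \<integral>x. G (unK n x) * (FK x \<bullet> \<psi>' x) \<partial>lborel) \<longlonglongrightarrow> (\<integral>x. G (uK x) * (FK x \<bullet> \<psi>' x) \<partial>lborel)"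
    proof (rule integral_dominated_convergence[where w = "\<lambda>x. B * (norm (FK x) * P')"])
      show "AE x in lborel. norm (G (unK n x) * (FK x \<bullet> \<psi>' x)) \<le> B * (norm (FK x) * P')" for n
      proof (rule AE_I2)
        fix x
        have "\<bar>FK x \<bullet> \<psi>' x\<bar> \<le> norm (FK x) * P'"
          using Cauchy_Schwarz_ineq2[of "FK x" "\<psi>' x"] mult_left_mono[OF P'(2)[of x], of "norm (FK x)"] by simp
        then show "norm (G (unK n x) * (FK x \<bullet> \<psi>' x)) \<le> B * (norm (FK x) * P')"
          using mult_mono[OF B[OF uK_ab(2)[of n x]], of "\<bar>FK x \<bullet> \<psi>' x\<bar>" "norm (FK x) * P'"] B0 by (simp add: abs_mult)
      qed
    qed (use iF limG in \<open>auto intro!: tendsto_intros\<close>)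
    have T3: "(\<lambda>n. \<integral>x. hK x * (\<psi> x * G (unK n x)) \<partial>lborel) \<longlonglongrightarrow> (\<integral>x. hK x * (\<psi> x * G (uK x)) \<partial>lborel)"
    proof (rule integral_dominated_convergence[where w = "\<lambda>x. norm (hK x) * (P * B)"])
      show "AE x in lborel. norm (hK x * (\<psi> x * G (unK n x))) \<le> norm (hK x) * (P * B)" for n
        unfolding norm_mult using B[OF uK_ab(2)] P by (intro AE_I2 mult_left_mono mult_mono) auto
    qed (use ih limG in \<open>auto intro!: tendsto_intros\<close>)
    have iFg: "integrable lborel (\<lambda>x. norm (FK x) * norm (gt x))"
    proof (rule Bochner_Integration.integrable_bound[of _ "\<lambda>x. A * X x powr m"])
      show "AE x in lborel. norm (norm (FK x) * norm (gt x)) \<le> norm (A * X x powr m)"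
      proof (rule AE_I2)
        fix x
        have "norm (FK x) * norm (gt x) \<le> A * X x powr (m - 1) * X x"
          unfolding X_def[symmetric] using FX[of x] X0[of x] by (intro mult_right_mono) auto
        also have "\<dots> = A * X x powr m" using X0[of x] by (cases "X x = 0") (auto simp: powr_mult_base' powr_diff)
        finally show "norm (norm (FK x) * norm (gt x)) \<le> norm (A * X x powr m)" using A(1) by simp
      qed
    qed (use iXm in auto)
    have bG': "\<bar>\<psi> x * G' (unK n x)\<bar> \<le> P * B'" "\<bar>\<psi> x * G' (uK x)\<bar> \<le> P * B'" for n x
      unfolding abs_mult using B'[OF uK_ab(2)[of n x]] B'[OF uK_ab(1)[of x]] P by (auto intro!: mult_mono)
    have PB: "P * B' \<ge> 0" using bG'(2)[of undefined] by (rule order.trans[OF abs_ge_zero])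
    have T2: "(\<lambda>n. \<integral>x. \<psi> x * G' (unK n x) * (FK x \<bullet> gt x) \<partial>lborel) \<longlonglongrightarrow> (\<integral>x. \<psi> x * G' (uK x) * (FK x \<bullet> gt x) \<partial>lborel)"
    proof (rule integral_dominated_convergence[where w = "\<lambda>x. P * B' * (norm (FK x) * norm (gt x))"])
      show "AE x in lborel. norm (\<psi> x * G' (unK n x) * (FK x \<bullet> gt x)) \<le> P * B' * (norm (FK x) * norm (gt x))" for n
      proof (rule AE_I2)
        fix x
        show "norm (\<psi> x * G' (unK n x) * (FK x \<bullet> gt x)) \<le> P * B' * (norm (FK x) * norm (gt x))"
          using mult_mono[OF bG'(1)[of x n] Cauchy_Schwarz_ineq2[of "FK x" "gt x"]] PB by (simp add: abs_mult)
      qed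
    qed (use iFg limG in \<open>auto intro!: tendsto_intros\<close>)
    \<comment> \<open>The error of replacing the gradient of the mollified u by g. It is paired with
      a field of size |g|^(m-1), which is the weight X in
      \<open>mollify_weighted_tendsto\<close>.\<close>
    define E where "E n x = FK x \<bullet> (mollify (\<eta> n) gt x - gt x)" for n x
    have [measurable]: "E n \<in> borel_measurable borel" for n unfolding E_def by measurable
    have Ele: "\<bar>E n x\<bar> \<le> A * (X x powr (m - 1) * norm (mollify (\<eta> n) gt x - gt x))" for n x
      using Cauchy_Schwarz_ineq2[of "FK x" "mollify (\<eta> n) gt x - gt x"]
        mult_right_mono[OF FX[of x], of "norm (mollify (\<eta> n) gt x - gt x)"] by (simp add: E_def)
    define C where "C = P * B' * A + 1"
    have C: "C > 0" "C \<ge> P * B' * A" using PB A(1) by (auto simp: C_def add_nonneg_pos)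
    have nnE: "eventually (\<lambda>n. (\<integral>\<^sup>+x. ennreal (norm (\<psi> x * G' (unK n x) * E n x)) \<partial>lborel) \<le> ennreal r) sequentially"
      if r: "r > 0" for r
    proof -
      have "eventually (\<lambda>n. (\<integral>\<^sup>+x. ennreal (X x powr (m - 1) * norm (mollify (\<eta> n) gt x - gt x)) \<partial>lborel) \<le> ennreal (r / C)) sequentially"
        by (rule mollify_weighted_tendsto[OF mo e(1) ig igm _ X0 iXm m]) (use r C in auto)
      then show ?thesis
      proof eventually_elim
        case (elim n)
        have "(\<integral>\<^sup>+x. ennreal (norm (\<psi> x * G' (unK n x) * E n x)) \<partial>lborel)
          \<le> (\<integral>\<^sup>+x. ennreal C * ennreal (X x powr (m - 1) * norm (mollify (\<eta> n) gt x - gt x)) \<partial>lborel)"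
        proof (rule nn_integral_mono)
          fix x
          have "norm (\<psi> x * G' (unK n x) * E n x) \<le> (P * B') * (A * (X x powr (m - 1) * norm (mollify (\<eta> n) gt x - gt x)))"
            using mult_mono[OF bG'(1)[of x n] Ele[of n x]] PB by (simp add: abs_mult)
          also have "\<dots> = (P * B' * A) * (X x powr (m - 1) * norm (mollify (\<eta> n) gt x - gt x))" by simp
          also have "\<dots> \<le> C * (X x powr (m - 1) * norm (mollify (\<eta> n) gt x - gt x))"
            by (intro mult_right_mono C) auto
          finally show "ennreal (norm (\<psi> x * G' (unK n x) * E n x)) \<le> ennreal C * ennreal (X x powr (m - 1) * norm (mollify (\<eta> n) gt x - gt x))"
            using C(1) by (auto simp flip: ennreal_mult intro!: ennreal_leI)
        qed
        also have "\<dots> = ennreal C * (\<integral>\<^sup>+x. ennreal (X x powr (m - 1) * norm (mollify (\<eta> n) gt x - gt x)) \<partial>lborel)"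
          by (rule nn_integral_cmult) measurable
        also have "\<dots> \<le> ennreal C * ennreal (r / C)" by (intro mult_left_mono elim) auto
        also have "\<dots> = ennreal r" using C(1) r by (simp flip: ennreal_mult)
        finally show ?case .
      qed
    qed
    have iE: "eventually (\<lambda>n. integrable lborel (\<lambda>x. \<psi> x * G' (unK n x) * E n x)) sequentially"
      using nnE[OF zero_less_one]
    proof eventually_elim
      case (elim n)
      then show ?case by (intro integrableI_bounded) (auto intro: le_less_trans)
    qed
    have T4: "(\<lambda>n. \<integral>x. \<psi> x * G' (unK n x) * E n x \<partial>lborel) \<longlonglongrightarrow> 0"
    proof (rule tendstoI)
      fix r :: real assume r: "r > 0"
      have "eventually (\<lambda>n. (\<integral>\<^sup>+x. ennreal (norm (\<psi> x * G' (unK n x) * E n x)) \<partial>lborel) \<le> ennreal (r / 2)) sequentially"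
        by (rule nnE) (use r in auto)
      then show "eventually (\<lambda>n. dist (\<integral>x. \<psi> x * G' (unK n x) * E n x \<partial>lborel) 0 < r) sequentially"
      proof eventually_elim
        case (elim n)
        have "ennreal (norm (\<integral>x. \<psi> x * G' (unK n x) * E n x \<partial>lborel)) \<le> ennreal (r / 2)"
          by (rule order.trans[OF norm_integral_le_nn_integral elim])
        then show ?case using r by (simp add: dist_norm ennreal_le_iff)
      qed
    qed
    let ?S = "\<lambda>n. (\<integral>x. G (unK n x) * (FK x \<bullet> \<psi>' x) \<partial>lborel) +
        ((\<integral>x. \<psi> x * G' (unK n x) * (FK x \<bullet> gt x) \<partial>lborel) + (\<integral>x. \<psi> x * G' (unK n x) * E n x \<partial>lborel))
        + (\<integral>x. hK x * (\<psi> x * G (unK n x)) \<partial>lborel)"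
    have L: "?S \<longlonglongrightarrow> (\<integral>x. G (uK x) * (FK x \<bullet> \<psi>' x) \<partial>lborel) + ((\<integral>x. \<psi> x * G' (uK x) * (FK x \<bullet> gt x) \<partial>lborel) + 0)
      + (\<integral>x. hK x * (\<psi> x * G (uK x)) \<partial>lborel)"
      by (intro tendsto_add T1 T2 T3 T4)
    have ev: "eventually (\<lambda>n. ?S n \<le> 0) sequentially"
      using iE
    proof eventually_elim
      case (elim n)
      have i1: "integrable lborel (\<lambda>x. G (unK n x) * (FK x \<bullet> \<psi>' x))"
      proof (rule Bochner_Integration.integrable_bound[where f = "\<lambda>x. B * (norm (FK x) * P')"])
        show "AE x in lborel. norm (G (unK n x) * (FK x \<bullet> \<psi>' x)) \<le> norm (B * (norm (FK x) * P'))"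
        proof (rule AE_I2)
          fix x
          have "\<bar>FK x \<bullet> \<psi>' x\<bar> \<le> norm (FK x) * P'"
            using Cauchy_Schwarz_ineq2[of "FK x" "\<psi>' x"] mult_left_mono[OF P'(2)[of x], of "norm (FK x)"] by simp
          then have "norm (G (unK n x) * (FK x \<bullet> \<psi>' x)) \<le> B * (norm (FK x) * P')"
            using mult_mono[OF B[OF uK_ab(2)[of n x]], of "\<bar>FK x \<bullet> \<psi>' x\<bar>" "norm (FK x) * P'"] B0 by (simp add: abs_mult)
          then show "norm (G (unK n x) * (FK x \<bullet> \<psi>' x)) \<le> norm (B * (norm (FK x) * P'))"
            by (simp add: order.trans[OF _ abs_ge_self])
        qed
      qed (use iF in auto)
      have i2: "integrable lborel (\<lambda>x. \<psi> x * G' (unK n x) * (FK x \<bullet> gt x))"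
      proof (rule Bochner_Integration.integrable_bound[where f = "\<lambda>x. P * B' * (norm (FK x) * norm (gt x))"])
        show "AE x in lborel. norm (\<psi> x * G' (unK n x) * (FK x \<bullet> gt x)) \<le> norm (P * B' * (norm (FK x) * norm (gt x)))"
        proof (rule AE_I2)
          fix x
          have "norm (\<psi> x * G' (unK n x) * (FK x \<bullet> gt x)) \<le> P * B' * (norm (FK x) * norm (gt x))"
            using mult_mono[OF bG'(1)[of x n] Cauchy_Schwarz_ineq2[of "FK x" "gt x"]] PB by (simp add: abs_mult)
          then show "norm (\<psi> x * G' (unK n x) * (FK x \<bullet> gt x)) \<le> norm (P * B' * (norm (FK x) * norm (gt x)))"
            by (rule order.trans) simp
        qed
      qed (use iFg in auto)
      have "(\<integral>x. F x \<bullet> \<phi>' n x \<partial>lborel) = (\<integral>x. G (unK n x) * (FK x \<bullet> \<psi>' x) +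
          (\<psi> x * G' (unK n x) * (FK x \<bullet> gt x) + \<psi> x * G' (unK n x) * E n x) \<partial>lborel)"
      proof (rule Bochner_Integration.integral_cong)
        fix x
        show "F x \<bullet> \<phi>' n x = G (unK n x) * (FK x \<bullet> \<psi>' x) +
          (\<psi> x * G' (unK n x) * (FK x \<bullet> gt x) + \<psi> x * G' (unK n x) * E n x)"
        proof (cases "x \<in> K")
          case True
          then show ?thesis
            by (simp add: \<phi>'_def FK_def unK_def E_def dn_eq inner_add_right inner_diff_right algebra_simps)
        next
          case False
          then show ?thesis by (simp add: \<phi>'_def FK_def K(3) \<psi>'0)
        qed
      qed simp
      also have "\<dots> = (\<integral>x. G (unK n x) * (FK x \<bullet> \<psi>' x) \<partial>lborel) +
        ((\<integral>x. \<psi> x * G' (unK n x) * (FK x \<bullet> gt x) \<partial>lborel) + (\<integral>x. \<psi> x * G' (unK n x) * E n x \<partial>lborel))"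
        using i1 i2 elim by (simp add: Bochner_Integration.integral_add Bochner_Integration.integrable_add)
      finally have 1: "(\<integral>x. F x \<bullet> \<phi>' n x \<partial>lborel) = \<dots>" .
      have 2: "(\<integral>x. h x * \<phi> n x \<partial>lborel) = (\<integral>x. hK x * (\<psi> x * G (unK n x)) \<partial>lborel)"
        by (rule Bochner_Integration.integral_cong) (auto simp: \<phi>_def hK_def unK_def indicator_def K(3))
      show ?case using main[of n] unfolding 1 2 by simp
    qed
    have "(\<integral>x. G (uK x) * (FK x \<bullet> \<psi>' x) \<partial>lborel) + ((\<integral>x. \<psi> x * G' (uK x) * (FK x \<bullet> gt x) \<partial>lborel) + 0)
      + (\<integral>x. hK x * (\<psi> x * G (uK x)) \<partial>lborel) \<le> 0"
      by (rule tendsto_upperbound[OF L ev]) simp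
    moreover have "(\<integral>x. G (uK x) * (FK x \<bullet> \<psi>' x) \<partial>lborel) = (\<integral>x. G (u x) * (F x \<bullet> \<psi>' x) \<partial>lborel)"
      by (rule Bochner_Integration.integral_cong) (auto simp: FK_def uK_def indicator_def \<psi>'0)
    moreover have "(\<integral>x. \<psi> x * G' (uK x) * (FK x \<bullet> gt x) \<partial>lborel) = (\<integral>x. \<psi> x * G' (u x) * (F x \<bullet> g x) \<partial>lborel)"
      by (rule Bochner_Integration.integral_cong) (auto simp: FK_def gt_def uK_def indicator_def K(3) KK)
    moreover have "(\<integral>x. hK x * (\<psi> x * G (uK x)) \<partial>lborel) = (\<integral>x. h x * (\<psi> x * G (u x)) \<partial>lborel)"
      by (rule Bochner_Integration.integral_cong) (auto simp: hK_def uK_def indicator_def K(3))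
    ultimately show ?thesis by simp
  qed
qed

subsection \<open>Cutoff functions on annuli\<close>

definition smooth_step :: "real \<Rightarrow> real" where
  "smooth_step t = flat 1 t / (flat 1 t + flat 1 (1 - t))"

definition smooth_step' :: "real \<Rightarrow> real" where
  "smooth_step' t = (flat (flat_deriv 1) t * flat 1 (1 - t) + flat 1 t * flat (flat_deriv 1) (1 - t))
     / (flat 1 t + flat 1 (1 - t))\<^sup>2"

lemma smooth_step_denom_pos: "flat 1 t + flat 1 (1 - t) > 0"
  by (auto simp: flat_def intro!: add_pos_pos)

lemma flat_1_nonneg: "flat 1 t \<ge> 0" "flat (flat_deriv 1) t \<ge> 0"
  by (auto simp: flat_def flat_deriv_def)

lemma DERIV_smooth_step: "(smooth_step has_real_derivative smooth_step' t) (at t)"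
proof -
  have 1: "(flat 1 has_real_derivative flat (flat_deriv 1) t) (at t)" by (rule DERIV_flat)
  have 2: "((\<lambda>t. flat 1 (1 - t)) has_real_derivative flat (flat_deriv 1) (1 - t) * (- 1)) (at t)"
    by (rule DERIV_chain2[OF DERIV_flat]) (auto intro!: derivative_eq_intros)
  show ?thesis unfolding smooth_step_def
    by (rule DERIV_cong[OF DERIV_divide[OF 1 DERIV_add[OF 1 2]]])
      (use smooth_step_denom_pos[of t] in \<open>auto simp: smooth_step'_def power2_eq_square algebra_simps\<close>)
qed

lemma smooth_step_props:
  "smooth_step t \<in> {0..1}" "t \<le> 0 \<Longrightarrow> smooth_step t = 0" "t \<ge> 1 \<Longrightarrow> smooth_step t = 1"
  "t > 0 \<Longrightarrow> smooth_step t > 0" "smooth_step' t \<ge> 0"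
  "t \<le> 0 \<Longrightarrow> smooth_step' t = 0" "t \<ge> 1 \<Longrightarrow> smooth_step' t = 0"
  using smooth_step_denom_pos[of t] flat_1_nonneg[of t] flat_1_nonneg[of "1 - t"]
  by (auto simp: smooth_step_def smooth_step'_def field_simps) (auto simp: flat_def)

lemma continuous_smooth_step': "continuous_on UNIV smooth_step'"
proof -
  have c: "continuous_on UNIV (flat P)" for P
    using DERIV_flat by (auto intro!: continuous_at_imp_continuous_on DERIV_isCont)
  show ?thesis unfolding smooth_step'_def
    using smooth_step_denom_pos
    by (intro continuous_intros c continuous_on_compose2[OF c]) (auto simp: less_imp_neq[symmetric])
qed

lemma smooth_step'_bounded: obtains c where "c > 0" "\<And>t. smooth_step' t \<le> c"
proof -
  have "continuous_on {0..1} smooth_step'" using continuous_smooth_step' by (rule continuous_on_subset) simp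
  from continuous_attains_sup[OF _ _ this] obtain t0
    where t0: "\<And>t. t \<in> {0..1} \<Longrightarrow> smooth_step' t \<le> smooth_step' t0" by fastforce
  have "smooth_step' t \<le> smooth_step' t0 + 1" for t
    using t0[of t] smooth_step_props(5)[of t0] smooth_step_props(6,7)[of t] by (cases "t \<in> {0..1}") auto
  moreover have "smooth_step' t0 + 1 > 0" using smooth_step_props(5)[of t0] by simp
  ultimately show thesis using that by blast
qed

definition annulus :: "real \<Rightarrow> real \<Rightarrow> 'a::real_normed_vector set" where
  "annulus a b = {x. a \<le> norm x \<and> norm x \<le> b}"

lemma mem_annulus [simp]: "x \<in> annulus a b \<longleftrightarrow> a \<le> norm x \<and> norm x \<le> b"
  by (simp add: annulus_def)

lemma compact_annulus [simp, intro]: "compact (annulus a b :: 'a::euclidean_space set)"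
proof -
  have "closed (annulus a b :: 'a set)"
    unfolding annulus_def by (intro closed_Collect_conj closed_Collect_le continuous_intros)
  moreover have "annulus a b \<subseteq> cball (0::'a) b" by (auto simp: annulus_def)
  ultimately show ?thesis by (metis bounded_cball bounded_subset compact_eq_bounded_closed)
qed

lemma borel_annulus [measurable]: "annulus a b \<in> sets (borel :: 'a::euclidean_space measure)"
  by (rule borel_compact) simp

text \<open>The gradient bound is recorded separately for the inner and the outer shell: \<rho> will
  tend to 0 while R stays fixed, and the bound c / \<rho> would spoil the outer contribution. The
  constant c is meant to be the same for all radii.\<close>

definition annulus_cutoff :: "real \<Rightarrow> real \<Rightarrow> real \<Rightarrow> ('a::euclidean_space \<Rightarrow> real) \<Rightarrow> ('a \<Rightarrow> 'a) \<Rightarrow> bool" where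
  "annulus_cutoff c \<rho> R \<zeta> \<zeta>' \<longleftrightarrow> C1_grad \<zeta> \<zeta>' \<and> (\<forall>x. \<zeta> x \<in> {0..1}) \<and>
     (\<forall>x\<in>annulus (2 * \<rho>) R. \<zeta> x = 1) \<and> (\<forall>x. x \<notin> annulus \<rho> (2 * R) \<longrightarrow> \<zeta> x = 0) \<and>
     (\<forall>x. x \<notin> annulus \<rho> (2 * \<rho>) \<union> annulus R (2 * R) \<longrightarrow> \<zeta>' x = 0) \<and>
     (\<forall>x. norm (\<zeta>' x) \<le> c / \<rho>) \<and> (\<forall>x. 2 * \<rho> < norm x \<longrightarrow> norm (\<zeta>' x) \<le> c / R)"

text \<open>\<open>p\<close> rises from 0 at \<open>norm x = \<rho>\<close> to 1 at
  \<open>norm x = 2 * \<rho>\<close>, which explains the divisor 3 = 4 - 1; the squared norm keeps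
  it smooth at the origin.\<close>

lemma radial_step:
  assumes \<rho>: "\<rho> > 0" and c: "\<And>t. smooth_step' t \<le> c"
  defines "p \<equiv> \<lambda>x::'a::euclidean_space. (x \<bullet> x / \<rho>\<^sup>2 - 1) / 3"
  shows "C1_grad (\<lambda>x. smooth_step (p x)) (\<lambda>x. (smooth_step' (p x) * (2 / (3 * \<rho>\<^sup>2))) *\<^sub>R x)"
    "norm x \<le> \<rho> \<Longrightarrow> p x \<le> 0" "2 * \<rho> \<le> norm x \<Longrightarrow> p x \<ge> 1"
    "norm ((smooth_step' (p x) * (2 / (3 * \<rho>\<^sup>2))) *\<^sub>R x) \<le> 4 * c / 3 / \<rho>"
proof -
  have c0: "c \<ge> 0" using c[of 0] smooth_step_props(5)[of 0] by simp
  show 1: "norm x \<le> \<rho> \<Longrightarrow> p x \<le> 0" for x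
    using power_mono[of "norm x" \<rho> 2] \<rho> by (simp add: p_def dot_square_norm)
  show 2: "2 * \<rho> \<le> norm x \<Longrightarrow> p x \<ge> 1" for x
    using power_mono[of "2 * \<rho>" "norm x" 2] \<rho> by (simp add: p_def dot_square_norm field_simps)
  show "norm ((smooth_step' (p x) * (2 / (3 * \<rho>\<^sup>2))) *\<^sub>R x) \<le> 4 * c / 3 / \<rho>"
  proof (cases "norm x \<le> 2 * \<rho>")
    case True
    have "norm ((smooth_step' (p x) * (2 / (3 * \<rho>\<^sup>2))) *\<^sub>R x) = smooth_step' (p x) * (2 / (3 * \<rho>\<^sup>2)) * norm x"
      using smooth_step_props(5)[of "p x"] by (simp add: abs_mult)
    also have "\<dots> \<le> c * (2 / (3 * \<rho>\<^sup>2)) * (2 * \<rho>)"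
      using True c[of "p x"] c0 smooth_step_props(5)[of "p x"] by (intro mult_mono) auto
    also have "\<dots> = 4 * c / 3 / \<rho>" using \<rho> by (simp add: power2_eq_square field_simps)
    finally show ?thesis .
  next
    case False
    then have "smooth_step' (p x) = 0" by (intro smooth_step_props(7) 2) simp
    then show ?thesis using c0 \<rho> by simp
  qed
  show "C1_grad (\<lambda>x. smooth_step (p x)) (\<lambda>x. (smooth_step' (p x) * (2 / (3 * \<rho>\<^sup>2))) *\<^sub>R x)"
    unfolding C1_grad_def
  proof (intro conjI allI)
    fix x :: 'a
    have "(p has_derivative (\<lambda>v. (2 / (3 * \<rho>\<^sup>2)) * (x \<bullet> v))) (at x)"
    proof -
      have "p = (\<lambda>x. (1 / (3 * \<rho>\<^sup>2)) * (x \<bullet> x) - 1 / 3)" by (auto simp: p_def field_simps)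
      moreover have "((\<lambda>x. k * (x \<bullet> x) - 1 / 3) has_derivative (\<lambda>v. (2 * k) * (x \<bullet> v))) (at x)" for k :: real
        by (auto intro!: derivative_eq_intros simp: inner_commute)
      from this[of "1 / (3 * \<rho>\<^sup>2)"] have "((\<lambda>x. (1 / (3 * \<rho>\<^sup>2)) * (x \<bullet> x) - 1 / 3) has_derivative (\<lambda>v. (2 / (3 * \<rho>\<^sup>2)) * (x \<bullet> v))) (at x)"
        by simp
      ultimately show ?thesis by simp
    qed
    from has_derivative_compose[OF this DERIV_smooth_step[unfolded has_field_derivative_def]]
    show "((\<lambda>x. smooth_step (p x)) has_derivative (\<lambda>v. ((smooth_step' (p x) * (2 / (3 * \<rho>\<^sup>2))) *\<^sub>R x) \<bullet> v)) (at x)"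
      by (simp add: mult.assoc)
    have "continuous_on UNIV p" unfolding p_def using \<rho> by (intro continuous_intros) auto
    then show "continuous_on UNIV (\<lambda>x. (smooth_step' (p x) * (2 / (3 * \<rho>\<^sup>2))) *\<^sub>R x)"
      using \<rho> by (intro continuous_intros continuous_on_compose2[OF continuous_smooth_step']) auto
  qed
qed

lemma annulus_cutoff_exists:
  obtains c where "c > 0" "\<And>\<rho> R. 0 < \<rho> \<Longrightarrow> 2 * \<rho> \<le> R \<Longrightarrow>
    \<exists>(\<zeta> :: 'a::euclidean_space \<Rightarrow> real) \<zeta>'. annulus_cutoff c \<rho> R \<zeta> \<zeta>'"
proof -
  obtain c where c: "c > 0" "\<And>t. smooth_step' t \<le> c" using smooth_step'_bounded by blast
  have "\<exists>(\<zeta> :: 'a \<Rightarrow> real) \<zeta>'. annulus_cutoff (4 * c / 3) \<rho> R \<zeta> \<zeta>'" if \<rho>: "0 < \<rho>" "2 * \<rho> \<le> R" for \<rho> R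
  proof -
    have R: "R > 0" using \<rho> by simp
    define p where "p r x = ((x::'a) \<bullet> x / r\<^sup>2 - 1) / 3" for r :: real and x
    define P where "P r x = smooth_step (p r x)" for r x
    define P' where "P' r x = (smooth_step' (p r x) * (2 / (3 * r\<^sup>2))) *\<^sub>R x" for r x
    have C: "C1_grad (P r) (P' r)" and n: "norm (P' r x) \<le> 4 * c / 3 / r" and
      lo: "norm x \<le> r \<Longrightarrow> P r x = 0 \<and> P' r x = 0" and hi: "2 * r \<le> norm x \<Longrightarrow> P r x = 1 \<and> P' r x = 0"
      if "r > 0" for r x
    proof -
      note r = radial_step[OF that c(2)]
      show "C1_grad (P r) (P' r)" using r(1) unfolding P_def P'_def p_def .
      show "norm (P' r x) \<le> 4 * c / 3 / r" using r(4)[of x] unfolding P'_def p_def .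
      show "P r x = 0 \<and> P' r x = 0" if "norm x \<le> r"
      proof -
        have "p r x \<le> 0" using r(2)[OF that] unfolding p_def .
        then show ?thesis by (simp add: P_def P'_def smooth_step_props)
      qed
      show "P r x = 1 \<and> P' r x = 0" if "2 * r \<le> norm x"
      proof -
        have "1 \<le> p r x" using r(3)[OF that] unfolding p_def .
        then show ?thesis by (simp add: P_def P'_def smooth_step_props)
      qed
    qed
    have C2: "C1_grad (\<lambda>x. 1 - P R x) (\<lambda>x. - P' R x)"
      using C[OF R] unfolding C1_grad_def by (auto intro!: derivative_eq_intros continuous_intros)
    have P01: "P r x \<in> {0..1}" for r x unfolding P_def by (rule smooth_step_props)
    \<comment> \<open>Inner step times reversed outer step. Since \<open>2 * \<rho> \<le> R\<close>,
      wherever one factor varies the other equals 1, so the two gradient bounds do not mix.\<close>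
    let ?\<zeta> = "\<lambda>x. P \<rho> x * (1 - P R x)" and ?\<zeta>' = "\<lambda>x. P \<rho> x *\<^sub>R (- P' R x) + (1 - P R x) *\<^sub>R P' \<rho> x"
    have bound: "norm (?\<zeta>' x) \<le> 4 * c / 3 / \<rho>" "2 * \<rho> < norm x \<Longrightarrow> norm (?\<zeta>' x) \<le> 4 * c / 3 / R" for x
    proof -
      have le: "4 * c / 3 / R \<le> 4 * c / 3 / \<rho>" using \<rho> c(1) by (intro divide_left_mono) auto
      have l: "norm (?\<zeta>' x) \<le> 4 * c / 3 / \<rho>" if "norm x \<le> 2 * \<rho>"
      proof -
        have "P R x = 0 \<and> P' R x = 0" using lo[OF R, of x] that \<rho> by auto
        then show ?thesis using n[OF \<rho>(1), of x] by simp
      qed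
      have h: "norm (?\<zeta>' x) \<le> 4 * c / 3 / R" if "2 * \<rho> < norm x"
        using hi[OF \<rho>(1), of x] that n[OF R, of x] by simp
      show "norm (?\<zeta>' x) \<le> 4 * c / 3 / \<rho>" using l h le by linarith
      show "2 * \<rho> < norm x \<Longrightarrow> norm (?\<zeta>' x) \<le> 4 * c / 3 / R" by (rule h)
    qed
    have "annulus_cutoff (4 * c / 3) \<rho> R ?\<zeta> ?\<zeta>'"
      unfolding annulus_cutoff_def
    proof (intro conjI allI ballI impI bound)
      show "C1_grad ?\<zeta> ?\<zeta>'" by (rule C1_grad_mult[OF C[OF \<rho>(1)] C2])
      fix x
      show "?\<zeta> x \<in> {0..1}" using P01[of \<rho> x] P01[of R x] by (auto intro: mult_le_one)
      show "?\<zeta> x = 1" if "x \<in> annulus (2 * \<rho>) R" using hi[OF \<rho>(1), of x] lo[OF R, of x] that by simp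
      show "?\<zeta> x = 0" if "x \<notin> annulus \<rho> (2 * R)" using lo[OF \<rho>(1), of x] hi[OF R, of x] that by auto
      show "?\<zeta>' x = 0" if "x \<notin> annulus \<rho> (2 * \<rho>) \<union> annulus R (2 * R)"
        using lo[OF \<rho>(1), of x] hi[OF \<rho>(1), of x] lo[OF R, of x] hi[OF R, of x] that \<rho> by force
    qed auto
    then show ?thesis by blast
  qed
  then show thesis using that[of "4 * c / 3"] c(1) by simp
qed

subsection \<open>Energy and flux estimates\<close>

lemma norm_flux: "norm (flux \<alpha> m g x) = norm x powr (- \<alpha>) * norm (g x) powr (m - 1)"
  by (cases "g x = 0") (auto simp: flux_def powr_mult_base' powr_diff powr_add[symmetric] power2_eq_square field_simps)

lemma flux_inner: "m > 1 \<Longrightarrow> flux \<alpha> m g x \<bullet> g x = norm x powr (- \<alpha>) * norm (g x) powr m"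
  by (cases "g x = 0") (auto simp: flux_def dot_square_norm powr_diff power2_eq_square powr_numeral)

lemma C1_grad_power:
  assumes "C1_grad f f'"
  shows "C1_grad (\<lambda>x. f x ^ n) (\<lambda>x. (real n * f x ^ (n - 1)) *\<^sub>R f' x)"
  unfolding C1_grad_def
proof (intro conjI allI)
  fix x
  show "((\<lambda>x. f x ^ n) has_derivative (\<lambda>v. ((real n * f x ^ (n - 1)) *\<^sub>R f' x) \<bullet> v)) (at x)"
    by (rule has_derivative_eq_rhs[OF has_derivative_power[OF C1_grad_derivative[OF assms]]]) (auto simp: mult_ac)
  show "continuous_on UNIV (\<lambda>x. (real n * f x ^ (n - 1)) *\<^sub>R f' x)"
    using C1_grad_continuous'[OF assms] C1_grad_continuous[OF assms] by (intro continuous_intros)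
qed

lemma measure_annulus_le:
  assumes "b \<ge> 0"
  shows "measure lborel (annulus a b :: 'a::euclidean_space set) \<le> unit_ball_vol (real DIM('a)) * b powr real DIM('a)"
    and "emeasure lborel (annulus a b :: 'a set) < \<infinity>"
proof -
  have sub: "annulus a b \<subseteq> cball (0::'a) b" by auto
  have fin: "emeasure lborel (cball (0::'a) b) < \<infinity>" by (rule emeasure_lborel_cball_finite)
  have "measure lborel (annulus a b :: 'a set) \<le> measure lborel (cball (0::'a) b)"
    by (rule measure_mono_fmeasurable[OF sub]) (use fin in \<open>auto simp: fmeasurable_def\<close>)
  also have "\<dots> = unit_ball_vol (real DIM('a)) * b ^ DIM('a)" by (rule content_cball[OF assms])
  also have "b ^ DIM('a) = b powr real DIM('a)" using assms by (cases "b = 0") (auto simp: powr_realpow)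
  finally show "measure lborel (annulus a b :: 'a set) \<le> unit_ball_vol (real DIM('a)) * b powr real DIM('a)" .
  show "emeasure lborel (annulus a b :: 'a set) < \<infinity>"
    using emeasure_mono[OF sub, of lborel] fin by (auto intro: le_less_trans)
qed

text \<open>Splitting at the threshold T takes the place of Hoelder's inequality on shells: a lower
  power is paid for by a constant and a multiple of a higher power, with both coefficients explicit
  in T.\<close>

lemma powr_le_scaled:
  fixes u T a b :: real
  assumes "u > 0" "T > 0" "0 \<le> a" "a \<le> b"
  shows "u powr a \<le> T powr a + T powr (a - b) * u powr b"
proof (cases "u \<le> T")
  case True
  then have "u powr a \<le> T powr a" using assms by (intro powr_mono2) auto
  then show ?thesis using assms by (simp add: add_increasing2)
next
  case False
  have "u powr a = u powr (a - b) * u powr b" by (simp add: powr_add[symmetric])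
  also have "\<dots> \<le> T powr (a - b) * u powr b"
    using False assms by (intro mult_right_mono powr_mono2') auto
  finally show ?thesis by (simp add: add_increasing)
qed

text \<open>What the necessity argument retains of a solution: h stands for the right-hand side and
  its nonlocal origin is forgotten. The assumption \<open>test\<close> is the weak inequality
  already extended to test functions \<psi> times G of u. Positivity of u everywhere is arranged by
  altering it off the punctured ball.\<close>

locale weak_sol =
  fixes m \<alpha> :: real and u h :: "'a::euclidean_space \<Rightarrow> real" and g :: "'a \<Rightarrow> 'a"
  assumes m: "m > 1" and \<alpha>: "\<alpha> > 0"
    and u_cont: "continuous_on (ball 0 1 - {0}) u" and u_pos: "\<And>x. u x > 0"
    and meas [measurable]: "u \<in> borel_measurable borel" "g \<in> borel_measurable borel" "h \<in> borel_measurable borel"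
    and h_pos: "\<And>x. x \<in> ball 0 1 - {0} \<Longrightarrow> h x > 0" and h_nonneg: "\<And>x. h x \<ge> 0"
    and h_int: "\<And>a b. 0 < a \<Longrightarrow> b < 1 \<Longrightarrow> integrable lborel (\<lambda>x. indicator (annulus a b) x * h x)"
    and g_int: "\<And>a b. 0 < a \<Longrightarrow> b < 1 \<Longrightarrow> integrable lborel (\<lambda>x. indicator (annulus a b) x * norm (g x) powr m)"
    and test: "\<And>\<psi> \<psi>' a b G G'. C1_grad \<psi> \<psi>' \<Longrightarrow> (\<And>x. \<psi> x \<ge> 0) \<Longrightarrow> 0 < a \<Longrightarrow> b < 1 \<Longrightarrow>
        (\<And>x. x \<notin> annulus a b \<Longrightarrow> \<psi> x = 0) \<Longrightarrow>
        (\<And>t. t > 0 \<Longrightarrow> (G has_real_derivative G' t) (at t)) \<Longrightarrow> continuous_on {0<..} G' \<Longrightarrow> (\<And>t. t > 0 \<Longrightarrow> G t \<ge> 0) \<Longrightarrow>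
        (\<integral>x. G (u x) * (flux \<alpha> m g x \<bullet> \<psi>' x) \<partial>lborel) + (\<integral>x. \<psi> x * G' (u x) * (flux \<alpha> m g x \<bullet> g x) \<partial>lborel)
        + (\<integral>x. h x * (\<psi> x * G (u x)) \<partial>lborel) \<le> 0"
begin

lemma annulus_sub: "0 < a \<Longrightarrow> b < 1 \<Longrightarrow> annulus a b \<subseteq> ball (0::'a) 1 - {0}"
  by auto

lemma bounded_weight_integrable:
  fixes f k :: "'a \<Rightarrow> real"
  assumes f: "integrable lborel (\<lambda>x. indicator (annulus a b) x * f x)"
    and [measurable]: "k \<in> borel_measurable borel"
    and B: "\<And>x. x \<in> annulus a b \<Longrightarrow> \<bar>k x\<bar> \<le> B" and 0: "\<And>x. x \<notin> annulus a b \<Longrightarrow> k x = 0"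
  shows "integrable lborel (\<lambda>x. k x * f x)"
proof -
  have "integrable lborel (\<lambda>x. k x *\<^sub>R (indicator (annulus a b) x * f x))"
  proof (rule integrable_bounded_scaleR[OF f])
    show "\<bar>k x\<bar> \<le> max B 0" for x
      using B[of x] 0[of x] by (cases "x \<in> annulus a b") (auto simp: le_max_iff_disj simp del: mem_annulus)
  qed measurable
  also have "(\<lambda>x. k x *\<^sub>R (indicator (annulus a b) x * f x)) = (\<lambda>x. k x * f x)"
    using 0 by (auto simp: fun_eq_iff indicator_def simp del: mem_annulus)
  finally show ?thesis .
qed

lemma u_powr_integrable:
  assumes "0 < a" "b < 1"
  shows "integrable lborel (\<lambda>x. indicator (annulus a b) x * u x powr s)"
proof -
  have "continuous_on (annulus a b) (\<lambda>x. u x powr s)"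
    using continuous_on_subset[OF u_cont annulus_sub[OF assms]] u_pos
    by (intro continuous_intros) (auto simp: less_imp_neq[symmetric])
  from borel_integrable_compact[OF compact_annulus this] show ?thesis by simp
qed

lemma u_powr_bounded:
  assumes "0 < a" "b < 1"
  obtains M where "M \<ge> 0" "\<And>x. x \<in> annulus a b \<Longrightarrow> u x powr s \<le> M"
proof -
  have "continuous_on (annulus a b) (\<lambda>x. u x powr s)"
    using continuous_on_subset[OF u_cont annulus_sub[OF assms]] u_pos
    by (intro continuous_intros) (auto simp: less_imp_neq[symmetric])
  from compact_continuous_image[OF this compact_annulus]
  obtain M where "\<forall>y\<in>(\<lambda>x. u x powr s) ` annulus a b. norm y \<le> M"
    using compact_imp_bounded bounded_iff by metis
  then have "u x powr s \<le> max M 0" if "x \<in> annulus a b" for x using that by (auto simp: le_max_iff_disj simp del: mem_annulus)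
  then show thesis using that[of "max M 0"] by simp
qed

lemma meas_flux [measurable]: "flux \<alpha> m g \<in> borel_measurable borel"
  unfolding flux_def by measurable

lemma annulus_integrable:
  assumes "b < 1" shows "integrable lborel (\<lambda>x::'a. indicator (annulus a b) x * (c :: real))"
proof -
  have "emeasure lborel (annulus a b :: 'a set) < \<infinity>"
    using measure_annulus_le(2)[of "max b 0" a, where 'a = 'a]
      emeasure_mono[of "annulus a b :: 'a set" "annulus a (max b 0)" lborel]
    by (force intro: le_less_trans simp: le_max_iff_disj)
  then show ?thesis by (intro integrable_mult_left) (auto simp: integrable_indicator_iff)
qed

lemma flux_integrable:
  assumes "0 < a" "b < 1"
  shows "integrable lborel (\<lambda>x. indicator (annulus a b) x * norm (flux \<alpha> m g x))"
proof (rule Bochner_Integration.integrable_bound)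
  \<comment> \<open>Where the gradient is below 1, its power m - 1 exceeds its power m; the summand
    1 covers these points.\<close>
  show "integrable lborel (\<lambda>x. a powr (- \<alpha>) * (indicator (annulus a b) x * 1 + indicator (annulus a b) x * norm (g x) powr m))"
    by (intro integrable_mult_right Bochner_Integration.integrable_add annulus_integrable g_int assms)
  show "AE x in lborel. norm (indicator (annulus a b) x * norm (flux \<alpha> m g x))
    \<le> norm (a powr (- \<alpha>) * (indicator (annulus a b) x * 1 + indicator (annulus a b) x * norm (g x) powr m))"
  proof (rule AE_I2)
    fix x :: 'a
    show "norm (indicator (annulus a b) x * norm (flux \<alpha> m g x))
      \<le> norm (a powr (- \<alpha>) * (indicator (annulus a b) x * 1 + indicator (annulus a b) x * norm (g x) powr m))"
    proof (cases "x \<in> annulus a b")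
      case True
      have "norm (g x) powr (m - 1) \<le> 1 + norm (g x) powr m"
        using powr_le_scaled[of "norm (g x)" 1 "m - 1" m] m by (cases "g x = 0") auto
      moreover have "norm x powr (- \<alpha>) \<le> a powr (- \<alpha>)" using True assms \<alpha> by (intro powr_mono2') auto
      ultimately have "norm x powr (- \<alpha>) * norm (g x) powr (m - 1) \<le> a powr (- \<alpha>) * (1 + norm (g x) powr m)"
        by (intro mult_mono) auto
      then show ?thesis using True by (simp add: norm_flux abs_of_nonneg)
    qed simp
  qed
qed measurable

definition energy_density :: "'a \<Rightarrow> real" where
  "energy_density x = norm x powr (- \<alpha>) * norm (g x) powr m"

lemma meas_energy_density [measurable]: "energy_density \<in> borel_measurable borel"
  unfolding energy_density_def by measurable

lemma energy_density_integrable: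
  assumes "0 < a" "b < 1"
  shows "integrable lborel (\<lambda>x. indicator (annulus a b) x * energy_density x)"
proof -
  have "integrable lborel (\<lambda>x. (indicator (annulus a b) x * norm x powr (- \<alpha>)) * norm (g x) powr m)"
  proof (rule bounded_weight_integrable[OF g_int[OF assms]])
    show "\<bar>indicator (annulus a b) x * norm x powr (- \<alpha>)\<bar> \<le> a powr (- \<alpha>)" if "x \<in> annulus a b" for x :: 'a
      using that assms \<alpha> by (auto intro!: powr_mono2')
  qed auto
  then show ?thesis by (simp add: energy_density_def mult.assoc)
qed

text \<open>Testing with \<zeta>^n u^k puts the factor k on the energy term. Young's inequality lets
  half of it absorb the term with the gradient of \<zeta> and leaves u^(m-1+k) \<zeta>^(n-m) times
  \<open>\<rho> powr (- \<alpha> - m)\<close>; \<open>real n \<ge> m\<close> keeps the remaining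
  power of the cutoff bounded.\<close>

lemma energy_estimate:
  fixes k c :: real and n :: nat
  assumes k: "k > 0" and n: "real n \<ge> m" and c: "c > 0"
  obtains C where "C > 0"
    "\<And>\<rho> R \<zeta> \<zeta>'. 0 < \<rho> \<Longrightarrow> 2 * \<rho> \<le> R \<Longrightarrow> 2 * R < 1 \<Longrightarrow> annulus_cutoff c \<rho> R \<zeta> \<zeta>' \<Longrightarrow>
       (\<integral>x. (\<zeta> x ^ n * u x powr (k - 1)) * energy_density x \<partial>lborel)
         \<le> C * \<rho> powr (- \<alpha> - m) * (\<integral>x. indicator (annulus \<rho> (2 * R)) x * (u x powr (m - 1 + k) * \<zeta> x powr (real n - m)) \<partial>lborel) \<and>
       (\<integral>x. (\<zeta> x ^ n * u x powr k) * h x \<partial>lborel)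
         \<le> C * \<rho> powr (- \<alpha> - m) * (\<integral>x. indicator (annulus \<rho> (2 * R)) x * (u x powr (m - 1 + k) * \<zeta> x powr (real n - m)) \<partial>lborel)"
proof -
  have n2: "n \<ge> 2" using n m by linarith
  \<comment> \<open>The coefficient that \<open>young_split\<close> with t = 1/2 leaves for the W of
    the pointwise bound below. The final C adds 2 / k times C1 for the energy integral, whose
    coefficient after absorption is k / 2.\<close>
  define C1 where "C1 = k * (1 / 2) powr (- (m - 1)) * (real n * c / k) powr m"
  have C1: "C1 > 0" using k c n2 by (simp add: C1_def)
  define C where "C = C1 + 2 / k * C1"
  have C: "C > 0" "C1 \<le> C" "2 / k * C1 \<le> C" using C1 k by (auto simp: C_def add_pos_pos)
  show thesis
  proof (rule that[OF C(1)])
    fix \<rho> R :: real and \<zeta> :: "'a \<Rightarrow> real" and \<zeta>'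
    assume \<rho>: "0 < \<rho>" "2 * \<rho> \<le> R" "2 * R < 1" and cut: "annulus_cutoff c \<rho> R \<zeta> \<zeta>'"
    let ?A = "annulus \<rho> (2 * R) :: 'a set"
    have \<zeta>: "C1_grad \<zeta> \<zeta>'" "\<And>x. 0 \<le> \<zeta> x" "\<And>x. \<zeta> x \<le> 1" "\<And>x. x \<notin> ?A \<Longrightarrow> \<zeta> x = 0"
      "\<And>x. norm (\<zeta>' x) \<le> c / \<rho>" using cut by (auto simp: annulus_cutoff_def)
    have [measurable]: "\<zeta> \<in> borel_measurable borel" "\<zeta>' \<in> borel_measurable borel"
      using C1_grad_continuous'[OF \<zeta>(1)] C1_grad_continuous[OF \<zeta>(1)] by (auto intro: borel_measurable_continuous_onI)
    define \<psi>' where "\<psi>' x = (real n * \<zeta> x ^ (n - 1)) *\<^sub>R \<zeta>' x" for x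
    have [measurable]: "\<psi>' \<in> borel_measurable borel" unfolding \<psi>'_def by measurable
    note A01 = \<rho>(1,3)
    have fold_ed: "flux \<alpha> m g x \<bullet> g x = energy_density x" for x
      using flux_inner[OF m] by (simp add: energy_density_def)
    have T: "(\<integral>x. u x powr k * (flux \<alpha> m g x \<bullet> \<psi>' x) \<partial>lborel) + (\<integral>x. \<zeta> x ^ n * (k * u x powr (k - 1)) * energy_density x \<partial>lborel)
        + (\<integral>x. h x * (\<zeta> x ^ n * u x powr k) \<partial>lborel) \<le> 0"
      unfolding fold_ed[symmetric] \<psi>'_def
    proof (rule test[of "\<lambda>x. \<zeta> x ^ n" _ \<rho> "2 * R" "\<lambda>t. t powr k"])
      show "C1_grad (\<lambda>x. \<zeta> x ^ n) (\<lambda>x. (real n * \<zeta> x ^ (n - 1)) *\<^sub>R \<zeta>' x)" by (rule C1_grad_power[OF \<zeta>(1)])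
      show "\<zeta> x ^ n = 0" if "x \<notin> ?A" for x using \<zeta>(4)[OF that] n2 by simp
      show "((\<lambda>t. t powr k) has_real_derivative k * t powr (k - 1)) (at t)" if "t > 0" for t
        using that by (auto intro!: derivative_eq_intros)
      show "continuous_on {0<..} (\<lambda>t. k * t powr (k - 1))" by (intro continuous_intros) auto
    qed (use \<zeta> \<rho> in auto)
    obtain M where M: "M \<ge> 0" "\<And>x. x \<in> ?A \<Longrightarrow> u x powr k \<le> M" using u_powr_bounded[OF A01] by blast
    obtain M' where M': "M' \<ge> 0" "\<And>x. x \<in> ?A \<Longrightarrow> u x powr (k - 1) \<le> M'" using u_powr_bounded[OF A01] by blast
    have \<zeta>n: "0 \<le> \<zeta> x ^ n" "\<zeta> x ^ n \<le> 1" "\<zeta> x ^ (n - 1) \<le> 1" "0 \<le> \<zeta> x ^ (n - 1)" for x using \<zeta>(2,3) by (auto intro: power_le_one)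
    have \<zeta>n0: "\<zeta> x ^ n = 0" "\<psi>' x = 0" if "x \<notin> ?A" for x using \<zeta>(4)[OF that] n2 by (auto simp: \<psi>'_def)
    have i2: "integrable lborel (\<lambda>x. (\<zeta> x ^ n * u x powr (k - 1)) * energy_density x)"
    proof (rule bounded_weight_integrable[OF energy_density_integrable[OF A01]])
      show "\<bar>\<zeta> x ^ n * u x powr (k - 1)\<bar> \<le> 1 * M'" if "x \<in> ?A" for x
        unfolding abs_mult using \<zeta>n[of x] M'(2)[OF that] by (intro mult_mono) auto
    qed (use \<zeta>n0 in auto)
    have i1: "integrable lborel (\<lambda>x. u x powr k * (flux \<alpha> m g x \<bullet> \<psi>' x))"
    proof (rule Bochner_Integration.integrable_bound)
      show "integrable lborel (\<lambda>x. (M * (real n * (c / \<rho>))) * (indicator ?A x * norm (flux \<alpha> m g x)))"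
        by (intro integrable_mult_right flux_integrable A01)
      show "AE x in lborel. norm (u x powr k * (flux \<alpha> m g x \<bullet> \<psi>' x)) \<le> norm ((M * (real n * (c / \<rho>))) * (indicator ?A x * norm (flux \<alpha> m g x)))"
      proof (rule AE_I2)
        fix x
        show "norm (u x powr k * (flux \<alpha> m g x \<bullet> \<psi>' x)) \<le> norm ((M * (real n * (c / \<rho>))) * (indicator ?A x * norm (flux \<alpha> m g x)))"
        proof (cases "x \<in> ?A")
          case True
          have "norm (\<psi>' x) = real n * \<zeta> x ^ (n - 1) * norm (\<zeta>' x)" using \<zeta>n[of x] by (simp add: \<psi>'_def)
          also have "\<dots> \<le> real n * 1 * (c / \<rho>)" using \<zeta>n[of x] \<zeta>(5)[of x] by (intro mult_mono) auto
          finally have p: "norm (\<psi>' x) \<le> real n * (c / \<rho>)" by simp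
          have "\<bar>flux \<alpha> m g x \<bullet> \<psi>' x\<bar> \<le> norm (flux \<alpha> m g x) * norm (\<psi>' x)" by (rule Cauchy_Schwarz_ineq2)
          also have "\<dots> \<le> norm (flux \<alpha> m g x) * (real n * (c / \<rho>))" by (intro mult_left_mono p) auto
          finally have "\<bar>u x powr k\<bar> * \<bar>flux \<alpha> m g x \<bullet> \<psi>' x\<bar> \<le> M * (norm (flux \<alpha> m g x) * (real n * (c / \<rho>)))"
            using M(2)[OF True] M(1) by (intro mult_mono) auto
          then show ?thesis using True M(1) c \<rho> by (simp add: abs_mult mult_ac)
        next
          case False
          then show ?thesis using \<zeta>n0[OF False] by simp
        qed
      qed
    qed measurable
    define y where "y x = indicator ?A x * (u x powr (m - 1 + k) * \<zeta> x powr (real n - m))" for x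
    have iy: "integrable lborel y"
    proof -
      have "integrable lborel (\<lambda>x. (indicator ?A x * \<zeta> x powr (real n - m)) * u x powr (m - 1 + k))"
      proof (rule bounded_weight_integrable[OF u_powr_integrable[OF A01]])
        show "\<bar>indicator ?A x * \<zeta> x powr (real n - m)\<bar> \<le> 1" if "x \<in> ?A" for x
          using that \<zeta>(2,3)[of x] n powr_mono2[of "real n - m" "\<zeta> x" 1] by auto
      qed auto
      then show ?thesis unfolding y_def by (simp add: mult_ac)
    qed
    have y0: "y x \<ge> 0" for x by (simp add: y_def)
    have pw: "- (u x powr k * (flux \<alpha> m g x \<bullet> \<psi>' x)) \<le> (k / 2) * ((\<zeta> x ^ n * u x powr (k - 1)) * energy_density x)
        + C1 * \<rho> powr (- \<alpha> - m) * y x" for x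
    proof (cases "\<zeta> x = 0")
      case True
      then have "\<psi>' x = 0" using n2 by (simp add: \<psi>'_def)
      then show ?thesis using k C1 y0[of x] \<zeta>n[of x] by (auto intro!: add_nonneg_nonneg mult_nonneg_nonneg simp: energy_density_def)
    next
      case False
      then have z: "\<zeta> x > 0" using \<zeta>(2)[of x] by simp
      have xA: "x \<in> ?A" using False \<zeta>(4) by blast
      define X where "X = norm (g x)"
      define U where "U = u x"
      define Z where "Z = \<zeta> x"
      have pos: "X \<ge> 0" "U > 0" "Z > 0" using u_pos z by (auto simp: X_def U_def Z_def)
      \<comment> \<open>Normalised so that the gradient term carries the same weight
        \<open>k * (U powr (k - 1) * Z ^ n)\<close> as the energy term: differentiating the cutoff
        costs one power of Z, and u^k has one power of U more than u^(k-1).\<close>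
      define W where "W = (real n * c / k) * (U / (\<rho> * Z))"
      have W: "W \<ge> 0" using pos k c \<rho> by (simp add: W_def)
      have Wm: "W powr m = (real n * c / k) powr m * (U powr m * \<rho> powr (- m) * Z powr (- m))"
        unfolding W_def using pos k c \<rho> by (simp add: powr_mult powr_divide powr_minus_divide)
      have "\<bar>flux \<alpha> m g x \<bullet> \<psi>' x\<bar> \<le> norm (flux \<alpha> m g x) * norm (\<psi>' x)" by (rule Cauchy_Schwarz_ineq2)
      also have "\<dots> \<le> (norm x powr (- \<alpha>) * X powr (m - 1)) * (real n * Z ^ (n - 1) * (c / \<rho>))"
      proof -
        have "norm (\<psi>' x) = (real n * Z ^ (n - 1)) * norm (\<zeta>' x)" using pos by (simp add: \<psi>'_def Z_def)
        also have "\<dots> \<le> (real n * Z ^ (n - 1)) * (c / \<rho>)" using \<zeta>(5)[of x] pos by (intro mult_left_mono) auto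
        finally show ?thesis unfolding norm_flux X_def by (intro mult_left_mono) auto
      qed
      finally have "- (u x powr k * (flux \<alpha> m g x \<bullet> \<psi>' x))
          \<le> U powr k * ((norm x powr (- \<alpha>) * X powr (m - 1)) * (real n * Z ^ (n - 1) * (c / \<rho>)))"
        unfolding U_def mult_minus_right[symmetric] by (intro mult_left_mono) auto
      also have "\<dots> = norm x powr (- \<alpha>) * (k * (U powr (k - 1) * Z ^ n)) * (X powr (m - 1) * W)"
      proof -
        have "U powr k = U powr (k - 1) * U" using pos by (simp add: powr_diff)
        moreover have "Z ^ n = Z ^ (n - 1) * Z" using n2 by (metis One_nat_def Suc_pred less_le_trans pos2 power_Suc2)
        ultimately show ?thesis using pos k \<rho> by (simp add: W_def field_simps)
      qed
      also have "\<dots> \<le> norm x powr (- \<alpha>) * (k * (U powr (k - 1) * Z ^ n)) * ((1/2) * X powr m + (1/2) powr (- (m - 1)) * W powr m)"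
        using young_split[OF pos(1) W, of "1/2" m] m k pos by (intro mult_left_mono) auto
      also have "\<dots> = (k / 2) * ((Z ^ n * U powr (k - 1)) * (norm x powr (- \<alpha>) * X powr m))
          + norm x powr (- \<alpha>) * (C1 * \<rho> powr (- m) * (U powr (k - 1) * U powr m * (Z ^ n * Z powr (- m))))"
        unfolding Wm C1_def by (simp add: algebra_simps)
      also have "U powr (k - 1) * U powr m * (Z ^ n * Z powr (- m)) = y x"
        using xA pos by (simp add: y_def U_def[symmetric] Z_def[symmetric] powr_add[symmetric] powr_realpow[symmetric] algebra_simps)
      also have "norm x powr (- \<alpha>) * (C1 * \<rho> powr (- m) * y x) \<le> \<rho> powr (- \<alpha>) * (C1 * \<rho> powr (- m) * y x)"
        using xA \<rho> \<alpha> C1 y0[of x] by (intro mult_right_mono powr_mono2') auto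
      also have "\<rho> powr (- \<alpha>) * (C1 * \<rho> powr (- m) * y x) = C1 * \<rho> powr (- \<alpha> - m) * y x"
        using \<rho> by (simp add: powr_diff powr_minus field_simps)
      finally show ?thesis by (simp add: energy_density_def X_def U_def Z_def)
    qed
    let ?I2 = "\<integral>x. (\<zeta> x ^ n * u x powr (k - 1)) * energy_density x \<partial>lborel"
    let ?I3 = "\<integral>x. (\<zeta> x ^ n * u x powr k) * h x \<partial>lborel"
    let ?Y = "\<rho> powr (- \<alpha> - m) * (\<integral>x. y x \<partial>lborel)"
    have "- (\<integral>x. u x powr k * (flux \<alpha> m g x \<bullet> \<psi>' x) \<partial>lborel)
        \<le> (\<integral>x. (k / 2) * ((\<zeta> x ^ n * u x powr (k - 1)) * energy_density x) + C1 * \<rho> powr (- \<alpha> - m) * y x \<partial>lborel)"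
      unfolding integral_minus[symmetric] by (rule integral_mono) (use i1 i2 iy pw in auto)
    also have "\<dots> = (k / 2) * ?I2 + C1 * ?Y"
      using i2 iy by (subst Bochner_Integration.integral_add) (auto simp: mult.assoc)
    finally have "- (\<integral>x. u x powr k * (flux \<alpha> m g x \<bullet> \<psi>' x) \<partial>lborel) \<le> (k / 2) * ?I2 + C1 * ?Y" .
    moreover have "(\<integral>x. \<zeta> x ^ n * (k * u x powr (k - 1)) * energy_density x \<partial>lborel) = k * ?I2"
      by (subst integral_mult_right_zero[symmetric]) (simp add: mult_ac)
    moreover have "(\<integral>x. h x * (\<zeta> x ^ n * u x powr k) \<partial>lborel) = ?I3" by (simp add: mult_ac)
    ultimately have E: "(k / 2) * ?I2 + ?I3 \<le> C1 * ?Y" using T by simp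
    have I2: "?I2 \<ge> 0" and I3: "?I3 \<ge> 0" and Y: "?Y \<ge> 0"
      using \<zeta>n h_nonneg y0 by (auto intro!: integral_nonneg mult_nonneg_nonneg simp: energy_density_def)
    have "(k / 2) * ?I2 \<le> C1 * ?Y" using E I3 by simp
    then have "?I2 \<le> (2 / k * C1) * ?Y" using k by (simp add: field_simps)
    also have "\<dots> \<le> C * ?Y" by (rule mult_right_mono[OF C(3) Y])
    finally have r1: "?I2 \<le> C * ?Y" .
    have "?I3 \<le> C1 * ?Y" using E I2 k mult_nonneg_nonneg[of "k / 2" ?I2] by linarith
    also have "\<dots> \<le> C * ?Y" by (rule mult_right_mono[OF C(2) Y])
    finally have r2: "?I3 \<le> C * ?Y" .
    show "?I2 \<le> C * \<rho> powr (- \<alpha> - m) * (\<integral>x. indicator (annulus \<rho> (2 * R)) x * (u x powr (m - 1 + k) * \<zeta> x powr (real n - m)) \<partial>lborel) \<and>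
       ?I3 \<le> C * \<rho> powr (- \<alpha> - m) * (\<integral>x. indicator (annulus \<rho> (2 * R)) x * (u x powr (m - 1 + k) * \<zeta> x powr (real n - m)) \<partial>lborel)"
      using r1 r2 unfolding y_def by (simp add: mult.assoc)
  qed
qed

text \<open>T is the typical size of u: the hypothesis bounds the integral of u^s, s = m - 1 + k, by
  \<rho>^N T^s. The conclusion is the flux of a function with gradient of size T / \<rho>, namely
  \<rho>^(N-\<alpha>) (T / \<rho>)^(m-1). Young's inequality trades the flux for the energy and a
  power of u with exponent at most s.\<close>

lemma flux_estimate:
  fixes k L :: real
  assumes k: "0 < k" "k \<le> 1" and L: "L \<ge> 2"
  obtains C where "C \<ge> 0"
    "\<And>\<rho> T. 0 < \<rho> \<Longrightarrow> 2 * (L * \<rho>) < 1 \<Longrightarrow> 0 < T \<Longrightarrow>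
       (\<integral>x. indicator (annulus \<rho> (2 * (L * \<rho>))) x * u x powr (m - 1 + k) \<partial>lborel) \<le> \<rho> powr real DIM('a) * T powr (m - 1 + k) \<Longrightarrow>
       (\<integral>x. indicator (annulus (2 * \<rho>) (L * \<rho>)) x * norm (flux \<alpha> m g x) \<partial>lborel)
         \<le> C * \<rho> powr (real DIM('a) + 1 - \<alpha> - m) * T powr (m - 1)"
proof -
  let ?N = "real DIM('a)" and ?s = "m - 1 + k"
  obtain c where c: "c > 0" "\<And>\<rho> R. 0 < \<rho> \<Longrightarrow> 2 * \<rho> \<le> R \<Longrightarrow> \<exists>(\<zeta> :: 'a \<Rightarrow> real) \<zeta>'. annulus_cutoff c \<rho> R \<zeta> \<zeta>'"
    using annulus_cutoff_exists by blast
  obtain n :: nat where n: "real n \<ge> m" using real_arch_simple by blast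
  obtain C where C: "C > 0" and C2: "\<And>\<rho> R \<zeta> \<zeta>'. 0 < \<rho> \<Longrightarrow> 2 * \<rho> \<le> R \<Longrightarrow> 2 * R < 1 \<Longrightarrow> annulus_cutoff c \<rho> R \<zeta> \<zeta>' \<Longrightarrow>
       (\<integral>x. (\<zeta> x ^ n * u x powr (k - 1)) * energy_density x \<partial>lborel)
         \<le> C * \<rho> powr (- \<alpha> - m) * (\<integral>x. indicator (annulus \<rho> (2 * R)) x * (u x powr (m - 1 + k) * \<zeta> x powr (real n - m)) \<partial>lborel) \<and>
       (\<integral>x. (\<zeta> x ^ n * u x powr k) * h x \<partial>lborel)
         \<le> C * \<rho> powr (- \<alpha> - m) * (\<integral>x. indicator (annulus \<rho> (2 * R)) x * (u x powr (m - 1 + k) * \<zeta> x powr (real n - m)) \<partial>lborel)"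
    by (rule energy_estimate[OF k(1) n c(1)], rule that)
  define V where "V = unit_ball_vol ?N * (2 * L) powr ?N"
  have V: "V \<ge> 0" by (simp add: V_def)
  show thesis
  proof (rule that[of "C + V + 1"])
    show "C + V + 1 \<ge> 0" using C(1) V by simp
    fix \<rho> T :: real
    assume \<rho>: "0 < \<rho>" "2 * (L * \<rho>) < 1" and T: "0 < T"
      and Y: "(\<integral>x. indicator (annulus \<rho> (2 * (L * \<rho>))) x * u x powr ?s \<partial>lborel) \<le> \<rho> powr ?N * T powr ?s"
    define R where "R = L * \<rho>"
    have R: "2 * \<rho> \<le> R" "2 * R < 1" using \<rho> L by (auto simp: R_def)
    obtain \<zeta> :: "'a \<Rightarrow> real" and \<zeta>' where cut: "annulus_cutoff c \<rho> R \<zeta> \<zeta>'" using c(2)[OF \<rho>(1) R(1)] by blast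
    let ?A = "annulus \<rho> (2 * R) :: 'a set" and ?A' = "annulus (2 * \<rho>) R :: 'a set"
    have \<zeta>: "C1_grad \<zeta> \<zeta>'" "\<And>x. 0 \<le> \<zeta> x" "\<And>x. \<zeta> x \<le> 1" "\<And>x. x \<notin> ?A \<Longrightarrow> \<zeta> x = 0"
      "\<And>x. x \<in> ?A' \<Longrightarrow> \<zeta> x = 1" using cut by (auto simp: annulus_cutoff_def)
    have [measurable]: "\<zeta> \<in> borel_measurable borel"
      using C1_grad_continuous'[OF \<zeta>(1)] by (auto intro: borel_measurable_continuous_onI)
    define y where "y x = indicator ?A x * u x powr ?s" for x
    have iy: "integrable lborel y" unfolding y_def by (rule u_powr_integrable[OF \<rho>(1) R(2)])
    have Yle: "(\<integral>x. y x \<partial>lborel) \<le> \<rho> powr ?N * T powr ?s" using Y by (simp add: y_def R_def)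
    let ?E = "\<lambda>x. (\<zeta> x ^ n * u x powr (k - 1)) * energy_density x"
    have iE: "integrable lborel ?E"
    proof -
      obtain M' where M': "M' \<ge> 0" "\<And>x. x \<in> ?A \<Longrightarrow> u x powr (k - 1) \<le> M'" using u_powr_bounded[OF \<rho>(1) R(2)] by blast
      show ?thesis
      proof (rule bounded_weight_integrable[OF energy_density_integrable[OF \<rho>(1) R(2)]])
        show "\<bar>\<zeta> x ^ n * u x powr (k - 1)\<bar> \<le> 1 * M'" if "x \<in> ?A" for x
          unfolding abs_mult using \<zeta>(2,3)[of x] M'(2)[OF that] by (intro mult_mono) (auto intro: power_le_one)
        have "n > 0" using n m by (cases n) auto
        then show "\<zeta> x ^ n * u x powr (k - 1) = 0" if "x \<notin> ?A" for x using \<zeta>(4)[OF that] by simp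
      qed auto
    qed
    have "(\<integral>x. indicator ?A x * (u x powr ?s * \<zeta> x powr (real n - m)) \<partial>lborel) \<le> (\<integral>x. y x \<partial>lborel)"
    proof (rule integral_mono')
      show "integrable lborel y" by (rule iy)
      fix x
      have "\<zeta> x powr (real n - m) \<le> 1" using \<zeta>(2,3)[of x] n powr_mono2[of "real n - m" "\<zeta> x" 1] by simp
      then show "indicator ?A x * (u x powr ?s * \<zeta> x powr (real n - m)) \<le> y x"
        unfolding y_def by (intro mult_left_mono mult_left_le) auto
      show "0 \<le> y x" by (simp add: y_def)
    qed
    then have "C * \<rho> powr (- \<alpha> - m) * (\<integral>x. indicator ?A x * (u x powr ?s * \<zeta> x powr (real n - m)) \<partial>lborel)
       \<le> C * \<rho> powr (- \<alpha> - m) * (\<rho> powr ?N * T powr ?s)"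
      using C(1) Yle by (intro mult_left_mono) auto
    with C2[OF \<rho>(1) R cut, THEN conjunct1] have EI: "(\<integral>x. ?E x \<partial>lborel) \<le> C * \<rho> powr (- \<alpha> - m) * (\<rho> powr ?N * T powr ?s)"
      by (rule order.trans)
    \<comment> \<open>This choice gives the energy part and the remainder the same order in \<rho>
      and T; both come out as \<rho>^(N+1-\<alpha>-m) T^(m-1).\<close>
    define t where "t = \<rho> * T powr (- k)"
    have t: "t > 0" using \<rho> T by (simp add: t_def)
    \<comment> \<open>The exponent of u left over when \<open>X powr (m - 1)\<close> is written as
      \<open>U powr (k - 1)\<close> times \<open>X powr (m - 1) * U powr (1 - k)\<close> and split
      by Young's inequality; \<open>k \<le> 1\<close> makes it nonnegative.\<close>
    define s' where "s' = (1 - k) * (m - 1)"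
    have "s' = (m - 1) - k * (m - 1)" by (simp add: s'_def algebra_simps)
    moreover have "0 \<le> k * (m - 1)" using k m by simp
    ultimately have "s' \<le> ?s" using k by linarith
    moreover have "0 \<le> s'" using k m by (simp add: s'_def)
    ultimately have s': "0 \<le> s'" "s' \<le> ?s" by auto
    define D where "D = t powr (- (m - 1)) * \<rho> powr (- \<alpha>)"
    have D: "D \<ge> 0" by (simp add: D_def)
    have pw: "indicator ?A' x * norm (flux \<alpha> m g x) \<le> t * ?E x + D * (indicator ?A x * T powr s' + T powr (s' - ?s) * y x)" for x
    proof (cases "x \<in> ?A'")
      case True
      have xA: "x \<in> ?A" using True \<rho> R by auto
      define X where "X = norm (g x)"
      define U where "U = u x"
      have pos: "X \<ge> 0" "U > 0" using u_pos by (auto simp: X_def U_def)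
      have "X powr (m - 1) = U powr (k - 1) * (X powr (m - 1) * U powr (1 - k))"
        using pos by (simp add: powr_add[symmetric] mult.left_commute)
      also have "\<dots> \<le> U powr (k - 1) * (t * X powr m + t powr (- (m - 1)) * (U powr (1 - k)) powr m)"
        using young_split[OF pos(1) _ t m, of "U powr (1 - k)"] by (intro mult_left_mono) auto
      also have "\<dots> = t * (U powr (k - 1) * X powr m) + t powr (- (m - 1)) * U powr s'"
        using pos by (simp add: s'_def powr_powr powr_add[symmetric] algebra_simps)
      finally have 1: "X powr (m - 1) \<le> t * (U powr (k - 1) * X powr m) + t powr (- (m - 1)) * U powr s'" .
      have "norm (flux \<alpha> m g x) \<le> norm x powr (- \<alpha>) * (t * (U powr (k - 1) * X powr m) + t powr (- (m - 1)) * U powr s')"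
        unfolding norm_flux X_def[symmetric] by (intro mult_left_mono 1) auto
      also have "\<dots> = t * ?E x + t powr (- (m - 1)) * (norm x powr (- \<alpha>) * U powr s')"
        using \<zeta>(5)[OF True] by (simp add: energy_density_def X_def U_def algebra_simps)
      also have "norm x powr (- \<alpha>) * U powr s' \<le> \<rho> powr (- \<alpha>) * (T powr s' + T powr (s' - ?s) * U powr ?s)"
        using xA \<rho> \<alpha> powr_le_scaled[OF pos(2) T s'] by (intro mult_mono powr_mono2') auto
      finally show ?thesis using True xA t by (simp add: D_def y_def U_def mult.assoc)
    next
      case False
      then show ?thesis using t D \<zeta>(2)[of x] by (auto simp: y_def energy_density_def intro!: add_nonneg_nonneg mult_nonneg_nonneg)
    qed
    have iA: "integrable lborel (\<lambda>x. indicator ?A x * T powr s')" by (rule annulus_integrable[OF R(2)])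
    have "(\<integral>x. indicator ?A' x * norm (flux \<alpha> m g x) \<partial>lborel)
        \<le> (\<integral>x. t * ?E x + D * (indicator ?A x * T powr s' + T powr (s' - ?s) * y x) \<partial>lborel)"
    proof (rule integral_mono'[OF _ pw])
      fix x
      show "0 \<le> t * ?E x + D * (indicator ?A x * T powr s' + T powr (s' - ?s) * y x)"
        by (rule order.trans[OF _ pw]) simp
    qed (use iE iy iA in auto)
    also have "\<dots> = t * (\<integral>x. ?E x \<partial>lborel) + D * (measure lborel ?A * T powr s' + T powr (s' - ?s) * (\<integral>x. y x \<partial>lborel))"
      using iE iy iA by (subst Bochner_Integration.integral_add) auto
    also have "\<dots> \<le> t * (C * \<rho> powr (- \<alpha> - m) * (\<rho> powr ?N * T powr ?s)) + D * ((V * \<rho> powr ?N) * T powr s' + T powr (s' - ?s) * (\<rho> powr ?N * T powr ?s))"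
    proof (intro add_mono mult_left_mono mult_right_mono EI Yle)
      have "measure lborel ?A \<le> unit_ball_vol ?N * (2 * R) powr ?N"
        using \<rho> R by (intro measure_annulus_le) auto
      also have "\<dots> = V * \<rho> powr ?N" using \<rho> L by (simp add: V_def R_def powr_mult mult.assoc)
      finally show "measure lborel ?A \<le> V * \<rho> powr ?N" .
    qed (use t D in auto)
    also have "\<dots> = (C + V + 1) * \<rho> powr (?N + 1 - \<alpha> - m) * T powr (m - 1)"
    proof -
      have 1: "t * (\<rho> powr (- \<alpha> - m) * (\<rho> powr ?N * T powr ?s)) = \<rho> powr (?N + 1 - \<alpha> - m) * T powr (m - 1)"
      proof -
        have "t = \<rho> powr 1 * T powr (- k)" using \<rho> by (simp add: t_def)
        then have "t * (\<rho> powr (- \<alpha> - m) * (\<rho> powr ?N * T powr ?s))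
           = (\<rho> powr 1 * \<rho> powr (- \<alpha> - m) * \<rho> powr ?N) * (T powr (- k) * T powr ?s)" by simp
        also have "\<dots> = \<rho> powr (?N + 1 - \<alpha> - m) * T powr (m - 1)"
          unfolding powr_add[symmetric] by (simp add: algebra_simps)
        finally show ?thesis .
      qed
      have 2: "D * (\<rho> powr ?N * T powr s') = \<rho> powr (?N + 1 - \<alpha> - m) * T powr (m - 1)"
      proof -
        have "t powr (- (m - 1)) = \<rho> powr (- (m - 1)) * T powr (k * (m - 1))"
          using \<rho> T by (simp add: t_def powr_mult powr_powr right_diff_distrib)
        then have "D * (\<rho> powr ?N * T powr s') = (\<rho> powr (- (m - 1)) * \<rho> powr (- \<alpha>) * \<rho> powr ?N) * (T powr (k * (m - 1)) * T powr s')"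
          by (simp add: D_def)
        also have "\<dots> = \<rho> powr (?N + 1 - \<alpha> - m) * T powr (m - 1)"
          unfolding powr_add[symmetric] by (simp add: s'_def algebra_simps)
        finally show ?thesis .
      qed
      have 3: "T powr (s' - ?s) * (\<rho> powr ?N * T powr ?s) = \<rho> powr ?N * T powr s'"
        by (simp add: powr_add[symmetric] mult.left_commute)
      show ?thesis using 1 2 unfolding 3 by (simp add: distrib_left distrib_right mult.assoc mult.left_commute)
    qed
    finally show "(\<integral>x. indicator (annulus (2 * \<rho>) (L * \<rho>)) x * norm (flux \<alpha> m g x) \<partial>lborel)
         \<le> (C + V + 1) * \<rho> powr (?N + 1 - \<alpha> - m) * T powr (m - 1)" by (simp add: R_def)
  qed
qed

end

subsection \<open>Growth of singular solutions\<close>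

context weak_sol
begin

text \<open>Since G is nondecreasing, the energy term has a sign and is dropped. What remains bounds
  a mass of h by the fluxes through the two shells where the cutoff varies. G of u is kept in the
  outer term, so that it can be made to vanish there.\<close>

lemma cutoff_test:
  assumes \<rho>: "0 < \<rho>" "2 * \<rho> \<le> R" "2 * R < 1" and c: "c > 0" and cut: "annulus_cutoff c \<rho> R \<zeta> \<zeta>'"
    and G: "\<And>t. t > 0 \<Longrightarrow> (G has_real_derivative G' t) (at t)" "continuous_on {0<..} G'"
      "\<And>t. t > 0 \<Longrightarrow> 0 \<le> G t \<and> G t \<le> 1" "\<And>t. t > 0 \<Longrightarrow> 0 \<le> G' t"
  shows "integrable lborel (\<lambda>x. \<zeta> x * G (u x) * h x)"
    "(\<integral>x. \<zeta> x * G (u x) * h x \<partial>lborel) \<le> c / \<rho> * (\<integral>x. indicator (annulus \<rho> (2 * \<rho>)) x * norm (flux \<alpha> m g x) \<partial>lborel)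
      + c / R * (\<integral>x. indicator (annulus R (2 * R)) x * (G (u x) * norm (flux \<alpha> m g x)) \<partial>lborel)"
proof -
  have R: "R > 0" using \<rho> by simp
  have \<zeta>: "C1_grad \<zeta> \<zeta>'" "\<And>x. 0 \<le> \<zeta> x" "\<And>x. \<zeta> x \<le> 1" "\<And>x. x \<notin> annulus \<rho> (2 * R) \<Longrightarrow> \<zeta> x = 0"
    "\<And>x. norm (\<zeta>' x) \<le> c / \<rho>" "\<And>x. x \<notin> annulus \<rho> (2 * \<rho>) \<union> annulus R (2 * R) \<Longrightarrow> \<zeta>' x = 0"
    "\<And>x. 2 * \<rho> < norm x \<Longrightarrow> norm (\<zeta>' x) \<le> c / R" 
    using cut by (auto simp: annulus_cutoff_def simp del: mem_annulus Un_iff)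
  have [measurable]: "\<zeta> \<in> borel_measurable borel" "\<zeta>' \<in> borel_measurable borel"
    using C1_grad_continuous'[OF \<zeta>(1)] C1_grad_continuous[OF \<zeta>(1)] by (auto intro: borel_measurable_continuous_onI)
  have G_cont: "continuous_on {0<..} G" using G(1) by (auto intro!: continuous_at_imp_continuous_on DERIV_isCont)
  have [measurable]: "(\<lambda>x. G (u x)) \<in> borel_measurable borel"
  proof -
    have "(\<lambda>t. indicator {0<..} t *\<^sub>R G t) \<in> borel_measurable borel"
      by (intro borel_measurable_continuous_on_indicator G_cont) simp
    from measurable_compose[OF meas(1) this] show ?thesis using u_pos by simp
  qed
  show ih: "integrable lborel (\<lambda>x. \<zeta> x * G (u x) * h x)"
  proof (rule bounded_weight_integrable[OF h_int[OF \<rho>(1,3)]])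
    show "\<bar>\<zeta> x * G (u x)\<bar> \<le> 1 * 1" for x
      unfolding abs_mult using \<zeta>(2,3)[of x] G(3)[OF u_pos, of x] by (intro mult_mono) auto
  qed (use \<zeta>(4) in auto)
  have T: "(\<integral>x. G (u x) * (flux \<alpha> m g x \<bullet> \<zeta>' x) \<partial>lborel) + (\<integral>x. \<zeta> x * G' (u x) * (flux \<alpha> m g x \<bullet> g x) \<partial>lborel)
        + (\<integral>x. h x * (\<zeta> x * G (u x)) \<partial>lborel) \<le> 0"
    by (rule test[OF \<zeta>(1,2) \<rho>(1,3) \<zeta>(4) G(1,2)]) (use G(3) in auto)
  have I2: "(\<integral>x. \<zeta> x * G' (u x) * (flux \<alpha> m g x \<bullet> g x) \<partial>lborel) \<ge> 0"
    unfolding flux_inner[OF m] using \<zeta>(2) G(4)[OF u_pos] by (intro Bochner_Integration.integral_nonneg) auto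
  define f1 where "f1 x = indicator (annulus \<rho> (2 * \<rho>)) x * norm (flux \<alpha> m g x)" for x
  define f2 where "f2 x = indicator (annulus R (2 * R)) x * (G (u x) * norm (flux \<alpha> m g x))" for x
  have i1: "integrable lborel f1" unfolding f1_def by (rule flux_integrable) (use \<rho> in auto)
  have i2: "integrable lborel f2"
  proof -
    have "integrable lborel (\<lambda>x. (indicator (annulus R (2 * R)) x * G (u x)) * norm (flux \<alpha> m g x))"
    proof (rule bounded_weight_integrable[OF flux_integrable])
      show "\<bar>indicator (annulus R (2 * R)) x * G (u x)\<bar> \<le> 1" if "x \<in> annulus R (2 * R)" for x :: 'a
        using that G(3)[OF u_pos, of x] by auto
    qed (use R \<rho> in auto)
    then show ?thesis unfolding f2_def by (simp add: mult.assoc)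
  qed
  have f0: "f1 x \<ge> 0" "f2 x \<ge> 0" for x using G(3)[OF u_pos] by (auto simp: f1_def f2_def)
  have pw: "- (G (u x) * (flux \<alpha> m g x \<bullet> \<zeta>' x)) \<le> c / \<rho> * f1 x + c / R * f2 x" for x
  proof -
    have Gx: "0 \<le> G (u x)" "G (u x) \<le> 1" using G(3)[OF u_pos] by auto
    have "\<bar>flux \<alpha> m g x \<bullet> \<zeta>' x\<bar> \<le> norm (flux \<alpha> m g x) * norm (\<zeta>' x)" by (rule Cauchy_Schwarz_ineq2)
    then have "G (u x) * \<bar>flux \<alpha> m g x \<bullet> \<zeta>' x\<bar> \<le> G (u x) * (norm (flux \<alpha> m g x) * norm (\<zeta>' x))"
      using Gx by (intro mult_left_mono)
    then have 1: "- (G (u x) * (flux \<alpha> m g x \<bullet> \<zeta>' x)) \<le> G (u x) * norm (flux \<alpha> m g x) * norm (\<zeta>' x)"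
      using Gx abs_ge_minus_self[of "G (u x) * (flux \<alpha> m g x \<bullet> \<zeta>' x)"] by (simp add: abs_mult)
    consider "x \<in> annulus \<rho> (2 * \<rho>)" | "x \<notin> annulus \<rho> (2 * \<rho>)" "x \<in> annulus R (2 * R)" | "x \<notin> annulus \<rho> (2 * \<rho>) \<union> annulus R (2 * R)"
      by blast
    then have "G (u x) * norm (flux \<alpha> m g x) * norm (\<zeta>' x) \<le> c / \<rho> * f1 x + c / R * f2 x"
    proof cases
      case 1
      have "G (u x) * norm (flux \<alpha> m g x) * norm (\<zeta>' x) \<le> 1 * norm (flux \<alpha> m g x) * (c / \<rho>)"
        using Gx \<zeta>(5)[of x] by (intro mult_mono) auto
      also have "\<dots> = c / \<rho> * f1 x" using 1 by (simp add: f1_def)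
      also have "\<dots> \<le> c / \<rho> * f1 x + c / R * f2 x" using c R f0[of x] by simp
      finally show ?thesis .
    next
      case 2
      then have "2 * \<rho> < norm x" using \<rho> by auto
      then have "G (u x) * norm (flux \<alpha> m g x) * norm (\<zeta>' x) \<le> G (u x) * norm (flux \<alpha> m g x) * (c / R)"
        using Gx \<zeta>(7)[of x] by (intro mult_left_mono) auto
      also have "\<dots> = c / R * f2 x" using 2(2) by (simp add: f2_def)
      also have "\<dots> \<le> c / \<rho> * f1 x + c / R * f2 x" using c \<rho> f0[of x] by simp
      finally show ?thesis .
    next
      case 3
      then show ?thesis using \<zeta>(6)[OF 3] c \<rho> R f0[of x] by simp
    qed
    with 1 show ?thesis by linarith
  qed
  have "- (\<integral>x. G (u x) * (flux \<alpha> m g x \<bullet> \<zeta>' x) \<partial>lborel) \<le> (\<integral>x. c / \<rho> * f1 x + c / R * f2 x \<partial>lborel)"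
    unfolding integral_minus[symmetric]
    by (rule integral_mono'[OF _ pw]) (use i1 i2 f0 c \<rho> R in \<open>auto intro!: add_nonneg_nonneg\<close>)
  also have "\<dots> = c / \<rho> * (\<integral>x. f1 x \<partial>lborel) + c / R * (\<integral>x. f2 x \<partial>lborel)"
    using i1 i2 by (subst Bochner_Integration.integral_add) auto
  finally have "(\<integral>x. h x * (\<zeta> x * G (u x)) \<partial>lborel) \<le> c / \<rho> * (\<integral>x. f1 x \<partial>lborel) + c / R * (\<integral>x. f2 x \<partial>lborel)"
    using T I2 by linarith
  then show "(\<integral>x. \<zeta> x * G (u x) * h x \<partial>lborel) \<le> c / \<rho> * (\<integral>x. indicator (annulus \<rho> (2 * \<rho>)) x * norm (flux \<alpha> m g x) \<partial>lborel)
      + c / R * (\<integral>x. indicator (annulus R (2 * R)) x * (G (u x) * norm (flux \<alpha> m g x)) \<partial>lborel)"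
    unfolding f1_def f2_def by (simp add: mult_ac)
qed

text \<open>The radius 1/4 is that of the fixed outer cutoff, whose gradient lives on the shell from
  1/4 to 1/2.\<close>

definition bounded_near_0 :: bool where
  "bounded_near_0 \<longleftrightarrow> (\<exists>L. \<forall>x. x \<noteq> 0 \<and> norm x < 1 / 4 \<longrightarrow> u x \<le> L)"

text \<open>With \<open>T = \<kappa> * \<rho> powr (- \<sigma>)\<close> the relation between
  \<sigma> and m turns the power of \<rho> in \<open>flux_estimate\<close> into \<rho> itself.
  Divided by \<rho>, as a cutoff gradient does, the flux is at most a multiple of
  \<open>\<kappa> powr (m - 1)\<close>, uniformly in the radius.\<close>

lemma flux_small:
  assumes k: "0 < k" "k \<le> 1" and \<sigma>: "\<sigma> * (m - 1) = real DIM('a) - m - \<alpha>"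
  obtains C where "C \<ge> 0"
    "\<And>\<rho> \<kappa>. 0 < \<rho> \<Longrightarrow> 8 * \<rho> < 1 \<Longrightarrow> 0 < \<kappa> \<Longrightarrow>
       (\<integral>x. indicator (annulus \<rho> (8 * \<rho>)) x * u x powr (m - 1 + k) \<partial>lborel) \<le> \<kappa> powr (m - 1 + k) * \<rho> powr (real DIM('a) - \<sigma> * (m - 1 + k)) \<Longrightarrow>
       (\<integral>x. indicator (annulus (2 * \<rho>) (4 * \<rho>)) x * norm (flux \<alpha> m g x) \<partial>lborel) \<le> C * \<kappa> powr (m - 1) * \<rho>"
proof -
  let ?N = "real DIM('a)" and ?s = "m - 1 + k"
  obtain C where C: "C \<ge> 0" and C2:
    "\<And>\<rho> T. 0 < \<rho> \<Longrightarrow> 2 * (4 * \<rho>) < 1 \<Longrightarrow> 0 < T \<Longrightarrow>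
       (\<integral>x. indicator (annulus \<rho> (2 * (4 * \<rho>))) x * u x powr (m - 1 + k) \<partial>lborel) \<le> \<rho> powr real DIM('a) * T powr (m - 1 + k) \<Longrightarrow>
       (\<integral>x. indicator (annulus (2 * \<rho>) (4 * \<rho>)) x * norm (flux \<alpha> m g x) \<partial>lborel)
         \<le> C * \<rho> powr (real DIM('a) + 1 - \<alpha> - m) * T powr (m - 1)"
    by (rule flux_estimate[OF k, of 4], simp, rule that)
  show thesis
  proof (rule that[OF C])
    fix \<rho> \<kappa> :: real
    assume \<rho>: "0 < \<rho>" "8 * \<rho> < 1" and \<kappa>: "0 < \<kappa>"
      and Y: "(\<integral>x. indicator (annulus \<rho> (8 * \<rho>)) x * u x powr ?s \<partial>lborel) \<le> \<kappa> powr ?s * \<rho> powr (?N - \<sigma> * ?s)"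
    define T where "T = \<kappa> * \<rho> powr (- \<sigma>)"
    have T: "T > 0" using \<rho> \<kappa> by (simp add: T_def)
    have Tp: "T powr a = \<kappa> powr a * \<rho> powr (- (\<sigma> * a))" for a
      using \<rho> \<kappa> by (simp add: T_def powr_mult powr_powr)
    have "\<rho> powr ?N * T powr ?s = \<kappa> powr ?s * \<rho> powr (?N - \<sigma> * ?s)"
      unfolding Tp by (simp add: powr_diff powr_minus divide_inverse)
    then have "(\<integral>x. indicator (annulus \<rho> (2 * (4 * \<rho>))) x * u x powr ?s \<partial>lborel) \<le> \<rho> powr ?N * T powr ?s"
      using Y by simp
    from C2[OF \<rho>(1) _ T this] \<rho>
    have "(\<integral>x. indicator (annulus (2 * \<rho>) (4 * \<rho>)) x * norm (flux \<alpha> m g x) \<partial>lborel)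
        \<le> C * \<rho> powr (?N + 1 - \<alpha> - m) * T powr (m - 1)" by simp
    also have "\<dots> = C * \<kappa> powr (m - 1) * (\<rho> powr (?N + 1 - \<alpha> - m) * \<rho> powr (- (?N - m - \<alpha>)))"
      unfolding Tp \<sigma> by simp
    also have "\<rho> powr (?N + 1 - \<alpha> - m) * \<rho> powr (- (?N - m - \<alpha>)) = \<rho>"
      using \<rho> by (simp add: powr_add[symmetric])
    finally show "(\<integral>x. indicator (annulus (2 * \<rho>) (4 * \<rho>)) x * norm (flux \<alpha> m g x) \<partial>lborel) \<le> C * \<kappa> powr (m - 1) * \<rho>" .
  qed
qed

text \<open>If the bound failed for all constants, there would be arbitrarily small radii with flux
  as small as desired. Testing with a function of u that vanishes for u at most L removes the outer
  flux, so h has no mass where u exceeds L; as h is positive and u continuous, u stays below L near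
  0.\<close>

lemma singular_lower_bound:
  assumes k: "0 < k" "k \<le> 1" and \<sigma>: "\<sigma> * (m - 1) = real DIM('a) - m - \<alpha>" and sing: "\<not> bounded_near_0"
  obtains c r where "c > 0" "r > 0" "r \<le> 1 / 32"
    "\<And>\<rho>. 0 < \<rho> \<Longrightarrow> \<rho> < r \<Longrightarrow>
       c * \<rho> powr (real DIM('a) - \<sigma> * (m - 1 + k)) \<le> (\<integral>x. indicator (annulus \<rho> (8 * \<rho>)) x * u x powr (m - 1 + k) \<partial>lborel)"
proof (rule ccontr)
  let ?N = "real DIM('a)" and ?s = "m - 1 + k"
  let ?Y = "\<lambda>\<rho>. (\<integral>x. indicator (annulus \<rho> (8 * \<rho>)) x * u x powr ?s \<partial>lborel)"
  assume neg: "\<not> thesis"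
  note conc = that
  have seq: "\<exists>\<rho>. 0 < \<rho> \<and> \<rho> < r \<and> ?Y \<rho> < c * \<rho> powr (?N - \<sigma> * ?s)" if "c > 0" "r > 0" "r \<le> 1 / 32" for c r
  proof (rule ccontr)
    assume n: "\<not> (\<exists>\<rho>. 0 < \<rho> \<and> \<rho> < r \<and> ?Y \<rho> < c * \<rho> powr (?N - \<sigma> * ?s))"
    have thesis
    proof (rule conc[OF that])
      show "c * \<rho> powr (?N - \<sigma> * ?s) \<le> ?Y \<rho>" if "0 < \<rho>" "\<rho> < r" for \<rho>
        using n that by (meson not_le)
    qed
    with neg show False ..
  qed
  obtain c0 where c0: "c0 > 0" "\<And>\<rho> R. 0 < \<rho> \<Longrightarrow> 2 * \<rho> \<le> R \<Longrightarrow> \<exists>(\<zeta> :: 'a \<Rightarrow> real) \<zeta>'. annulus_cutoff c0 \<rho> R \<zeta> \<zeta>'"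
    using annulus_cutoff_exists by blast
  obtain C where C: "C \<ge> 0" and C2: "\<And>\<rho> \<kappa>. 0 < \<rho> \<Longrightarrow> 8 * \<rho> < 1 \<Longrightarrow> 0 < \<kappa> \<Longrightarrow>
       ?Y \<rho> \<le> \<kappa> powr ?s * \<rho> powr (?N - \<sigma> * ?s) \<Longrightarrow>
       (\<integral>x. indicator (annulus (2 * \<rho>) (4 * \<rho>)) x * norm (flux \<alpha> m g x) \<partial>lborel) \<le> C * \<kappa> powr (m - 1) * \<rho>"
    by (rule flux_small[OF k \<sigma>], rule that)
  \<comment> \<open>L bounds u on the outer shell of the cutoff, so that \<open>G (u x)\<close>
    vanishes there.\<close>
  obtain L where L: "L \<ge> 0" "\<And>x. x \<in> annulus (1/4) (1/2) \<Longrightarrow> u x powr 1 \<le> L"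
    using u_powr_bounded[of "1/4" "1/2" 1] by auto
  define G where "G t = smooth_step (t - L)" for t
  define G' where "G' t = smooth_step' (t - L)" for t
  have G: "(G has_real_derivative G' t) (at t)" for t
  proof -
    have "((\<lambda>t. smooth_step (t - L)) has_real_derivative smooth_step' (t - L) * 1) (at t)"
      by (rule DERIV_chain2[OF DERIV_smooth_step]) (auto intro!: derivative_eq_intros)
    then show ?thesis unfolding G_def G'_def by simp
  qed
  have G'c: "continuous_on {0<..} G'"
    unfolding G'_def by (intro continuous_on_compose2[OF continuous_smooth_step'] continuous_intros) auto
  have G01: "0 \<le> G t \<and> G t \<le> 1" and G'0: "0 \<le> G' t" for t
    using smooth_step_props(1,5)[of "t - L"] by (auto simp: G_def G'_def)
  have [measurable]: "(\<lambda>x. G (u x)) \<in> borel_measurable borel"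
  proof -
    have "continuous_on UNIV G" using G by (auto intro!: continuous_at_imp_continuous_on DERIV_isCont)
    from borel_measurable_continuous_onI[OF this] show ?thesis by measurable
  qed
  have null: "(\<integral>x. indicator (annulus \<delta> (1/4)) x * (G (u x) * h x) \<partial>lborel) \<le> e" if \<delta>: "\<delta> > 0" and e: "e > 0" for \<delta> e
  proof -
    \<comment> \<open>Solves \<open>(c0 * C / 2 + 1) * \<kappa> powr (m - 1) = e\<close>. The factor
      c0 C / 2 arises from c0 / (2 \<rho>) times the flux bound; the added 1 keeps the divisor
      positive when C = 0.\<close>
    define \<kappa> where "\<kappa> = (e / (c0 * C / 2 + 1)) powr (1 / (m - 1))"
    have den: "c0 * C / 2 + 1 > 0" using c0(1) C by (simp add: add_nonneg_pos)
    have \<kappa>: "\<kappa> > 0" using e den by (simp add: \<kappa>_def)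
    have \<kappa>m: "\<kappa> powr (m - 1) = e / (c0 * C / 2 + 1)" using e den m by (simp add: \<kappa>_def powr_powr)
    \<comment> \<open>The failure is used with the constant \<open>\<kappa> powr (m - 1 + k)\<close>
      and below \<delta> / 4: the cutoff equals 1 from 4 \<rho> on, hence on the whole shell from
      \<delta> to 1/4.\<close>
    obtain \<rho> where \<rho>: "0 < \<rho>" "\<rho> < min (\<delta> / 4) (1 / 32)" "?Y \<rho> < \<kappa> powr ?s * \<rho> powr (?N - \<sigma> * ?s)"
      using seq[OF _ _ min.cobounded2, of "\<kappa> powr ?s" "\<delta> / 4"] \<delta> \<kappa> by auto
    have F: "(\<integral>x. indicator (annulus (2 * \<rho>) (4 * \<rho>)) x * norm (flux \<alpha> m g x) \<partial>lborel) \<le> C * \<kappa> powr (m - 1) * \<rho>"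
      by (rule C2[OF \<rho>(1) _ \<kappa>]) (use \<rho> in auto)
    have r: "0 < 2 * \<rho>" "2 * (2 * \<rho>) \<le> 1/4" "2 * (1/4) < (1::real)" using \<rho> by auto
    obtain \<zeta> :: "'a \<Rightarrow> real" and \<zeta>' where cut: "annulus_cutoff c0 (2 * \<rho>) (1/4) \<zeta> \<zeta>'" using c0(2)[OF r(1,2)] by blast
    note ct = cutoff_test[OF r c0(1) cut G G'c G01 G'0]
    have "(\<integral>x. indicator (annulus \<delta> (1/4)) x * (G (u x) * h x) \<partial>lborel) \<le> (\<integral>x. \<zeta> x * G (u x) * h x \<partial>lborel)"
    proof (rule integral_mono'[OF ct(1)])
      fix x :: 'a
      have z: "0 \<le> \<zeta> x" "x \<in> annulus (2 * (2 * \<rho>)) (1/4) \<Longrightarrow> \<zeta> x = 1" using cut by (auto simp: annulus_cutoff_def)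
      show "0 \<le> \<zeta> x * G (u x) * h x" using z(1) G01 h_nonneg by simp
      show "indicator (annulus \<delta> (1/4)) x * (G (u x) * h x) \<le> \<zeta> x * G (u x) * h x"
      proof (cases "x \<in> annulus \<delta> (1/4)")
        case True
        then have "\<zeta> x = 1" using \<rho> by (intro z(2)) auto
        then show ?thesis using True by simp
      next
        case False
        then show ?thesis using \<open>0 \<le> \<zeta> x * G (u x) * h x\<close> by simp
      qed
    qed
    also have "\<dots> \<le> c0 / (2 * \<rho>) * (\<integral>x. indicator (annulus (2 * \<rho>) (2 * (2 * \<rho>))) x * norm (flux \<alpha> m g x) \<partial>lborel)
      + c0 / (1/4) * (\<integral>x. indicator (annulus (1/4) (2 * (1/4))) x * (G (u x) * norm (flux \<alpha> m g x)) \<partial>lborel)"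
      by (rule ct(2))
    also have "(\<lambda>x::'a. indicator (annulus (1/4) (2 * (1/4))) x * (G (u x) * norm (flux \<alpha> m g x))) = (\<lambda>x. 0)"
    proof
      fix x :: 'a
      have "x \<in> annulus (1/4) (1/2) \<Longrightarrow> G (u x) = 0"
        unfolding G_def using L(2)[of x] u_pos[of x] by (intro smooth_step_props(2)) simp
      then show "indicator (annulus (1/4) (2 * (1/4))) x * (G (u x) * norm (flux \<alpha> m g x)) = 0"
        by (auto simp: indicator_def)
    qed
    also have "c0 / (2 * \<rho>) * (\<integral>x. indicator (annulus (2 * \<rho>) (2 * (2 * \<rho>))) x * norm (flux \<alpha> m g x) \<partial>lborel) + c0 / (1/4) * (\<integral>x. 0 \<partial>(lborel :: 'a measure))
      \<le> c0 / (2 * \<rho>) * (C * \<kappa> powr (m - 1) * \<rho>)"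
    proof -
      have "c0 / (2 * \<rho>) * (\<integral>x. indicator (annulus (2 * \<rho>) (4 * \<rho>)) x * norm (flux \<alpha> m g x) \<partial>lborel)
        \<le> c0 / (2 * \<rho>) * (C * \<kappa> powr (m - 1) * \<rho>)"
        using F c0(1) \<rho>(1) by (intro mult_left_mono) auto
      then show ?thesis by simp
    qed
    also have "\<dots> = (c0 * C / 2) * \<kappa> powr (m - 1)" using \<rho> by simp
    also have "\<dots> \<le> (c0 * C / 2 + 1) * \<kappa> powr (m - 1)" by (intro mult_right_mono) auto
    also have "\<dots> = e" unfolding \<kappa>m using den by simp
    finally show ?thesis .
  qed
  have "u x \<le> L" if x: "x \<noteq> 0" "norm x < 1 / 4" for x
  proof (rule ccontr)
    assume ux: "\<not> u x \<le> L"
    define \<delta> where "\<delta> = norm x / 2"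
    have \<delta>: "\<delta> > 0" using x by (simp add: \<delta>_def)
    let ?f = "\<lambda>x. indicator (annulus \<delta> (1/4)) x * (G (u x) * h x)"
    have i: "integrable lborel ?f"
    proof -
      have "integrable lborel (\<lambda>x. (indicator (annulus \<delta> (1/4)) x * G (u x)) * h x)"
        by (rule bounded_weight_integrable[OF h_int[OF \<delta>, of "1/4"], where B = 1]) (use G01 in auto)
      then show ?thesis by (simp add: mult.assoc)
    qed
    have f0: "?f x \<ge> 0" for x using G01 h_nonneg by simp
    have "(\<integral>x. ?f x \<partial>lborel) \<le> 0" using null[OF \<delta>] by (meson field_le_epsilon add_0 order.trans dense_ge)
    moreover have "(\<integral>x. ?f x \<partial>lborel) \<ge> 0" by (intro Bochner_Integration.integral_nonneg f0)
    ultimately have "AE x in lborel. ?f x = 0"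
      using integral_nonneg_eq_0_iff_AE[OF i] f0 by auto
    \<comment> \<open>A point with u > L has a neighbourhood on which both factors of the integrand
      are positive, and this ball would be a null set.\<close>
    define V where "V = {y \<in> ball 0 (1/4) - cball (0::'a) \<delta>. u y > L}"
    have VO: "V = (ball 0 (1/4) - cball 0 \<delta>) \<inter> u -` {L<..}" by (auto simp: V_def)
    have "open V" unfolding VO
    proof (rule continuous_open_preimage)
      show "continuous_on (ball 0 (1/4) - cball 0 \<delta>) u"
        by (rule continuous_on_subset[OF u_cont]) (use \<delta> in auto)
    qed auto
    moreover have "x \<in> V" using x ux by (auto simp: V_def \<delta>_def)
    ultimately obtain r where r: "r > 0" "ball x r \<subseteq> V" by (meson openE)
    have "AE y in lborel. y \<notin> ball x r"
      using \<open>AE x in lborel. ?f x = 0\<close>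
    proof eventually_elim
      case (elim y)
      show ?case
      proof
        assume "y \<in> ball x r"
        then have y: "y \<in> V" using r by auto
        then have "y \<in> annulus \<delta> (1/4)" "y \<in> ball 0 1 - {0}" using \<delta> by (auto simp: V_def)
        moreover have "G (u y) > 0" unfolding G_def using y by (intro smooth_step_props(4)) (simp add: V_def)
        ultimately show False using elim h_pos[of y] by auto
      qed
    qed
    then have "emeasure lborel (ball x r) = 0" by (subst (asm) AE_iff_measurable[of "ball x r"]) auto
    moreover have "0 < unit_ball_vol (real DIM('a)) * r ^ DIM('a)" using r by (intro mult_pos_pos) auto
    ultimately show False using r by (simp add: emeasure_ball ennreal_eq_0_iff)
  qed
  then show False using sing unfolding bounded_near_0_def by blast
qed

text \<open>Apply \<open>powr_le_scaled\<close> with threshold \<kappa> \<rho>^-\<sigma>. For small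
  \<kappa> the constant term uses up at most half of the lower bound for exponent s, and the other
  half bounds the integral for exponent w from below.\<close>

lemma lower_bound_upgrade:
  assumes s: "0 < s" "s \<le> w" and c: "c > 0" and r: "r \<le> 1 / 32"
    and lb: "\<And>\<rho>. 0 < \<rho> \<Longrightarrow> \<rho> < r \<Longrightarrow>
       c * \<rho> powr (real DIM('a) - \<sigma> * s) \<le> (\<integral>x. indicator (annulus \<rho> (8 * \<rho>)) x * u x powr s \<partial>lborel)"
  obtains c' where "c' > 0" "\<And>\<rho>. 0 < \<rho> \<Longrightarrow> \<rho> < r \<Longrightarrow>
       c' * \<rho> powr (real DIM('a) - \<sigma> * w) \<le> (\<integral>x. indicator (annulus \<rho> (8 * \<rho>)) x * u x powr w \<partial>lborel)"
proof -
  let ?N = "real DIM('a)"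
  define V where "V = unit_ball_vol ?N * 8 powr ?N"
  have V: "V \<ge> 0" by (simp add: V_def)
  define \<kappa> where "\<kappa> = (c / (2 * (V + 1))) powr (1 / s)"
  have \<kappa>: "\<kappa> > 0" using c V by (simp add: \<kappa>_def)
  have \<kappa>s: "\<kappa> powr s * V \<le> c / 2"
  proof -
    have "\<kappa> powr s = c / (2 * (V + 1))" using s c V by (simp add: \<kappa>_def powr_powr)
    then have "\<kappa> powr s * V = (c / 2) * (V / (V + 1))" by simp
    also have "\<dots> \<le> (c / 2) * 1" using V c by (intro mult_left_mono) auto
    finally show ?thesis by simp
  qed
  show thesis
  proof (rule that[of "c / 2 * \<kappa> powr (w - s)"])
    show "c / 2 * \<kappa> powr (w - s) > 0" using c \<kappa> by simp
    fix \<rho> :: real assume \<rho>: "0 < \<rho>" "\<rho> < r"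
    then have \<rho>8: "8 * \<rho> < 1" using r by simp
    define T where "T = \<kappa> * \<rho> powr (- \<sigma>)"
    have T: "T > 0" using \<rho> \<kappa> by (simp add: T_def)
    have Tp: "T powr a = \<kappa> powr a * \<rho> powr (- (\<sigma> * a))" for a
      using \<rho> \<kappa> by (simp add: T_def powr_mult powr_powr)
    let ?A = "annulus \<rho> (8 * \<rho>) :: 'a set"
    let ?Z = "\<integral>x. indicator ?A x * u x powr w \<partial>lborel"
    have iw: "integrable lborel (\<lambda>x. indicator ?A x * u x powr w)" by (rule u_powr_integrable[OF \<rho>(1) \<rho>8])
    have iA: "integrable lborel (\<lambda>x. indicator ?A x * T powr s)" by (rule annulus_integrable[OF \<rho>8])
    have "c * \<rho> powr (?N - \<sigma> * s) \<le> (\<integral>x. indicator ?A x * u x powr s \<partial>lborel)" by (rule lb[OF \<rho>])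
    also have "\<dots> \<le> (\<integral>x. indicator ?A x * T powr s + T powr (s - w) * (indicator ?A x * u x powr w) \<partial>lborel)"
    proof (rule integral_mono')
      show "integrable lborel (\<lambda>x. indicator ?A x * T powr s + T powr (s - w) * (indicator ?A x * u x powr w))"
        using iA iw by auto
      fix x :: 'a
      show "indicator ?A x * u x powr s \<le> indicator ?A x * T powr s + T powr (s - w) * (indicator ?A x * u x powr w)"
        using powr_le_scaled[OF u_pos T _ s(2), of x] s by (auto simp: indicator_def)
      show "0 \<le> indicator ?A x * T powr s + T powr (s - w) * (indicator ?A x * u x powr w)" by simp
    qed
    also have "\<dots> = measure lborel ?A * T powr s + T powr (s - w) * ?Z"
      using iA iw by (subst Bochner_Integration.integral_add) auto
    also have "measure lborel ?A * T powr s \<le> (V * \<rho> powr ?N) * T powr s"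
      using measure_annulus_le(1)[of "8 * \<rho>" \<rho>, where 'a = 'a] \<rho>
      by (intro mult_right_mono) (auto simp: V_def powr_mult mult.assoc)
    also have "(V * \<rho> powr ?N) * T powr s = (\<kappa> powr s * V) * \<rho> powr (?N - \<sigma> * s)"
      unfolding Tp by (simp add: powr_diff powr_minus divide_inverse)
    also have "\<dots> \<le> (c / 2) * \<rho> powr (?N - \<sigma> * s)" by (intro mult_right_mono \<kappa>s) auto
    finally have "(c / 2) * \<rho> powr (?N - \<sigma> * s) \<le> T powr (s - w) * ?Z" by simp
    then have "T powr (w - s) * ((c / 2) * \<rho> powr (?N - \<sigma> * s)) \<le> T powr (w - s) * (T powr (s - w) * ?Z)"
      by (intro mult_left_mono) auto
    also have "\<dots> = ?Z" using T by (simp add: mult.assoc[symmetric] powr_add[symmetric])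
    also have "T powr (w - s) * ((c / 2) * \<rho> powr (?N - \<sigma> * s)) = c / 2 * \<kappa> powr (w - s) * (\<rho> powr (- (\<sigma> * (w - s))) * \<rho> powr (?N - \<sigma> * s))"
      unfolding Tp by simp
    also have "\<rho> powr (- (\<sigma> * (w - s))) * \<rho> powr (?N - \<sigma> * s) = \<rho> powr (?N - \<sigma> * w)"
      unfolding powr_add[symmetric] by (simp add: algebra_simps)
    finally show "c / 2 * \<kappa> powr (w - s) * \<rho> powr (?N - \<sigma> * w) \<le> ?Z" .
  qed
qed

end

section \<open>Absorption and the bound of Keller-Osserman type\<close>

context weak_sol
begin

text \<open>
  With \<open>T = \<kappa> \<rho>\<^sup>-\<^sup>\<sigma>\<close> and \<open>\<kappa>\<close> large, Young's inequality turns the right-hand side of the energy estimate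
  into a part absorbed by the term with \<open>h\<close> and a remainder of order \<open>\<rho>\<^sup>N T\<^sup>s\<close>.
\<close>

lemma keller_osserman:
  assumes k: "0 < k" and q: "q > m - 1" and c1: "c1 > 0"
    and \<sigma>: "\<sigma> * (m - 1) = real DIM('a) - m - \<alpha>" and tau: "real DIM('a) \<le> \<sigma> * q + \<tau>"
  obtains C where "C > 0"
    "\<And>\<rho>. 0 < \<rho> \<Longrightarrow> 32 * \<rho> < 1 \<Longrightarrow> (\<forall>x\<in>annulus \<rho> (32 * \<rho>). c1 * \<rho> powr (- \<tau>) * u x powr q \<le> h x) \<Longrightarrow>
       (\<integral>x. indicator (annulus (2 * \<rho>) (16 * \<rho>)) x * u x powr (m - 1 + k) \<partial>lborel) \<le> C * \<rho> powr (real DIM('a) - \<sigma> * (m - 1 + k))"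
proof -
  let ?N = "real DIM('a)" and ?s = "m - 1 + k"
  define d where "d = q - m + 1"
  have d: "d > 0" using q by (simp add: d_def)
  have s: "?s > 0" using k m by simp
  obtain c where c: "c > 0" "\<And>\<rho> R. 0 < \<rho> \<Longrightarrow> 2 * \<rho> \<le> R \<Longrightarrow> \<exists>(\<zeta> :: 'a \<Rightarrow> real) \<zeta>'. annulus_cutoff c \<rho> R \<zeta> \<zeta>'"
    using annulus_cutoff_exists by blast
  \<comment> \<open>Large enough that a nonnegative power e of the cutoff remains after the power m
    s / d, s = m - 1 + k, has been joined to u.\<close>
  obtain n :: nat where n: "real n \<ge> m + m * ?s / d" using real_arch_simple by blast
  have "m * ?s / d \<ge> 0" using m s d by simp
  then have nm: "real n \<ge> m" using n by linarith
  obtain C where C: "C > 0" and C2: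
    "\<And>\<rho> R \<zeta> \<zeta>'. 0 < \<rho> \<Longrightarrow> 2 * \<rho> \<le> R \<Longrightarrow> 2 * R < 1 \<Longrightarrow> annulus_cutoff c \<rho> R \<zeta> \<zeta>' \<Longrightarrow>
       (\<integral>x. (\<zeta> x ^ n * u x powr (k - 1)) * energy_density x \<partial>lborel)
         \<le> C * \<rho> powr (- \<alpha> - m) * (\<integral>x. indicator (annulus \<rho> (2 * R)) x * (u x powr (m - 1 + k) * \<zeta> x powr (real n - m)) \<partial>lborel) \<and>
       (\<integral>x. (\<zeta> x ^ n * u x powr k) * h x \<partial>lborel)
         \<le> C * \<rho> powr (- \<alpha> - m) * (\<integral>x. indicator (annulus \<rho> (2 * R)) x * (u x powr (m - 1 + k) * \<zeta> x powr (real n - m)) \<partial>lborel)"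
    by (rule energy_estimate[OF k nm c(1)], rule that)
  \<comment> \<open>Makes \<open>C * b * T powr (- d)\<close> at most a / 2, half of the coefficient
    of the absorbing term. It can be solved for because q exceeds the homogeneity m - 1 of the
    operator, that is d > 0.\<close>
  define \<kappa> where "\<kappa> = (2 * C / c1) powr (1 / d)"
  have \<kappa>: "\<kappa> > 0" using C c1 by (simp add: \<kappa>_def)
  have \<kappa>d: "\<kappa> powr d = 2 * C / c1" using C c1 d by (simp add: \<kappa>_def powr_powr)
  define V where "V = unit_ball_vol ?N * 32 powr ?N"
  have V: "V \<ge> 0" by (simp add: V_def)
  show thesis
  proof (rule that[of "2 * V * \<kappa> powr ?s + 1"])
    show "2 * V * \<kappa> powr ?s + 1 > 0" using V by (simp add: add_nonneg_pos)
    fix \<rho> :: real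
    assume \<rho>: "0 < \<rho>" "32 * \<rho> < 1" and hb: "\<forall>x\<in>annulus \<rho> (32 * \<rho>). c1 * \<rho> powr (- \<tau>) * u x powr q \<le> h x"
    define R where "R = 16 * \<rho>"
    have R: "2 * \<rho> \<le> R" "2 * R < 1" "2 * R = 32 * \<rho>" using \<rho> by (auto simp: R_def)
    obtain \<zeta> :: "'a \<Rightarrow> real" and \<zeta>' where cut: "annulus_cutoff c \<rho> R \<zeta> \<zeta>'" using c(2)[OF \<rho>(1) R(1)] by blast
    let ?A = "annulus \<rho> (2 * R) :: 'a set" and ?A' = "annulus (2 * \<rho>) R :: 'a set"
    have \<zeta>: "C1_grad \<zeta> \<zeta>'" "\<And>x. 0 \<le> \<zeta> x" "\<And>x. \<zeta> x \<le> 1" "\<And>x. x \<notin> ?A \<Longrightarrow> \<zeta> x = 0"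
      "\<And>x. x \<in> ?A' \<Longrightarrow> \<zeta> x = 1" using cut by (auto simp: annulus_cutoff_def)
    have [measurable]: "\<zeta> \<in> borel_measurable borel"
      using C1_grad_continuous'[OF \<zeta>(1)] by (auto intro: borel_measurable_continuous_onI)
    have n0: "n > 0" using nm m by (cases n) auto
    have \<zeta>n: "0 \<le> \<zeta> x ^ n" "\<zeta> x ^ n \<le> 1" for x using \<zeta>(2,3) by (auto intro: power_le_one)
    have \<zeta>n0: "\<zeta> x ^ n = 0" if "x \<notin> ?A" for x using \<zeta>(4)[OF that] n0 by simp
    define T where "T = \<kappa> * \<rho> powr (- \<sigma>)"
    have T: "T > 0" using \<rho> \<kappa> by (simp add: T_def)
    have Tp: "T powr a = \<kappa> powr a * \<rho> powr (- (\<sigma> * a))" for a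
      using \<rho> \<kappa> by (simp add: T_def powr_mult powr_powr)
    define z where "z x = \<zeta> x ^ n * u x powr (q + k)" for x
    have iz: "integrable lborel z"
    proof -
      have "integrable lborel (\<lambda>x. \<zeta> x ^ n * u x powr (q + k))"
      proof -
        have "integrable lborel (\<lambda>x. \<zeta> x ^ n *\<^sub>R (indicator ?A x * u x powr (q + k)))"
          by (rule integrable_bounded_scaleR[OF u_powr_integrable[OF \<rho>(1) R(2)], where B = 1]) (use \<zeta>n in auto)
        also have "(\<lambda>x. \<zeta> x ^ n *\<^sub>R (indicator ?A x * u x powr (q + k))) = (\<lambda>x. \<zeta> x ^ n * u x powr (q + k))"
          using \<zeta>n0 by (auto simp: fun_eq_iff indicator_def simp del: mem_annulus)
        finally show ?thesis .
      qed
      then show ?thesis unfolding z_def .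
    qed
    have z0: "z x \<ge> 0" for x using \<zeta>n by (simp add: z_def)
    define Z where "Z = (\<integral>x. z x \<partial>lborel)"
    have Z0: "Z \<ge> 0" unfolding Z_def by (intro Bochner_Integration.integral_nonneg z0)
    have iA: "integrable lborel (\<lambda>x. indicator ?A x * T powr ?s)" by (rule annulus_integrable[OF R(2)])
    have pw: "indicator ?A x * (u x powr ?s * \<zeta> x powr (real n - m)) \<le> T powr (- d) * z x + indicator ?A x * T powr ?s" for x
    proof (cases "\<zeta> x = 0")
      case True
      then show ?thesis using z0[of x] by simp
    next
      case False
      then have zp: "\<zeta> x > 0" using \<zeta>(2)[of x] by simp
      have xA: "x \<in> ?A" using False \<zeta>(4) by blast
      define U where "U = u x"
      define W where "W = \<zeta> x"
      have pos: "U > 0" "W > 0" "W \<le> 1" using u_pos zp \<zeta>(3) by (auto simp: U_def W_def)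
      define e where "e = real n - m - m * ?s / d"
      have e: "e \<ge> 0" using n by (simp add: e_def)
      \<comment> \<open>The cutoff is merged into u so that the higher power of v, times
        \<open>W powr e\<close>, is exactly U^(q+k) W^n: the exponents satisfy m (q + k) / d + e =
        n.\<close>
      define v where "v = U * W powr (m / d)"
      have v: "v > 0" using pos by (simp add: v_def)
      have vp: "v powr a = U powr a * W powr (m * a / d)" for a using pos by (simp add: v_def powr_mult powr_powr)
      have "U powr ?s * W powr (real n - m) = v powr ?s * W powr e"
        unfolding vp mult.assoc powr_add[symmetric] by (simp add: e_def)
      also have "\<dots> \<le> (T powr ?s + T powr (?s - (?s + d)) * v powr (?s + d)) * W powr e"
        using d s by (intro mult_right_mono powr_le_scaled v T) auto
      also have "\<dots> = T powr ?s * W powr e + T powr (- d) * (v powr (?s + d) * W powr e)"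
        by (simp add: algebra_simps)
      also have "v powr (?s + d) * W powr e = z x"
      proof -
        have f2: "?s + d = q + k" by (simp add: d_def)
        have f1: "m * (q + k) / d + e = real n" unfolding f2[symmetric] using d by (simp add: e_def field_simps)
        have "v powr (?s + d) * W powr e = U powr (q + k) * W powr (real n)"
          unfolding f2 vp mult.assoc powr_add[symmetric] f1 ..
        then show ?thesis using pos by (simp add: z_def U_def[symmetric] W_def[symmetric] powr_realpow mult.commute)
      qed
      also have "T powr ?s * W powr e \<le> T powr ?s * 1"
        using pos e powr_mono2[of e W 1] by (intro mult_left_mono) auto
      finally show ?thesis using xA by (simp add: U_def W_def)
    qed
    have I: "(\<integral>x. indicator ?A x * (u x powr ?s * \<zeta> x powr (real n - m)) \<partial>lborel) \<le> T powr (- d) * Z + V * \<rho> powr ?N * T powr ?s"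
    proof -
      have "(\<integral>x. indicator ?A x * (u x powr ?s * \<zeta> x powr (real n - m)) \<partial>lborel)
          \<le> (\<integral>x. T powr (- d) * z x + indicator ?A x * T powr ?s \<partial>lborel)"
        by (rule integral_mono'[OF _ pw]) (use iz iA z0 in auto)
      also have "\<dots> = T powr (- d) * Z + measure lborel ?A * T powr ?s"
        using iz iA by (subst Bochner_Integration.integral_add) (auto simp: Z_def)
      also have "measure lborel ?A * T powr ?s \<le> V * \<rho> powr ?N * T powr ?s"
        using measure_annulus_le(1)[of "32 * \<rho>" \<rho>, where 'a = 'a] \<rho>
        by (intro mult_right_mono) (auto simp: V_def powr_mult mult.assoc R)
      finally show ?thesis by simp
    qed
    define b where "b = \<rho> powr (- \<alpha> - m)"
    define a where "a = c1 * \<rho> powr (- \<tau>)"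
    have b: "b > 0" and a: "a > 0" using \<rho> c1 by (auto simp: a_def b_def)
    have aZ: "a * Z \<le> (\<integral>x. (\<zeta> x ^ n * u x powr k) * h x \<partial>lborel)"
    proof -
      have ih: "integrable lborel (\<lambda>x. (\<zeta> x ^ n * u x powr k) * h x)"
      proof -
        obtain M where M: "M \<ge> 0" "\<And>x. x \<in> ?A \<Longrightarrow> u x powr k \<le> M" using u_powr_bounded[OF \<rho>(1) R(2)] by blast
        show ?thesis
        proof (rule bounded_weight_integrable[OF h_int[OF \<rho>(1) R(2)]])
          show "\<bar>\<zeta> x ^ n * u x powr k\<bar> \<le> 1 * M" if "x \<in> ?A" for x
            unfolding abs_mult using \<zeta>n[of x] M(2)[OF that] by (intro mult_mono) auto
        qed (use \<zeta>n0 in auto)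
      qed
      have "a * Z = (\<integral>x. a * z x \<partial>lborel)" by (simp add: Z_def)
      also have "\<dots> \<le> (\<integral>x. (\<zeta> x ^ n * u x powr k) * h x \<partial>lborel)"
      proof (rule integral_mono'[OF ih])
        fix x
        show "0 \<le> (\<zeta> x ^ n * u x powr k) * h x" using \<zeta>n h_nonneg by simp
        show "a * z x \<le> (\<zeta> x ^ n * u x powr k) * h x"
        proof (cases "x \<in> ?A")
          case True
          then have "a * u x powr q \<le> h x" using bspec[OF hb, of x] R(3) by (simp add: a_def)
          then have "(\<zeta> x ^ n * u x powr k) * (a * u x powr q) \<le> (\<zeta> x ^ n * u x powr k) * h x"
            using \<zeta>n[of x] by (intro mult_left_mono) auto
          then show ?thesis by (simp add: z_def powr_add mult_ac)
        next
          case False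
          show ?thesis unfolding z_def \<zeta>n0[OF False] by simp
        qed
      qed
      finally show ?thesis .
    qed
    have abs: "C * b * T powr (- d) \<le> a / 2"
    proof -
      have "b * T powr (- d) = \<kappa> powr (- d) * \<rho> powr (\<sigma> * d - \<alpha> - m)"
      proof -
        have "\<rho> powr (- \<alpha> - m) * \<rho> powr (- (\<sigma> * - d)) = \<rho> powr (\<sigma> * d - \<alpha> - m)"
          unfolding powr_add[symmetric] by (simp add: algebra_simps)
        then show ?thesis unfolding b_def Tp by (simp add: mult.left_commute)
      qed
      \<comment> \<open>The exponent on the left equals \<sigma> q - N, so for \<rho> < 1 this is
        the hypothesis \<open>tau\<close>.\<close>
      also have "\<rho> powr (\<sigma> * d - \<alpha> - m) \<le> \<rho> powr (- \<tau>)"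
      proof -
        have "\<sigma> * d = \<sigma> * q - \<sigma> * (m - 1)" by (simp add: d_def algebra_simps)
        then have "- \<tau> \<le> \<sigma> * d - \<alpha> - m" using tau \<sigma> by linarith
        then show ?thesis using \<rho> by (intro powr_mono') auto
      qed
      also have "\<kappa> powr (- d) = c1 / (2 * C)" using \<kappa>d C c1 by (simp add: powr_minus)
      finally have "b * T powr (- d) \<le> c1 / (2 * C) * \<rho> powr (- \<tau>)" by (simp add: mult_left_mono)
      then have "C * (b * T powr (- d)) \<le> C * (c1 / (2 * C) * \<rho> powr (- \<tau>))" using C by (intro mult_left_mono) auto
      also have "\<dots> = a / 2" using C by (simp add: a_def)
      finally show ?thesis by (simp add: mult.assoc)
    qed
    have "a * Z \<le> C * b * (T powr (- d) * Z + V * \<rho> powr ?N * T powr ?s)"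
    proof -
      have "a * Z \<le> C * b * (\<integral>x. indicator ?A x * (u x powr ?s * \<zeta> x powr (real n - m)) \<partial>lborel)"
        using order.trans[OF aZ C2[OF \<rho>(1) R(1,2) cut, THEN conjunct2]] by (simp add: b_def)
      also have "\<dots> \<le> C * b * (T powr (- d) * Z + V * \<rho> powr ?N * T powr ?s)"
        using C b by (intro mult_left_mono I) auto
      finally show ?thesis .
    qed
    also have "\<dots> = (C * b * T powr (- d)) * Z + C * b * (V * \<rho> powr ?N * T powr ?s)"
      by (simp add: algebra_simps)
    also have "\<dots> \<le> (a / 2) * Z + C * b * (V * \<rho> powr ?N * T powr ?s)"
      using mult_right_mono[OF abs Z0] by simp
    finally have "(a / 2) * Z \<le> C * b * (V * \<rho> powr ?N * T powr ?s)" by simp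
    then have "T powr (- d) * ((a / 2) * Z) \<le> T powr (- d) * (C * b * (V * \<rho> powr ?N * T powr ?s))"
      by (intro mult_left_mono) auto
    also have "\<dots> = (C * b * T powr (- d)) * (V * \<rho> powr ?N * T powr ?s)" by simp
    also have "\<dots> \<le> (a / 2) * (V * \<rho> powr ?N * T powr ?s)" using V by (intro mult_right_mono abs) auto
    finally have "(a / 2) * (T powr (- d) * Z) \<le> (a / 2) * (V * \<rho> powr ?N * T powr ?s)" by (simp add: mult_ac)
    then have TZ: "T powr (- d) * Z \<le> V * \<rho> powr ?N * T powr ?s" using a by simp
    have "(\<integral>x. indicator (annulus (2 * \<rho>) (16 * \<rho>)) x * u x powr ?s \<partial>lborel)
        \<le> (\<integral>x. T powr (- d) * z x + indicator ?A x * T powr ?s \<partial>lborel)"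
    proof (rule integral_mono')
      show "integrable lborel (\<lambda>x. T powr (- d) * z x + indicator ?A x * T powr ?s)" using iz iA by auto
      fix x :: 'a
      show "0 \<le> T powr (- d) * z x + indicator ?A x * T powr ?s" using z0[of x] by simp
      show "indicator (annulus (2 * \<rho>) (16 * \<rho>)) x * u x powr ?s \<le> T powr (- d) * z x + indicator ?A x * T powr ?s"
      proof (cases "x \<in> ?A'")
        case True
        then have "x \<in> ?A" using \<rho> R by auto
        then show ?thesis using pw[of x] \<zeta>(5)[OF True] True by (simp add: R_def)
      next
        case False
        then show ?thesis using z0[of x] by (simp add: R_def)
      qed
    qed
    also have "\<dots> = T powr (- d) * Z + measure lborel ?A * T powr ?s"
      using iz iA by (subst Bochner_Integration.integral_add) (auto simp: Z_def)
    also have "measure lborel ?A * T powr ?s \<le> V * \<rho> powr ?N * T powr ?s"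
      using measure_annulus_le(1)[of "32 * \<rho>" \<rho>, where 'a = 'a] \<rho>
      by (intro mult_right_mono) (auto simp: V_def powr_mult mult.assoc R)
    also have "T powr (- d) * Z + V * \<rho> powr ?N * T powr ?s \<le> 2 * (V * \<rho> powr ?N * T powr ?s)" using TZ by simp
    also have "\<dots> = 2 * V * \<kappa> powr ?s * \<rho> powr (?N - \<sigma> * ?s)"
      unfolding Tp by (simp add: powr_diff powr_minus divide_inverse)
    also have "\<dots> \<le> (2 * V * \<kappa> powr ?s + 1) * \<rho> powr (?N - \<sigma> * ?s)" by (intro mult_right_mono) auto
    finally show "(\<integral>x. indicator (annulus (2 * \<rho>) (16 * \<rho>)) x * u x powr ?s \<partial>lborel) \<le> (2 * V * \<kappa> powr ?s + 1) * \<rho> powr (?N - \<sigma> * ?s)" by simp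
  qed
qed

text \<open>For an unbounded u, \<open>keller_osserman\<close> bounds the flux and hence the
  integral of h over the shell from \<delta> to 1/4 independently of \<delta>. The lower bound for
  exponent q, on the other hand, gives each of infinitely many disjoint shells a mass of h at least
  \<open>c1 * c'\<close>.\<close>

lemma absorption_imp_bounded:
  assumes k: "0 < k" "k \<le> 1" "m - 1 + k \<le> q" and c1: "c1 > 0" and r1: "r1 > 0"
    and \<sigma>: "\<sigma> * (m - 1) = real DIM('a) - m - \<alpha>" and tau: "real DIM('a) \<le> \<sigma> * q + \<tau>"
    and hb: "\<And>\<rho> x. 0 < \<rho> \<Longrightarrow> \<rho> < r1 \<Longrightarrow> x \<in> annulus \<rho> (32 * \<rho>) \<Longrightarrow> c1 * \<rho> powr (- \<tau>) * u x powr q \<le> h x"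
  shows bounded_near_0
proof (rule ccontr)
  let ?N = "real DIM('a)" and ?s = "m - 1 + k"
  assume sing: "\<not> bounded_near_0"
  have q: "q > m - 1" using k by simp
  have s: "0 < ?s" using k m by simp
  obtain c r where c: "c > 0" and r: "r > 0" "r \<le> 1 / 32" and lb0:
    "\<And>\<rho>. 0 < \<rho> \<Longrightarrow> \<rho> < r \<Longrightarrow> c * \<rho> powr (?N - \<sigma> * ?s) \<le> (\<integral>x. indicator (annulus \<rho> (8 * \<rho>)) x * u x powr ?s \<partial>lborel)"
    by (rule singular_lower_bound[OF k(1,2) \<sigma> sing], rule that)
  obtain c' where c': "c' > 0" and lb: "\<And>\<rho>. 0 < \<rho> \<Longrightarrow> \<rho> < r \<Longrightarrow>
       c' * \<rho> powr (?N - \<sigma> * q) \<le> (\<integral>x. indicator (annulus \<rho> (8 * \<rho>)) x * u x powr q \<partial>lborel)"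
    by (rule lower_bound_upgrade[OF s k(3) c r(2)], rule lb0, assumption, assumption, rule that)
  obtain K where K: "K > 0" and ko:
    "\<And>\<rho>. 0 < \<rho> \<Longrightarrow> 32 * \<rho> < 1 \<Longrightarrow> (\<forall>x\<in>annulus \<rho> (32 * \<rho>). c1 * \<rho> powr (- \<tau>) * u x powr q \<le> h x) \<Longrightarrow>
       (\<integral>x. indicator (annulus (2 * \<rho>) (16 * \<rho>)) x * u x powr ?s \<partial>lborel) \<le> K * \<rho> powr (?N - \<sigma> * ?s)"
    by (rule keller_osserman[OF k(1) q c1 \<sigma> tau], rule that)
  obtain C where C: "C \<ge> 0" and C2: "\<And>\<rho> \<kappa>. 0 < \<rho> \<Longrightarrow> 8 * \<rho> < 1 \<Longrightarrow> 0 < \<kappa> \<Longrightarrow>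
       (\<integral>x. indicator (annulus \<rho> (8 * \<rho>)) x * u x powr ?s \<partial>lborel) \<le> \<kappa> powr ?s * \<rho> powr (?N - \<sigma> * ?s) \<Longrightarrow>
       (\<integral>x. indicator (annulus (2 * \<rho>) (4 * \<rho>)) x * norm (flux \<alpha> m g x) \<partial>lborel) \<le> C * \<kappa> powr (m - 1) * \<rho>"
    by (rule flux_small[OF k(1,2) \<sigma>], rule that)
  obtain c0 where c0: "c0 > 0" "\<And>\<rho> R. 0 < \<rho> \<Longrightarrow> 2 * \<rho> \<le> R \<Longrightarrow> \<exists>(\<zeta> :: 'a \<Rightarrow> real) \<zeta>'. annulus_cutoff c0 \<rho> R \<zeta> \<zeta>'"
    using annulus_cutoff_exists by blast
  define r0 where "r0 = min r r1"
  have r0: "r0 > 0" "r0 \<le> r" "r0 \<le> r1" "r0 \<le> 1 / 32" using r r1 by (auto simp: r0_def)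
  \<comment> \<open>\<open>keller_osserman\<close> at \<rho> speaks of the shell from 2 \<rho> to 16
    \<rho>, to which the flux bound is applied with inner radius 2 \<rho>; the power of 1/2 rewrites
    \<rho> in terms of 2 \<rho>.\<close>
  define M where "M = K * (1 / 2) powr (?N - \<sigma> * ?s)"
  have M: "M > 0" using K by (simp add: M_def)
  define \<kappa> where "\<kappa> = M powr (1 / ?s)"
  have \<kappa>: "\<kappa> > 0" "\<kappa> powr ?s = M" using M s by (auto simp: \<kappa>_def powr_powr)
  define F where "F = (\<integral>x. indicator (annulus (1/4) (2 * (1/4))) x * (1 * norm (flux \<alpha> m g x)) \<partial>lborel)"
  define B where "B = c0 / 2 * (C * \<kappa> powr (m - 1)) + c0 / (1/4) * F"
  define H where "H \<delta> = (\<integral>x. indicator (annulus \<delta> (1/4)) x * h x \<partial>lborel)" for \<delta>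
  have HB: "H \<delta> \<le> B" if \<delta>: "\<delta> > 0" for \<delta>
  proof -
    \<comment> \<open>The cutoff starts at 4 \<rho> and equals 1 from 8 \<rho> on, hence the bound
      \<delta> / 8.\<close>
    define \<rho> where "\<rho> = min (\<delta> / 8) (r0 / 2)"
    have \<rho>: "\<rho> > 0" "\<rho> \<le> \<delta> / 8" "\<rho> < r0" using \<delta> r0 by (auto simp: \<rho>_def)
    have ie: "integrable lborel (\<lambda>x. indicator (annulus (2 * \<rho>) (1/4)) x * h x)" using \<rho> by (intro h_int) auto
    have "(\<integral>x. indicator (annulus (2 * \<rho>) (16 * \<rho>)) x * u x powr ?s \<partial>lborel) \<le> K * \<rho> powr (?N - \<sigma> * ?s)"
      by (rule ko) (use \<rho> r0 hb in auto)
    also have "\<rho> powr (?N - \<sigma> * ?s) = (1 / 2) powr (?N - \<sigma> * ?s) * (2 * \<rho>) powr (?N - \<sigma> * ?s)"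
      using \<rho> by (simp add: powr_mult[symmetric])
    also have "K * \<dots> = \<kappa> powr ?s * (2 * \<rho>) powr (?N - \<sigma> * ?s)" unfolding \<kappa>(2) M_def by simp
    finally have "(\<integral>x. indicator (annulus (2 * \<rho>) (8 * (2 * \<rho>))) x * u x powr ?s \<partial>lborel) \<le> \<kappa> powr ?s * (2 * \<rho>) powr (?N - \<sigma> * ?s)"
      by simp
    then have fl: "(\<integral>x. indicator (annulus (2 * (2 * \<rho>)) (4 * (2 * \<rho>))) x * norm (flux \<alpha> m g x) \<partial>lborel) \<le> C * \<kappa> powr (m - 1) * (2 * \<rho>)"
      using \<rho> r0 by (intro C2 \<kappa>) auto
    have rr: "0 < 4 * \<rho>" "2 * (4 * \<rho>) \<le> 1/4" "2 * (1/4) < (1::real)" using \<rho> r0 by auto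
    obtain \<zeta> :: "'a \<Rightarrow> real" and \<zeta>' where cut: "annulus_cutoff c0 (4 * \<rho>) (1/4) \<zeta> \<zeta>'" using c0(2)[OF rr(1,2)] by blast
    \<comment> \<open>The case G = 1: the cutoff alone is the test function, and the outer flux F
      enters as a fixed number.\<close>
    have ct: "integrable lborel (\<lambda>x. \<zeta> x * 1 * h x)"
      "(\<integral>x. \<zeta> x * 1 * h x \<partial>lborel) \<le> c0 / (4 * \<rho>) * (\<integral>x. indicator (annulus (4 * \<rho>) (2 * (4 * \<rho>))) x * norm (flux \<alpha> m g x) \<partial>lborel)
        + c0 / (1/4) * F"
      unfolding F_def
      by (rule cutoff_test[OF rr c0(1) cut, where G = "\<lambda>_. 1" and G' = "\<lambda>_. 0"]; simp)+
    have "H \<delta> \<le> (\<integral>x. \<zeta> x * 1 * h x \<partial>lborel)"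
      unfolding H_def
    proof (rule integral_mono'[OF ct(1)])
      fix x :: 'a
      have z: "0 \<le> \<zeta> x" "x \<in> annulus (2 * (4 * \<rho>)) (1/4) \<Longrightarrow> \<zeta> x = 1" using cut by (auto simp: annulus_cutoff_def)
      show "0 \<le> \<zeta> x * 1 * h x" using z(1) h_nonneg by simp
      show "indicator (annulus \<delta> (1/4)) x * h x \<le> \<zeta> x * 1 * h x"
      proof (cases "x \<in> annulus \<delta> (1/4)")
        case True
        then have "\<zeta> x = 1" using \<rho> by (intro z(2)) auto
        then show ?thesis using True by simp
      next
        case False
        then show ?thesis using \<open>0 \<le> \<zeta> x * 1 * h x\<close> by simp
      qed
    qed
    also have "\<dots> \<le> c0 / (4 * \<rho>) * (\<integral>x. indicator (annulus (4 * \<rho>) (2 * (4 * \<rho>))) x * norm (flux \<alpha> m g x) \<partial>lborel) + c0 / (1/4) * F"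
      by (rule ct(2))
    also have "\<dots> \<le> c0 / (4 * \<rho>) * (C * \<kappa> powr (m - 1) * (2 * \<rho>)) + c0 / (1/4) * F"
    proof -
      have "c0 / (4 * \<rho>) * (\<integral>x. indicator (annulus (2 * (2 * \<rho>)) (4 * (2 * \<rho>))) x * norm (flux \<alpha> m g x) \<partial>lborel)
        \<le> c0 / (4 * \<rho>) * (C * \<kappa> powr (m - 1) * (2 * \<rho>))"
        using fl c0(1) \<rho>(1) by (intro mult_left_mono) auto
      then show ?thesis by simp
    qed
    also have "\<dots> = B" using \<rho> by (simp add: B_def)
    finally show ?thesis .
  qed
  \<comment> \<open>The ratio 16 exceeds 8, so the shells from \<open>\<rho> j\<close> to
    \<open>8 * \<rho> j\<close> are pairwise disjoint.\<close>
  define \<rho> where "\<rho> j = r0 / 2 / 16 ^ j" for j :: nat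
  have \<rho>: "\<rho> j > 0" "\<rho> j < r0" for j
  proof -
    show "\<rho> j > 0" using r0 by (simp add: \<rho>_def)
    have "r0 / 2 / 16 ^ j \<le> r0 / 2 / 1" using r0 by (intro divide_left_mono) auto
    then show "\<rho> j < r0" using r0 by (simp add: \<rho>_def)
  qed
  have step: "c1 * c' \<le> (\<integral>x. indicator (annulus (\<rho> j) (8 * \<rho> j)) x * h x \<partial>lborel)" for j
  proof -
    have small: "8 * \<rho> j < 1" "\<rho> j < r" "\<rho> j < r1" using \<rho>[of j] r0 by auto
    \<comment> \<open>By \<open>tau\<close> the exponent is nonpositive, so the mass of h in a shell
      does not decay as the shell shrinks.\<close>
    have "1 \<le> \<rho> j powr (?N - \<sigma> * q - \<tau>)"
      using powr_mono'[of "?N - \<sigma> * q - \<tau>" 0 "\<rho> j"] tau \<rho>[of j] r0 by auto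
    then have "c1 * c' \<le> c1 * c' * \<rho> j powr (?N - \<sigma> * q - \<tau>)"
      using c1 c' by simp
    also have "\<dots> = c1 * \<rho> j powr (- \<tau>) * (c' * \<rho> j powr (?N - \<sigma> * q))"
    proof -
      have "\<rho> j powr (?N - \<sigma> * q - \<tau>) = \<rho> j powr (- \<tau>) * \<rho> j powr (?N - \<sigma> * q)"
        by (simp add: powr_add[symmetric])
      then show ?thesis by simp
    qed
    also have "\<dots> \<le> c1 * \<rho> j powr (- \<tau>) * (\<integral>x. indicator (annulus (\<rho> j) (8 * \<rho> j)) x * u x powr q \<partial>lborel)"
      using lb[OF \<rho>(1) small(2)] c1 by (intro mult_left_mono) auto
    also have "\<dots> = (\<integral>x. c1 * \<rho> j powr (- \<tau>) * (indicator (annulus (\<rho> j) (8 * \<rho> j)) x * u x powr q) \<partial>lborel)"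
      by simp
    also have "\<dots> \<le> (\<integral>x. indicator (annulus (\<rho> j) (8 * \<rho> j)) x * h x \<partial>lborel)"
    proof (rule integral_mono'[OF h_int[OF \<rho>(1) small(1)]])
      fix x :: 'a
      show "0 \<le> indicator (annulus (\<rho> j) (8 * \<rho> j)) x * h x" using h_nonneg by simp
      show "c1 * \<rho> j powr (- \<tau>) * (indicator (annulus (\<rho> j) (8 * \<rho> j)) x * u x powr q) \<le> indicator (annulus (\<rho> j) (8 * \<rho> j)) x * h x"
        using hb[OF \<rho>(1) small(3), of x] \<rho>(1)[of j] by (auto simp: indicator_def)
    qed
    finally show ?thesis .
  qed
  have grow: "real j * (c1 * c') \<le> H (\<rho> j)" for j
  proof (induction j)
    case 0
    have "0 \<le> H (\<rho> 0)" unfolding H_def using h_nonneg by (intro Bochner_Integration.integral_nonneg) simp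
    then show ?case by simp
  next
    case (Suc j)
    have e: "8 * \<rho> (Suc j) < \<rho> j" "\<rho> (Suc j) \<le> \<rho> j" using \<rho>(1)[of j] by (auto simp: \<rho>_def)
    have small: "8 * \<rho> (Suc j) < 1" "8 * \<rho> (Suc j) \<le> 1/4" using \<rho>[of "Suc j"] r0 by auto
    have i1: "integrable lborel (\<lambda>x. indicator (annulus (\<rho> (Suc j)) (8 * \<rho> (Suc j))) x * h x)"
      by (rule h_int[OF \<rho>(1) small(1)])
    have i2: "integrable lborel (\<lambda>x. indicator (annulus (\<rho> j) (1/4)) x * h x)" by (rule h_int[OF \<rho>(1)]) simp
    have i3: "integrable lborel (\<lambda>x. indicator (annulus (\<rho> (Suc j)) (1/4)) x * h x)" by (rule h_int[OF \<rho>(1)]) simp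
    have "real (Suc j) * (c1 * c') \<le> (\<integral>x. indicator (annulus (\<rho> (Suc j)) (8 * \<rho> (Suc j))) x * h x \<partial>lborel) + H (\<rho> j)"
      using Suc.IH step[of "Suc j"] by (simp add: algebra_simps)
    also have "\<dots> = (\<integral>x. indicator (annulus (\<rho> (Suc j)) (8 * \<rho> (Suc j))) x * h x + indicator (annulus (\<rho> j) (1/4)) x * h x \<partial>lborel)"
      using i1 i2 by (simp add: H_def)
    also have "\<dots> \<le> H (\<rho> (Suc j))"
      unfolding H_def
    proof (rule integral_mono'[OF i3])
      fix x :: 'a
      show "0 \<le> indicator (annulus (\<rho> (Suc j)) (1/4)) x * h x" using h_nonneg by simp
      show "indicator (annulus (\<rho> (Suc j)) (8 * \<rho> (Suc j))) x * h x + indicator (annulus (\<rho> j) (1/4)) x * h x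
        \<le> indicator (annulus (\<rho> (Suc j)) (1/4)) x * h x"
        using e small h_nonneg[of x] by (auto simp: indicator_def)
    qed
    finally show ?case .
  qed
  obtain j :: nat where "real j * (c1 * c') > B" using reals_Archimedean3[of "c1 * c'"] c1 c' by auto
  then show False using grow[of j] HB[OF \<rho>(1), of j] by linarith
qed

end

subsection \<open>Riesz potentials\<close>

abbreviation (input) punctured_ball :: "'a::euclidean_space set" where
  "punctured_ball \<equiv> ball 0 1 - {0}"

lemma integrable_norm_powr_ball:
  assumes "0 \<le> t" "t < real DIM('a::euclidean_space)" "R > 0"
  shows "integrable lborel (\<lambda>x::'a. norm x powr (- t) * indicator (ball 0 R) x)"
proof -
  have [measurable]: "ball (0::'a) R \<in> sets borel" by simp
  obtain C where C: "C \<ge> 0" "\<And>R. R > 0 \<Longrightarrow> (\<integral>\<^sup>+x. ennreal (norm x powr (- t)) * indicator (ball (0::'a) R) x \<partial>lborel)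
       \<le> ennreal (C * R powr (real DIM('a) - t))"
    using nn_integral_norm_powr_ball[OF assms(1,2)] by blast
  have "(\<integral>\<^sup>+x. ennreal (norm x powr (- t)) * indicator (ball (0::'a) R) x \<partial>lborel) < \<infinity>"
    by (rule le_less_trans[OF C(2)[OF assms(3)]]) simp
  also have "(\<integral>\<^sup>+x. ennreal (norm x powr (- t)) * indicator (ball (0::'a) R) x \<partial>lborel)
      = (\<integral>\<^sup>+x. ennreal (norm (norm x powr (- t) * indicator (ball (0::'a) R) x)) \<partial>lborel)"
    by (intro nn_integral_cong) (auto simp: indicator_def)
  finally show ?thesis by (intro integrableI_bounded) measurable
qed

lemma riesz_const_pos:
  assumes "0 < \<beta>" "\<beta> < real DIM('a::euclidean_space)"
  shows "riesz_const TYPE('a) \<beta> > 0"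
  unfolding riesz_const_def using assms by (intro divide_pos_pos mult_pos_pos Gamma_real_pos) auto

lemma riesz_kernel_nonneg:
  assumes "0 < \<beta>" "\<beta> < real DIM('a::euclidean_space)"
  shows "riesz_kernel \<beta> (x :: 'a) \<ge> 0"
  unfolding riesz_kernel_def using riesz_const_pos[OF assms] by simp

lemma meas_riesz_kernel [measurable]: "riesz_kernel \<beta> \<in> borel_measurable borel"
  unfolding riesz_kernel_def by measurable

lemma riesz_conv_lborel:
  fixes u :: "'a::euclidean_space \<Rightarrow> real"
  assumes [measurable]: "v \<in> borel_measurable borel"
    and v: "\<And>y. v y = indicator punctured_ball y * u y powr p"
  shows "riesz_conv \<beta> p u x = (\<integral>y. riesz_kernel \<beta> (x - y) * v y \<partial>lborel)"
proof -
  have "riesz_conv \<beta> p u x = (LINT y:punctured_ball|lebesgue. riesz_kernel \<beta> (x - y) * u y powr p)"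
    unfolding riesz_conv_def
    by (rule set_integral_discrete_difference[where X = "{0}"]) auto
  also have "\<dots> = (\<integral>y. riesz_kernel \<beta> (x - y) * v y \<partial>lebesgue)"
    unfolding set_lebesgue_integral_def v by (rule Bochner_Integration.integral_cong) auto
  also have "\<dots> = (\<integral>y. riesz_kernel \<beta> (x - y) * v y \<partial>lborel)"
    by (rule integral_completion) measurable
  finally show ?thesis .
qed

text \<open>Within distance \<delta> of x the density is at most M and the kernel is integrable
  because \<open>0 < \<beta>\<close>; farther away the kernel is bounded and v is
  integrable.\<close>

lemma riesz_integrable:
  fixes v :: "'a::euclidean_space \<Rightarrow> real"
  assumes \<beta>: "0 < \<beta>" "\<beta> < real DIM('a)" and v: "integrable lborel v" "\<And>y. v y \<ge> 0"
    and bnd: "\<delta> > 0" "\<And>y. norm (x - y) < \<delta> \<Longrightarrow> v y \<le> M"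
  shows "integrable lborel (\<lambda>y. riesz_kernel \<beta> (x - y) * v y)"
proof (rule Bochner_Integration.integrable_bound)
  define c where "c = riesz_const TYPE('a) \<beta>"
  have c: "c > 0" using riesz_const_pos[OF \<beta>] by (simp add: c_def)
  let ?t = "real DIM('a) - \<beta>"
  let ?k = "\<lambda>z::'a. norm z powr (- ?t) * indicator (ball 0 \<delta>) z"
  have M: "M \<ge> 0" using bnd(2)[of x] v(2)[of x] bnd(1) by simp
  have "integrable lborel (\<lambda>y. ?k (x - y))"
    by (rule integrable_lborel_minus, rule integrable_norm_powr_ball) (use \<beta> bnd in auto)
  then show "integrable lborel (\<lambda>y. c * M * ?k (x - y) + c * \<delta> powr (- ?t) * v y)"
    using v by auto
  have [measurable]: "v \<in> borel_measurable borel" using v by auto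
  show "(\<lambda>y. riesz_kernel \<beta> (x - y) * v y) \<in> borel_measurable lborel" by measurable
  show "AE y in lborel. norm (riesz_kernel \<beta> (x - y) * v y) \<le> norm (c * M * ?k (x - y) + c * \<delta> powr (- ?t) * v y)"
  proof (rule AE_I2)
    fix y
    have "riesz_kernel \<beta> (x - y) * v y \<le> c * M * ?k (x - y) + c * \<delta> powr (- ?t) * v y"
    proof (cases "norm (x - y) < \<delta>")
      case True
      have "riesz_kernel \<beta> (x - y) * v y \<le> riesz_kernel \<beta> (x - y) * M"
        using bnd(2)[OF True] riesz_kernel_nonneg[OF \<beta>, of "x - y"] by (intro mult_left_mono) auto
      also have "\<dots> = c * M * ?k (x - y)" using True by (simp add: riesz_kernel_def c_def)
      also have "\<dots> \<le> c * M * ?k (x - y) + c * \<delta> powr (- ?t) * v y" using c v(2)[of y] by simp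
      finally show ?thesis .
    next
      case False
      have "norm (x - y) powr (- ?t) \<le> \<delta> powr (- ?t)" using False bnd(1) \<beta> by (intro powr_mono2') auto
      then have "riesz_kernel \<beta> (x - y) * v y \<le> c * \<delta> powr (- ?t) * v y"
        unfolding riesz_kernel_def using c v(2)[of y] by (auto simp: c_def intro!: mult_right_mono mult_left_mono)
      then show ?thesis using False by simp
    qed
    moreover have "0 \<le> riesz_kernel \<beta> (x - y) * v y" using riesz_kernel_nonneg[OF \<beta>, of "x - y"] v(2)[of y] by simp
    ultimately show "norm (riesz_kernel \<beta> (x - y) * v y) \<le> norm (c * M * ?k (x - y) + c * \<delta> powr (- ?t) * v y)"
      by simp
  qed
qed

text \<open>The kernel decreases with the distance, so a part w of v within distance D of x is
  weighted by at least the value at distance D. All of v yields a constant bound in the unit ball;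
  the part of v in one shell yields the bound of order \<rho>^(\<beta> - \<sigma> p).\<close>

lemma riesz_lower_bound:
  fixes v :: "'a::euclidean_space \<Rightarrow> real"
  assumes \<beta>: "0 < \<beta>" "\<beta> < real DIM('a)" and v: "\<And>y. v y \<ge> 0"
    and int: "integrable lborel (\<lambda>y. riesz_kernel \<beta> (x - y) * v y)"
    and D: "D > 0" "\<And>y. w y \<noteq> 0 \<Longrightarrow> norm (x - y) \<le> D" and w: "\<And>y. 0 \<le> w y \<and> w y \<le> v y"
    and [measurable]: "w \<in> borel_measurable borel"
  shows "riesz_const TYPE('a) \<beta> * D powr (- (real DIM('a) - \<beta>)) * (\<integral>y. w y \<partial>lborel) \<le> (\<integral>y. riesz_kernel \<beta> (x - y) * v y \<partial>lborel)"
proof -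
  define c where "c = riesz_const TYPE('a) \<beta>"
  have c: "c > 0" using riesz_const_pos[OF \<beta>] by (simp add: c_def)
  let ?t = "real DIM('a) - \<beta>"
  have "c * D powr (- ?t) * (\<integral>y. w y \<partial>lborel) = (\<integral>y. c * D powr (- ?t) * w y \<partial>lborel)" by simp
  also have "\<dots> \<le> (\<integral>y. riesz_kernel \<beta> (x - y) * v y \<partial>lborel)"
  proof (rule integral_mono_AE')
    show "AE y in lborel. c * D powr (- ?t) * w y \<le> riesz_kernel \<beta> (x - y) * v y"
      \<comment> \<open>At \<open>y = x\<close> the kernel has the value 0 by the convention for
        \<open>powr\<close>, so the pointwise comparison can fail there.\<close>
      using AE_lborel_singleton[of x]
    proof eventually_elim
      case (elim y)
      show ?case
      proof (cases "w y = 0")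
        case True
        then show ?thesis using riesz_kernel_nonneg[OF \<beta>, of "x - y"] v[of y] by simp
      next
        case False
        have "D powr (- ?t) \<le> norm (x - y) powr (- ?t)"
          using D(2)[OF False] elim \<beta> by (intro powr_mono2') auto
        then have "c * D powr (- ?t) * w y \<le> riesz_kernel \<beta> (x - y) * w y"
          unfolding riesz_kernel_def c_def[symmetric] using w[of y] c by (intro mult_right_mono mult_left_mono) auto
        also have "\<dots> \<le> riesz_kernel \<beta> (x - y) * v y"
          using w[of y] riesz_kernel_nonneg[OF \<beta>, of "x - y"] by (intro mult_left_mono) auto
        finally show ?thesis .
      qed
    qed
    show "AE y in lborel. 0 \<le> riesz_kernel \<beta> (x - y) * v y"
      using riesz_kernel_nonneg[OF \<beta>] v by simp
  qed (rule int)
  finally show ?thesis by (simp add: c_def)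
qed

text \<open>Put R = |x| / 2 and let N be the dimension. Near 0 the kernel is at most its value at
  distance R, and |y|^-s is integrable as s < N; near x the roles are exchanged; elsewhere |x - y|
  is at least |y| / 3, and the product is integrable at infinity as s > \<beta>. Each region
  contributes a multiple of R^(\<beta> - s).\<close>

lemma riesz_upper_bound:
  fixes s :: real
  assumes \<beta>: "0 < \<beta>" "\<beta> < real DIM('a::euclidean_space)" and s: "\<beta> < s" "s < real DIM('a)"
  obtains C where "C \<ge> 0" "\<And>x::'a. x \<noteq> 0 \<Longrightarrow>
    (\<integral>\<^sup>+y. ennreal (riesz_kernel \<beta> (x - y) * norm y powr (- s)) \<partial>lborel) \<le> ennreal (C * norm x powr (\<beta> - s))"
proof -
  let ?N = "real DIM('a)"
  let ?t = "?N - \<beta>"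
  define c where "c = riesz_const TYPE('a) \<beta>"
  have c: "c > 0" using riesz_const_pos[OF \<beta>] by (simp add: c_def)
  obtain C1 where C1: "C1 \<ge> 0" "\<And>R. R > 0 \<Longrightarrow> (\<integral>\<^sup>+x. ennreal (norm x powr (- s)) * indicator (ball (0::'a) R) x \<partial>lborel) \<le> ennreal (C1 * R powr (?N - s))"
    using nn_integral_norm_powr_ball[of s, where 'a = 'a] s \<beta> by auto
  obtain C2 where C2: "C2 \<ge> 0" "\<And>R. R > 0 \<Longrightarrow> (\<integral>\<^sup>+x. ennreal (norm x powr (- ?t)) * indicator (ball (0::'a) R) x \<partial>lborel) \<le> ennreal (C2 * R powr (?N - ?t))"
    using nn_integral_norm_powr_ball[of ?t, where 'a = 'a] \<beta> by auto
  obtain C3 where C3: "C3 \<ge> 0" "\<And>R. R > 0 \<Longrightarrow> (\<integral>\<^sup>+x. ennreal (norm x powr (- (?t + s))) * indicator (- ball (0::'a) R) x \<partial>lborel) \<le> ennreal (C3 * R powr (?N - (?t + s)))"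
    using nn_integral_norm_powr_exterior[of "?t + s", where 'a = 'a] s by auto
  define E where "E = (C1 + C2 + 3 powr ?t * C3) * (1/2) powr (\<beta> - s)"
  have E: "E \<ge> 0" using C1 C2 C3 by (simp add: E_def)
  show thesis
  proof (rule that[of "c * E"])
    show "c * E \<ge> 0" using c E by simp
    fix x :: 'a assume x: "x \<noteq> 0"
    define R where "R = norm x / 2"
    have R: "R > 0" using x by (simp add: R_def)
    have [measurable]: "ball (0::'a) R \<in> sets borel" by simp
    let ?f1 = "\<lambda>y::'a. ennreal (R powr (- ?t)) * (ennreal (norm y powr (- s)) * indicator (ball 0 R) y)"
    let ?g2 = "\<lambda>y::'a. ennreal (norm y powr (- ?t)) * indicator (ball 0 R) y"
    let ?f3 = "\<lambda>y::'a. ennreal (3 powr ?t) * (ennreal (norm y powr (- (?t + s))) * indicator (- ball 0 R) y)"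
    have pw: "ennreal (riesz_kernel \<beta> (x - y) * norm y powr (- s)) \<le> ennreal c * (?f1 y + ennreal (R powr (- s)) * ?g2 (x - y) + ?f3 y)" for y
    proof -
      let ?A = "norm (x - y) powr (- ?t)" and ?B = "norm y powr (- s)"
      have "ennreal (?A * ?B) \<le> ?f1 y + ennreal (R powr (- s)) * ?g2 (x - y) + ?f3 y"
      proof -
        have tri: "2 * R \<le> norm (x - y) + norm y"
          using norm_triangle_ineq[of "x - y" y] by (simp add: R_def)
        consider "norm y < R" | "norm y \<ge> R" "norm (x - y) < R" | "norm y \<ge> R" "norm (x - y) \<ge> R" by linarith
        then show ?thesis
        proof cases
          case 1
          then have "?A \<le> R powr (- ?t)" using tri R \<beta> by (intro powr_mono2') auto
          then have "ennreal (?A * ?B) \<le> ennreal (R powr (- ?t) * ?B)" by (intro ennreal_leI mult_right_mono) auto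
          also have "\<dots> = ?f1 y" using 1 by (simp add: ennreal_mult)
          finally show ?thesis by (simp add: add_increasing2)
        next
          case 2
          then have "?B \<le> R powr (- s)" using R s \<beta> by (intro powr_mono2') auto
          then have "ennreal (?A * ?B) \<le> ennreal (R powr (- s) * ?A)" by (subst mult.commute) (intro ennreal_leI mult_right_mono, auto)
          also have "\<dots> = ennreal (R powr (- s)) * ?g2 (x - y)" using 2 by (simp add: ennreal_mult)
          finally show ?thesis by (simp add: add_increasing add_increasing2)
        next
          case 3
          have "norm y \<le> norm (x - y) + norm x" using norm_triangle_ineq4[of x "x - y"] by simp
          \<comment> \<open>Here \<open>norm x = 2 * R \<le> 2 * norm (x - y)\<close>, whence the
            3.\<close>
          then have le: "norm y / 3 \<le> norm (x - y)" using 3 by (simp add: R_def)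
          have yp: "norm y > 0" using 3 R by linarith
          then have "?A \<le> (norm y / 3) powr (- ?t)" using le \<beta> by (intro powr_mono2') auto
          also have "\<dots> = 3 powr ?t * norm y powr (- ?t)"
          proof -
            have "(norm y / 3) powr (- a) = 3 powr a * norm y powr (- a)" for a :: real
              using yp by (simp add: powr_divide powr_minus field_simps)
            then show ?thesis by blast
          qed
          finally have "?A * ?B \<le> 3 powr ?t * norm y powr (- ?t) * ?B" by (intro mult_right_mono) auto
          also have "\<dots> = 3 powr ?t * norm y powr (- (?t + s))"
            by (simp add: powr_add[symmetric] mult.assoc)
          finally have "ennreal (?A * ?B) \<le> ennreal (3 powr ?t * norm y powr (- (?t + s)))" by (rule ennreal_leI)
          also have "\<dots> = ?f3 y" using 3 by (simp add: ennreal_mult)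
          finally show ?thesis by (simp add: add_increasing)
        qed
      qed
      then have "ennreal c * ennreal (?A * ?B) \<le> ennreal c * (?f1 y + ennreal (R powr (- s)) * ?g2 (x - y) + ?f3 y)"
        by (rule mult_left_mono) simp
      then show ?thesis using c by (simp add: riesz_kernel_def c_def ennreal_mult mult.assoc)
    qed
    have g2: "(\<integral>\<^sup>+y. ?g2 (x - y) \<partial>lborel) = (\<integral>\<^sup>+y. ?g2 y \<partial>lborel)"
      by (rule nn_integral_lborel_minus) measurable
    have "(\<integral>\<^sup>+y. ennreal (riesz_kernel \<beta> (x - y) * norm y powr (- s)) \<partial>lborel)
      \<le> (\<integral>\<^sup>+y. ennreal c * (?f1 y + ennreal (R powr (- s)) * ?g2 (x - y) + ?f3 y) \<partial>lborel)"
      by (rule nn_integral_mono) (rule pw)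
    also have "\<dots> = ennreal c * (ennreal (R powr (- ?t)) * (\<integral>\<^sup>+y. ennreal (norm y powr (- s)) * indicator (ball (0::'a) R) y \<partial>lborel)
        + ennreal (R powr (- s)) * (\<integral>\<^sup>+y. ?g2 y \<partial>lborel)
        + ennreal (3 powr ?t) * (\<integral>\<^sup>+y. ennreal (norm y powr (- (?t + s))) * indicator (- ball (0::'a) R) y \<partial>lborel))"
      unfolding g2[symmetric] by (simp add: nn_integral_cmult nn_integral_add)
    also have "\<dots> \<le> ennreal c * (ennreal (R powr (- ?t)) * ennreal (C1 * R powr (?N - s))
        + ennreal (R powr (- s)) * ennreal (C2 * R powr (?N - ?t))
        + ennreal (3 powr ?t) * ennreal (C3 * R powr (?N - (?t + s))))"
      by (intro mult_left_mono add_mono C1(2) C2(2) C3(2) R) auto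
    also have "\<dots> = ennreal (c * (R powr (- ?t) * (C1 * R powr (?N - s)) + R powr (- s) * (C2 * R powr (?N - ?t)) + 3 powr ?t * (C3 * R powr (?N - (?t + s)))))"
      using c C1(1) C2(1) C3(1) by (simp flip: ennreal_mult ennreal_plus)
    also have "c * (R powr (- ?t) * (C1 * R powr (?N - s)) + R powr (- s) * (C2 * R powr (?N - ?t)) + 3 powr ?t * (C3 * R powr (?N - (?t + s))))
      = c * ((C1 + C2 + 3 powr ?t * C3) * R powr (\<beta> - s))"
    proof -
      have "R powr (- ?t) * R powr (?N - s) = R powr (\<beta> - s)" "R powr (- s) * R powr (?N - ?t) = R powr (\<beta> - s)"
        "?N - (?t + s) = \<beta> - s" unfolding powr_add[symmetric] by auto
      then show ?thesis by (simp add: algebra_simps)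
    qed
    also have "R powr (\<beta> - s) = (1/2) powr (\<beta> - s) * norm x powr (\<beta> - s)"
      unfolding R_def using x by (subst powr_mult[symmetric]) auto
    also have "c * ((C1 + C2 + 3 powr ?t * C3) * ((1/2) powr (\<beta> - s) * norm x powr (\<beta> - s))) = c * E * norm x powr (\<beta> - s)"
      by (simp add: E_def)
    finally show "(\<integral>\<^sup>+y. ennreal (riesz_kernel \<beta> (x - y) * norm y powr (- s)) \<partial>lborel) \<le> ennreal (c * E * norm x powr (\<beta> - s))" .
  qed
qed

subsection \<open>Necessity\<close>

text \<open>Translations, Tonelli and mollification are handled above for Borel functions, while the
  definition of a solution speaks of Lebesgue measurable ones; a representative built coordinate by
  coordinate bridges the two.\<close>

lemma borel_version:
  fixes f :: "'a::euclidean_space \<Rightarrow> 'b::euclidean_space"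
  assumes f: "f \<in> borel_measurable lebesgue"
  obtains f' where "f' \<in> borel_measurable borel" "AE x in lborel. f x = f' x"
proof -
  have "\<exists>g. g \<in> borel_measurable lborel \<and> (AE x in lborel. f x \<bullet> b = g x)" for b
    using completion_ex_borel_measurable_real[of "\<lambda>x. f x \<bullet> b" lborel] f by auto
  then obtain g where g: "\<And>b. g b \<in> borel_measurable lborel" "\<And>b. AE x in lborel. f x \<bullet> b = g b x" by metis
  have "AE x in lborel. \<forall>b\<in>Basis. f x \<bullet> b = g b x"
    by (rule AE_finite_allI) (auto intro: g)
  then have "AE x in lborel. f x = (\<Sum>b\<in>Basis. g b x *\<^sub>R b)"
  proof eventually_elim
    case (elim x)
    have "f x = (\<Sum>b\<in>Basis. (f x \<bullet> b) *\<^sub>R b)" by (simp add: euclidean_representation)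
    also have "\<dots> = (\<Sum>b\<in>Basis. g b x *\<^sub>R b)" using elim by (intro sum.cong) auto
    finally show ?case .
  qed
  moreover have "(\<lambda>x. \<Sum>b\<in>Basis. g b x *\<^sub>R b) \<in> borel_measurable borel"
    using g(1) by (auto intro!: borel_measurable_sum borel_measurable_scaleR)
  ultimately show thesis using that by blast
qed

lemma lebesgue_lborel_cong:
  fixes F :: "'a::euclidean_space \<Rightarrow> 'b::euclidean_space"
  assumes F: "F \<in> borel_measurable lebesgue" and F': "F' \<in> borel_measurable borel" and eq: "AE x in lborel. F x = F' x"
  shows "integral\<^sup>L lebesgue F = integral\<^sup>L lborel F'" "integrable lebesgue F \<longleftrightarrow> integrable lborel F'"
proof -
  have F'2: "F' \<in> borel_measurable lborel" using F' by simp
  have F'3: "F' \<in> borel_measurable lebesgue" by (rule measurable_completion[OF F'2])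
  have eq': "AE x in lebesgue. F x = F' x" by (rule AE_completion[OF eq])
  have "integral\<^sup>L lebesgue F = integral\<^sup>L lebesgue F'" by (rule integral_cong_AE[OF F F'3 eq'])
  also have "\<dots> = integral\<^sup>L lborel F'" by (rule integral_completion[OF F'2])
  finally show "integral\<^sup>L lebesgue F = integral\<^sup>L lborel F'" .
  have "integrable lebesgue F \<longleftrightarrow> integrable lebesgue F'" by (rule integrable_cong_AE[OF F F'3 eq'])
  also have "\<dots> \<longleftrightarrow> integrable lborel F'" by (rule integrable_completion[OF F'2])
  finally show "integrable lebesgue F \<longleftrightarrow> integrable lborel F'" .
qed

lemma Lp_loc_lborel:
  fixes f :: "'a::euclidean_space \<Rightarrow> 'b::euclidean_space"
  assumes f: "f \<in> Lp_loc s \<Omega>" and fb: "fb \<in> borel_measurable borel" and eq: "AE x in lborel. indicator \<Omega> x *\<^sub>R f x = fb x"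
    and K: "compact K" "K \<subseteq> \<Omega>"
  shows "integrable lborel (\<lambda>x. indicator K x * norm (fb x) powr s)"
proof -
  have [measurable]: "K \<in> sets borel" using K(1) by (rule borel_compact)
  note [measurable] = fb
  have i: "integrable lebesgue (\<lambda>x. indicator K x *\<^sub>R norm (f x) powr s)"
    using f K by (auto simp: Lp_loc_def set_integrable_def)
  show ?thesis
  proof (rule lebesgue_lborel_cong(2)[THEN iffD1, OF _ _ _ i])
    show "(\<lambda>x. indicator K x *\<^sub>R norm (f x) powr s) \<in> borel_measurable lebesgue" using i by (rule borel_measurable_integrable)
    show "(\<lambda>x. indicator K x * norm (fb x) powr s) \<in> borel_measurable borel" by measurable
    show "AE x in lborel. indicator K x *\<^sub>R norm (f x) powr s = indicator K x * norm (fb x) powr s"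
      using eq
    proof eventually_elim
      case (elim x)
      then show ?case using K(2) by (cases "x \<in> K") (auto simp: indicator_def subset_iff)
    qed
  qed
qed

lemma Lp_loc_1_integrable:
  fixes f :: "'a::euclidean_space \<Rightarrow> 'b::euclidean_space"
  assumes f: "f \<in> Lp_loc 1 \<Omega>" and fb: "fb \<in> borel_measurable borel" and eq: "AE x in lborel. indicator \<Omega> x *\<^sub>R f x = fb x"
    and K: "compact K" "K \<subseteq> \<Omega>"
  shows "integrable lborel (\<lambda>x. indicator K x *\<^sub>R fb x)"
proof -
  have [measurable]: "K \<in> sets borel" using K(1) by (rule borel_compact)
  note [measurable] = fb
  have "integrable lborel (\<lambda>x. norm (indicator K x *\<^sub>R fb x))"
    using Lp_loc_lborel[OF assms] by simp
  moreover have "(\<lambda>x. indicator K x *\<^sub>R fb x) \<in> borel_measurable lborel" by measurable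
  ultimately show ?thesis using integrable_norm_iff by blast
qed

lemma Lp_loc_borel_version:
  fixes f :: "'a::euclidean_space \<Rightarrow> 'b::euclidean_space"
  assumes f: "f \<in> Lp_loc s \<Omega>"
  obtains fb where "fb \<in> borel_measurable borel" "AE x in lborel. indicator \<Omega> x *\<^sub>R f x = fb x"
  using borel_version[of "\<lambda>x. indicator \<Omega> x *\<^sub>R f x"] f by (auto simp: Lp_loc_def set_borel_measurable_def)

text \<open>The definition tests one coordinate at a time. With a Borel representative the
  coordinates combine into one vector identity, the form in which the gradient of a mollification is
  computed.\<close>

lemma weak_gradient_lborel:
  fixes u v :: "'a::euclidean_space \<Rightarrow> real"
  assumes wg: "weak_gradient \<Omega> u g" and v: "v \<in> borel_measurable borel" "\<And>x. x \<in> \<Omega> \<Longrightarrow> v x = u x" "continuous_on \<Omega> u"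
    and gb: "gb \<in> borel_measurable borel" "AE x in lborel. indicator \<Omega> x *\<^sub>R g x = gb x"
    and \<phi>: "\<phi> \<in> test_functions \<Omega>"
  shows "(\<integral>x. v x *\<^sub>R grad \<phi> x \<partial>lborel) = - (\<integral>x. \<phi> x *\<^sub>R gb x \<partial>lborel)"
proof -
  obtain K where K: "C1_grad \<phi> (grad \<phi>)" "compact K" "K \<subseteq> \<Omega>" "\<And>x. x \<notin> K \<Longrightarrow> \<phi> x = 0" "\<And>x. x \<notin> K \<Longrightarrow> grad \<phi> x = 0"
    using test_functionsD[OF \<phi>] by blast
  have c: "continuous_on UNIV \<phi>" "continuous_on UNIV (grad \<phi>)"
    using C1_grad_continuous'[OF K(1)] C1_grad_continuous[OF K(1)] by auto
  have meas[measurable]: "\<phi> \<in> borel_measurable borel" "grad \<phi> \<in> borel_measurable borel" "K \<in> sets borel"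
    using c K(2) by (auto intro: borel_measurable_continuous_onI borel_compact)
  note [measurable] = v(1) gb(1)
  obtain R where "\<And>x. x \<in> K \<Longrightarrow> norm x \<le> R"
    using compact_imp_bounded[OF K(2)] by (auto simp: bounded_iff)
  then have R: "x \<notin> K" if "norm x > R" for x using that by force
  obtain D where D: "\<And>x. norm (grad \<phi> x) \<le> D" using bounded_continuous_compact_support[OF c(2), of R] K(5) R by metis
  obtain B where B: "\<And>x. norm (\<phi> x) \<le> B" using bounded_continuous_compact_support[OF c(1), of R] K(4) R by metis
  have iv: "integrable lborel (\<lambda>x. v x *\<^sub>R grad \<phi> x)"
  proof -
    have "continuous_on K v" using continuous_on_subset[OF v(3) K(3)] v(2) K(3) by (subst continuous_on_cong[where g = u]) auto
    then have "integrable lborel (\<lambda>x. indicator K x *\<^sub>R v x)" by (rule borel_integrable_compact[OF K(2)])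
    then have "integrable lborel (\<lambda>x. (indicator K x *\<^sub>R v x) *\<^sub>R grad \<phi> x)"
      by (rule integrable_scaleR_bounded) (use D in auto)
    also have "(\<lambda>x. (indicator K x *\<^sub>R v x) *\<^sub>R grad \<phi> x) = (\<lambda>x. v x *\<^sub>R grad \<phi> x)"
      using K(5) by (auto simp: indicator_def fun_eq_iff)
    finally show ?thesis .
  qed
  have ig: "integrable lborel (\<lambda>x. \<phi> x *\<^sub>R gb x)"
  proof -
    have "g \<in> Lp_loc 1 \<Omega>" using wg by (simp add: weak_gradient_def)
    from Lp_loc_1_integrable[OF this gb K(2,3)]
    have "integrable lborel (\<lambda>x. \<phi> x *\<^sub>R (indicator K x *\<^sub>R gb x))"
      by (rule integrable_bounded_scaleR) (use B in auto)
    also have "(\<lambda>x. \<phi> x *\<^sub>R (indicator K x *\<^sub>R gb x)) = (\<lambda>x. \<phi> x *\<^sub>R gb x)"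
      using K(4) by (auto simp: indicator_def fun_eq_iff)
    finally show ?thesis .
  qed
  have "(\<integral>x. v x *\<^sub>R grad \<phi> x \<partial>lborel) \<bullet> b = (- (\<integral>x. \<phi> x *\<^sub>R gb x \<partial>lborel)) \<bullet> b" if b: "b \<in> Basis" for b
  proof -
    have "(LINT x:\<Omega>|lebesgue. u x * (grad \<phi> x \<bullet> b)) = (\<integral>x. (v x *\<^sub>R grad \<phi> x) \<bullet> b \<partial>lebesgue)"
      unfolding set_lebesgue_integral_def
    proof (rule Bochner_Integration.integral_cong)
      fix x
      show "indicator \<Omega> x *\<^sub>R (u x * (grad \<phi> x \<bullet> b)) = (v x *\<^sub>R grad \<phi> x) \<bullet> b"
      proof (cases "x \<in> \<Omega>")
        case False
        then have "grad \<phi> x = 0" using K(3,5) by blast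
        then show ?thesis by simp
      qed (simp add: v(2))
    qed simp
    also have "\<dots> = (\<integral>x. (v x *\<^sub>R grad \<phi> x) \<bullet> b \<partial>lborel)" by (rule integral_completion) measurable
    also have "\<dots> = (\<integral>x. v x *\<^sub>R grad \<phi> x \<partial>lborel) \<bullet> b" by (rule integral_inner_left) (rule iv)
    finally have 1: "(LINT x:\<Omega>|lebesgue. u x * (grad \<phi> x \<bullet> b)) = (\<integral>x. v x *\<^sub>R grad \<phi> x \<partial>lborel) \<bullet> b" .
    have "(LINT x:\<Omega>|lebesgue. (g x \<bullet> b) * \<phi> x) = (\<integral>x. (\<phi> x *\<^sub>R gb x) \<bullet> b \<partial>lborel)"
      unfolding set_lebesgue_integral_def
    proof (rule lebesgue_lborel_cong(1))
      have G[measurable]: "(\<lambda>x. indicator \<Omega> x *\<^sub>R g x) \<in> borel_measurable lebesgue"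
      proof -
        have "g \<in> Lp_loc 1 \<Omega>" using wg by (simp add: weak_gradient_def)
        then show ?thesis by (simp add: Lp_loc_def set_borel_measurable_def)
      qed
      have P[measurable]: "\<phi> \<in> borel_measurable lebesgue" by (rule measurable_completion) simp
      have "(\<lambda>x. ((indicator \<Omega> x *\<^sub>R g x) \<bullet> b) * \<phi> x) \<in> borel_measurable lebesgue" by measurable
      then show "(\<lambda>x. indicator \<Omega> x *\<^sub>R ((g x \<bullet> b) * \<phi> x)) \<in> borel_measurable lebesgue" by (simp add: mult.assoc)
      show "(\<lambda>x. (\<phi> x *\<^sub>R gb x) \<bullet> b) \<in> borel_measurable borel" by measurable
      show "AE x in lborel. indicator \<Omega> x *\<^sub>R ((g x \<bullet> b) * \<phi> x) = (\<phi> x *\<^sub>R gb x) \<bullet> b"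
        using gb(2)
      proof eventually_elim
        case (elim x)
        then show ?case by (simp add: elim[symmetric] mult_ac)
      qed
    qed
    also have "\<dots> = (\<integral>x. \<phi> x *\<^sub>R gb x \<partial>lborel) \<bullet> b" by (rule integral_inner_left) (rule ig)
    finally show ?thesis using wg \<phi> b 1 by (simp add: weak_gradient_def)
  qed
  then show ?thesis by (rule euclidean_eqI)
qed

lemma compact_in_punctured_ball:
  fixes K :: "'a::euclidean_space set"
  assumes "compact K" "K \<subseteq> ball 0 1 - {0}"
  obtains a b where "0 < a" "b < 1" "K \<subseteq> annulus a b"
proof (cases "K = {}")
  case False
  have c: "continuous_on K norm" by (intro continuous_intros)
  obtain x0 x1 where "x0 \<in> K" "\<forall>y\<in>K. norm x0 \<le> norm y" "x1 \<in> K" "\<forall>y\<in>K. norm y \<le> norm x1"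
    using continuous_attains_inf[OF assms(1) False c] continuous_attains_sup[OF assms(1) False c] by blast
  then show thesis using assms(2) by (intro that[of "norm x0" "norm x1"]) auto
qed (use that[of 1 0] in auto)

section \<open>Reduction of a solution to the local setting\<close>

definition riesz_rhs :: "real \<Rightarrow> real \<Rightarrow> real \<Rightarrow> ('a::euclidean_space \<Rightarrow> real) \<Rightarrow> 'a \<Rightarrow> real" where
  "riesz_rhs \<beta> p q u x = indicator punctured_ball x * (riesz_conv \<beta> p u x * u x powr q)"

text \<open>Off the punctured ball u is arbitrary, but \<open>weak_sol\<close> wants a function that
  is positive everywhere; the value 1 is a positive placeholder.\<close>

definition extend_by_1 :: "('a::euclidean_space \<Rightarrow> real) \<Rightarrow> 'a \<Rightarrow> real" where
  "extend_by_1 u x = (if x \<in> punctured_ball then u x else 1)"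

lemma punctured_ball_powr_measurable:
  fixes u :: "'a::euclidean_space \<Rightarrow> real"
  assumes "continuous_on punctured_ball u" "\<And>x. x \<in> punctured_ball \<Longrightarrow> u x > 0"
  shows "(\<lambda>y. indicator punctured_ball y * u y powr p) \<in> borel_measurable borel"
    and "extend_by_1 u \<in> borel_measurable borel"
proof -
  have "(\<lambda>y. indicator punctured_ball y *\<^sub>R u y powr p) \<in> borel_measurable borel"
    using assms by (intro borel_measurable_continuous_on_indicator continuous_intros) (auto simp: less_imp_neq[symmetric])
  then show "(\<lambda>y. indicator punctured_ball y * u y powr p) \<in> borel_measurable borel" by simp
  have 1: "(\<lambda>y. indicator punctured_ball y *\<^sub>R u y) \<in> borel_measurable borel"
    using assms by (intro borel_measurable_continuous_on_indicator) auto
  have [measurable]: "punctured_ball \<in> sets (borel :: 'a measure)" by simp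
  have "extend_by_1 u = (\<lambda>y. indicator punctured_ball y *\<^sub>R u y + indicator (- punctured_ball) y)"
    by (auto simp: extend_by_1_def fun_eq_iff indicator_def)
  also have "\<dots> \<in> borel_measurable borel" using 1 by measurable
  finally show "extend_by_1 u \<in> borel_measurable borel" .
qed

text \<open>In the punctured ball u is continuous, hence u^p is bounded near x, and u^p is
  integrable over the ball; \<open>riesz_integrable\<close> then shows that the potential is a
  genuine integral and not the default value 0.\<close>

lemma positive_solution_riesz:
  fixes u :: "'a::euclidean_space \<Rightarrow> real"
  assumes sol: "positive_solution m p q \<alpha> \<beta> u" and \<beta>: "0 < \<beta>" "\<beta> < real DIM('a)"
  defines "v \<equiv> \<lambda>y. indicator punctured_ball y * u y powr p"
  shows "v \<in> borel_measurable borel" "integrable lborel v" "riesz_conv \<beta> p u x = (\<integral>y. riesz_kernel \<beta> (x - y) * v y \<partial>lborel)"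
    "x \<in> punctured_ball \<Longrightarrow> integrable lborel (\<lambda>y. riesz_kernel \<beta> (x - y) * v y)"
proof -
  have cont: "continuous_on punctured_ball u" and pos: "\<And>x. x \<in> punctured_ball \<Longrightarrow> u x > 0"
    and int: "set_integrable lebesgue (ball 0 1) (\<lambda>x. u x powr p)"
    using sol by (auto simp: positive_solution_def Let_def intro: continuous_on_subset)
  show v[measurable]: "v \<in> borel_measurable borel" unfolding v_def by (rule punctured_ball_powr_measurable[OF cont pos])
  show iv: "integrable lborel v"
  proof (rule lebesgue_lborel_cong(2)[THEN iffD1, OF _ _ _ int[unfolded set_integrable_def]])
    show "(\<lambda>x. indicator (ball 0 1) x *\<^sub>R u x powr p) \<in> borel_measurable lebesgue"
      using int unfolding set_integrable_def by (rule borel_measurable_integrable)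
    show "AE x in lborel. indicator (ball 0 1) x *\<^sub>R u x powr p = v x"
      using AE_lborel_singleton[of "0::'a"] by eventually_elim (auto simp: v_def indicator_def)
  qed (rule v)
  show "riesz_conv \<beta> p u x = (\<integral>y. riesz_kernel \<beta> (x - y) * v y \<partial>lborel)"
    by (rule riesz_conv_lborel[OF v]) (simp add: v_def)
  show "integrable lborel (\<lambda>y. riesz_kernel \<beta> (x - y) * v y)" if x: "x \<in> punctured_ball"
  proof -
    have "open (punctured_ball :: 'a set)" by auto
    then obtain \<delta> where \<delta>: "\<delta> > 0" "cball x \<delta> \<subseteq> punctured_ball" using x by (meson open_contains_cball)
    have "continuous_on (cball x \<delta>) (\<lambda>y. u y powr p)"
      using continuous_on_subset[OF cont \<delta>(2)] pos \<delta>(2) by (intro continuous_intros) (auto simp: less_imp_neq[symmetric] subset_iff)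
    from compact_continuous_image[OF this compact_cball]
    obtain M where M: "\<forall>z\<in>(\<lambda>y. u y powr p) ` cball x \<delta>. norm z \<le> M" using compact_imp_bounded bounded_iff by metis
    show ?thesis
    proof (rule riesz_integrable[OF \<beta> iv _ \<delta>(1)])
      show "v y \<ge> 0" for y by (simp add: v_def)
      fix y assume "norm (x - y) < \<delta>"
      then have "y \<in> cball x \<delta>" by (simp add: dist_norm)
      then have "u y powr p \<le> M" using M by fastforce
      moreover have "y \<in> punctured_ball" using \<open>y \<in> cball x \<delta>\<close> \<delta>(2) by blast
      ultimately show "v y \<le> M" by (simp add: v_def)
    qed
  qed
qed

text \<open>Two points of the unit ball are at distance at most 2, and the integral of u^p is
  positive. This is the absorption bound with \<tau> = 0.\<close>

lemma positive_solution_riesz_pos: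
  fixes u :: "'a::euclidean_space \<Rightarrow> real"
  assumes sol: "positive_solution m p q \<alpha> \<beta> u" and \<beta>: "0 < \<beta>" "\<beta> < real DIM('a)"
  obtains c where "c > 0" "\<And>x. x \<in> punctured_ball \<Longrightarrow> c \<le> riesz_conv \<beta> p u x"
proof -
  define v where "v y = indicator punctured_ball y * u y powr p" for y
  note r = positive_solution_riesz[OF sol \<beta>, folded v_def]
  have pos: "\<And>x. x \<in> punctured_ball \<Longrightarrow> u x > 0" using sol by (auto simp: positive_solution_def Let_def)
  have v0: "v y \<ge> 0" for y by (simp add: v_def)
  have "(\<integral>y. v y \<partial>lborel) \<noteq> 0"
  proof
    assume "(\<integral>y. v y \<partial>lborel) = 0"
    then have "AE y in lborel. v y = 0" using integral_nonneg_eq_0_iff_AE[OF r(2)] v0 by auto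
    then have "AE y in lborel. y \<notin> ball (0::'a) 1"
      using AE_lborel_singleton[of "0::'a"]
    proof eventually_elim
      case (elim y)
      then show ?case using pos[of y] by (auto simp: v_def)
    qed
    then have "emeasure lborel (ball (0::'a) 1) = 0" by (subst (asm) AE_iff_measurable[of "ball 0 1"]) auto
    moreover have "0 < unit_ball_vol (real DIM('a))" by simp
    ultimately show False by (simp add: emeasure_ball ennreal_eq_0_iff del: unit_ball_vol_pos)
  qed
  then have iv: "(\<integral>y. v y \<partial>lborel) > 0" using v0 by (simp add: less_le)
  define c where "c = riesz_const TYPE('a) \<beta> * 2 powr (- (real DIM('a) - \<beta>)) * (\<integral>y. v y \<partial>lborel)"
  have "c > 0" using iv riesz_const_pos[OF \<beta>] by (simp add: c_def)
  moreover have "c \<le> riesz_conv \<beta> p u x" if x: "x \<in> punctured_ball" for x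
    unfolding c_def r(3)
  proof (rule riesz_lower_bound[OF \<beta> v0 r(4)[OF x]])
    show "norm (x - y) \<le> 2" if "v y \<noteq> 0" for y
      using that x norm_triangle_ineq4[of x y] by (auto simp: v_def indicator_def split: if_splits)
  qed (use v0 r(1) in auto)
  ultimately show thesis using that by blast
qed

text \<open>\<open>positive_solution\<close> supplies two weak gradients, one in L^m through
  \<open>W1_loc\<close> and one in the inequality. Their uniqueness lets a single Borel field
  \<open>gb\<close> serve as both, and \<open>weak_inequality_composite\<close> then provides the
  locale assumption \<open>test\<close>.\<close>

lemma positive_solution_weak_sol:
  fixes u :: "'a::euclidean_space \<Rightarrow> real"
  assumes sol: "positive_solution m p q \<alpha> \<beta> u" and \<beta>: "0 < \<beta>" "\<beta> < real DIM('a)" and m: "m > 1" and \<alpha>: "\<alpha> > 0"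
  obtains g where "weak_sol m \<alpha> (extend_by_1 u) (riesz_rhs \<beta> p q u) g"
proof -
  let ?\<Omega> = "punctured_ball :: 'a set"
  have o: "open ?\<Omega>" by auto
  have W: "u \<in> W1_loc m ?\<Omega>" and cont: "continuous_on ?\<Omega> u" and pos: "\<And>x. x \<in> ?\<Omega> \<Longrightarrow> u x > 0"
    and hL: "(\<lambda>x. riesz_conv \<beta> p u x * u x powr q) \<in> Lp_loc 1 ?\<Omega>"
    using sol by (auto simp: positive_solution_def Let_def intro: continuous_on_subset)
  obtain g where wg: "weak_gradient ?\<Omega> u g" and wd: "\<exists>h. weak_divergence ?\<Omega> (flux \<alpha> m g) h"
    and ineq: "\<And>\<phi>. \<phi> \<in> test_functions ?\<Omega> \<Longrightarrow> (\<And>x. \<phi> x \<ge> 0) \<Longrightarrow>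
      (LINT x:ball 0 1|lebesgue. flux \<alpha> m g x \<bullet> grad \<phi> x) + (LINT x:ball 0 1|lebesgue. riesz_conv \<beta> p u x * u x powr q * \<phi> x) \<le> 0"
    using sol by (auto simp: positive_solution_def Let_def)
  obtain g2 where wg2: "weak_gradient ?\<Omega> u g2" and g2m: "g2 \<in> Lp_loc m ?\<Omega>" using W by (auto simp: W1_loc_def)
  have gL: "g \<in> Lp_loc 1 ?\<Omega>" "g2 \<in> Lp_loc 1 ?\<Omega>" using wg wg2 by (auto simp: weak_gradient_def)
  have FL: "flux \<alpha> m g \<in> Lp_loc 1 ?\<Omega>" using wd by (auto simp: weak_divergence_def)
  obtain gb where gb[measurable]: "gb \<in> borel_measurable borel" and gbe: "AE x in lborel. indicator ?\<Omega> x *\<^sub>R g x = gb x"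
    using Lp_loc_borel_version[OF gL(1)] by blast
  obtain gb2 where gb2[measurable]: "gb2 \<in> borel_measurable borel" and gb2e: "AE x in lborel. indicator ?\<Omega> x *\<^sub>R g2 x = gb2 x"
    using Lp_loc_borel_version[OF gL(2)] by blast
  define v where "v = extend_by_1 u"
  have v: "v \<in> borel_measurable borel" "\<And>x. x \<in> ?\<Omega> \<Longrightarrow> v x = u x"
    using punctured_ball_powr_measurable(2)[OF cont pos] by (auto simp: v_def extend_by_1_def)
  have vpos: "v x > 0" for x using pos by (simp add: v_def extend_by_1_def)
  have vcont: "continuous_on ?\<Omega> v" using cont v(2) by (subst continuous_on_cong[where g = u]) auto
  have ug: "(\<integral>x. v x *\<^sub>R grad \<phi> x \<partial>lborel) = - (\<integral>x. \<phi> x *\<^sub>R gb x \<partial>lborel)"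
    and ug2: "(\<integral>x. v x *\<^sub>R grad \<phi> x \<partial>lborel) = - (\<integral>x. \<phi> x *\<^sub>R gb2 x \<partial>lborel)"
    if "\<phi> \<in> test_functions ?\<Omega>" for \<phi>
    using weak_gradient_lborel[OF wg v(1) _ cont gb gbe that] weak_gradient_lborel[OF wg2 v(1) _ cont gb2 gb2e that] v(2)
    by blast+
  note i1 = Lp_loc_1_integrable[OF gL(1) gb gbe] and i2 = Lp_loc_1_integrable[OF gL(2) gb2 gb2e]
  have ip: "integrable lborel (\<lambda>x. \<phi> x *\<^sub>R w x)"
    if \<phi>: "\<phi> \<in> test_functions ?\<Omega>" and w: "\<And>K. compact K \<Longrightarrow> K \<subseteq> ?\<Omega> \<Longrightarrow> integrable lborel (\<lambda>x. indicator K x *\<^sub>R w x)"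
    for \<phi> and w :: "'a \<Rightarrow> 'a"
  proof -
    obtain K where K: "C1_grad \<phi> (grad \<phi>)" "compact K" "K \<subseteq> ?\<Omega>" "\<And>x. x \<notin> K \<Longrightarrow> \<phi> x = 0"
      by (rule test_functionsD[OF \<phi>], rule that)
    have c: "continuous_on UNIV \<phi>" using C1_grad_continuous'[OF K(1)] .
    have "\<phi> x = 0" if "norm x > 1" for x
    proof (rule K(4))
      show "x \<notin> K" using K(3) that by auto
    qed
    then obtain B where B: "\<And>x. norm (\<phi> x) \<le> B" using bounded_continuous_compact_support[OF c, of 1] by metis
    have "integrable lborel (\<lambda>x. \<phi> x *\<^sub>R (indicator K x *\<^sub>R w x))"
      by (rule integrable_bounded_scaleR[OF w[OF K(2,3)], of _ B]) (use B c in \<open>auto intro: borel_measurable_continuous_onI\<close>)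
    also have "(\<lambda>x. \<phi> x *\<^sub>R (indicator K x *\<^sub>R w x)) = (\<lambda>x. \<phi> x *\<^sub>R w x)"
      using K(4) by (auto simp: indicator_def fun_eq_iff)
    finally show ?thesis .
  qed
  have "AE x in lborel. x \<in> ?\<Omega> \<longrightarrow> gb x - gb2 x = 0"
  proof (rule weak_zero_imp_AE_zero[OF o])
    show "integrable lborel (\<lambda>x. indicator K x *\<^sub>R (gb x - gb2 x))" if "compact K" "K \<subseteq> ?\<Omega>" for K
      unfolding scaleR_diff_right by (rule Bochner_Integration.integrable_diff[OF i1[OF that] i2[OF that]])
    show "(\<integral>x. \<phi> x *\<^sub>R (gb x - gb2 x) \<partial>lborel) = 0" if \<phi>: "\<phi> \<in> test_functions ?\<Omega>" for \<phi>
      unfolding scaleR_diff_right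
      using ug[OF \<phi>] ug2[OF \<phi>] ip[OF \<phi> i1] ip[OF \<phi> i2] by (subst Bochner_Integration.integral_diff) auto
  qed
  then have gb_eq: "AE x in lborel. indicator ?\<Omega> x *\<^sub>R g2 x = gb x"
    using gbe gb2e
  proof eventually_elim
    case (elim x)
    then show ?case by (cases "x \<in> ?\<Omega>") auto
  qed
  have gm: "integrable lborel (\<lambda>x. indicator K x * norm (gb x) powr m)" if "compact K" "K \<subseteq> ?\<Omega>" for K
    by (rule Lp_loc_lborel[OF g2m gb gb_eq that])
  have [measurable]: "flux \<alpha> m gb \<in> borel_measurable borel" unfolding flux_def by measurable
  have Fe: "AE x in lborel. indicator ?\<Omega> x *\<^sub>R flux \<alpha> m g x = flux \<alpha> m gb x"
    using gbe
  proof eventually_elim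
    case (elim x)
    then show ?case by (cases "x \<in> ?\<Omega>") (auto simp: flux_def)
  qed
  have Fi: "integrable lborel (\<lambda>x. indicator K x *\<^sub>R flux \<alpha> m gb x)" if "compact K" "K \<subseteq> ?\<Omega>" for K
    by (rule Lp_loc_1_integrable[OF FL _ Fe that]) measurable
  define w where "w y = indicator ?\<Omega> y * u y powr p" for y
  note r = positive_solution_riesz[OF sol \<beta>, folded w_def]
  note [measurable] = r(1)
  define h where "h = riesz_rhs \<beta> p q u"
  have h_meas[measurable]: "h \<in> borel_measurable borel"
  proof -
    have [measurable]: "(\<lambda>y. indicator ?\<Omega> y * u y powr q) \<in> borel_measurable borel"
      by (rule punctured_ball_powr_measurable[OF cont pos])
    have "h = (\<lambda>x. (\<integral>y. riesz_kernel \<beta> (x - y) * w y \<partial>lborel) * (indicator ?\<Omega> x * u x powr q))"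
      by (auto simp: h_def riesz_rhs_def r(3) fun_eq_iff)
    also have "\<dots> \<in> borel_measurable borel" by measurable
    finally show ?thesis .
  qed
  have he: "AE x in lborel. indicator ?\<Omega> x *\<^sub>R (riesz_conv \<beta> p u x * u x powr q) = h x"
    by (rule AE_I2) (simp add: h_def riesz_rhs_def)
  have hi: "integrable lborel (\<lambda>x. indicator K x *\<^sub>R h x)" if "compact K" "K \<subseteq> ?\<Omega>" for K
    by (rule Lp_loc_1_integrable[OF hL h_meas he that])
  obtain c where c: "c > 0" "\<And>x. x \<in> ?\<Omega> \<Longrightarrow> c \<le> riesz_conv \<beta> p u x"
    by (rule positive_solution_riesz_pos[OF sol \<beta>], rule that)
  have h_pos: "h x > 0" if "x \<in> ?\<Omega>" for x
    using c(1) c(2)[OF that] pos[OF that] that by (auto simp: h_def riesz_rhs_def intro!: mult_pos_pos)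
  have h_nonneg: "h x \<ge> 0" for x
    using h_pos[of x] by (cases "x \<in> ?\<Omega>") (auto simp: h_def riesz_rhs_def)
  have Fg: "\<exists>A\<ge>0. \<forall>x\<in>K. norm (flux \<alpha> m gb x) \<le> A * norm (gb x) powr (m - 1)" if "compact K" "K \<subseteq> ?\<Omega>" for K
  proof -
    obtain a b where ab: "0 < a" "b < 1" "K \<subseteq> annulus a b" using compact_in_punctured_ball[OF \<open>compact K\<close> \<open>K \<subseteq> ?\<Omega>\<close>] by blast
    have "norm (flux \<alpha> m gb x) \<le> a powr (- \<alpha>) * norm (gb x) powr (m - 1)" if "x \<in> K" for x
      unfolding norm_flux using ab that \<alpha> by (intro mult_right_mono powr_mono2') auto
    then show ?thesis by (intro exI[of _ "a powr (- \<alpha>)"]) auto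
  qed
  have ineq': "(\<integral>x. flux \<alpha> m gb x \<bullet> grad \<phi> x \<partial>lborel) + (\<integral>x. h x * \<phi> x \<partial>lborel) \<le> 0"
    if \<phi>: "\<phi> \<in> test_functions ?\<Omega>" "\<And>x. \<phi> x \<ge> 0" for \<phi>
  proof -
    obtain K where K: "C1_grad \<phi> (grad \<phi>)" "compact K" "K \<subseteq> ?\<Omega>" "\<And>x. x \<notin> K \<Longrightarrow> \<phi> x = 0" "\<And>x. x \<notin> K \<Longrightarrow> grad \<phi> x = 0"
      using test_functionsD[OF \<phi>(1)] by blast
    have [measurable]: "\<phi> \<in> borel_measurable borel" "grad \<phi> \<in> borel_measurable borel"
      using C1_grad_continuous'[OF K(1)] C1_grad_continuous[OF K(1)] by (auto intro: borel_measurable_continuous_onI)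
    have "(LINT x:ball 0 1|lebesgue. flux \<alpha> m g x \<bullet> grad \<phi> x) = (\<integral>x. flux \<alpha> m gb x \<bullet> grad \<phi> x \<partial>lborel)"
      unfolding set_lebesgue_integral_def
    proof (rule lebesgue_lborel_cong(1))
      have FM[measurable]: "(\<lambda>x. indicator ?\<Omega> x *\<^sub>R flux \<alpha> m g x) \<in> borel_measurable lebesgue"
        using FL by (auto simp: Lp_loc_def set_borel_measurable_def)
      have gM[measurable]: "grad \<phi> \<in> borel_measurable lebesgue" by (rule measurable_completion) simp
      have "(\<lambda>x. (indicator ?\<Omega> x *\<^sub>R flux \<alpha> m g x) \<bullet> grad \<phi> x) \<in> borel_measurable lebesgue" by measurable
      also have "(\<lambda>x. (indicator ?\<Omega> x *\<^sub>R flux \<alpha> m g x) \<bullet> grad \<phi> x) = (\<lambda>x. indicator (ball 0 1) x *\<^sub>R (flux \<alpha> m g x \<bullet> grad \<phi> x))"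
        using K(3,5) by (force simp: indicator_def fun_eq_iff)
      finally show "(\<lambda>x. indicator (ball 0 1) x *\<^sub>R (flux \<alpha> m g x \<bullet> grad \<phi> x)) \<in> borel_measurable lebesgue" .
      show "(\<lambda>x. flux \<alpha> m gb x \<bullet> grad \<phi> x) \<in> borel_measurable borel" by measurable
      show "AE x in lborel. indicator (ball 0 1) x *\<^sub>R (flux \<alpha> m g x \<bullet> grad \<phi> x) = flux \<alpha> m gb x \<bullet> grad \<phi> x"
        using Fe
      proof eventually_elim
        case (elim x)
        show ?case
        proof (cases "x \<in> ?\<Omega>")
          case True
          then show ?thesis using elim by simp
        next
          case False
          then show ?thesis using K(3,5) by (metis inner_zero_right scaleR_zero_right subsetD)
        qed
      qed
    qed
    moreover have "(LINT x:ball 0 1|lebesgue. riesz_conv \<beta> p u x * u x powr q * \<phi> x) = (\<integral>x. h x * \<phi> x \<partial>lborel)"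
    proof -
      have "(LINT x:ball 0 1|lebesgue. riesz_conv \<beta> p u x * u x powr q * \<phi> x) = (\<integral>x. h x * \<phi> x \<partial>lebesgue)"
        unfolding set_lebesgue_integral_def
      proof (rule Bochner_Integration.integral_cong)
        fix x
        show "indicator (ball 0 1) x *\<^sub>R (riesz_conv \<beta> p u x * u x powr q * \<phi> x) = h x * \<phi> x"
        proof (cases "x \<in> ?\<Omega>")
          case False
          then have "\<phi> x = 0" using K(3,4) by blast
          then show ?thesis by simp
        qed (simp add: h_def riesz_rhs_def)
      qed simp
      also have "\<dots> = (\<integral>x. h x * \<phi> x \<partial>lborel)" by (rule integral_completion) measurable
      finally show ?thesis .
    qed
    ultimately show ?thesis using ineq[OF \<phi>] by simp
  qed
  have asub: "annulus a b \<subseteq> ?\<Omega>" if "0 < a" "b < 1" for a b using that by auto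
  have "weak_sol m \<alpha> v h gb"
  proof
    show "m > 1" "\<alpha> > 0" "continuous_on ?\<Omega> v" by fact+
    show "v x > 0" "h x \<ge> 0" for x by fact+
    show "v \<in> borel_measurable borel" "gb \<in> borel_measurable borel" "h \<in> borel_measurable borel" by fact+
    show "h x > 0" if "x \<in> ?\<Omega>" for x by (rule h_pos[OF that])
    show "integrable lborel (\<lambda>x. indicator (annulus a b) x * h x)" if "0 < a" "b < 1" for a b
      using hi[OF compact_annulus asub[OF that]] by simp
    show "integrable lborel (\<lambda>x. indicator (annulus a b) x * norm (gb x) powr m)" if "0 < a" "b < 1" for a b
      by (rule gm[OF compact_annulus asub[OF that]])
    fix \<psi> \<psi>' and a b :: real and G G' :: "real \<Rightarrow> real"
    assume t: "C1_grad \<psi> \<psi>'" "\<And>x::'a. \<psi> x \<ge> 0" "0 < a" "b < 1" "\<And>x. x \<notin> annulus a b \<Longrightarrow> \<psi> x = 0"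
      "\<And>t. t > 0 \<Longrightarrow> (G has_real_derivative G' t) (at t)" "continuous_on {0<..} G'" "\<And>t. t > 0 \<Longrightarrow> G t \<ge> 0"
    show "(\<integral>x. G (v x) * (flux \<alpha> m gb x \<bullet> \<psi>' x) \<partial>lborel) + (\<integral>x. \<psi> x * G' (v x) * (flux \<alpha> m gb x \<bullet> gb x) \<partial>lborel)
        + (\<integral>x. h x * (\<psi> x * G (v x)) \<partial>lborel) \<le> 0"
    proof (rule weak_inequality_composite[OF o m vcont vpos gb gm i1 ug Fi _ Fg hi ineq' t(1,2) compact_annulus asub[OF t(3,4)] t(5) t(6,7,8)])
      show "flux \<alpha> m gb \<in> borel_measurable borel" by measurable
    qed
  qed
  then show thesis using that by (simp add: v_def h_def)
qed

text \<open>The lower bounds on shells contradict in turn the integrability of u^p, the absorption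
  by a constant potential, and the absorption by the potential of the mass of u^p near the same
  radius.\<close>

lemma singular_solution_exponents:
  fixes u :: "'a::euclidean_space \<Rightarrow> real"
  assumes sing: "singular_solution m p q \<alpha> \<beta> u" and \<beta>: "0 < \<beta>" "\<beta> < real DIM('a)"
    and m: "m > 1" and \<alpha>: "\<alpha> > 0" and p: "p > m - 1" and q: "q > m - 1"
    and \<sigma>: "\<sigma> * (m - 1) = real DIM('a) - m - \<alpha>"
  shows "\<sigma> * p < real DIM('a)" "\<sigma> * q < real DIM('a)" "\<sigma> * (p + q) < real DIM('a) + \<beta>"
proof -
  let ?N = "real DIM('a)"
  have sol: "positive_solution m p q \<alpha> \<beta> u" and lim: "Limsup (at 0) (\<lambda>x. ereal (u x)) = \<infinity>"
    using sing unfolding singular_solution_def by blast+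
  define v where "v = extend_by_1 u"
  define h where "h = riesz_rhs \<beta> p q u"
  obtain g where "weak_sol m \<alpha> (extend_by_1 u) (riesz_rhs \<beta> p q u) g"
    by (rule positive_solution_weak_sol[OF sol \<beta> m \<alpha>], rule that)
  then interpret W: weak_sol m \<alpha> v h g unfolding v_def h_def .
  have vu: "v x = u x" if "x \<in> punctured_ball" for x using that by (simp add: v_def extend_by_1_def)
  have unb: "\<not> W.bounded_near_0"
  proof
    assume "W.bounded_near_0"
    then obtain L where L: "\<And>x. x \<noteq> 0 \<Longrightarrow> norm x < 1/4 \<Longrightarrow> v x \<le> L" unfolding W.bounded_near_0_def by blast
    have "eventually (\<lambda>x. ereal (u x) \<le> ereal L) (at 0)"
      unfolding eventually_at
    proof (intro exI[of _ "1/4"] conjI ballI impI)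
      fix x :: 'a assume "x \<noteq> 0 \<and> dist x 0 < 1/4"
      then show "ereal (u x) \<le> ereal L" using L[of x] vu[of x] by simp
    qed simp
    then have "Limsup (at 0) (\<lambda>x. ereal (u x)) \<le> ereal L" by (rule Limsup_bounded)
    then show False using lim by simp
  qed
  \<comment> \<open>The exponent m - 1 + k must exceed neither p nor q, since the lower bound is
    carried over from it to these; k at most 1 is asked for by the flux estimate.\<close>
  define k where "k = min 1 (min (p - (m - 1)) (q - (m - 1)))"
  have k: "0 < k" "k \<le> 1" "m - 1 + k \<le> p" "m - 1 + k \<le> q" using p q by (auto simp: k_def)
  have s: "0 < m - 1 + k" using k m by simp
  obtain c r where c: "c > 0" and r: "r > 0" "r \<le> 1 / 32" and lb0:
    "\<And>\<rho>. 0 < \<rho> \<Longrightarrow> \<rho> < r \<Longrightarrow> c * \<rho> powr (?N - \<sigma> * (m - 1 + k)) \<le> (\<integral>x. indicator (annulus \<rho> (8 * \<rho>)) x * v x powr (m - 1 + k) \<partial>lborel)"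
    by (rule W.singular_lower_bound[OF k(1,2) \<sigma> unb], rule that)
  obtain c' where c': "c' > 0" and lb: "\<And>\<rho>. 0 < \<rho> \<Longrightarrow> \<rho> < r \<Longrightarrow>
       c' * \<rho> powr (?N - \<sigma> * p) \<le> (\<integral>x. indicator (annulus \<rho> (8 * \<rho>)) x * v x powr p \<partial>lborel)"
    by (rule W.lower_bound_upgrade[OF s k(3) c r(2)], rule lb0, assumption, assumption, rule that)
  define w where "w y = indicator punctured_ball y * u y powr p" for y
  note rz = positive_solution_riesz[OF sol \<beta>, folded w_def]
  have wv: "indicator (annulus \<rho> (8 * \<rho>)) x * v x powr p = indicator (annulus \<rho> (8 * \<rho>)) x * w x" if "0 < \<rho>" "8 * \<rho> < 1" for \<rho> x
    using that vu[of x] by (auto simp: indicator_def w_def)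
  have w0: "w x \<ge> 0" for x by (simp add: w_def)
  note [measurable] = rz(1)
  show "\<sigma> * p < ?N"
  proof (rule ccontr)
    assume "\<not> \<sigma> * p < ?N"
    then have le: "?N - \<sigma> * p \<le> 0" by simp
    define \<rho> where "\<rho> n = r / real (n + 2)" for n
    have \<rho>: "0 < \<rho> n" "\<rho> n < r" "8 * \<rho> n < 1" for n
    proof -
      show 1: "0 < \<rho> n" using r by (simp add: \<rho>_def)
      have "r / real (n + 2) < r / 1" using r by (intro divide_strict_left_mono) auto
      then show 2: "\<rho> n < r" by (simp add: \<rho>_def)
      show "8 * \<rho> n < 1" using 2 r by simp
    qed
    have \<rho>0: "\<rho> \<longlonglongrightarrow> 0"
      unfolding \<rho>_def by (rule LIMSEQ_ignore_initial_segment[OF lim_const_over_n])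
    \<comment> \<open>Shells shrinking to the origin carry a vanishing mass of the integrable u^p,
      but for \<sigma> p at least N the lower bound keeps this mass above c'.\<close>
    have "(\<lambda>n. \<integral>x. indicator (annulus (\<rho> n) (8 * \<rho> n)) x * w x \<partial>lborel) \<longlonglongrightarrow> (\<integral>x. 0 \<partial>(lborel :: 'a measure))"
    proof (rule integral_dominated_convergence[where w = w])
      show "AE x in lborel. (\<lambda>n. indicator (annulus (\<rho> n) (8 * \<rho> n)) x * w x) \<longlonglongrightarrow> 0"
      proof (rule AE_I2)
        fix x :: 'a
        show "(\<lambda>n. indicator (annulus (\<rho> n) (8 * \<rho> n)) x * w x) \<longlonglongrightarrow> 0"
        proof (cases "x = 0")
          case True
          then have "w x = 0" by (simp add: w_def)
          then show ?thesis by simp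
        next
          case False
          then have "eventually (\<lambda>n. \<rho> n < norm x / 8) sequentially"
            using order_tendstoD(2)[OF \<rho>0, of "norm x / 8"] by simp
          then have "eventually (\<lambda>n. indicator (annulus (\<rho> n) (8 * \<rho> n)) x * w x = 0) sequentially"
            by eventually_elim auto
          then show ?thesis by (rule tendsto_eventually)
        qed
      qed
      show "AE x in lborel. norm (indicator (annulus (\<rho> n) (8 * \<rho> n)) x * w x) \<le> w x" for n
        using w0 by (auto simp: indicator_def)
    qed (use rz(2) in auto)
    then have L: "(\<lambda>n. \<integral>x. indicator (annulus (\<rho> n) (8 * \<rho> n)) x * w x \<partial>lborel) \<longlonglongrightarrow> 0" by simp
    have ge: "c' \<le> (\<integral>x. indicator (annulus (\<rho> n) (8 * \<rho> n)) x * w x \<partial>lborel)" for n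
    proof -
      have "1 \<le> \<rho> n powr (?N - \<sigma> * p)" using powr_mono'[OF le, of "\<rho> n"] \<rho>[of n] r by auto
      then have "c' \<le> c' * \<rho> n powr (?N - \<sigma> * p)" using c' by simp
      also have "\<dots> \<le> (\<integral>x. indicator (annulus (\<rho> n) (8 * \<rho> n)) x * v x powr p \<partial>lborel)" by (rule lb[OF \<rho>(1,2)])
      finally show ?thesis unfolding wv[OF \<rho>(1,3)] .
    qed
    have "c' \<le> 0" by (rule LIMSEQ_le_const[OF L]) (use ge in auto)
    then show False using c' by simp
  qed
  show "\<sigma> * q < ?N"
  proof (rule ccontr)
    assume "\<not> \<sigma> * q < ?N"
    then have tau: "?N \<le> \<sigma> * q + 0" by simp
    obtain c1 where c1: "c1 > 0" "\<And>x. x \<in> punctured_ball \<Longrightarrow> c1 \<le> riesz_conv \<beta> p u x"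
      by (rule positive_solution_riesz_pos[OF sol \<beta>], rule that)
    have "W.bounded_near_0"
    proof (rule W.absorption_imp_bounded[OF k(1,2,4) c1(1) _ \<sigma> tau])
      \<comment> \<open>A radius below 1/64 keeps the shell up to 32 \<rho> inside the unit
        ball.\<close>
      show "0 < (1 / 64 :: real)" by simp
      fix \<rho> and x :: 'a assume \<rho>: "0 < \<rho>" "\<rho> < 1 / 64" and x: "x \<in> annulus \<rho> (32 * \<rho>)"
      then have xP: "x \<in> punctured_ball" by auto
      have "c1 * v x powr q \<le> riesz_conv \<beta> p u x * u x powr q"
        unfolding vu[OF xP] by (intro mult_right_mono c1(2) xP) auto
      then show "c1 * \<rho> powr (- 0) * v x powr q \<le> h x" using xP \<rho> by (simp add: h_def riesz_rhs_def)
    qed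
    then show False using unb by simp
  qed
  show "\<sigma> * (p + q) < ?N + \<beta>"
  proof (rule ccontr)
    assume "\<not> \<sigma> * (p + q) < ?N + \<beta>"
    then have tau: "?N \<le> \<sigma> * q + (\<sigma> * p - \<beta>)" by (simp add: distrib_left)
    \<comment> \<open>For x in the shell up to 32 \<rho> and y in the shell up to 8 \<rho> the
      distance is at most 40 \<rho>; the mass of u^p in the latter shell is at least c' \<rho>^(N -
      \<sigma> p).\<close>
    define c1 where "c1 = riesz_const TYPE('a) \<beta> * 40 powr (- (?N - \<beta>)) * c'"
    have c1: "c1 > 0" using riesz_const_pos[OF \<beta>] c' by (simp add: c1_def)
    have "W.bounded_near_0"
    proof (rule W.absorption_imp_bounded[OF k(1,2,4) c1 _ \<sigma> tau])
      show "0 < min r (1 / 64 :: real)" using r by simp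
      fix \<rho> and x :: 'a assume \<rho>: "0 < \<rho>" "\<rho> < min r (1 / 64)" and x: "x \<in> annulus \<rho> (32 * \<rho>)"
      then have xP: "x \<in> punctured_ball" by auto
      let ?I = "\<integral>y. indicator (annulus \<rho> (8 * \<rho>)) y * w y \<partial>lborel"
      have "riesz_const TYPE('a) \<beta> * (40 * \<rho>) powr (- (?N - \<beta>)) * ?I \<le> (\<integral>y. riesz_kernel \<beta> (x - y) * w y \<partial>lborel)"
      proof (rule riesz_lower_bound[OF \<beta> w0 rz(4)[OF xP]])
        show "0 < 40 * \<rho>" using \<rho> by simp
        show "norm (x - y) \<le> 40 * \<rho>" if "indicator (annulus \<rho> (8 * \<rho>)) y * w y \<noteq> 0" for y
          using that x norm_triangle_ineq4[of x y] by (auto simp: indicator_def split: if_splits)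
        show "0 \<le> indicator (annulus \<rho> (8 * \<rho>)) y * w y \<and> indicator (annulus \<rho> (8 * \<rho>)) y * w y \<le> w y" for y
          using w0[of y] by (auto simp: indicator_def)
      qed measurable
      moreover have "riesz_const TYPE('a) \<beta> * (40 * \<rho>) powr (- (?N - \<beta>)) * (c' * \<rho> powr (?N - \<sigma> * p))
          \<le> riesz_const TYPE('a) \<beta> * (40 * \<rho>) powr (- (?N - \<beta>)) * ?I"
      proof (intro mult_left_mono)
        show "c' * \<rho> powr (?N - \<sigma> * p) \<le> ?I"
          using lb[OF \<rho>(1)] \<rho> unfolding wv[OF \<rho>(1)] by (simp add: wv)
      qed (use riesz_const_pos[OF \<beta>] in auto)
      moreover have "riesz_const TYPE('a) \<beta> * (40 * \<rho>) powr (- (?N - \<beta>)) * (c' * \<rho> powr (?N - \<sigma> * p)) = c1 * \<rho> powr (- (\<sigma> * p - \<beta>))"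
      proof -
        have "(40 * \<rho>) powr (- (?N - \<beta>)) = 40 powr (- (?N - \<beta>)) * \<rho> powr (- (?N - \<beta>))" using \<rho> by (simp add: powr_mult)
        moreover have "\<rho> powr (- (?N - \<beta>)) * \<rho> powr (?N - \<sigma> * p) = \<rho> powr (- (\<sigma> * p - \<beta>))"
          unfolding powr_add[symmetric] by simp
        ultimately show ?thesis by (simp add: c1_def mult_ac)
      qed
      ultimately have "c1 * \<rho> powr (- (\<sigma> * p - \<beta>)) \<le> riesz_conv \<beta> p u x" unfolding rz(3) by linarith
      then have "c1 * \<rho> powr (- (\<sigma> * p - \<beta>)) * u x powr q \<le> riesz_conv \<beta> p u x * u x powr q"
        by (intro mult_right_mono) auto
      then show "c1 * \<rho> powr (- (\<sigma> * p - \<beta>)) * v x powr q \<le> h x"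
        unfolding vu[OF xP] using xP by (simp add: h_def riesz_rhs_def)
    qed
    then show False using unb by simp
  qed
qed

subsection \<open>Existence\<close>

lemma has_derivative_norm_powr:
  fixes x :: "'a::euclidean_space"
  assumes "x \<noteq> 0"
  shows "((\<lambda>x. norm x powr r) has_derivative (\<lambda>v. ((r * norm x powr (r - 2)) *\<^sub>R x) \<bullet> v)) (at x)"
proof -
  have x: "norm x > 0" using assms by simp
  have d1: "(norm has_derivative (\<lambda>v. sgn x \<bullet> v)) (at x)"
    using has_derivative_norm[OF assms] by (simp add: inner_commute)
  have d2: "((\<lambda>t. t powr r) has_derivative (\<lambda>t. (r * norm x powr (r - 1)) * t)) (at (norm x))"
    using x by (auto intro!: derivative_eq_intros simp: has_field_derivative_def[symmetric])
  show ?thesis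
    by (rule has_derivative_eq_rhs[OF has_derivative_compose[OF d1 d2]])
      (use x in \<open>auto simp: sgn_div_norm powr_diff power2_eq_square powr_numeral field_simps\<close>)
qed

text \<open>The product of \<phi> and f is C1 on the whole space, although f is only so on \<Omega>,
  because \<phi> vanishes off a compact subset; the integral of its gradient is therefore 0.\<close>

lemma integral_by_parts_test:
  fixes f :: "'a::euclidean_space \<Rightarrow> real"
  assumes \<Omega>: "open \<Omega>" and f: "\<And>x. x \<in> \<Omega> \<Longrightarrow> (f has_derivative (\<lambda>v. f' x \<bullet> v)) (at x)"
    and f': "continuous_on \<Omega> f'" and \<phi>: "\<phi> \<in> test_functions \<Omega>"
  shows "integrable lborel (\<lambda>x. \<phi> x *\<^sub>R f' x)" "integrable lborel (\<lambda>x. f x *\<^sub>R grad \<phi> x)"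
    "(\<integral>x. f x *\<^sub>R grad \<phi> x \<partial>lborel) = - (\<integral>x. \<phi> x *\<^sub>R f' x \<partial>lborel)"
proof -
  obtain K where K: "C1_grad \<phi> (grad \<phi>)" "compact K" "K \<subseteq> \<Omega>" "\<And>x. x \<notin> K \<Longrightarrow> \<phi> x = 0" "\<And>x. x \<notin> K \<Longrightarrow> grad \<phi> x = 0"
    using test_functionsD[OF \<phi>] by blast
  have c: "continuous_on UNIV \<phi>" "continuous_on UNIV (grad \<phi>)"
    using C1_grad_continuous'[OF K(1)] C1_grad_continuous[OF K(1)] by auto
  have cf: "continuous_on \<Omega> f"
    using f by (auto intro!: continuous_at_imp_continuous_on has_derivative_continuous)
  have "integrable lborel (\<lambda>x. indicator K x *\<^sub>R (\<phi> x *\<^sub>R f' x))"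
    by (intro borel_integrable_compact K(2) continuous_intros continuous_on_subset[OF c(1)] continuous_on_subset[OF f' K(3)]) auto
  also have "(\<lambda>x. indicator K x *\<^sub>R (\<phi> x *\<^sub>R f' x)) = (\<lambda>x. \<phi> x *\<^sub>R f' x)" using K(4) by (auto simp: indicator_def fun_eq_iff)
  finally show i1: "integrable lborel (\<lambda>x. \<phi> x *\<^sub>R f' x)" .
  have "integrable lborel (\<lambda>x. indicator K x *\<^sub>R (f x *\<^sub>R grad \<phi> x))"
    by (intro borel_integrable_compact K(2) continuous_intros continuous_on_subset[OF c(2)] continuous_on_subset[OF cf K(3)]) auto
  also have "(\<lambda>x. indicator K x *\<^sub>R (f x *\<^sub>R grad \<phi> x)) = (\<lambda>x. f x *\<^sub>R grad \<phi> x)" using K(5) by (auto simp: indicator_def fun_eq_iff)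
  finally show i2: "integrable lborel (\<lambda>x. f x *\<^sub>R grad \<phi> x)" .
  have C: "C1_grad (\<lambda>x. \<phi> x * f x) (\<lambda>x. \<phi> x *\<^sub>R f' x + f x *\<^sub>R grad \<phi> x)"
  proof (rule C1_grad_extend[OF \<Omega> K(2,3)])
    show "((\<lambda>x. \<phi> x * f x) has_derivative (\<lambda>v. (\<phi> x *\<^sub>R f' x + f x *\<^sub>R grad \<phi> x) \<bullet> v)) (at x)" if "x \<in> \<Omega>" for x
      by (rule has_derivative_eq_rhs[OF has_derivative_mult[OF C1_grad_derivative[OF K(1)] f[OF that]]])
        (auto simp: inner_add_left)
    show "continuous_on \<Omega> (\<lambda>x. \<phi> x *\<^sub>R f' x + f x *\<^sub>R grad \<phi> x)"
      by (intro continuous_intros f' cf continuous_on_subset[OF c(1)] continuous_on_subset[OF c(2)]) auto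
  qed (use K(4,5) in auto)
  obtain R where "\<And>x. x \<in> K \<Longrightarrow> norm x \<le> R"
    using compact_imp_bounded[OF K(2)] by (auto simp: bounded_iff)
  then have R: "x \<notin> K" if "norm x > R" for x using that by force
  have "(\<integral>x. \<phi> x *\<^sub>R f' x + f x *\<^sub>R grad \<phi> x \<partial>lborel) = 0"
    by (rule integral_C1_grad_eq_0[OF C, of R]) (use K(4) R in auto)
  then show "(\<integral>x. f x *\<^sub>R grad \<phi> x \<partial>lborel) = - (\<integral>x. \<phi> x *\<^sub>R f' x \<partial>lborel)"
    using i1 i2 by (simp add: Bochner_Integration.integral_add add_eq_0_iff)
qed

lemma continuous_Lp_loc:
  fixes f :: "'a::euclidean_space \<Rightarrow> 'b::euclidean_space"
  assumes \<Omega>: "open \<Omega>" and f: "continuous_on \<Omega> f" and s: "s > 0"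
  shows "f \<in> Lp_loc s \<Omega>"
proof -
  have "set_integrable lebesgue K (\<lambda>x. norm (f x) powr s)" if K: "compact K" "K \<subseteq> \<Omega>" for K
  proof -
    have "continuous_on K (\<lambda>x. norm (f x) powr s)"
      using s by (intro continuous_on_powr' continuous_intros continuous_on_subset[OF f K(2)]) auto
    from borel_integrable_compact[OF K(1) this]
    have i: "integrable lborel (\<lambda>x. indicator K x *\<^sub>R norm (f x) powr s)" .
    then have "(\<lambda>x. indicator K x *\<^sub>R norm (f x) powr s) \<in> borel_measurable lborel" by (rule borel_measurable_integrable)
    from integrable_completion[OF this] i show ?thesis unfolding set_integrable_def by blast
  qed
  moreover have "set_borel_measurable lebesgue \<Omega> f"
    unfolding set_borel_measurable_def
    by (rule measurable_completion) (use borel_measurable_continuous_on_indicator[OF _ f] \<Omega> in auto)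
  ultimately show ?thesis by (simp add: Lp_loc_def)
qed

lemma set_integral_lborel_test:
  fixes f :: "'a::euclidean_space \<Rightarrow> real"
  assumes f: "integrable lborel f" "\<And>x. x \<notin> A \<Longrightarrow> f x = 0"
  shows "(LINT x:A|lebesgue. f x) = (\<integral>x. f x \<partial>lborel)"
proof -
  have "(LINT x:A|lebesgue. f x) = (\<integral>x. f x \<partial>lebesgue)"
    unfolding set_lebesgue_integral_def by (rule Bochner_Integration.integral_cong) (use f(2) in \<open>auto simp: indicator_def\<close>)
  also have "\<dots> = (\<integral>x. f x \<partial>lborel)" by (rule integral_completion) (use f(1) in auto)
  finally show ?thesis .
qed

lemma continuous_norm_powr:
  "continuous_on (ball 0 1 - {0}) (\<lambda>x::'a::euclidean_space. norm x powr r)"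
  "continuous_on (cball 0 1 - {0}) (\<lambda>x::'a. norm x powr r)"
  by (intro continuous_intros; simp)+

text \<open>For u = k |x|^-a the flux is - B |x|^-e x with divergence B (e - N) |x|^-e, where e > N
  amounts to a (m - 1) > N - m - \<alpha>. The right-hand side is at most a multiple of k^(p+q)
  |x|^(\<beta>-s-aq), less singular at 0, while B is proportional to k^(m-1); as p + q > m - 1, a
  small k adjusts the constants.\<close>

lemma power_singular_solution:
  fixes a m p q \<alpha> \<beta> :: real
  assumes \<beta>: "0 < \<beta>" "\<beta> < real DIM('a::euclidean_space)" and m: "m > 1" and \<alpha>: "\<alpha> > 0" and p: "p > 0" and q: "q > m - 1"
    and a: "a > 0" "a * (m - 1) > real DIM('a) - m - \<alpha>" "a * p < real DIM('a)" "a * q < real DIM('a)" "a * (p + q) < real DIM('a) + \<beta>"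
  shows "\<exists>u :: 'a \<Rightarrow> real. singular_solution m p q \<alpha> \<beta> u"
proof -
  let ?N = "real DIM('a)"
  let ?\<Omega> = "punctured_ball :: 'a set"
  have o: "open ?\<Omega>" by auto
  \<comment> \<open>\<open>riesz_upper_bound\<close> needs an exponent strictly between \<beta> and
    N, and a p may fall short of \<beta>. It is enlarged to s, which only increases |y|^-s for |y| <
    1, while s + a q - \<beta> stays below N.\<close>
  have "max (a * p) \<beta> < min ?N (?N + \<beta> - a * q)" using a \<beta> by (auto simp: distrib_left)
  then obtain s where "max (a * p) \<beta> < s" "s < min ?N (?N + \<beta> - a * q)" using dense by blast
  then have s: "a * p < s" "\<beta> < s" "s < ?N" "s + a * q - \<beta> < ?N" by auto
  obtain C where C: "C \<ge> 0" "\<And>x::'a. x \<noteq> 0 \<Longrightarrow>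
    (\<integral>\<^sup>+y. ennreal (riesz_kernel \<beta> (x - y) * norm y powr (- s)) \<partial>lborel) \<le> ennreal (C * norm x powr (\<beta> - s))"
    by (rule riesz_upper_bound[OF \<beta> s(2,3)], rule that)
  \<comment> \<open>The gradient has size |x|^-(a+1), so the flux has size |x|^-(\<alpha> +
    (a+1)(m-1)); the last 1 appears because the flux is written as a multiple of x and not of x /
    |x|.\<close>
  define e where "e = \<alpha> + (a + 1) * (m - 1) + 1"
  have e: "e > ?N" using a(2) by (simp add: e_def algebra_simps)
  define d where "d = p + q - (m - 1)"
  have d: "d > 0" using p q by (simp add: d_def)
  define E where "E = a powr (m - 1) * (e - ?N)"
  have E: "E > 0" using a(1) e by (simp add: E_def)
  \<comment> \<open>Gives \<open>k powr d * C \<le> E\<close>, where d is the excess of p + q over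
    the homogeneity m - 1 of the operator; C + 1 avoids a division by 0.\<close>
  define k where "k = (E / (C + 1)) powr (1 / d)"
  have k: "k > 0" using E C(1) by (simp add: k_def)
  have kd: "k powr d * C \<le> E"
  proof -
    have "k powr d = E / (C + 1)" using E C(1) d by (simp add: k_def powr_powr)
    then have "k powr d * C = E * (C / (C + 1))" by simp
    also have "\<dots> \<le> E * 1" using C(1) E by (intro mult_left_mono) auto
    finally show ?thesis by simp
  qed
  define u where "u x = k * norm x powr (- a)" for x :: 'a
  define g where "g x = (- (k * a) * norm x powr (- a - 2)) *\<^sub>R x" for x :: 'a
  define B where "B = (k * a) powr (m - 1)"
  have B: "B > 0" using k a by (simp add: B_def)
  \<comment> \<open>The classical divergence of the flux away from the origin.\<close>
  define h0 where "h0 x = B * (e - ?N) * norm x powr (- e)" for x :: 'a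
  have h0_nonneg: "h0 x \<ge> 0" for x using B e by (simp add: h0_def)
  have cu: "continuous_on ?\<Omega> u" "continuous_on (cball 0 1 - {0}) u"
    unfolding u_def by (intro continuous_intros continuous_norm_powr)+
  have cg: "continuous_on ?\<Omega> g" unfolding g_def by (intro continuous_intros continuous_norm_powr)
  have ch0: "continuous_on ?\<Omega> h0" unfolding h0_def by (intro continuous_intros continuous_norm_powr)
  have upos: "u x > 0" if "x \<in> ?\<Omega>" for x using that k by (simp add: u_def)
  have du: "(u has_derivative (\<lambda>v. g x \<bullet> v)) (at x)" if "x \<in> ?\<Omega>" for x
    unfolding u_def
    by (rule has_derivative_eq_rhs[OF has_derivative_mult_right[OF has_derivative_norm_powr]])
      (use that in \<open>auto simp: g_def\<close>)
  have ng: "norm (g x) = k * a * norm x powr (- a - 1)" for x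
  proof (cases "x = 0")
    case False
    have "- a - 2 + 1 = - a - 1" by simp
    then have "norm x powr (- a - 2) * norm x powr 1 = norm x powr (- a - 1)"
      unfolding powr_add[symmetric] by (rule arg_cong)
    then have "norm x powr (- a - 2) * norm x = norm x powr (- a - 1)" by simp
    then show ?thesis using k a by (simp add: g_def abs_mult)
  qed (simp add: g_def)
  define F where "F = flux \<alpha> m g"
  have F: "F x = (- B * norm x powr (- e)) *\<^sub>R x" for x
  proof (cases "x = 0")
    case False
    then have x: "norm x > 0" by simp
    have ka: "k * a > 0" using k a by simp
    have "norm (g x) powr (m - 2) = (k * a) powr (m - 2) * norm x powr ((- a - 1) * (m - 2))"
      unfolding ng using ka x by (simp add: powr_mult powr_powr)
    then have "F x = (norm x powr (- \<alpha>) * ((k * a) powr (m - 2) * norm x powr ((- a - 1) * (m - 2))) * (- (k * a) * norm x powr (- a - 2))) *\<^sub>R x"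
      by (simp add: F_def flux_def g_def)
    also have "norm x powr (- \<alpha>) * ((k * a) powr (m - 2) * norm x powr ((- a - 1) * (m - 2))) * (- (k * a) * norm x powr (- a - 2))
      = - ((k * a) powr (m - 2) * (k * a)) * (norm x powr (- \<alpha>) * norm x powr ((- a - 1) * (m - 2)) * norm x powr (- a - 2))" by simp
    also have "(k * a) powr (m - 2) * (k * a) = B"
      using powr_add[of "k * a" "m - 2" 1] ka by (simp add: B_def)
    also have "norm x powr (- \<alpha>) * norm x powr ((- a - 1) * (m - 2)) * norm x powr (- a - 2) = norm x powr (- e)"
      unfolding powr_add[symmetric] by (simp add: e_def algebra_simps)
    finally show ?thesis .
  qed (simp add: F_def flux_def g_def)
  have cF: "continuous_on ?\<Omega> F"
    unfolding F by (intro continuous_intros continuous_norm_powr)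
  have wg: "weak_gradient ?\<Omega> u g"
    unfolding weak_gradient_def
  proof (intro conjI ballI)
    show "u \<in> Lp_loc 1 ?\<Omega>" "g \<in> Lp_loc 1 ?\<Omega>" by (auto intro!: continuous_Lp_loc o cu cg)
    fix \<phi> and b :: 'a assume \<phi>: "\<phi> \<in> test_functions ?\<Omega>" and b: "b \<in> Basis"
    have ibp: "integrable lborel (\<lambda>x. \<phi> x *\<^sub>R g x)" "integrable lborel (\<lambda>x. u x *\<^sub>R grad \<phi> x)"
      "(\<integral>x. u x *\<^sub>R grad \<phi> x \<partial>lborel) = - (\<integral>x. \<phi> x *\<^sub>R g x \<partial>lborel)"
      by (rule integral_by_parts_test[OF o _ cg \<phi>], erule du)+
    obtain K where K: "C1_grad \<phi> (grad \<phi>)" "compact K" "K \<subseteq> ?\<Omega>" "\<And>x. x \<notin> K \<Longrightarrow> \<phi> x = 0" "\<And>x. x \<notin> K \<Longrightarrow> grad \<phi> x = 0"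
      using test_functionsD[OF \<phi>] by blast
    have z: "\<phi> x = 0" "grad \<phi> x = 0" if "x \<notin> ?\<Omega>" for x using that K(3,4,5) by blast+
    have i1: "integrable lborel (\<lambda>x. u x * (grad \<phi> x \<bullet> b))" using integrable_inner_left[of b lborel "\<lambda>x. u x *\<^sub>R grad \<phi> x"] ibp(2) by simp
    have i2: "integrable lborel (\<lambda>x. (g x \<bullet> b) * \<phi> x)" using integrable_inner_left[of b lborel "\<lambda>x. \<phi> x *\<^sub>R g x"] ibp(1) by (simp add: mult.commute)
    have "(LINT x:?\<Omega>|lebesgue. u x * (grad \<phi> x \<bullet> b)) = (\<integral>x. (u x *\<^sub>R grad \<phi> x) \<bullet> b \<partial>lborel)"
      by (subst set_integral_lborel_test[OF i1]) (use z in auto)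
    also have "\<dots> = (\<integral>x. u x *\<^sub>R grad \<phi> x \<partial>lborel) \<bullet> b" by (rule integral_inner_left) (rule ibp(2))
    also have "\<dots> = - ((\<integral>x. \<phi> x *\<^sub>R g x \<partial>lborel) \<bullet> b)" unfolding ibp(3) by simp
    also have "(\<integral>x. \<phi> x *\<^sub>R g x \<partial>lborel) \<bullet> b = (\<integral>x. (\<phi> x *\<^sub>R g x) \<bullet> b \<partial>lborel)" by (rule integral_inner_left[symmetric]) (rule ibp(1))
    also have "\<dots> = (LINT x:?\<Omega>|lebesgue. (g x \<bullet> b) * \<phi> x)"
      by (subst set_integral_lborel_test[OF i2]) (use z in \<open>auto simp: mult.commute\<close>)
    finally show "(LINT x:?\<Omega>|lebesgue. u x * (grad \<phi> x \<bullet> b)) = - (LINT x:?\<Omega>|lebesgue. (g x \<bullet> b) * \<phi> x)" .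
  qed
  have div: "integrable lborel (\<lambda>x. F x \<bullet> grad \<phi> x)" "integrable lborel (\<lambda>x. h0 x * \<phi> x)"
    "(\<integral>x. F x \<bullet> grad \<phi> x \<partial>lborel) = - (\<integral>x. h0 x * \<phi> x \<partial>lborel)" if \<phi>: "\<phi> \<in> test_functions ?\<Omega>" for \<phi>
  proof -
    \<comment> \<open>The coordinates of F and their gradients: integration by parts has been shown
      for scalar functions, and the sum of the b-th coordinates of \<open>f' b\<close> over the
      basis is h0.\<close>
    define f where "f b x = (- B * norm x powr (- e)) * (x \<bullet> b)" for b x :: 'a
    define f' where "f' b x = (- B * norm x powr (- e)) *\<^sub>R b + ((x \<bullet> b) * (B * e * norm x powr (- e - 2))) *\<^sub>R x" for b x :: 'a
    have df: "(f b has_derivative (\<lambda>v. f' b x \<bullet> v)) (at x)" if "x \<in> ?\<Omega>" for b x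
    proof -
      have x: "x \<noteq> 0" using that by simp
      have "((\<lambda>x. - B * norm x powr (- e)) has_derivative (\<lambda>v. - B * (((- e * norm x powr (- e - 2)) *\<^sub>R x) \<bullet> v))) (at x)"
        by (rule has_derivative_mult_right[OF has_derivative_norm_powr[OF x]])
      from has_derivative_mult[OF this, of "\<lambda>x. x \<bullet> b" "\<lambda>v. v \<bullet> b"]
      show ?thesis unfolding f_def
        by (rule has_derivative_eq_rhs) (auto intro!: derivative_eq_intros simp: f'_def inner_add_left inner_commute algebra_simps)
    qed
    have cf: "continuous_on ?\<Omega> (f' b)" for b unfolding f'_def by (intro continuous_intros continuous_norm_powr)
    have ibp: "integrable lborel (\<lambda>x. \<phi> x *\<^sub>R f' b x)" "integrable lborel (\<lambda>x. f b x *\<^sub>R grad \<phi> x)"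
      "(\<integral>x. f b x *\<^sub>R grad \<phi> x \<partial>lborel) = - (\<integral>x. \<phi> x *\<^sub>R f' b x \<partial>lborel)" for b
      by (rule integral_by_parts_test[OF o _ cf \<phi>], erule df)+
    have i1: "integrable lborel (\<lambda>x. (f b x *\<^sub>R grad \<phi> x) \<bullet> b)" "integrable lborel (\<lambda>x. (\<phi> x *\<^sub>R f' b x) \<bullet> b)" for b
      using ibp(1,2) by (auto intro: integrable_inner_left simp del: inner_scaleR_left)
    have eqF: "F x \<bullet> grad \<phi> x = (\<Sum>b\<in>Basis. (f b x *\<^sub>R grad \<phi> x) \<bullet> b)" for x
    proof -
      have "F x \<bullet> grad \<phi> x = (\<Sum>b\<in>Basis. (F x \<bullet> b) * (grad \<phi> x \<bullet> b))" by (rule euclidean_inner)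
      then show ?thesis by (simp add: F f_def)
    qed
    have eqh: "h0 x * \<phi> x = (\<Sum>b\<in>Basis. (\<phi> x *\<^sub>R f' b x) \<bullet> b)" for x
    proof -
      have 1: "(\<Sum>b\<in>(Basis :: 'a set). (x \<bullet> b) * (x \<bullet> b)) = norm x * norm x"
        using euclidean_inner[of x x] by (simp add: dot_square_norm power2_eq_square)
      have 2: "norm x powr (- e - 2) * (norm x * norm x) = norm x powr (- e)"
        by (cases "x = 0") (auto simp: powr_diff powr_numeral power2_eq_square)
      have "(\<Sum>b\<in>(Basis :: 'a set). (\<phi> x *\<^sub>R f' b x) \<bullet> b)
        = (\<Sum>b\<in>(Basis :: 'a set). \<phi> x * (- B * norm x powr (- e)) + \<phi> x * (B * e * norm x powr (- e - 2)) * ((x \<bullet> b) * (x \<bullet> b)))"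
        by (intro sum.cong) (auto simp: f'_def inner_add_left inner_Basis algebra_simps)
      also have "\<dots> = ?N * (\<phi> x * (- B * norm x powr (- e))) + \<phi> x * (B * e * norm x powr (- e - 2)) * (norm x * norm x)"
        unfolding sum.distrib sum_distrib_left[symmetric] 1 by simp
      also have "\<dots> = ?N * (\<phi> x * (- B * norm x powr (- e))) + \<phi> x * B * e * (norm x powr (- e - 2) * (norm x * norm x))" by simp
      also have "\<dots> = h0 x * \<phi> x" unfolding 2 by (simp add: h0_def algebra_simps)
      finally show ?thesis by simp
    qed
    show "integrable lborel (\<lambda>x. F x \<bullet> grad \<phi> x)" unfolding eqF by (intro Bochner_Integration.integrable_sum i1)
    show "integrable lborel (\<lambda>x. h0 x * \<phi> x)" unfolding eqh by (intro Bochner_Integration.integrable_sum i1)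
    have "(\<integral>x. F x \<bullet> grad \<phi> x \<partial>lborel) = (\<Sum>b\<in>Basis. (\<integral>x. (f b x *\<^sub>R grad \<phi> x) \<bullet> b \<partial>lborel))"
      unfolding eqF by (rule Bochner_Integration.integral_sum) (rule i1)
    also have "\<dots> = (\<Sum>b\<in>Basis. (\<integral>x. f b x *\<^sub>R grad \<phi> x \<partial>lborel) \<bullet> b)"
      by (intro sum.cong refl integral_inner_left ibp(2))
    also have "\<dots> = (\<Sum>b\<in>Basis. - ((\<integral>x. \<phi> x *\<^sub>R f' b x \<partial>lborel) \<bullet> b))" unfolding ibp(3) by simp
    also have "\<dots> = (\<Sum>b\<in>Basis. - (\<integral>x. (\<phi> x *\<^sub>R f' b x) \<bullet> b \<partial>lborel))"
      by (intro sum.cong refl arg_cong[where f = uminus] integral_inner_left[symmetric] ibp(1))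
    also have "\<dots> = - (\<integral>x. (\<Sum>b\<in>Basis. (\<phi> x *\<^sub>R f' b x) \<bullet> b) \<partial>lborel)"
      by (subst Bochner_Integration.integral_sum) (auto simp: sum_negf simp del: inner_scaleR_left intro: i1)
    also have "\<dots> = - (\<integral>x. h0 x * \<phi> x \<partial>lborel)" unfolding eqh ..
    finally show "(\<integral>x. F x \<bullet> grad \<phi> x \<partial>lborel) = - (\<integral>x. h0 x * \<phi> x \<partial>lborel)" .
  qed
  have zero: "\<phi> x = 0" "grad \<phi> x = 0" if \<phi>: "\<phi> \<in> test_functions ?\<Omega>" and x: "x \<notin> ?\<Omega>" for \<phi> x
  proof -
    obtain K where K: "C1_grad \<phi> (grad \<phi>)" "compact K" "K \<subseteq> ?\<Omega>" "\<And>x. x \<notin> K \<Longrightarrow> \<phi> x = 0" "\<And>x. x \<notin> K \<Longrightarrow> grad \<phi> x = 0"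
      using test_functionsD[OF \<phi>] by blast
    have "x \<notin> K" using x K(3) by blast
    then show "\<phi> x = 0" "grad \<phi> x = 0" by (rule K(4), rule K(5))
  qed
  have wd: "weak_divergence ?\<Omega> F h0"
    unfolding weak_divergence_def
  proof (intro conjI ballI)
    show "F \<in> Lp_loc 1 ?\<Omega>" "h0 \<in> Lp_loc 1 ?\<Omega>" by (auto intro!: continuous_Lp_loc o cF ch0)
    fix \<phi> assume \<phi>: "\<phi> \<in> test_functions ?\<Omega>"
    have "(LINT x:?\<Omega>|lebesgue. F x \<bullet> grad \<phi> x) = (\<integral>x. F x \<bullet> grad \<phi> x \<partial>lborel)"
      by (rule set_integral_lborel_test[OF div(1)[OF \<phi>]]) (subst zero(2)[OF \<phi>], assumption, rule inner_zero_right)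
    moreover have "(LINT x:?\<Omega>|lebesgue. h0 x * \<phi> x) = (\<integral>x. h0 x * \<phi> x \<partial>lborel)"
      by (rule set_integral_lborel_test[OF div(2)[OF \<phi>]]) (subst zero(1)[OF \<phi>], assumption, rule mult_zero_right)
    ultimately show "(LINT x:?\<Omega>|lebesgue. F x \<bullet> grad \<phi> x) = - (LINT x:?\<Omega>|lebesgue. h0 x * \<phi> x)"
      using div(3)[OF \<phi>] by simp
  qed
  have up: "u x powr r = k powr r * norm x powr (- (a * r))" for x r
    using k by (simp add: u_def powr_mult powr_powr)
  define w where "w y = indicator ?\<Omega> y * u y powr p" for y
  define H where "H x = indicator ?\<Omega> x * (riesz_conv \<beta> p u x * u x powr q)" for x
  have wm[measurable]: "w \<in> borel_measurable borel"
    unfolding w_def by (rule punctured_ball_powr_measurable[OF cu(1) upos])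
  have J: "riesz_conv \<beta> p u x = (\<integral>y. riesz_kernel \<beta> (x - y) * w y \<partial>lborel)" for x
    by (rule riesz_conv_lborel[OF wm]) (simp add: w_def)
  have w0: "w y \<ge> 0" for y by (simp add: w_def)
  have J0: "riesz_conv \<beta> p u x \<ge> 0" for x
    unfolding J using riesz_kernel_nonneg[OF \<beta>] w0 by (intro Bochner_Integration.integral_nonneg) auto
  have Jle: "riesz_conv \<beta> p u x \<le> k powr p * (C * norm x powr (\<beta> - s))" if x: "x \<in> ?\<Omega>" for x
  proof -
    have wle: "w y \<le> k powr p * norm y powr (- s)" for y
    proof (cases "y \<in> ?\<Omega>")
      case True
      then have "norm y powr (- (a * p)) \<le> norm y powr (- s)" using s(1) by (intro powr_mono') auto
      then show ?thesis using True by (simp add: w_def up mult_left_mono)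
    qed (simp add: w_def)
    have "ennreal (norm (riesz_conv \<beta> p u x)) \<le> (\<integral>\<^sup>+y. ennreal (norm (riesz_kernel \<beta> (x - y) * w y)) \<partial>lborel)"
      unfolding J by (rule norm_integral_le_nn_integral)
    also have "\<dots> \<le> (\<integral>\<^sup>+y. ennreal (k powr p) * ennreal (riesz_kernel \<beta> (x - y) * norm y powr (- s)) \<partial>lborel)"
    proof (rule nn_integral_mono)
      fix y
      have "riesz_kernel \<beta> (x - y) * w y \<le> riesz_kernel \<beta> (x - y) * (k powr p * norm y powr (- s))"
        by (intro mult_left_mono wle riesz_kernel_nonneg[OF \<beta>])
      then have "norm (riesz_kernel \<beta> (x - y) * w y) \<le> k powr p * (riesz_kernel \<beta> (x - y) * norm y powr (- s))"
        using w0[of y] riesz_kernel_nonneg[OF \<beta>, of "x - y"] by (simp add: mult_ac abs_of_nonneg)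
      then show "ennreal (norm (riesz_kernel \<beta> (x - y) * w y)) \<le> ennreal (k powr p) * ennreal (riesz_kernel \<beta> (x - y) * norm y powr (- s))"
        using riesz_kernel_nonneg[OF \<beta>, of "x - y"] by (simp add: ennreal_mult[symmetric] ennreal_leI)
    qed
    also have "\<dots> = ennreal (k powr p) * (\<integral>\<^sup>+y. ennreal (riesz_kernel \<beta> (x - y) * norm y powr (- s)) \<partial>lborel)"
      by (rule nn_integral_cmult) measurable
    also have "\<dots> \<le> ennreal (k powr p) * ennreal (C * norm x powr (\<beta> - s))"
      using x by (intro mult_left_mono C(2)) auto
    also have "\<dots> = ennreal (k powr p * (C * norm x powr (\<beta> - s)))" using C(1) by (simp add: ennreal_mult)
    finally have "norm (riesz_conv \<beta> p u x) \<le> k powr p * (C * norm x powr (\<beta> - s))"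
      using C(1) by (subst (asm) ennreal_le_iff) auto
    then show ?thesis by simp
  qed
  have hle: "riesz_conv \<beta> p u x * u x powr q \<le> h0 x" if x: "x \<in> ?\<Omega>" for x
  proof -
    have nx: "0 < norm x" "norm x < 1" using x by auto
    have "riesz_conv \<beta> p u x * u x powr q \<le> (k powr p * (C * norm x powr (\<beta> - s))) * (k powr q * norm x powr (- (a * q)))"
      unfolding up by (intro mult_right_mono Jle[OF x]) auto
    also have "\<dots> = (k powr p * k powr q) * C * (norm x powr (\<beta> - s) * norm x powr (- (a * q)))" by simp
    also have "k powr p * k powr q = k powr (m - 1) * k powr d" unfolding powr_add[symmetric] by (simp add: d_def)
    also have "norm x powr (\<beta> - s) * norm x powr (- (a * q)) = norm x powr (\<beta> - s - a * q)" unfolding powr_add[symmetric] by simp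
    also have "(k powr (m - 1) * k powr d) * C * norm x powr (\<beta> - s - a * q) = k powr (m - 1) * (k powr d * C) * norm x powr (\<beta> - s - a * q)" by simp
    also have "\<dots> \<le> k powr (m - 1) * E * norm x powr (- e)"
    proof (intro mult_mono kd)
      show "norm x powr (\<beta> - s - a * q) \<le> norm x powr (- e)" using s(4) e nx by (intro powr_mono') auto
    qed (use C(1) E in auto)
    also have "\<dots> = h0 x" using k a by (simp add: h0_def B_def E_def powr_mult)
    finally show ?thesis .
  qed
  have H0: "0 \<le> H x" for x using J0 by (simp add: H_def)
  have Hle: "H x \<le> h0 x" for x using hle[of x] h0_nonneg[of x] by (cases "x \<in> ?\<Omega>") (auto simp: H_def)
  have Hm[measurable]: "H \<in> borel_measurable borel"
  proof -
    have [measurable]: "(\<lambda>y. indicator ?\<Omega> y * u y powr q) \<in> borel_measurable borel"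
      by (rule punctured_ball_powr_measurable[OF cu(1) upos])
    have "H = (\<lambda>x. (\<integral>y. riesz_kernel \<beta> (x - y) * w y \<partial>lborel) * (indicator ?\<Omega> x * u x powr q))"
      by (auto simp: H_def J fun_eq_iff)
    also have "\<dots> \<in> borel_measurable borel" by measurable
    finally show ?thesis .
  qed
  have hL: "(\<lambda>x. riesz_conv \<beta> p u x * u x powr q) \<in> Lp_loc 1 ?\<Omega>"
    unfolding Lp_loc_def
  proof (intro CollectI conjI allI impI)
    have "H \<in> borel_measurable lebesgue" by (rule measurable_completion) simp
    then show "set_borel_measurable lebesgue ?\<Omega> (\<lambda>x. riesz_conv \<beta> p u x * u x powr q)"
      by (simp add: set_borel_measurable_def H_def[abs_def])
    fix K assume K: "compact K \<and> K \<subseteq> ?\<Omega>"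
    have [measurable]: "K \<in> sets borel" using K by (auto intro: borel_compact)
    have "h0 \<in> Lp_loc 1 ?\<Omega>" by (auto intro!: continuous_Lp_loc o ch0)
    then have ih: "set_integrable lebesgue K (\<lambda>x. norm (h0 x) powr 1)" using K by (simp add: Lp_loc_def)
    show "set_integrable lebesgue K (\<lambda>x. norm (riesz_conv \<beta> p u x * u x powr q) powr 1)"
    proof (rule set_integrable_bound[OF ih])
      have "(\<lambda>x. indicator K x *\<^sub>R norm (riesz_conv \<beta> p u x * u x powr q) powr 1) = (\<lambda>x. indicator K x * norm (H x))"
        using K by (auto simp: H_def indicator_def fun_eq_iff)
      also have "\<dots> \<in> borel_measurable lebesgue" by (rule measurable_completion) measurable
      finally show "set_borel_measurable lebesgue K (\<lambda>x. norm (riesz_conv \<beta> p u x * u x powr q) powr 1)"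
        by (simp only: set_borel_measurable_def)
      show "AE x in lebesgue. x \<in> K \<longrightarrow> norm (norm (riesz_conv \<beta> p u x * u x powr q) powr 1) \<le> norm (norm (h0 x) powr 1)"
      proof (intro AE_I2 impI)
        fix x assume "x \<in> K"
        then have "x \<in> ?\<Omega>" using K by blast
        then show "norm (norm (riesz_conv \<beta> p u x * u x powr q) powr 1) \<le> norm (norm (h0 x) powr 1)"
          using hle[of x] J0[of x] h0_nonneg[of x] by (simp add: abs_mult)
      qed
    qed
  qed
  have up_int: "set_integrable lebesgue (ball 0 1) (\<lambda>x. u x powr p)"
  proof -
    have i: "integrable lborel (\<lambda>x::'a. norm x powr (- (a * p)) * indicator (ball 0 1) x)"
      by (rule integrable_norm_powr_ball) (use a p in auto)
    then have "integrable lborel (\<lambda>x::'a. k powr p * (norm x powr (- (a * p)) * indicator (ball 0 1) x))" by simp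
    then have i2: "integrable lborel (\<lambda>x::'a. indicator (ball 0 1) x *\<^sub>R u x powr p)" unfolding up by (simp add: mult_ac)
    then have "(\<lambda>x::'a. indicator (ball 0 1) x *\<^sub>R u x powr p) \<in> borel_measurable lborel" by (rule borel_measurable_integrable)
    from integrable_completion[OF this] i2 show ?thesis unfolding set_integrable_def by blast
  qed
  have ineq: "(LINT x:ball 0 1|lebesgue. F x \<bullet> grad \<phi> x) + (LINT x:ball 0 1|lebesgue. riesz_conv \<beta> p u x * u x powr q * \<phi> x) \<le> 0"
    if \<phi>: "\<phi> \<in> test_functions ?\<Omega>" and pos: "\<And>x. \<phi> x \<ge> 0" for \<phi>
  proof -
    have z: "\<phi> x = 0" "grad \<phi> x = 0" if "x \<notin> ball 0 1" for x using zero[OF \<phi>, of x] that by auto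
    obtain K where "C1_grad \<phi> (grad \<phi>)"
      using test_functionsD[OF \<phi>] by metis
    then have [measurable]: "\<phi> \<in> borel_measurable borel"
      by (intro borel_measurable_continuous_onI C1_grad_continuous')
    have iH: "integrable lborel (\<lambda>x. H x * \<phi> x)"
    proof (rule Bochner_Integration.integrable_bound[OF div(2)[OF \<phi>]])
      show "AE x in lborel. norm (H x * \<phi> x) \<le> norm (h0 x * \<phi> x)"
        using H0 Hle h0_nonneg pos by (auto intro!: AE_I2 mult_right_mono simp: abs_mult)
    qed measurable
    have "(LINT x:ball 0 1|lebesgue. F x \<bullet> grad \<phi> x) = - (\<integral>x. h0 x * \<phi> x \<partial>lborel)"
      by (subst set_integral_lborel_test[OF div(1)[OF \<phi>]]) (use z div(3)[OF \<phi>] in auto)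
    moreover have "(LINT x:ball 0 1|lebesgue. riesz_conv \<beta> p u x * u x powr q * \<phi> x) = (\<integral>x. H x * \<phi> x \<partial>lborel)"
    proof -
      have "(LINT x:ball 0 1|lebesgue. H x * \<phi> x) = (\<integral>x. H x * \<phi> x \<partial>lborel)"
        by (rule set_integral_lborel_test[OF iH]) (simp add: z)
      moreover have "(LINT x:ball 0 1|lebesgue. riesz_conv \<beta> p u x * u x powr q * \<phi> x) = (LINT x:ball 0 1|lebesgue. H x * \<phi> x)"
        unfolding set_lebesgue_integral_def
      proof (rule Bochner_Integration.integral_cong)
        fix x
        show "indicator (ball 0 1) x *\<^sub>R (riesz_conv \<beta> p u x * u x powr q * \<phi> x) = indicator (ball 0 1) x *\<^sub>R (H x * \<phi> x)"
        proof (cases "x \<in> ?\<Omega>")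
          case False
          then show ?thesis by (simp only: zero(1)[OF \<phi> False] mult_zero_right scaleR_zero_right)
        qed (simp add: H_def)
      qed simp
      ultimately show ?thesis by simp
    qed
    moreover have "(\<integral>x. H x * \<phi> x \<partial>lborel) \<le> (\<integral>x. h0 x * \<phi> x \<partial>lborel)"
      by (rule integral_mono[OF iH div(2)[OF \<phi>]]) (intro mult_right_mono Hle pos)
    ultimately show ?thesis by simp
  qed
  have W1: "u \<in> W1_loc m ?\<Omega>"
    unfolding W1_loc_def
  proof (intro CollectI conjI bexI[of _ g])
    show "u \<in> Lp_loc m ?\<Omega>" "g \<in> Lp_loc m ?\<Omega>" using m by (auto intro!: continuous_Lp_loc o cu cg)
  qed (rule wg)
  have "positive_solution m p q \<alpha> \<beta> u"
    unfolding positive_solution_def Let_def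
    using W1 cu(2) upos up_int hL wg wd ineq unfolding F_def by blast
  moreover have "Limsup (at 0) (\<lambda>x. ereal (u x)) = \<infinity>"
  proof (rule lim_imp_Limsup)
    show "((\<lambda>x. ereal (u x)) \<longlongrightarrow> \<infinity>) (at 0)"
      unfolding tendsto_PInfty
    proof
      fix r :: real
      \<comment> \<open>The radius at which k |x|^-a equals |r| + 1.\<close>
      define \<delta> where "\<delta> = (k / (\<bar>r\<bar> + 1)) powr (1 / a)"
      have \<delta>: "\<delta> > 0" using k by (simp add: \<delta>_def)
      have \<delta>a: "\<delta> powr a = k / (\<bar>r\<bar> + 1)" using k a by (simp add: \<delta>_def powr_powr)
      show "\<forall>\<^sub>F x in at 0. ereal r < ereal (u x)"
        unfolding eventually_at
      proof (intro exI[of _ \<delta>] conjI ballI impI \<delta>)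
        fix x :: 'a assume x: "x \<noteq> 0 \<and> dist x 0 < \<delta>"
        then have nx: "0 < norm x" "norm x < \<delta>" by auto
        then have "norm x powr a < k / (\<bar>r\<bar> + 1)" unfolding \<delta>a[symmetric] using a by (intro powr_less_mono2) auto
        then have "\<bar>r\<bar> + 1 < k / norm x powr a" using nx by (simp add: field_simps)
        then have "r < u x" by (simp add: u_def powr_minus_divide)
        then show "ereal r < ereal (u x)" by simp
      qed
    qed
  qed simp
  ultimately show ?thesis unfolding singular_solution_def by blast
qed

theorem theorem1p1:
  fixes m p q \<alpha> \<beta> N :: real
  assumes N_def: "N = real DIM('a::euclidean_space)"
    and m: "m > 1" and p: "p > 0" and q: "q > m - 1" and \<alpha>: "\<alpha> > 0"
    and \<beta>: "0 < \<beta>" "\<beta> < N"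
  shows "(N \<le> m + \<alpha> \<longrightarrow> (\<exists>u :: 'a \<Rightarrow> real. singular_solution m p q \<alpha> \<beta> u)) \<and>
    (N > m + \<alpha> \<and> p > m - 1 \<longrightarrow>
       ((\<exists>u :: 'a \<Rightarrow> real. singular_solution m p q \<alpha> \<beta> u) \<longleftrightarrow>
          max p q < N * (m - 1) / (N - m - \<alpha>) \<and>
          p + q < (N + \<beta>) * (m - 1) / (N - m - \<alpha>) \<and>
          N - 2 * m < 2 * \<alpha> + \<beta>))"
proof (intro conjI impI)
  have \<beta>': "0 < \<beta>" "\<beta> < real DIM('a)" using \<beta> N_def by auto
  have q0: "q > 0" using m q by simp
  assume le: "N \<le> m + \<alpha>"
  \<comment> \<open>As N - m - \<alpha> is at most 0, every positive a meets the condition on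
    \<open>a * (m - 1)\<close>; this one makes \<open>a * (p + q)\<close> equal to N / 2, which
    leaves the upper bounds strict.\<close>
  define a where "a = N / (2 * (p + q))"
  have N0: "N > 0" using \<beta> by simp
  have a: "a > 0" using N0 p q0 by (simp add: a_def)
  have "N / (2 * r) * r = N / 2" if "r > 0" for r :: real using that by simp
  from this[of "p + q"] have a2: "a * (p + q) = N / 2" using p q0 by (simp only: a_def add_pos_pos)
  have "a * p > 0" "a * q > 0" "a * p + a * q = N / 2" using a p q0 a2 by (simp_all add: distrib_left)
  then have "a * p < N" "a * q < N" using N0 by linarith+
  moreover have "0 < a * (m - 1)" using a m by simp
  ultimately show "\<exists>u :: 'a \<Rightarrow> real. singular_solution m p q \<alpha> \<beta> u"
    using le a a2 N0 \<beta> unfolding N_def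
    by (intro power_singular_solution[OF \<beta>' m \<alpha> p q, of a]) auto
next
  have \<beta>': "0 < \<beta>" "\<beta> < real DIM('a)" using \<beta> N_def by auto
  assume "N > m + \<alpha> \<and> p > m - 1"
  then have gt: "N > m + \<alpha>" and pm: "p > m - 1" by auto
  define \<sigma> where "\<sigma> = (N - m - \<alpha>) / (m - 1)"
  have \<sigma>m: "\<sigma> * (m - 1) = real DIM('a) - m - \<alpha>" using m by (simp add: \<sigma>_def N_def)
  have \<sigma>0: "\<sigma> > 0" using gt m by (simp add: \<sigma>_def)
  \<comment> \<open>Every quotient bound is read as a bound on \<sigma> times an exponent, the form
    in which the necessary conditions are proved and from which the exponent a is chosen.\<close>
  have conv: "z < y * (m - 1) / (N - m - \<alpha>) \<longleftrightarrow> \<sigma> * z < y" for y z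
    using gt m by (simp add: \<sigma>_def field_simps)
  show "(\<exists>u :: 'a \<Rightarrow> real. singular_solution m p q \<alpha> \<beta> u) \<longleftrightarrow>
          max p q < N * (m - 1) / (N - m - \<alpha>) \<and>
          p + q < (N + \<beta>) * (m - 1) / (N - m - \<alpha>) \<and>
          N - 2 * m < 2 * \<alpha> + \<beta>"
    unfolding max_less_iff_conj unfolding conv
  proof
    assume "\<exists>u :: 'a \<Rightarrow> real. singular_solution m p q \<alpha> \<beta> u"
    then obtain u :: "'a \<Rightarrow> real" where u: "singular_solution m p q \<alpha> \<beta> u" ..
    note ex = singular_solution_exponents[OF u \<beta>' m \<alpha> pm q \<sigma>m]
    \<comment> \<open>Both p and q exceed m - 1, so 2 (N - m - \<alpha>) < \<sigma> (p + q) < N +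
      \<beta>, and this rearranges to the third condition.\<close>
    have "\<sigma> * (2 * (m - 1)) < \<sigma> * (p + q)" using pm q \<sigma>0 by (intro mult_strict_left_mono) auto
    moreover have "\<sigma> * (2 * (m - 1)) = 2 * (N - m - \<alpha>)" unfolding N_def \<sigma>m[symmetric] by simp
    ultimately have "N - 2 * m < 2 * \<alpha> + \<beta>" using ex(3) by (simp add: N_def)
    with ex show "(\<sigma> * p < N \<and> \<sigma> * q < N) \<and> \<sigma> * (p + q) < N + \<beta> \<and> N - 2 * m < 2 * \<alpha> + \<beta>"
      unfolding N_def by simp
  next
    assume c: "(\<sigma> * p < N \<and> \<sigma> * q < N) \<and> \<sigma> * (p + q) < N + \<beta> \<and> N - 2 * m < 2 * \<alpha> + \<beta>"
    have q0: "q > 0" using m q by simp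
    \<comment> \<open>The conditions are strict, so some a above \<sigma> still satisfies them: the
      power must be strictly steeper than the fundamental solution, whose divergence term is
      0.\<close>
    have "\<sigma> < min (N / p) (min (N / q) ((N + \<beta>) / (p + q)))" using c p q0 by (simp add: field_simps)
    then obtain a where a: "\<sigma> < a" "a < min (N / p) (min (N / q) ((N + \<beta>) / (p + q)))" using dense by blast
    have a': "a * p < N" "a * q < N" "a * (p + q) < N + \<beta>"
      using a(2) p q0 by (auto simp: field_simps)
    have "\<sigma> * (m - 1) < a * (m - 1)" using a(1) m by (intro mult_strict_right_mono) auto
    then show "\<exists>u :: 'a \<Rightarrow> real. singular_solution m p q \<alpha> \<beta> u"
      using a a' \<sigma>0 \<sigma>m unfolding N_def
      by (intro power_singular_solution[OF \<beta>' m \<alpha> p q, of a]) auto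
  qed
qed

end
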